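(* Let $\phi$ be a normalised Hölder continuous potential on an irreducible and aperiodic one-sided shift of finite type $(\Sigma_A^+,T)$ with finite alphabet $\boldsymbol V$, and let $\mu$ be its equilibrium state. Let $\Delta\subsetneq\boldsymbol V$ be such that $\Sigma_\Delta$ is an irreducible and aperiodic subshift of finite type in its alphabet $\Delta$. Let $P_\Delta<0$ be the pressure of the restriction of $\phi$ to $(\Sigma_\Delta,T)$ and let $h_\Delta$ be the density of the Pianigiani-Yorke measure associated to $(\Sigma_A^+,\Sigma_\Delta,\phi)$. For $\omega\in\Sigma_A^+$ distributed according to $\mu$, consider the point process of hitting times in $\Delta_n=\{x\in\Sigma_A^+ : x_i\in\Delta \text{ for } i=0,\dots,n-1\}$ scaled by $e^{-nP_\Delta}$, $$\tau_n(\omega)=\sum_{k>0}\mathbf 1_{\Delta_n}(T^k\omega)\,\delta_{k e^{nP_\Delta}} .$$ Then, as $n\to\infty$, $\tau_n$ converges in law to a marked Poisson point process on $[0,\infty)$ with constant parameter measure $\lambda\pi$, where $$\lambda=(1-e^{P_\Delta})\int h_\Delta\,d\mu\qquad\text{and}\qquad \pi_j=(1-e^{P_\Delta})\,e^{(j-1)P_\Delta}\quad (j\ge 1).$$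
   Context: Shift: $\boldsymbol V=\{1,\dots,\ell\}$ is a finite set, $A$ is an irreducible and aperiodic $\ell\times\ell$ matrix with entries in $\{0,1\}$, $\Sigma_A^+=\{x=(x_n)_{n\ge0}\in\boldsymbol V^{\mathbb N}: A(x_{i-1},x_i)=1\ \forall i\ge1\}$ with the product topology, and $T:\Sigma_A^+\to\Sigma_A^+$, $T(x)_n=x_{n+1}$. Hölder functions: for a continuous $\psi:\Sigma_A^+\to\mathbb C$, $\mathrm{var}_n(\psi)=\sup\{|\psi(x)-\psi(y)|: x_i=y_i,\ i\le n\}$; $\psi$ is Hölder continuous if $\sup_n \mathrm{var}_n(\psi)/\theta^n<\infty$ for some $0<\theta<1$. Potential: $\phi$ is a real-valued Hölder continuous function on $\Sigma_A^+$, with transfer operator $(\mathcal L_\phi\psi)(x)=\sum_{Ty=x}e^{\phi(y)}\psi(y)$. It is normalised: $\mathcal L_\phi \mathbf 1=\mathbf 1$ (hence its pressure $P(\phi)=\sup_m\{h(m)+\int\phi\,dm\}$, over $T$-invariant probabilities $m$, is $0$). $\mu$ is the equilibrium state of $\phi$, i.e. the unique $T$-invariant probability measure attaining this supremum. Subsystem: for $\Delta\subsetneq\boldsymbol V$ let $\Sigma_\Delta=\{x\in\Sigma_A^+: x_i\in\Delta\ \forall i\ge0\}$. That $\Sigma_\Delta$ is an irreducible and aperiodic subshift of finite type in its alphabet $\Delta$ means that the restriction $A_\Delta$ of the matrix $A$ to the symbols of $\Delta$ is irreducible and aperiodic. Let $\phi_\Delta=\phi|_{\Sigma_\Delta}$,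 let $P_\Delta$ be the pressure of $\phi_\Delta$ for $(\Sigma_\Delta,T)$ (one has $P_\Delta<0$), and let $w_\Delta=\lim_{n\to\infty}e^{-nP_\Delta}\mathcal L_{\phi_\Delta}^n(\mathbf 1)$, a strictly positive Hölder function on $\Sigma_\Delta$, where $\mathcal L_{\phi_\Delta}$ is the transfer operator of $\phi_\Delta$ on $\Sigma_\Delta$. Density $h_\Delta$: the restricted transfer operator is $\mathcal L_\Delta\psi=\mathcal L_\phi(\psi\cdot\mathbf 1_{\{x_0\in\Delta\}})$. The function $h_\Delta$ is the unique Hölder continuous function on $\Sigma_A^+$ with $\mathcal L_\Delta h_\Delta=e^{P_\Delta}h_\Delta$ and $h_\Delta|_{\Sigma_\Delta}= w_\Delta$; it is the density with respect to $\mu$ of the Pianigiani-Yorke measure $\mu_{PY}(B)=\int_B h_\Delta\,d\mu$. One has $h_\Delta=\lim_n e^{-nP_\Delta}\mathcal L_\Delta^n(\mathbf 1)$ uniformly on $\Sigma_A^+$. Point processes: a point process is a random element of the space of $\sigma$-finite Borel measures on $[0,\infty)$; $\delta_t$ is the Dirac mass at $t$. Point processes $\tau_n$ converge in law to $\tau$ if and only if for every continuous compactly supported $g$ on $[0,\infty)$ the random variables $\int g\,d\tau_n$ converge in law to $\int g\,d\tau$. A marked Poisson point process of constant parameter measure $\lambda\pi$ ($\lambda>0$, $\pi=\{\pi_j\}_{j\ge1}$ a probability on the positive integers) is $\tau=\sum_{k>0}L_k\,\delta_{X_k}$, where $X_0\equiv0$, the variables $D_k=X_k-X_{k-1}$ ($k\ge1$)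 and $L_{k'}$ ($k'\ge1$) are all independent, each $D_k$ is exponentially distributed with parameter $\lambda$, and $\mathbb P(L_{k'}=j)=\pi_j$. *)

theory Defs
  imports "HOL-Probability.Probability"
begin

section \<open>Shifts of finite type\<close>

text \<open>
  Symbols are natural numbers, so that points are of type \<^typ>\<open>nat \<Rightarrow> nat\<close>, whose type class
  topology is the product of discrete topologies. A matrix over a finite set \<open>S\<close> of symbols is a
  function of which only the values on \<open>S \<times> S\<close> matter; restricting it to \<open>\<Delta> \<subseteq> S\<close> amounts to
  using \<open>\<Delta>\<close> as the index set.
\<close>

primrec matrix_power :: "nat set \<Rightarrow> (nat \<Rightarrow> nat \<Rightarrow> nat) \<Rightarrow> nat \<Rightarrow> nat \<Rightarrow> nat \<Rightarrow> nat" where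
  "matrix_power S A 0 = (\<lambda>i j. if i = j then 1 else 0)"
| "matrix_power S A (Suc n) = (\<lambda>i j. \<Sum>k\<in>S. matrix_power S A n i k * A k j)"

definition irreducible_matrix :: "nat set \<Rightarrow> (nat \<Rightarrow> nat \<Rightarrow> nat) \<Rightarrow> bool" where
  "irreducible_matrix S A \<longleftrightarrow>
     S \<noteq> {} \<and> (\<forall>i\<in>S. \<forall>j\<in>S. \<exists>n\<ge>1. matrix_power S A n i j > 0)"

definition aperiodic_matrix :: "nat set \<Rightarrow> (nat \<Rightarrow> nat \<Rightarrow> nat) \<Rightarrow> bool" where
  "aperiodic_matrix S A \<longleftrightarrow> (\<forall>i\<in>S. Gcd {n. n \<ge> 1 \<and> matrix_power S A n i i > 0} = 1)"

definition sft :: "nat set \<Rightarrow> (nat \<Rightarrow> nat \<Rightarrow> nat) \<Rightarrow> (nat \<Rightarrow> nat) set" where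
  "sft S A = {x. (\<forall>n. x n \<in> S) \<and> (\<forall>i\<ge>1. A (x (i - 1)) (x i) = 1)}"

definition subsystem :: "(nat \<Rightarrow> nat) set \<Rightarrow> nat set \<Rightarrow> (nat \<Rightarrow> nat) set" where
  "subsystem X \<Delta> = {x \<in> X. \<forall>i. x i \<in> \<Delta>}"

definition neighbourhood :: "(nat \<Rightarrow> nat) set \<Rightarrow> nat set \<Rightarrow> nat \<Rightarrow> (nat \<Rightarrow> nat) set" where
  "neighbourhood X \<Delta> n = {x \<in> X. \<forall>i<n. x i \<in> \<Delta>}"

definition shift :: "(nat \<Rightarrow> nat) \<Rightarrow> nat \<Rightarrow> nat" where
  "shift x = (\<lambda>n. x (n + 1))"


section \<open>Hoelder functions and transfer operators\<close>

text \<open>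
  Functions on a shift space \<open>X\<close> are represented by functions on all of \<^typ>\<open>nat \<Rightarrow> nat\<close>; only the
  values on \<open>X\<close> are used below. The supremum in \<open>variation\<close> is that of a bounded set when \<open>\<psi>\<close> is
  continuous on a compact \<open>X\<close>.
\<close>

definition variation ::
  "(nat \<Rightarrow> nat) set \<Rightarrow> nat \<Rightarrow> ((nat \<Rightarrow> nat) \<Rightarrow> 'b::real_normed_vector) \<Rightarrow> real" where
  "variation X n \<psi> = Sup {norm (\<psi> x - \<psi> y) | x y. x \<in> X \<and> y \<in> X \<and> (\<forall>i\<le>n. x i = y i)}"

definition hoelder_on ::
  "(nat \<Rightarrow> nat) set \<Rightarrow> ((nat \<Rightarrow> nat) \<Rightarrow> 'b::real_normed_vector) \<Rightarrow> bool" where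
  "hoelder_on X \<psi> \<longleftrightarrow> continuous_on X \<psi> \<and>
     (\<exists>\<theta>. 0 < \<theta> \<and> \<theta> < 1 \<and> bdd_above (range (\<lambda>n. variation X n \<psi> / \<theta> ^ n)))"

definition transfer_op ::
  "(nat \<Rightarrow> nat) set \<Rightarrow> ((nat \<Rightarrow> nat) \<Rightarrow> real) \<Rightarrow> ((nat \<Rightarrow> nat) \<Rightarrow> real) \<Rightarrow> (nat \<Rightarrow> nat) \<Rightarrow> real" where
  "transfer_op X \<phi> \<psi> x = (\<Sum>y\<in>{y \<in> X. shift y = x}. exp (\<phi> y) * \<psi> y)"

definition normalised :: "(nat \<Rightarrow> nat) set \<Rightarrow> ((nat \<Rightarrow> nat) \<Rightarrow> real) \<Rightarrow> bool" where
  "normalised X \<phi> \<longleftrightarrow> (\<forall>x\<in>X. transfer_op X \<phi> (\<lambda>_. 1) x = 1)"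

definition restricted_transfer_op ::
  "(nat \<Rightarrow> nat) set \<Rightarrow> nat set \<Rightarrow> ((nat \<Rightarrow> nat) \<Rightarrow> real) \<Rightarrow> ((nat \<Rightarrow> nat) \<Rightarrow> real) \<Rightarrow> (nat \<Rightarrow> nat) \<Rightarrow> real"
  where
  "restricted_transfer_op X \<Delta> \<phi> \<psi> = transfer_op X \<phi> (\<lambda>y. \<psi> y * indicator {y. y 0 \<in> \<Delta>} y)"


section \<open>Entropy, pressure and equilibrium states\<close>

definition invariant_probs :: "(nat \<Rightarrow> nat) set \<Rightarrow> (nat \<Rightarrow> nat) measure set" where
  "invariant_probs X =
     {m. prob_space m \<and> sets m = sets (restrict_space borel X) \<and> distr m m shift = m}"

text \<open>
  Kolmogorov--Sinai entropy. A finite measurable partition is given by a simple function \<open>\<xi>\<close>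
  labelling its atoms; \<open>itinerary T \<xi> n\<close> labels the atoms of the join of the preimages of the
  partition under \<open>T ^^ i\<close>, \<open>i < n\<close>.
\<close>

definition itinerary :: "('a \<Rightarrow> 'a) \<Rightarrow> ('a \<Rightarrow> nat) \<Rightarrow> nat \<Rightarrow> 'a \<Rightarrow> nat list" where
  "itinerary T \<xi> n x = map (\<lambda>i. \<xi> ((T ^^ i) x)) [0..<n]"

definition join_entropy :: "'a measure \<Rightarrow> ('a \<Rightarrow> 'a) \<Rightarrow> ('a \<Rightarrow> nat) \<Rightarrow> nat \<Rightarrow> real" where
  "join_entropy m T \<xi> n =
     prob_space.entropy m (exp 1) (count_space (itinerary T \<xi> n ` space m)) (itinerary T \<xi> n)"

definition ks_entropy :: "'a measure \<Rightarrow> ('a \<Rightarrow> 'a) \<Rightarrow> ereal" where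
  "ks_entropy m T =
     (SUP \<xi>\<in>{\<xi>. simple_function m \<xi>}. ereal (lim (\<lambda>n. join_entropy m T \<xi> n / real n)))"

definition pressure :: "(nat \<Rightarrow> nat) set \<Rightarrow> ((nat \<Rightarrow> nat) \<Rightarrow> real) \<Rightarrow> ereal" where
  "pressure X \<phi> = (SUP m\<in>invariant_probs X. ks_entropy m shift + ereal (integral\<^sup>L m \<phi>))"

definition equilibrium_state ::
  "(nat \<Rightarrow> nat) set \<Rightarrow> ((nat \<Rightarrow> nat) \<Rightarrow> real) \<Rightarrow> (nat \<Rightarrow> nat) measure \<Rightarrow> bool" where
  "equilibrium_state X \<phi> \<mu> \<longleftrightarrow> \<mu> \<in> invariant_probs X \<and>
     ks_entropy \<mu> shift + ereal (integral\<^sup>L \<mu> \<phi>) = pressure X \<phi>"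


section \<open>The density of the Pianigiani--Yorke measure\<close>

text \<open>In both definitions \<open>P\<close> stands for the pressure of \<open>\<phi>\<close> on the subsystem.\<close>

definition subsystem_eigenfunction ::
  "(nat \<Rightarrow> nat) set \<Rightarrow> nat set \<Rightarrow> ((nat \<Rightarrow> nat) \<Rightarrow> real) \<Rightarrow> real \<Rightarrow> (nat \<Rightarrow> nat) \<Rightarrow> real" where
  "subsystem_eigenfunction X \<Delta> \<phi> P x =
     lim (\<lambda>n. exp (- real n * P) * (transfer_op (subsystem X \<Delta>) \<phi> ^^ n) (\<lambda>_. 1) x)"

definition pianigiani_yorke_density ::
  "(nat \<Rightarrow> nat) set \<Rightarrow> nat set \<Rightarrow> ((nat \<Rightarrow> nat) \<Rightarrow> real) \<Rightarrow> real \<Rightarrow> ((nat \<Rightarrow> nat) \<Rightarrow> real) \<Rightarrow> bool" where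
  "pianigiani_yorke_density X \<Delta> \<phi> P h \<longleftrightarrow>
     hoelder_on X h \<and>
     (\<forall>x\<in>X. restricted_transfer_op X \<Delta> \<phi> h x = exp P * h x) \<and>
     (\<forall>x\<in>subsystem X \<Delta>. h x = subsystem_eigenfunction X \<Delta> \<phi> P x)"


section \<open>Point processes\<close>

text \<open>
  The Borel measure \<open>\<Sum>k>0. c k \<cdot> \<delta>\<^bsub>t k\<^esub>\<close> on \<open>[0, \<infinity>)\<close>. All subsets being measurable in
  \<^const>\<open>point_measure\<close>, points \<open>t k < 0\<close> simply do not contribute.
\<close>

definition dirac_series :: "(nat \<Rightarrow> ennreal) \<Rightarrow> (nat \<Rightarrow> real) \<Rightarrow> real measure" where
  "dirac_series c t = distr (point_measure {0<..} c) (restrict_space borel {0..}) t"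

definition converges_in_law ::
  "'a measure \<Rightarrow> (nat \<Rightarrow> 'a \<Rightarrow> real measure) \<Rightarrow> 'b measure \<Rightarrow> ('b \<Rightarrow> real measure) \<Rightarrow> bool" where
  "converges_in_law M \<tau>s N \<tau> \<longleftrightarrow>
     (\<forall>g :: real \<Rightarrow> real. continuous_on {0..} g \<and> (\<exists>R. \<forall>t>R. g t = 0) \<longrightarrow>
        weak_conv_m (\<lambda>n. distr M borel (\<lambda>\<omega>. integral\<^sup>L (\<tau>s n \<omega>) g))
                    (distr N borel (\<lambda>\<omega>. integral\<^sup>L (\<tau> \<omega>) g)))"

text \<open>
  Only the values \<open>\<pi> j\<close> with \<open>j \<ge> 1\<close> matter. The marks are coerced to the reals so that all
  variables form one family indexed by the disjoint union of two copies of the positive integers.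
\<close>

definition marked_poisson_process ::
  "real \<Rightarrow> (nat \<Rightarrow> real) \<Rightarrow> 'a measure \<Rightarrow> ('a \<Rightarrow> real measure) \<Rightarrow> bool" where
  "marked_poisson_process lam \<pi> N \<tau> \<longleftrightarrow>
     prob_space N \<and> lam > 0 \<and> (\<forall>j\<ge>1. \<pi> j \<ge> 0) \<and> (\<lambda>j. \<pi> (Suc j)) sums 1 \<and>
     (\<exists>(D :: nat \<Rightarrow> 'a \<Rightarrow> real) (L :: nat \<Rightarrow> 'a \<Rightarrow> nat).
        prob_space.indep_vars N (\<lambda>_. borel) (case_sum D (\<lambda>k \<omega>. real (L k \<omega>))) ({1..} <+> {1..}) \<and>
        (\<forall>k\<ge>1. distributed N lborel (D k) (exponential_density lam)) \<and>
        (\<forall>k\<ge>1. L k \<in> measurable N (count_space {1..})) \<and>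
        (\<forall>k\<ge>1. \<forall>j\<ge>1. measure N {\<omega> \<in> space N. L k \<omega> = j} = \<pi> j) \<and>
        (\<forall>\<omega>\<in>space N. \<tau> \<omega> =
           dirac_series (\<lambda>k. of_nat (L k \<omega>)) (\<lambda>k. \<Sum>i=1..k. D i \<omega>)))"

definition hitting_process ::
  "(nat \<Rightarrow> nat) set \<Rightarrow> nat set \<Rightarrow> real \<Rightarrow> nat \<Rightarrow> (nat \<Rightarrow> nat) \<Rightarrow> real measure" where
  "hitting_process X \<Delta> P n \<omega> =
     dirac_series (\<lambda>k. indicator (neighbourhood X \<Delta> n) ((shift ^^ k) \<omega>))
                  (\<lambda>k. real k * exp (real n * P))"

end

theory Submission
  imports Defs
begin

text \<open>
  Write \<open>r = e\<^sup>P\<close> and \<open>\<kappa> = \<integral> h d\<mu>\<close>. The sets \<open>\<Delta>\<^sub>n\<close> shrink like \<open>\<mu>(\<Delta>\<^sub>n) \<sim> \<kappa> r\<^sup>n\<close>, and a point of \<open>\<Delta>\<^sub>n\<close> is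
  again in \<open>\<Delta>\<^sub>n\<close> one step later with conditional probability close to \<open>r\<close>. Visits to \<open>\<Delta>\<^sub>n\<close> therefore
  come in runs of consecutive times, whose lengths are asymptotically geometric with ratio \<open>r\<close>; runs
  begin with frequency close to \<open>(1 - r) \<kappa> r\<^sup>n\<close> per unit of time, and separate runs are nearly
  independent because \<open>\<mu>\<close> is mixing. When a time step has length \<open>r\<^sup>n\<close>, a run collapses to one point
  that carries its length as a mark, and the runs become a Poisson process of rate \<open>(1 - r) \<kappa>\<close>.

  This is made precise with characteristic functions. By Levy's continuity theorem it is enough to
  show, for \<open>f\<close> continuous on \<open>[0, \<infinity>)\<close> and vanishing beyond \<open>R\<close>, that the mean of \<open>exp (i \<integral> f d\<tau>\<^sub>n)\<close>
  converges to that of \<open>exp (i \<integral> f d\<tau>)\<close>. Let \<open>\<Phi> k\<close> be the mean for the part of \<open>\<tau>\<^sub>n\<close> that comes from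
  times \<open>\<ge> k\<close>. Invariance of \<open>\<mu>\<close> shows that \<open>\<Phi> k - \<Phi> (k + 1)\<close> is \<open>exp (i f (k r\<^sup>n)) - 1\<close> times an
  integral over \<open>\<Delta>\<^sub>n\<close>, and splitting \<open>\<Delta>\<^sub>n\<close> according to the length of the present run, together with
  decay of correlations, evaluates this integral (lemma \<open>\<Phi>_step\<close>). The outcome (lemma \<open>\<Phi>_recursion\<close>)
  is the relation \<open>\<Phi> k - \<Phi> (k + 1) \<approx> r\<^sup>n c\<^sub>P(f (k r\<^sup>n)) \<Phi> (k + 1)\<close>, an Euler scheme of step \<open>r\<^sup>n\<close>
  for the linear equation \<open>F' = - c\<^sub>P(f) F\<close>, run backwards from time \<open>R\<close>. The corresponding mean \<open>F t\<close> for the compound Poisson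
  process after time \<open>t\<close> solves this equation exactly, by conditioning on the first point (theorem
  \<open>F_derivative\<close>), so the scheme converges to it (theorem \<open>\<Phi>_lim\<close>).

  Three facts about \<open>\<mu>\<close> are needed.

  \<^item> The transfer operator contracts a cone of log-Hoelder functions (lemma \<open>contraction\<close>). This gives
    its leading eigenvalue \<open>\<rho>\<close> and eigenfunction \<open>w\<close>, with uniform convergence, for the full shift
    and for the subsystem alike. The pressure, defined through Kolmogorov--Sinai entropy, equals
    \<open>ln \<rho>\<close> (theorem \<open>pressure_eq\<close>), so that \<open>r\<close> is the leading eigenvalue of the subsystem.

  \<^item> The equilibrium state is fixed by the dual of the normalised transfer operator (lemma
    \<open>integral_L\<close>): perturbing \<open>\<phi>\<close> to \<open>\<phi> + ln (1 + s F)\<close> with \<open>L F = 0\<close> leaves the pressure at \<open>0\<close>, and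
    the variational principle bounds \<open>\<integral> F d\<mu>\<close> to first order in \<open>s\<close>. Together with the contraction
    this yields decay of correlations (lemma \<open>decorrelation\<close>).

  \<^item> The functions \<open>r\<^bsup>-n\<^esup> L\<^sub>\<Delta>\<^sup>n 1\<close> converge to \<open>h\<close> uniformly (lemma \<open>u_uniform\<close>), because a point that
    spends a long time in \<open>\<Delta>\<close> is shadowed by a point of the subsystem, where the convergence is known.
    Integration gives \<open>r\<^bsup>-n\<^esup> \<mu>(\<Delta>\<^sub>n) \<longlonglongrightarrow> \<kappa>\<close> (theorem \<open>measure_N\<Delta>_asymp\<close>).
\<close>

section \<open>Primitive matrices\<close>

text \<open>The least positive difference \<open>d\<close> of two elements divides every element, hence is \<open>1\<close>; so there are two
  consecutive elements \<open>b\<close> and \<open>b + 1\<close>, and combinations of these reach every number above \<open>b\<^sup>2\<close>.\<close>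

lemma additive_Gcd_1_imp_cofinite:
  fixes G :: "nat set"
  assumes add: "\<And>a b. a \<in> G \<Longrightarrow> b \<in> G \<Longrightarrow> a + b \<in> G" and gcd: "Gcd G = 1"
  shows "\<exists>N. \<forall>n\<ge>N. n \<in> G"
proof -
  define G0 where "G0 = insert 0 G"
  have add0: "a + b \<in> G0" if "a \<in> G0" "b \<in> G0" for a b
    using that add by (auto simp: G0_def)
  have mult0: "k * a \<in> G0" if "a \<in> G0" for k a
    by (induction k) (use that add0 in \<open>auto simp: G0_def\<close>)
  define D where "D d \<longleftrightarrow> d > 0 \<and> (\<exists>a\<in>G0. \<exists>b\<in>G0. a = b + d)" for d :: nat
  have "\<exists>g\<in>G. g \<noteq> 0"
    using gcd by (metis Gcd_0_iff less_one not_less_zero subsetI insertI1 zero_neq_one singleton_iff)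
  then obtain g where g: "g \<in> G" "g > 0" by auto
  have Dg: "D g" unfolding D_def using g by (auto simp: G0_def)
  define d where "d = (LEAST d. D d)"
  have Dd: "D d" and dmin: "\<And>e. D e \<Longrightarrow> d \<le> e"
    unfolding d_def using Dg by (auto intro: LeastI Least_le)
  obtain a b where ab: "a \<in> G0" "b \<in> G0" "a = b + d" "d > 0" using Dd by (auto simp: D_def)
  have "d dvd h" if "h \<in> G" for h
  proof (rule ccontr)
    assume "\<not> d dvd h"
    then have r: "h mod d > 0" by (simp add: dvd_eq_mod_eq_0)
    have "h + (h div d) * b = (h div d) * a + h mod d"
      using ab(3) by (simp add: algebra_simps)
    moreover have "h + (h div d) * b \<in> G0" "(h div d) * a \<in> G0"
      using add0[OF _ mult0[OF ab(2)], of h] mult0[OF ab(1)] that by (auto simp: G0_def)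
    ultimately have "D (h mod d)" using r unfolding D_def by metis
    then show False using dmin[of "h mod d"] ab(4) mod_less_divisor[of d h] by linarith
  qed
  then have "d dvd Gcd G" by (rule Gcd_greatest)
  then have d1: "d = 1" using gcd by simp
  have bG: "Suc b \<in> G0" using ab d1 by simp
  show ?thesis
  proof (intro exI allI impI)
    fix n assume n: "n \<ge> Suc (b * b)"
    have "n \<in> G0"
    proof (cases "b = 0")
      case True
      then show ?thesis using mult0[OF bG, of n] by simp
    next
      case False
      have "b \<le> n div b" using n False
        by (metis Suc_leD div_le_mono nonzero_mult_div_cancel_left)
      then have "n mod b \<le> n div b" using mod_less_divisor[of b n] False by linarith
      then obtain e where e: "n div b = n mod b + e" using le_Suc_ex by blast
      have "n = (n div b) * b + n mod b" by simp
      also have "\<dots> = e * b + (n mod b) * Suc b" unfolding e by (simp add: algebra_simps)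
      finally show ?thesis using add0 mult0[OF bG] mult0[OF ab(2)] by metis
    qed
    then show "n \<in> G" using n by (auto simp: G0_def)
  qed
qed

lemma matrix_power_add_pos:
  assumes "finite S" "k \<in> S" "matrix_power S A m i k > 0" "matrix_power S A n k j > 0"
  shows "matrix_power S A (m + n) i j > 0"
  using assms(4)
proof (induction n arbitrary: j)
  case 0
  then show ?case using assms(3) by (auto split: if_splits)
next
  case (Suc n)
  then have "(\<Sum>k'\<in>S. matrix_power S A n k k' * A k' j) > 0" by simp
  then obtain k' where k': "k' \<in> S" "matrix_power S A n k k' * A k' j > 0"
    by (metis (no_types, lifting) gr0I not_gr_zero sum.neutral)
  then have "matrix_power S A (m + n) i k' * A k' j > 0" using Suc.IH by simp
  then have "(\<Sum>k'\<in>S. matrix_power S A (m + n) i k' * A k' j) > 0"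
    using k'(1) assms(1) by (metis sum_eq_0_iff gr0I less_irrefl)
  then show ?case by simp
qed

text \<open>Return times to \<open>i\<close> form an additive semigroup of gcd \<open>1\<close>, so all large times are return times; a path
  from \<open>i\<close> to \<open>j\<close> is then prolonged by loops at \<open>i\<close>.\<close>

lemma primitive_matrix:
  assumes fin: "finite S" and irr: "irreducible_matrix S A" and ap: "aperiodic_matrix S A"
  shows "\<exists>M\<ge>1. \<forall>n\<ge>M. \<forall>i\<in>S. \<forall>j\<in>S. matrix_power S A n i j > 0"
proof -
  have "\<exists>N. \<forall>n\<ge>N. matrix_power S A n i i > 0" if i: "i \<in> S" for i
  proof -
    have "\<exists>N. \<forall>n\<ge>N. n \<in> {n. n \<ge> 1 \<and> matrix_power S A n i i > 0}"
    proof (rule additive_Gcd_1_imp_cofinite)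
      show "Gcd {n. n \<ge> 1 \<and> matrix_power S A n i i > 0} = 1"
        using ap i by (auto simp: aperiodic_matrix_def)
    qed (use matrix_power_add_pos[OF fin i] in auto)
    then show ?thesis by blast
  qed
  then obtain N where N: "\<And>i n. i \<in> S \<Longrightarrow> n \<ge> N i \<Longrightarrow> matrix_power S A n i i > 0" by metis
  have "\<exists>n. matrix_power S A n i j > 0" if "i \<in> S" "j \<in> S" for i j
    using irr that unfolding irreducible_matrix_def by blast
  then obtain p where p: "\<And>i j. i \<in> S \<Longrightarrow> j \<in> S \<Longrightarrow> matrix_power S A (p i j) i j > 0" by metis
  define M where "M = Suc ((\<Sum>i\<in>S. N i) + (\<Sum>i\<in>S. \<Sum>j\<in>S. p i j))"
  have "matrix_power S A n i j > 0" if n: "n \<ge> M" and ij: "i \<in> S" "j \<in> S" for n i j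
  proof -
    have "N i \<le> (\<Sum>i\<in>S. N i)" using ij fin by (intro member_le_sum) auto
    moreover have "p i j \<le> (\<Sum>j\<in>S. p i j)" using ij fin by (intro member_le_sum) auto
    moreover have "(\<Sum>j\<in>S. p i j) \<le> (\<Sum>i\<in>S. \<Sum>j\<in>S. p i j)"
      using ij(1) fin by (intro member_le_sum[where f="\<lambda>i. \<Sum>j\<in>S. p i j"]) auto
    ultimately have "n - p i j \<ge> N i" and le: "p i j \<le> n" using n by (auto simp: M_def)
    then have "matrix_power S A ((n - p i j) + p i j) i j > 0"
      using matrix_power_add_pos[OF fin ij(1)] N p ij by blast
    then show ?thesis using le by simp
  qed
  moreover have "M \<ge> 1" by (simp add: M_def)
  ultimately show ?thesis by blast
qed

section \<open>The transfer operator on a cone of log-Hoelder functions\<close>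

text \<open>Distances between sequences are measured by the length of the common prefix throughout; the number
  of common symbols is one more than the index used in \<^const>\<open>variation\<close>.\<close>

definition agree :: "nat \<Rightarrow> (nat \<Rightarrow> 'a) \<Rightarrow> (nat \<Rightarrow> 'a) \<Rightarrow> bool" where
  "agree j x y \<longleftrightarrow> (\<forall>i<j. x i = y i)"

lemma agree_0 [simp]: "agree 0 x y" by (simp add: agree_def)
lemma agree_refl [simp]: "agree j x x" by (simp add: agree_def)
lemma agree_sym: "agree j x y \<Longrightarrow> agree j y x" by (simp add: agree_def)
lemma agree_mono: "agree j x y \<Longrightarrow> i \<le> j \<Longrightarrow> agree i x y" by (simp add: agree_def)

lemma agree_case_nat: "agree j x y \<Longrightarrow> agree (Suc j) (case_nat a x) (case_nat a y)"
  by (auto simp: agree_def split: nat.split)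

lemma agree_shift: "agree (Suc j) x y \<Longrightarrow> agree j (shift x) (shift y)"
  by (auto simp: agree_def shift_def)

lemma agree_shift_iff: "agree (Suc j) x y \<longleftrightarrow> x 0 = y 0 \<and> agree j (shift x) (shift y)"
  by (auto simp: agree_def shift_def less_Suc_eq_0_disj)

lemma shift_case_nat [simp]: "shift (case_nat a x) = x" by (auto simp: shift_def)
lemma case_nat_shift: "case_nat (x 0) (shift x) = x"
  by (auto simp: shift_def fun_eq_iff split: nat.split)

lemma shift_funpow: "(shift ^^ n) x i = x (i + n)"
  by (induction n arbitrary: i) (auto simp: shift_def)

lemma agree_funpow: "agree (n + j) x y \<Longrightarrow> agree j ((shift ^^ n) x) ((shift ^^ n) y)"
  by (auto simp: agree_def shift_funpow)

text \<open>A function in a narrow cone (constant \<open>K1\<close>) stays in the wider cone (constant \<open>K\<close>) after subtraction of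
  a sufficiently small multiple of another function of the narrow cone. Here \<open>u1, u2\<close> and \<open>v1, v2\<close> are
  the values of the two functions at two points at distance \<open>t\<close>. Expanding the exponentials to first
  order in \<open>t\<close> shows why the bound on \<open>v2\<close> can be chosen independently of \<open>t\<close>.\<close>

lemma exp_cone_difference:
  fixes u1 u2 v1 v2 t K K1 :: real
  assumes t: "0 \<le> t" "t \<le> 1" and K: "0 \<le> K1" "K1 < K"
    and u: "u1 \<le> exp (K1 * t) * u2" and v: "v2 \<le> exp (K1 * t) * v1" and nn: "0 \<le> v2" "0 \<le> u2"
    and small: "v2 \<le> (K - K1) / ((K + K1) * exp K) * u2"
  shows "u1 - v1 \<le> exp (K * t) * (u2 - v2)"
proof -
  have "exp (- (K1 * t)) * v2 \<le> exp (- (K1 * t)) * (exp (K1 * t) * v1)"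
    using v by (intro mult_left_mono) auto
  also have "\<dots> = v1" by (simp add: mult.assoc[symmetric] exp_add[symmetric])
  finally have v1: "exp (- (K1 * t)) * v2 \<le> v1" .
  have small': "(K + K1) * exp K * v2 \<le> (K - K1) * u2"
  proof -
    have pos: "(K + K1) * exp K > 0" using K by simp
    have "(K + K1) * exp K * v2 \<le> (K + K1) * exp K * ((K - K1) / ((K + K1) * exp K) * u2)"
      using small pos by (intro mult_left_mono) auto
    also have "\<dots> = (K - K1) * u2" using pos by (simp add: field_simps)
    finally show ?thesis .
  qed
  have "1 - exp (-((K + K1) * t)) \<le> (K + K1) * t"
    using exp_ge_add_one_self[of "-((K + K1) * t)"] by simp
  then have "exp (K * t) * (1 - exp (-((K + K1) * t))) \<le> exp K * ((K + K1) * t)"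
    using t K by (intro mult_mono) (auto simp: mult_left_le)
  moreover have "exp (K * t) * (1 - exp (-((K + K1) * t))) = exp (K * t) - exp (- (K1 * t))"
    by (simp add: algebra_simps exp_add[symmetric])
  ultimately have a1: "exp (K * t) - exp (- (K1 * t)) \<le> exp K * ((K + K1) * t)" by simp
  have "exp ((K - K1) * t) - 1 \<ge> (K - K1) * t"
    using exp_ge_add_one_self[of "(K - K1) * t"] by linarith
  then have "exp (K1 * t) * (exp ((K - K1) * t) - 1) \<ge> 1 * ((K - K1) * t)"
    using t K by (intro mult_mono) auto
  moreover have "exp (K1 * t) * (exp ((K - K1) * t) - 1) = exp (K * t) - exp (K1 * t)"
    by (simp add: algebra_simps exp_add[symmetric])
  ultimately have a2: "exp (K * t) - exp (K1 * t) \<ge> (K - K1) * t" by simp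
  have "(exp (K * t) - exp (- (K1 * t))) * v2 \<le> exp K * ((K + K1) * t) * v2"
    using a1 nn by (intro mult_right_mono) auto
  also have "\<dots> = t * ((K + K1) * exp K * v2)" by simp
  also have "\<dots> \<le> t * ((K - K1) * u2)" using small' t by (intro mult_left_mono) auto
  also have "\<dots> = (K - K1) * t * u2" by simp
  also have "\<dots> \<le> (exp (K * t) - exp (K1 * t)) * u2" using a2 nn by (intro mult_right_mono) auto
  finally have "exp (K1 * t) * u2 - exp (- (K1 * t)) * v2 \<le> exp (K * t) * (u2 - v2)"
    by (simp add: algebra_simps)
  then show ?thesis using u v1 by linarith
qed

text \<open>The parameters \<open>\<theta>\<close> and \<open>c\<close> fix one Hoelder modulus, so that the same constants serve the full shift and
  the subsystem.\<close>

locale sft_potential =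
  fixes S :: "nat set" and A :: "nat \<Rightarrow> nat \<Rightarrow> nat" and \<phi> :: "(nat \<Rightarrow> nat) \<Rightarrow> real" and \<theta> c :: real
  assumes finite_S: "finite S"
    and entries: "\<And>i j. i \<in> S \<Longrightarrow> j \<in> S \<Longrightarrow> A i j \<in> {0, 1}"
    and irreducible: "irreducible_matrix S A" and aperiodic: "aperiodic_matrix S A"
    and \<theta>: "0 < \<theta>" "\<theta> < 1" and c: "0 \<le> c"
    and \<phi>_lip: "\<And>x y j. x \<in> sft S A \<Longrightarrow> y \<in> sft S A \<Longrightarrow> agree j x y \<Longrightarrow> \<bar>\<phi> x - \<phi> y\<bar> \<le> c * \<theta> ^ j"
begin

abbreviation "X \<equiv> sft S A"
abbreviation "L \<equiv> transfer_op X \<phi>"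

lemma X_iff: "x \<in> X \<longleftrightarrow> (\<forall>n. x n \<in> S) \<and> (\<forall>n. A (x n) (x (Suc n)) = 1)"
proof -
  have "(\<forall>i\<ge>1. A (x (i - 1)) (x i) = 1) \<longleftrightarrow> (\<forall>n. A (x n) (x (Suc n)) = 1)"
    by (metis One_nat_def Suc_le_D Suc_eq_plus1 add_diff_cancel_right' le_add2)
  then show ?thesis by (simp add: sft_def)
qed

lemma shift_X [intro]: "x \<in> X \<Longrightarrow> shift x \<in> X" by (auto simp: X_iff shift_def)

lemma funpow_X [intro]: "x \<in> X \<Longrightarrow> (shift ^^ n) x \<in> X" by (induction n) auto

lemma case_nat_X_iff: "case_nat a x \<in> X \<longleftrightarrow> a \<in> S \<and> A a (x 0) = 1 \<and> x \<in> X"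
proof -
  have *: "(\<forall>n. Q n) \<longleftrightarrow> Q 0 \<and> (\<forall>n. Q (Suc n))" for Q :: "nat \<Rightarrow> bool"
    by (metis not0_implies_Suc)
  show ?thesis unfolding X_iff
    by (subst (1 2) *) auto
qed

text \<open>Preimages of a point under the shift are encoded by the symbol that is put in front of it.\<close>

definition pre :: "(nat \<Rightarrow> nat) \<Rightarrow> nat set" where "pre x = {a \<in> S. A a (x 0) = 1}"

lemma finite_pre [simp]: "finite (pre x)" using finite_S by (simp add: pre_def)

lemma pre_cong: "x 0 = y 0 \<Longrightarrow> pre x = pre y" by (simp add: pre_def)

lemma case_nat_pre: "x \<in> X \<Longrightarrow> a \<in> pre x \<Longrightarrow> case_nat a x \<in> X"
  by (simp add: case_nat_X_iff pre_def)

lemma preimages: "x \<in> X \<Longrightarrow> {y \<in> X. shift y = x} = (\<lambda>a. case_nat a x) ` pre x"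
proof safe
  fix y assume "y \<in> X" "x = shift y" "shift y \<in> X"
  then show "y \<in> (\<lambda>a. case_nat a (shift y)) ` pre (shift y)"
    by (intro image_eqI[of _ _ "y 0"] case_nat_shift[symmetric]) (auto simp: pre_def shift_def X_iff)
qed (auto simp: case_nat_pre)

lemma L_eq: "x \<in> X \<Longrightarrow> L f x = (\<Sum>a\<in>pre x. exp (\<phi> (case_nat a x)) * f (case_nat a x))"
  unfolding transfer_op_def
  by (subst preimages) (auto intro!: sum.reindex_cong[of "\<lambda>a. case_nat a x"] inj_onI dest: fun_cong[of _ _ 0])

lemma L_cong: "(\<And>y. y \<in> X \<Longrightarrow> f y = g y) \<Longrightarrow> x \<in> X \<Longrightarrow> L f x = L g x"
  by (simp add: L_eq case_nat_pre)

lemma Ln_cong: "(\<And>y. y \<in> X \<Longrightarrow> f y = g y) \<Longrightarrow> x \<in> X \<Longrightarrow> (L ^^ n) f x = (L ^^ n) g x"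
  by (induction n arbitrary: x) (auto intro: L_cong)

lemma L_mono: "(\<And>y. y \<in> X \<Longrightarrow> f y \<le> g y) \<Longrightarrow> x \<in> X \<Longrightarrow> L f x \<le> L g x"
  by (auto simp: L_eq case_nat_pre intro!: sum_mono)

lemma Ln_mono: "(\<And>y. y \<in> X \<Longrightarrow> f y \<le> g y) \<Longrightarrow> x \<in> X \<Longrightarrow> (L ^^ n) f x \<le> (L ^^ n) g x"
  by (induction n arbitrary: x) (auto intro: L_mono)

lemma L_nonneg: "(\<And>y. y \<in> X \<Longrightarrow> 0 \<le> f y) \<Longrightarrow> x \<in> X \<Longrightarrow> 0 \<le> L f x"
  by (auto simp: L_eq case_nat_pre intro!: sum_nonneg)

lemma Ln_nonneg: "(\<And>y. y \<in> X \<Longrightarrow> 0 \<le> f y) \<Longrightarrow> x \<in> X \<Longrightarrow> 0 \<le> (L ^^ n) f x"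
  by (induction n arbitrary: x) (auto intro: L_nonneg)

lemma L_linear: "L (\<lambda>x. u * f x + v * g x) = (\<lambda>x. u * L f x + v * L g x)"
  by (auto simp: transfer_op_def sum.distrib sum_distrib_left algebra_simps)

lemma Ln_linear: "(L ^^ n) (\<lambda>x. u * f x + v * g x) = (\<lambda>x. u * (L ^^ n) f x + v * (L ^^ n) g x)"
  by (induction n) (simp_all add: L_linear)

lemma Ln_scale: "(L ^^ n) (\<lambda>x. u * f x) x = u * (L ^^ n) f x"
  using fun_cong[OF Ln_linear[of n u f 0 f], of x] by simp

lemma Ln_diff: "(L ^^ n) (\<lambda>x. f x - u * g x) x = (L ^^ n) f x - u * (L ^^ n) g x"
  using fun_cong[OF Ln_linear[of n 1 f "-u" g], of x] by simp

lemma Ln_sum: "finite I \<Longrightarrow> (L ^^ n) (\<lambda>x. \<Sum>i\<in>I. f i x) x = (\<Sum>i\<in>I. (L ^^ n) (f i) x)"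
proof (induction I rule: finite_induct)
  case empty
  show ?case using Ln_scale[of n 0 "\<lambda>_. 0" x] by simp
next
  case (insert i I)
  then show ?case using fun_cong[OF Ln_linear[of n 1 "f i" 1 "\<lambda>x. \<Sum>i\<in>I. f i x"], of x] by simp
qed

lemma L_shift: "x \<in> X \<Longrightarrow> L (\<lambda>y. f y * g (shift y)) x = g x * L f x"
  by (simp add: L_eq sum_distrib_left mult_ac)

lemma Ln_shift: "x \<in> X \<Longrightarrow> (L ^^ n) (\<lambda>y. f y * g ((shift ^^ n) y)) x = g x * (L ^^ n) f x"
proof (induction n arbitrary: f x)
  case (Suc n)
  have "(L ^^ Suc n) (\<lambda>y. f y * g ((shift ^^ Suc n) y)) x
      = (L ^^ n) (L (\<lambda>y. f y * (\<lambda>z. g ((shift ^^ n) z)) (shift y))) x"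
    by (simp add: funpow_swap1)
  also have "\<dots> = (L ^^ n) (\<lambda>y. L f y * g ((shift ^^ n) y)) x"
    by (rule Ln_cong) (use Suc in \<open>auto simp: L_shift[where g="\<lambda>z. g ((shift ^^ n) z)"]\<close>)
  also have "\<dots> = g x * (L ^^ Suc n) f x" using Suc by (simp add: funpow_swap1)
  finally show ?case .
qed auto

lemma ex_bound: "\<exists>b\<ge>0. \<forall>x\<in>X. \<bar>\<phi> x\<bar> \<le> b"
proof (cases "X = {}")
  case False
  then obtain z where z: "z \<in> X" by auto
  have "\<bar>\<phi> x\<bar> \<le> \<bar>\<phi> z\<bar> + c" if "x \<in> X" for x
    using \<phi>_lip[OF that z, of 0] by simp
  then show ?thesis using c by (intro exI[of _ "\<bar>\<phi> z\<bar> + c"]) auto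
qed auto

definition b :: real where "b = (SOME b. b \<ge> 0 \<and> (\<forall>x\<in>X. \<bar>\<phi> x\<bar> \<le> b))"

lemma b: "b \<ge> 0" "\<And>x. x \<in> X \<Longrightarrow> \<bar>\<phi> x\<bar> \<le> b"
  using someI_ex[of "\<lambda>b. b \<ge> 0 \<and> (\<forall>x\<in>X. \<bar>\<phi> x\<bar> \<le> b)"] ex_bound unfolding b_def by auto

lemma S_nonempty: "S \<noteq> {}" using irreducible by (simp add: irreducible_matrix_def)

lemma ex_path:
  assumes "matrix_power S A n i j > 0" "x \<in> X" "x 0 = j" "i \<in> S"
  shows "\<exists>y\<in>X. (shift ^^ n) y = x \<and> y 0 = i"
  using assms
proof (induction n arbitrary: j x)
  case 0
  then show ?case by (auto split: if_splits)
next
  case (Suc n)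
  then have "(\<Sum>k\<in>S. matrix_power S A n i k * A k j) > 0" by simp
  then obtain k where k: "k \<in> S" "matrix_power S A n i k * A k j > 0"
    by (metis (no_types, lifting) gr0I not_gr_zero sum.neutral)
  moreover have "j \<in> S" using Suc.prems by (auto simp: X_iff)
  ultimately have "A k j = 1" using entries[of k j] by auto
  then have "case_nat k x \<in> X" using Suc.prems k by (simp add: case_nat_X_iff)
  then obtain y where y: "y \<in> X" "(shift ^^ n) y = case_nat k x" "y 0 = i"
    using Suc.IH[of k "case_nat k x"] k Suc.prems by auto
  then show ?case by (intro bexI[of _ y]) auto
qed

text \<open>A mixing time: after \<open>M\<close> steps every symbol leads to every symbol.\<close>

definition M :: nat where "M = (SOME M. M \<ge> 1 \<and> (\<forall>n\<ge>M. \<forall>i\<in>S. \<forall>j\<in>S. matrix_power S A n i j > 0))"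

lemma M: "M \<ge> 1" "\<And>n i j. n \<ge> M \<Longrightarrow> i \<in> S \<Longrightarrow> j \<in> S \<Longrightarrow> matrix_power S A n i j > 0"
  using someI_ex[OF primitive_matrix[OF finite_S irreducible aperiodic]] unfolding M_def by auto

lemma ex_preimage: "x \<in> X \<Longrightarrow> i \<in> S \<Longrightarrow> n \<ge> M \<Longrightarrow> \<exists>y\<in>X. (shift ^^ n) y = x \<and> y 0 = i"
  using ex_path[of n i "x 0" x] M by (auto simp: X_iff)

lemma ex_successor: "i \<in> S \<Longrightarrow> \<exists>j\<in>S. A i j = 1"
proof -
  assume i: "i \<in> S"
  have pos: "matrix_power S A n i k > 0 \<Longrightarrow> n \<ge> 1 \<Longrightarrow> k \<in> S \<Longrightarrow> \<exists>j\<in>S. A i j = 1" for n k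
  proof (induction n arbitrary: k)
    case (Suc n)
    then have "(\<Sum>l\<in>S. matrix_power S A n i l * A l k) > 0" by simp
    then obtain l where l: "l \<in> S" "matrix_power S A n i l * A l k > 0"
      by (metis (no_types, lifting) gr0I not_gr_zero sum.neutral)
    show ?case
    proof (cases "n = 0")
      case True
      then have "l = i" "A l k > 0" using l by (auto split: if_splits)
      then show ?thesis using entries[of i k] i Suc.prems by auto
    qed (use Suc.IH[of l] l in auto)
  qed auto
  show ?thesis using pos[of M i] M i by auto
qed

lemma ex_point: "i \<in> S \<Longrightarrow> \<exists>x\<in>X. x 0 = i"
proof -
  assume i: "i \<in> S"
  obtain s where s: "\<And>i. i \<in> S \<Longrightarrow> s i \<in> S \<and> A i (s i) = 1" using ex_successor by metis
  have "(s ^^ n) i \<in> S" for n by (induction n) (use i s in auto)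
  then show ?thesis using s by (intro bexI[of _ "\<lambda>n. (s ^^ n) i"]) (auto simp: X_iff)
qed

lemma X_nonempty: "X \<noteq> {}" using S_nonempty ex_point by blast

text \<open>Non-negative functions whose logarithm is Hoelder with constant \<open>K\<close>, tested only on points with at
  least \<open>max 1 m\<close> common symbols. A level \<open>m > 0\<close> admits functions that also contain the indicator of a
  set depending on the first \<open>m\<close> symbols; level \<open>0\<close> still compares only points with the same first symbol,
  since other points have unrelated preimages.\<close>

definition cone :: "nat \<Rightarrow> real \<Rightarrow> ((nat \<Rightarrow> nat) \<Rightarrow> real) \<Rightarrow> bool" where
  "cone m K f \<longleftrightarrow> (\<forall>x\<in>X. 0 \<le> f x) \<and>
     (\<forall>x\<in>X. \<forall>y\<in>X. \<forall>j\<ge>max 1 m. agree j x y \<longrightarrow> f x \<le> exp (K * \<theta> ^ j) * f y)"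

lemma coneD: "cone m K f \<Longrightarrow> x \<in> X \<Longrightarrow> y \<in> X \<Longrightarrow> 1 \<le> j \<Longrightarrow> m \<le> j \<Longrightarrow> agree j x y \<Longrightarrow> f x \<le> exp (K * \<theta> ^ j) * f y"
  by (auto simp: cone_def)

lemma cone_nonneg: "cone m K f \<Longrightarrow> x \<in> X \<Longrightarrow> 0 \<le> f x" by (auto simp: cone_def)

lemma cone_mono: "cone m K f \<Longrightarrow> K \<le> K' \<Longrightarrow> m \<le> m' \<Longrightarrow> cone m' K' f"
  unfolding cone_def using \<theta>
  by (auto intro!: order.trans[OF _ mult_right_mono[of "exp (K * _)" "exp (K' * _)"]] mult_right_mono)

lemma cone_mult: "cone m K f \<Longrightarrow> cone m K' g \<Longrightarrow> cone m (K + K') (\<lambda>x. f x * g x)"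
proof -
  assume f: "cone m K f" and g: "cone m K' g"
  have "f x * g x \<le> exp ((K + K') * \<theta> ^ j) * (f y * g y)"
    if "x \<in> X" "y \<in> X" "1 \<le> j" "m \<le> j" "agree j x y" for x y j
  proof -
    have "f x * g x \<le> (exp (K * \<theta> ^ j) * f y) * (exp (K' * \<theta> ^ j) * g y)"
      using coneD[OF f that] coneD[OF g that] cone_nonneg[OF f] cone_nonneg[OF g] that
      by (intro mult_mono) auto
    then show ?thesis by (simp add: distrib_right exp_add mult_ac)
  qed
  then show ?thesis using cone_nonneg[OF f] cone_nonneg[OF g] by (auto simp: cone_def)
qed

text \<open>Putting a symbol in front brings two points closer by the factor \<open>\<theta>\<close>, which improves the constant of
  \<open>f\<close> to \<open>\<theta> * K\<close> and the level by one, at the cost of the modulus \<open>c\<close> of \<open>\<phi>\<close>.\<close>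

lemma cone_L: assumes f: "cone m K f" and K: "0 \<le> K" shows "cone (m - 1) (\<theta> * K + c) (L f)"
  unfolding cone_def
proof safe
  fix x assume "x \<in> X" then show "0 \<le> L f x" using f by (intro L_nonneg) (auto simp: cone_def)
next
  fix x y j assume xy: "x \<in> X" "y \<in> X" and j: "max 1 (m - 1) \<le> j" and ag: "agree j x y"
  have eq: "pre x = pre y" using ag j by (intro pre_cong) (auto simp: agree_def)
  have "exp (\<phi> (case_nat a x)) * f (case_nat a x)
      \<le> exp ((\<theta> * K + c) * \<theta> ^ j) * (exp (\<phi> (case_nat a y)) * f (case_nat a y))"
    if a: "a \<in> pre x" for a
  proof -
    let ?x = "case_nat a x" and ?y = "case_nat a y"
    have X: "?x \<in> X" "?y \<in> X" using xy a eq case_nat_pre by auto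
    have ag': "agree (Suc j) ?x ?y" using ag by (rule agree_case_nat)
    have "\<phi> ?x \<le> \<phi> ?y + c * \<theta> ^ Suc j" using \<phi>_lip[OF X ag'] by simp
    then have 1: "exp (\<phi> ?x) \<le> exp (\<phi> ?y) * exp (c * \<theta> ^ Suc j)" by (simp add: exp_add[symmetric])
    have 2: "f ?x \<le> exp (K * \<theta> ^ Suc j) * f ?y"
      using coneD[OF f X _ _ ag'] j by linarith
    have "exp (\<phi> ?x) * f ?x \<le> (exp (\<phi> ?y) * exp (c * \<theta> ^ Suc j)) * (exp (K * \<theta> ^ Suc j) * f ?y)"
      using 1 2 cone_nonneg[OF f X(1)] by (intro mult_mono) auto
    also have "\<dots> = exp (c * \<theta> ^ Suc j + K * \<theta> ^ Suc j) * (exp (\<phi> ?y) * f ?y)"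
      by (simp add: exp_add)
    also have "\<dots> \<le> exp ((\<theta> * K + c) * \<theta> ^ j) * (exp (\<phi> ?y) * f ?y)"
    proof (rule mult_right_mono)
      have "c * (\<theta> * \<theta> ^ j) \<le> c * (1 * \<theta> ^ j)"
        using c \<theta> by (intro mult_left_mono mult_right_mono) auto
      then show "exp (c * \<theta> ^ Suc j + K * \<theta> ^ Suc j) \<le> exp ((\<theta> * K + c) * \<theta> ^ j)"
        by (simp add: algebra_simps)
    qed (use cone_nonneg[OF f X(2)] in auto)
    finally show ?thesis .
  qed
  then show "L f x \<le> exp ((\<theta> * K + c) * \<theta> ^ j) * L f y"
    using xy eq by (auto simp: L_eq sum_distrib_left intro!: sum_mono)
qed

text \<open>The fixed point of \<open>K \<mapsto> \<theta> * K + c\<close>; cones with \<open>K \<ge> K0\<close> are invariant under the transfer operator.\<close>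

definition K0 :: real where "K0 = c / (1 - \<theta>)"

lemma K0: "K0 \<ge> 0" "\<theta> * K0 + c = K0"
  using \<theta> c unfolding K0_def by (auto simp: field_simps)

lemma cone_L_invariant: assumes f: "cone m K f" and K: "K0 \<le> K" shows "cone (m - 1) K (L f)"
proof -
  have "\<theta> * (K - K0) \<le> K - K0" using K \<theta> by (intro mult_left_le_one_le) auto
  then have "\<theta> * K + c \<le> K" using K0(2) by (simp add: algebra_simps)
  then show ?thesis using cone_mono[OF cone_L[OF f]] K K0 by fastforce
qed

lemma cone_Ln: "cone m K f \<Longrightarrow> K0 \<le> K \<Longrightarrow> cone (m - n) K ((L ^^ n) f)"
  by (induction n) (auto dest: cone_L_invariant)

lemma cone_Ln_0: "cone m K f \<Longrightarrow> K0 \<le> K \<Longrightarrow> m \<le> n \<Longrightarrow> cone 0 K ((L ^^ n) f)"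
  using cone_Ln[of m K f n] by simp

lemma cone_const: "0 \<le> a \<Longrightarrow> 0 \<le> K \<Longrightarrow> cone m K (\<lambda>_. a)"
  using \<theta> by (auto simp: cone_def mult_le_cancel_right1)

lemma Ln_lower:
  assumes "\<And>y. y \<in> X \<Longrightarrow> 0 \<le> f y" "y \<in> X"
  shows "exp (- b * n) * f y \<le> (L ^^ n) f ((shift ^^ n) y)"
proof (induction n)
  case (Suc n)
  let ?z = "(shift ^^ n) y"
  have z: "?z \<in> X" using assms by auto
  have z0: "?z 0 \<in> pre (shift ?z)" using z by (auto simp: pre_def X_iff shift_def)
  have "exp (- b * Suc n) * f y = exp (- b) * (exp (- b * n) * f y)"
    by (simp add: exp_add[symmetric] algebra_simps)
  also have "\<dots> \<le> exp (\<phi> ?z) * (L ^^ n) f ?z"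
    using Suc b(2)[OF z] assms by (intro mult_mono) auto
  also have "\<dots> \<le> L ((L ^^ n) f) (shift ?z)"
  proof -
    let ?h = "\<lambda>a. exp (\<phi> (case_nat a (shift ?z))) * (L ^^ n) f (case_nat a (shift ?z))"
    have "0 \<le> ?h a" if "a \<in> pre (shift ?z)" for a
      using Ln_nonneg[of f] assms(1) case_nat_pre[OF shift_X[OF z] that] by simp
    then have "?h (?z 0) \<le> sum ?h (pre (shift ?z))" using z0 by (intro member_le_sum) auto
    then show ?thesis using z unfolding L_eq[OF shift_X[OF z]] case_nat_shift by simp
  qed
  finally show ?case by simp
qed auto

text \<open>A bound for the norm of the transfer operator in the supremum norm.\<close>

definition D :: real where "D = card S * exp b"

lemma D: "D \<ge> 1"
proof -
  have "real (card S) \<ge> 1" using finite_S S_nonempty by (simp add: Suc_leI card_gt_0_iff)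
  then show ?thesis using mult_mono[of 1 "real (card S)" 1 "exp b"] b by (simp add: D_def)
qed

lemma Ln_upper:
  assumes "\<And>y. y \<in> X \<Longrightarrow> 0 \<le> f y" "\<And>y. y \<in> X \<Longrightarrow> f y \<le> s" "x \<in> X"
  shows "(L ^^ n) f x \<le> D ^ n * s"
  using assms(3)
proof (induction n arbitrary: x)
  case (Suc n)
  have s0: "0 \<le> s" using assms by force
  have "L ((L ^^ n) f) x \<le> (\<Sum>a\<in>pre x. exp b * (D ^ n * s))"
    unfolding L_eq[OF Suc.prems]
  proof (intro sum_mono mult_mono)
    fix a assume "a \<in> pre x"
    then have a: "case_nat a x \<in> X" using Suc.prems by (rule case_nat_pre[rotated])
    show "exp (\<phi> (case_nat a x)) \<le> exp b" using b(2)[OF a] by simp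
    show "(L ^^ n) f (case_nat a x) \<le> D ^ n * s" "0 \<le> (L ^^ n) f (case_nat a x)"
      using Suc.IH[OF a] Ln_nonneg[of f] assms(1) a by auto
  qed auto
  also have "\<dots> = card (pre x) * (exp b * (D ^ n * s))" by simp
  also have "\<dots> \<le> card S * (exp b * (D ^ n * s))"
    using s0 D finite_S by (intro mult_right_mono) (auto simp: pre_def intro!: card_mono mult_nonneg_nonneg)
  also have "\<dots> = D ^ Suc n * s" by (simp add: D_def mult_ac)
  finally show ?case by simp
qed (use assms in auto)

abbreviation "g n \<equiv> (L ^^ n) (\<lambda>_. 1)"

lemma cone_g: "cone 0 K0 (g n)" using cone_Ln_0[OF cone_const[of 1 K0 0]] K0 by simp

text \<open>By mixing, \<open>y\<close> has an \<open>M\<close>-fold preimage with the same first symbol as \<open>x\<close>, where \<open>f\<close> is comparable to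
  \<open>f x\<close>; this single preimage bounds \<open>(L ^^ M) f y\<close> from below.\<close>

lemma cone_spread:
  assumes f: "cone 0 K f" and K: "0 \<le> K" and xy: "x \<in> X" "y \<in> X"
  shows "f x \<le> exp (K + b * M) * (L ^^ M) f y"
proof -
  obtain y' where y': "y' \<in> X" "(shift ^^ M) y' = y" "y' 0 = x 0"
    using ex_preimage[of y "x 0" M] xy by (auto simp: X_iff)
  have "f x \<le> exp (K * \<theta> ^ 1) * f y'"
    using y' by (intro coneD[OF f xy(1)]) (auto simp: agree_def)
  also have "\<dots> \<le> exp K * f y'"
    using K \<theta> cone_nonneg[OF f y'(1)] by (intro mult_right_mono) (auto simp: mult_left_le)
  also have "\<dots> = exp (K + b * M) * (exp (- b * M) * f y')" by (simp add: exp_add[symmetric])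
  also have "\<dots> \<le> exp (K + b * M) * (L ^^ M) f y"
    using Ln_lower[of f y' M] y' cone_nonneg[OF f] by (intro mult_left_mono) auto
  finally show ?thesis .
qed

text \<open>The distortion constant: \<open>g n\<close> varies at most by the factor \<open>B\<close>, uniformly in \<open>n\<close>.\<close>

definition B :: real where "B = D ^ M * exp (K0 + b * M)"

lemma g_pos: "x \<in> X \<Longrightarrow> 0 < g n x"
proof -
  assume x: "x \<in> X"
  obtain y where y: "y \<in> X" "(shift ^^ (n + M)) y = x" 
    using ex_preimage[OF x, of "x 0" "n + M"] x by (auto simp: X_iff)
  then have "(shift ^^ n) ((shift ^^ M) y) = x" by (simp add: funpow_add)
  then show ?thesis using Ln_lower[of "\<lambda>_. 1" "(shift ^^ M) y" n] y(1) funpow_X[OF y(1), of M]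
    by (metis (mono_tags) exp_gt_zero less_le_trans mult.right_neutral zero_le_one)
qed

lemma g_ratio: assumes xy: "x \<in> X" "y \<in> X" shows "g n x \<le> B * g n y"
proof (cases "M \<le> n")
  case True
  then obtain k where k: "n = M + k" using le_Suc_ex by blast
  have "g n x = (L ^^ M) (g k) x" by (simp add: k funpow_add)
  also have "\<dots> \<le> D ^ M * (exp (K0 + b * M) * (L ^^ M) (g k) y)"
    using xy cone_spread[OF cone_g K0(1)] by (intro Ln_upper) (auto intro: less_imp_le g_pos)
  also have "\<dots> = B * g n y" by (simp add: k funpow_add B_def)
  finally show ?thesis .
next
  case False
  obtain y' where y': "y' \<in> X" "(shift ^^ (n + M)) y' = y"
    using ex_preimage[OF xy(2), of "y 0" "n + M"] xy by (auto simp: X_iff)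
  then have "(shift ^^ n) ((shift ^^ M) y') = y" by (simp add: funpow_add)
  then have low: "exp (- b * n) \<le> g n y" using Ln_lower[of "\<lambda>_. 1" "(shift ^^ M) y'" n] y'(1) by auto
  have "g n x \<le> D ^ n * 1" using xy by (intro Ln_upper) auto
  also have "\<dots> \<le> D ^ M * 1" using D False by (auto intro: power_increasing)
  also have "\<dots> \<le> D ^ M * (exp (K0 + b * M) * exp (- b * n))"
  proof (rule mult_left_mono)
    have "b * n \<le> b * M" using b(1) False by (intro mult_left_mono) auto
    then show "1 \<le> exp (K0 + b * M) * exp (- b * n)" using K0(1) by (simp add: exp_add[symmetric])
  qed (use D in auto)
  also have "\<dots> \<le> D ^ M * (exp (K0 + b * M) * g n y)"
    using low D by (intro mult_left_mono) auto
  finally show ?thesis by (simp add: B_def mult_ac)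
qed

lemma B: "B \<ge> 1"
proof -
  obtain x where "x \<in> X" using X_nonempty by auto
  then show ?thesis using g_ratio[of x x 0] by simp
qed

text \<open>Because of the excess over \<open>K0\<close>, which could be any positive number, one step of the operator maps the
  cone of constant \<open>K2\<close> strictly inside itself; this leaves room for subtracting a multiple of \<open>g n\<close>.\<close>

definition K2 :: real where "K2 = K0 + 1"

lemma K2: "0 \<le> K2" "K0 \<le> K2" "\<theta> * K2 + c < K2" "0 \<le> \<theta> * K2 + c" "K0 \<le> \<theta> * K2 + c"
proof -
  have "\<theta> * K2 + c = K0 + \<theta>" using K0(2) by (simp add: K2_def algebra_simps)
  then show "0 \<le> K2" "K0 \<le> K2" "\<theta> * K2 + c < K2" "0 \<le> \<theta> * K2 + c" "K0 \<le> \<theta> * K2 + c"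
    using K0(1) \<theta> by (auto simp: K2_def)
qed

text \<open>If \<open>f\<close> reaches half of its upper bound \<open>a * g n\<close> somewhere, then by spreading \<open>(L ^^ M) f\<close> is at least a
  fixed fraction of the bound everywhere, and a multiple of \<open>g (n + M)\<close> can be subtracted without leaving
  the cone. Otherwise the bound can be halved. In both cases the oscillation of \<open>f\<close> relative to \<open>g n\<close>
  shrinks by a factor \<open>1 - \<eta>\<close>.\<close>

lemma contraction_step:
  "\<exists>\<eta>. 0 < \<eta> \<and> \<eta> < 1 \<and> (\<forall>f a n. cone 0 K2 f \<longrightarrow> 0 \<le> a \<longrightarrow> (\<forall>x\<in>X. f x \<le> a * g n x) \<longrightarrow>
     (\<exists>u\<ge>0. cone 0 K2 (\<lambda>x. (L ^^ M) f x - u * g (n + M) x) \<and>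
       (\<forall>x\<in>X. (L ^^ M) f x - u * g (n + M) x \<le> (1 - \<eta>) * a * g (n + M) x)))"
proof -
  define K1 where "K1 = \<theta> * K2 + c"
  \<comment> \<open>\<open>\<kappa>\<close> is the smallness required for subtraction in the cone, \<open>\<delta>\<close> the fraction of the bound reached everywhere\<close>
  define \<kappa> where "\<kappa> = (K2 - K1) / ((K2 + K1) * exp K2)"
  define \<delta> where "\<delta> = exp (- (K2 + b * M)) / (2 * D ^ M * B)"
  have K1: "0 \<le> K1" "K1 < K2" "K0 \<le> K1" using K2 by (auto simp: K1_def)
  have \<kappa>: "0 < \<kappa>" using K1 K2 by (auto simp: \<kappa>_def)
  have "\<kappa> \<le> 1"
  proof -
    have "K2 - K1 \<le> (K2 + K1) * 1" using K1 by simp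
    also have "\<dots> \<le> (K2 + K1) * exp K2" using K1 K2 by (intro mult_left_mono) auto
    finally show ?thesis using K1 K2 by (simp add: \<kappa>_def divide_le_eq_1 add_pos_nonneg)
  qed
  have D1: "D ^ M * B \<ge> 1" using D B mult_mono[of 1 "D ^ M" 1 B] by (simp add: one_le_power)
  have \<delta>0: "0 < \<delta>" unfolding \<delta>_def using D B by (intro divide_pos_pos mult_pos_pos zero_less_power) auto
  have "\<delta> \<le> 1 / 2"
  proof -
    have "0 \<le> b * M" using b by simp
    then have "exp (- (K2 + b * M)) \<le> 1" using K2 by simp
    then have "\<delta> \<le> 1 / (2 * (D ^ M * B))" unfolding \<delta>_def using D1 by (simp add: field_simps)
    also have "\<dots> \<le> 1 / 2" using D1 by (simp add: field_simps)
    finally show ?thesis .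
  qed
  define \<eta> where "\<eta> = \<delta> * \<kappa>"
  have \<eta>: "0 < \<eta>" "\<eta> \<le> 1 / 2"
    using \<open>\<kappa> \<le> 1\<close> \<kappa> \<delta>0 \<open>\<delta> \<le> 1 / 2\<close> mult_mono[of \<delta> "1/2" \<kappa> 1] by (auto simp: \<eta>_def)
  show ?thesis
  proof (rule exI[of _ \<eta>], intro conjI allI impI)
    fix f a n assume f: "cone 0 K2 f" and a: "0 \<le> (a::real)" and fa: "\<forall>x\<in>X. f x \<le> a * g n x"
    let ?u = "(L ^^ M) f" and ?v = "g (n + M)"
    have v: "?v x = (L ^^ M) (g n) x" for x by (subst add.commute) (simp add: funpow_add)
    have uv: "?u x \<le> a * ?v x" if "x \<in> X" for x
      using Ln_mono[of f "\<lambda>x. a * g n x" x M] fa that unfolding v Ln_scale by blast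
    have nn: "0 \<le> ?u x" "0 \<le> ?v x" if "x \<in> X" for x
      using that f g_pos[of x "n + M"] by (auto intro!: Ln_nonneg simp: cone_def)
    show "\<exists>u\<ge>0. cone 0 K2 (\<lambda>x. ?u x - u * ?v x) \<and> (\<forall>x\<in>X. ?u x - u * ?v x \<le> (1 - \<eta>) * a * ?v x)"
    proof (cases "\<forall>x\<in>X. f x \<le> a / 2 * g n x")
      case True
      have "?u x \<le> (1 - \<eta>) * a * ?v x" if x: "x \<in> X" for x
      proof -
        have "?u x \<le> a / 2 * ?v x"
          using Ln_mono[of f "\<lambda>x. a / 2 * g n x" x M] True x unfolding v Ln_scale by blast
        also have "\<dots> = 1 / 2 * (a * ?v x)" by simp
        also have "\<dots> \<le> (1 - \<eta>) * (a * ?v x)"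
          using \<eta> a nn[OF x] by (intro mult_right_mono) auto
        finally show ?thesis by (simp add: mult_ac)
      qed
      then show ?thesis using cone_Ln[OF f K2(2), of M] by (intro exI[of _ 0]) auto
    next
      case False
      then obtain z where z: "z \<in> X" "f z \<ge> a / 2 * g n z" by force
      have low: "a * \<delta> * ?v x \<le> ?u x" if x: "x \<in> X" for x
      proof -
        have "?v x \<le> D ^ M * (B * g n z)"
          unfolding v using x z g_ratio g_pos by (intro Ln_upper) (auto intro: less_imp_le)
        then have "a * \<delta> * ?v x \<le> a * \<delta> * (D ^ M * (B * g n z))"
          using a \<delta>0 by (intro mult_left_mono) auto
        also have "\<dots> = exp (- (K2 + b * M)) * (a / 2 * g n z)"
          using D1 D B unfolding \<delta>_def by (simp add: field_simps)
        also have "\<dots> \<le> exp (- (K2 + b * M)) * f z" using z by (intro mult_left_mono) auto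
        also have "\<dots> \<le> exp (- (K2 + b * M)) * (exp (K2 + b * M) * ?u x)"
          using cone_spread[OF f K2(1) z(1) x] by (intro mult_left_mono) auto
        also have "\<dots> = ?u x" by (simp add: mult.assoc[symmetric] exp_add[symmetric])
        finally show ?thesis .
      qed
      have LM: "(L ^^ M) = (\<lambda>f. L ((L ^^ (M - 1)) f))"
        using M(1) by (cases M) auto
      have cu: "cone 0 K1 ?u"
        using cone_L[OF cone_Ln[OF f K2(2), of "M - 1"] K2(1)] by (simp add: LM K1_def)
      have cv: "cone 0 K1 ?v" using cone_mono[OF cone_g K1(3)] by blast
      show ?thesis
      proof (intro exI[of _ "a * \<eta>"] conjI)
        show "0 \<le> a * \<eta>" using a \<eta> by simp
        show "cone 0 K2 (\<lambda>x. ?u x - a * \<eta> * ?v x)"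
          unfolding cone_def
        proof safe
          fix x assume x: "x \<in> X"
          have "a * \<eta> * ?v x \<le> a * \<delta> * ?v x"
            using a \<delta>0 \<kappa> \<open>\<kappa> \<le> 1\<close> nn[OF x] by (auto simp: \<eta>_def mult_left_le intro!: mult_right_mono mult_left_mono)
          then show "0 \<le> ?u x - a * \<eta> * ?v x" using low[OF x] by simp
        next
          fix x y j assume xy: "x \<in> X" "y \<in> X" and j: "max 1 0 \<le> (j::nat)" and ag: "agree j x y"
          show "?u x - a * \<eta> * ?v x \<le> exp (K2 * \<theta> ^ j) * (?u y - a * \<eta> * ?v y)"
          proof (rule exp_cone_difference[where ?K1.0=K1])
            show "?u x \<le> exp (K1 * \<theta> ^ j) * ?u y" using coneD[OF cu xy] j ag by auto
            have "?v y \<le> exp (K1 * \<theta> ^ j) * ?v x" using coneD[OF cv xy(2,1)] j agree_sym[OF ag] by auto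
            then have "(a * \<eta>) * ?v y \<le> (a * \<eta>) * (exp (K1 * \<theta> ^ j) * ?v x)"
              using a \<eta> by (intro mult_left_mono) auto
            then show "a * \<eta> * ?v y \<le> exp (K1 * \<theta> ^ j) * (a * \<eta> * ?v x)" by (simp add: mult_ac)
            have "\<kappa> * (a * \<delta> * ?v y) \<le> \<kappa> * ?u y" using low[OF xy(2)] \<kappa> by (intro mult_left_mono) auto
            then show "a * \<eta> * ?v y \<le> (K2 - K1) / ((K2 + K1) * exp K2) * ?u y"
              unfolding \<kappa>_def[symmetric] \<eta>_def by (simp add: mult_ac)
          qed (use \<theta> K1 a \<eta> nn xy in \<open>auto simp: power_le_one\<close>)
        qed
        show "\<forall>x\<in>X. ?u x - a * \<eta> * ?v x \<le> (1 - \<eta>) * a * ?v x"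
          using uv by (auto simp: algebra_simps)
      qed
    qed
  qed (use \<eta> in auto)
qed

text \<open>Iterating the step, the normalised iterates of \<open>f\<close> are trapped between \<open>u\<close> and \<open>u + r n * a\<close>. The rate
  \<open>r\<close> is the same for all functions of the cone, which later makes the decay of correlations uniform over
  all events.\<close>

lemma contraction:
  "\<exists>r. r \<longlonglongrightarrow> 0 \<and> (\<forall>n. 0 \<le> r n) \<and> (\<forall>f a n. cone 0 K2 f \<longrightarrow> (\<forall>x\<in>X. f x \<le> a) \<longrightarrow>
     (\<exists>u\<ge>0. \<forall>N\<ge>n. \<forall>x\<in>X. u * g N x \<le> (L ^^ N) f x \<and> (L ^^ N) f x \<le> (u + r n * a) * g N x))"
proof -
  obtain \<eta> where \<eta>: "0 < \<eta>" "\<eta> < 1" and step: "\<And>f a n. cone 0 K2 f \<Longrightarrow> 0 \<le> a \<Longrightarrow> (\<forall>x\<in>X. f x \<le> a * g n x) \<Longrightarrow>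
     (\<exists>u\<ge>0. cone 0 K2 (\<lambda>x. (L ^^ M) f x - u * g (n + M) x) \<and>
       (\<forall>x\<in>X. (L ^^ M) f x - u * g (n + M) x \<le> (1 - \<eta>) * a * g (n + M) x))"
    using contraction_step by auto
  have iter: "\<exists>u\<ge>0. cone 0 K2 (\<lambda>x. (L ^^ (k * M)) f x - u * g (k * M) x) \<and>
       (\<forall>x\<in>X. (L ^^ (k * M)) f x - u * g (k * M) x \<le> (1 - \<eta>) ^ k * a * g (k * M) x)"
    if f: "cone 0 K2 f" and a: "0 \<le> a" "\<forall>x\<in>X. f x \<le> a" for f a k
  proof (induction k)
    case 0
    show ?case using f a by (intro exI[of _ 0]) auto
  next
    case (Suc k)
    then obtain u where u: "u \<ge> 0" "cone 0 K2 (\<lambda>x. (L ^^ (k * M)) f x - u * g (k * M) x)"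
      "\<forall>x\<in>X. (L ^^ (k * M)) f x - u * g (k * M) x \<le> (1 - \<eta>) ^ k * a * g (k * M) x" by blast
    from step[OF u(2) _ u(3)] \<eta> a obtain v where v: "v \<ge> 0"
      "cone 0 K2 (\<lambda>x. (L ^^ M) (\<lambda>x. (L ^^ (k * M)) f x - u * g (k * M) x) x - v * g (k * M + M) x)"
      "\<forall>x\<in>X. (L ^^ M) (\<lambda>x. (L ^^ (k * M)) f x - u * g (k * M) x) x - v * g (k * M + M) x
          \<le> (1 - \<eta>) * ((1 - \<eta>) ^ k * a) * g (k * M + M) x" by auto
    have eq: "(L ^^ M) (\<lambda>x. (L ^^ (k * M)) f x - u * g (k * M) x) x - v * g (k * M + M) x
        = (L ^^ (Suc k * M)) f x - (u + v) * g (Suc k * M) x" for x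
      by (simp add: Ln_diff funpow_add add.commute[of "k * M"] algebra_simps)
    show ?case
      using v u(1) unfolding eq by (intro exI[of _ "u + v"]) (auto simp: algebra_simps)
  qed
  show ?thesis
  proof (intro exI[of _ "\<lambda>n. (1 - \<eta>) ^ (n div M)"] conjI allI impI)
    have "filterlim (\<lambda>n. n div M) at_top sequentially"
      unfolding filterlim_at_top
    proof
      fix Z show "\<forall>\<^sub>F n in sequentially. Z \<le> n div M"
        using M(1) by (intro eventually_sequentiallyI[of "Z * M"]) (metis div_le_mono nonzero_mult_div_cancel_right not_one_le_zero)
    qed
    then show "(\<lambda>n. (1 - \<eta>) ^ (n div M)) \<longlonglongrightarrow> 0"
      using filterlim_compose[OF LIMSEQ_power_zero[of "1 - \<eta>"]] \<eta> by auto
    fix f a n assume f: "cone 0 K2 f" and fa: "\<forall>x\<in>X. f x \<le> (a::real)"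
    have a: "0 \<le> a" using fa X_nonempty f by (force simp: cone_def)
    define k where "k = n div M"
    obtain u where u: "u \<ge> 0" "cone 0 K2 (\<lambda>x. (L ^^ (k * M)) f x - u * g (k * M) x)"
      "\<forall>x\<in>X. (L ^^ (k * M)) f x - u * g (k * M) x \<le> (1 - \<eta>) ^ k * a * g (k * M) x" using iter[OF f a fa] by blast
    show "\<exists>u\<ge>0. \<forall>N\<ge>n. \<forall>x\<in>X. u * g N x \<le> (L ^^ N) f x \<and> (L ^^ N) f x \<le> (u + (1 - \<eta>) ^ (n div M) * a) * g N x"
    proof (intro exI[of _ u] conjI allI impI ballI)
      fix N x assume N: "n \<le> N" and x: "x \<in> X"
      have "k * M \<le> N" using N by (metis k_def div_times_less_eq_dividend order.trans)
      then obtain i where i: "N = i + k * M" by (metis add.commute le_Suc_ex)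
      have LN: "(L ^^ N) h = (L ^^ i) ((L ^^ (k * M)) h)" for h by (simp add: i funpow_add)
      have "0 \<le> (L ^^ i) (\<lambda>x. (L ^^ (k * M)) f x - u * g (k * M) x) x"
        using x u(2) by (intro Ln_nonneg) (auto simp: cone_def)
      then show "u * g N x \<le> (L ^^ N) f x" by (simp add: Ln_diff LN)
      have "(L ^^ i) (\<lambda>x. (L ^^ (k * M)) f x - u * g (k * M) x) x \<le> (L ^^ i) (\<lambda>x. (1 - \<eta>) ^ k * a * g (k * M) x) x"
        using x u(3) by (intro Ln_mono) auto
      then show "(L ^^ N) f x \<le> (u + (1 - \<eta>) ^ (n div M) * a) * g N x"
        by (simp add: Ln_diff Ln_scale LN k_def algebra_simps)
    qed (use u in auto)
  qed (use \<eta> in auto)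
qed

end

section \<open>Cylinder sets\<close>

definition cyl :: "nat list \<Rightarrow> (nat \<Rightarrow> nat) set" where
  "cyl us = {x. \<forall>i<length us. x i = us ! i}"

lemma cyl_Nil [simp]: "cyl [] = UNIV" by (simp add: cyl_def)

lemma cyl_snoc: "x \<in> cyl (us @ [a]) \<longleftrightarrow> x \<in> cyl us \<and> x (length us) = a"
  by (auto simp: cyl_def nth_append less_Suc_eq)

lemma cyl_Cons: "x \<in> cyl (a # us) \<longleftrightarrow> x 0 = a \<and> shift x \<in> cyl us"
  by (auto simp: cyl_def shift_def nth_Cons' less_Suc_eq_0_disj)

lemma cyl_agree: "x \<in> cyl us \<Longrightarrow> agree (length us) x y \<longleftrightarrow> y \<in> cyl us"
  by (auto simp: cyl_def agree_def)

section \<open>Leading eigenvalue and eigenfunction\<close>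

context sft_potential
begin

definition rate :: "nat \<Rightarrow> real" where
  "rate = (SOME r. r \<longlonglongrightarrow> 0 \<and> (\<forall>n. 0 \<le> r n) \<and> (\<forall>f a n. cone 0 K2 f \<longrightarrow> (\<forall>x\<in>X. f x \<le> a) \<longrightarrow>
     (\<exists>u\<ge>0. \<forall>N\<ge>n. \<forall>x\<in>X. u * g N x \<le> (L ^^ N) f x \<and> (L ^^ N) f x \<le> (u + r n * a) * g N x)))"

lemma rate: "rate \<longlonglongrightarrow> 0" "0 \<le> rate n"
  and rateE: "cone 0 K2 f \<Longrightarrow> (\<And>x. x \<in> X \<Longrightarrow> f x \<le> a) \<Longrightarrow>
     \<exists>u\<ge>0. \<forall>N\<ge>n. \<forall>x\<in>X. u * g N x \<le> (L ^^ N) f x \<and> (L ^^ N) f x \<le> (u + rate n * a) * g N x"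
  using someI_ex[OF contraction] unfolding rate_def by blast+

definition x0 :: "nat \<Rightarrow> nat" where "x0 = (SOME x. x \<in> X)"

lemma x0: "x0 \<in> X" using X_nonempty by (simp add: x0_def some_in_eq)

text \<open>The eigenfunctional of the dual operator, up to normalisation, on functions of the cone.\<close>

definition \<nu> :: "((nat \<Rightarrow> nat) \<Rightarrow> real) \<Rightarrow> real" where "\<nu> f = lim (\<lambda>N. (L ^^ N) f x0 / g N x0)"

lemma \<nu>_rate:
  assumes f: "cone 0 K2 f" and a: "\<And>x. x \<in> X \<Longrightarrow> f x \<le> a" and N: "n \<le> N" and x: "x \<in> X"
  shows "\<bar>(L ^^ N) f x - \<nu> f * g N x\<bar> \<le> rate n * a * g N x"
proof -
  define q where "q N x = (L ^^ N) f x / g N x" for N x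
  have "\<exists>u\<ge>0. \<forall>N\<ge>n. \<forall>x\<in>X. u * g N x \<le> (L ^^ N) f x \<and> (L ^^ N) f x \<le> (u + rate n * a) * g N x" for n
    using rateE[OF f] a by blast
  then obtain u where u: "\<And>n N x. n \<le> N \<Longrightarrow> x \<in> X \<Longrightarrow> u n * g N x \<le> (L ^^ N) f x"
    "\<And>n N x. n \<le> N \<Longrightarrow> x \<in> X \<Longrightarrow> (L ^^ N) f x \<le> (u n + rate n * a) * g N x" by metis
  have q: "u n \<le> q N x" "q N x \<le> u n + rate n * a" if "n \<le> N" "x \<in> X" for n N x
    using u[OF that] g_pos[OF that(2), of N] by (auto simp: q_def pos_le_divide_eq pos_divide_le_eq)
  have lim0: "(\<lambda>n. rate n * a) \<longlonglongrightarrow> 0" using tendsto_mult_left_zero[OF rate(1)] by simp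
  have "Cauchy (\<lambda>N. q N x0)"
  proof (rule CauchyI)
    fix e :: real assume "0 < e"
    then obtain n where n: "\<bar>rate n * a\<bar> < e"
      using lim0 by (metis LIMSEQ_D diff_zero order_refl real_norm_def)
    show "\<exists>M. \<forall>m\<ge>M. \<forall>n\<ge>M. norm (q m x0 - q n x0) < e"
    proof (intro exI[of _ n] allI impI)
      fix i j assume "n \<le> i" "n \<le> j"
      then show "norm (q i x0 - q j x0) < e"
        using q[of n i x0] q[of n j x0] x0 n by (auto simp: abs_if split: if_splits)
    qed
  qed
  then have "(\<lambda>N. q N x0) \<longlonglongrightarrow> \<nu> f"
    unfolding \<nu>_def q_def by (simp add: Cauchy_convergent_iff convergent_LIMSEQ_iff)
  then have "u n \<le> \<nu> f" "\<nu> f \<le> u n + rate n * a"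
    using q[of n _ x0] x0 by (blast intro: LIMSEQ_le_const LIMSEQ_le_const2)+
  then have "\<bar>q N x - \<nu> f\<bar> \<le> rate n * a" using q[OF N x] by linarith
  then have "\<bar>q N x - \<nu> f\<bar> * g N x \<le> rate n * a * g N x"
    using g_pos[OF x, of N] by (intro mult_right_mono) auto
  moreover have "\<bar>q N x - \<nu> f\<bar> * g N x = \<bar>(L ^^ N) f x - \<nu> f * g N x\<bar>"
    using g_pos[OF x, of N] by (simp add: q_def abs_mult[symmetric] field_simps)
  ultimately show ?thesis by simp
qed

lemma \<nu>_lim:
  assumes f: "cone 0 K2 f" and x: "x \<in> X"
  shows "(\<lambda>N. (L ^^ N) f x / g N x) \<longlonglongrightarrow> \<nu> f"
proof -
  define a where "a = D * exp K2 * (\<Sum>i\<in>S. f (SOME x. x \<in> X \<and> x 0 = i))"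
  have a: "f y \<le> a" if y: "y \<in> X" for y
  proof -
    define z where "z i = (SOME x. x \<in> X \<and> x 0 = i)" for i
    have z: "z i \<in> X" "z i 0 = i" if "i \<in> S" for i
      using someI_ex[of "\<lambda>x. x \<in> X \<and> x 0 = i"] ex_point[OF that] by (auto simp: z_def)
    have yS: "y 0 \<in> S" using y by (auto simp: X_iff)
    have "f y \<le> exp (K2 * \<theta> ^ 1) * f (z (y 0))"
      using z[OF yS] y by (intro coneD[OF f]) (auto simp: agree_def)
    also have "\<dots> \<le> exp K2 * f (z (y 0))"
      using K2 \<theta> cone_nonneg[OF f z(1)[OF yS]] by (intro mult_right_mono) (auto simp: mult_left_le)
    also have "\<dots> \<le> exp K2 * (\<Sum>i\<in>S. f (z i))"
      using finite_S yS z cone_nonneg[OF f] by (intro mult_left_mono member_le_sum[of "y 0" S "\<lambda>i. f (z i)"]) auto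
    also have "\<dots> \<le> D * (exp K2 * (\<Sum>i\<in>S. f (z i)))"
    proof -
      have "0 \<le> exp K2 * (\<Sum>i\<in>S. f (z i))"
        using z cone_nonneg[OF f] by (intro mult_nonneg_nonneg sum_nonneg) auto
      from mult_right_mono[OF D this] show ?thesis by simp
    qed
    finally show ?thesis by (simp add: a_def z_def)
  qed
  show ?thesis
  proof (rule LIM_zero_cancel, rule Lim_null_comparison)
    show "\<forall>\<^sub>F N in sequentially. norm ((L ^^ N) f x / g N x - \<nu> f) \<le> rate N * a"
    proof (intro always_eventually allI)
      fix N
      have "\<bar>(L ^^ N) f x - \<nu> f * g N x\<bar> \<le> rate N * a * g N x"
        using \<nu>_rate[OF f a order_refl x] .
      moreover have "\<bar>(L ^^ N) f x - \<nu> f * g N x\<bar> = \<bar>(L ^^ N) f x / g N x - \<nu> f\<bar> * g N x"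
        using g_pos[OF x, of N] by (simp add: abs_mult[symmetric] field_simps)
      ultimately show "norm ((L ^^ N) f x / g N x - \<nu> f) \<le> rate N * a"
        using g_pos[OF x, of N] by (simp add: mult_le_cancel_right)
    qed
    show "(\<lambda>N. rate N * a) \<longlonglongrightarrow> 0" using tendsto_mult_left_zero[OF rate(1)] by simp
  qed
qed

definition \<rho> :: real where "\<rho> = \<nu> (g 1)"

lemma cone_g2: "cone 0 K2 (g n)" using cone_mono[OF cone_g K2(2)] by blast

lemma g_quot: "x \<in> X \<Longrightarrow> (\<lambda>N. g (N + n) x / g N x) \<longlonglongrightarrow> \<rho> ^ n"
proof (induction n)
  case 0
  have "g N x / g N x = 1" for N using g_pos[OF 0, of N] by simp
  then show ?case by simp
next
  case (Suc n)
  have 1: "(\<lambda>N. g (N + 1) x / g N x) \<longlonglongrightarrow> \<rho>"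
    using \<nu>_lim[OF cone_g2[of 1] Suc.prems] unfolding \<rho>_def by (simp add: funpow_swap1 del: funpow.simps(2))
       (simp add: funpow_swap1)
  have "(\<lambda>N. g (N + n + 1) x / g (N + n) x * (g (N + n) x / g N x)) \<longlonglongrightarrow> \<rho> * \<rho> ^ n"
    using LIMSEQ_ignore_initial_segment[OF 1, of n] Suc by (intro tendsto_mult) auto
  moreover have "g (N + n + 1) x / g (N + n) x * (g (N + n) x / g N x) = g (N + Suc n) x / g N x" for N
    using g_pos[OF Suc.prems, of "N + n"] by simp
  ultimately have "(\<lambda>N. g (N + Suc n) x / g N x) \<longlonglongrightarrow> \<rho> * \<rho> ^ n" by (simp only:)
  then show ?case by simp
qed

lemma \<nu>_g: "\<nu> (g n) = \<rho> ^ n"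
proof -
  have "(\<lambda>N. (L ^^ N) (g n) x0 / g N x0) \<longlonglongrightarrow> \<rho> ^ n"
    using g_quot[OF x0, of n] by (simp add: funpow_add)
  then show ?thesis using \<nu>_lim[OF cone_g2 x0] LIMSEQ_unique by blast
qed

lemma g_bounds:
  assumes x: "x \<in> X" shows "g n x \<le> B * \<rho> ^ n" "\<rho> ^ n \<le> B * g n x"
proof -
  have up: "g (N + n) x0 / g N x0 \<le> B * g n x" for N
  proof -
    have "(L ^^ N) (g n) x0 \<le> (L ^^ N) (\<lambda>y. B * g n x * 1) x0"
      using g_ratio[OF _ x, of _ n] x0 by (intro Ln_mono) auto
    then have "g (N + n) x0 \<le> B * g n x * g N x0" unfolding Ln_scale by (simp add: funpow_add)
    then show ?thesis using g_pos[OF x0, of N] by (simp add: pos_divide_le_eq)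
  qed
  show "\<rho> ^ n \<le> B * g n x" 
    by (rule LIMSEQ_le_const2[OF g_quot[OF x0, of n]]) (use up in blast)
  have lo: "g n x / B \<le> g (N + n) x0 / g N x0" for N
  proof -
    have "(L ^^ N) (\<lambda>y. g n x / B * 1) x0 \<le> (L ^^ N) (g n) x0"
      using g_ratio[OF x, of _ n] x0 B by (intro Ln_mono) (auto simp: divide_le_eq mult.commute)
    then have "g n x / B * g N x0 \<le> g (N + n) x0" unfolding Ln_scale by (simp add: funpow_add)
    then show ?thesis using g_pos[OF x0, of N] by (simp add: pos_le_divide_eq)
  qed
  have "g n x / B \<le> \<rho> ^ n" 
    by (rule LIMSEQ_le_const[OF g_quot[OF x0, of n]]) (use lo in blast)
  then show "g n x \<le> B * \<rho> ^ n" using B by (simp add: divide_le_eq mult.commute)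
qed

lemma \<rho>_pos: "0 < \<rho>"
proof -
  have "0 < g 1 x0" "g 1 x0 \<le> B * \<rho> ^ 1" using g_pos[OF x0] g_bounds[OF x0] by blast+
  then show ?thesis using B zero_less_mult_pos[of B \<rho>] by simp
qed

text \<open>These are the functions whose limit defines the eigenfunction of a subsystem.\<close>

definition v :: "nat \<Rightarrow> (nat \<Rightarrow> nat) \<Rightarrow> real" where "v n x = g n x / \<rho> ^ n"

lemma v_bounds: "x \<in> X \<Longrightarrow> v n x \<le> B" "x \<in> X \<Longrightarrow> 1 / B \<le> v n x"
  using g_bounds[of x n] \<rho>_pos B by (auto simp: v_def field_simps)

text \<open>The eigenfunctional applied to \<open>g n\<close> is \<open>\<rho> ^ n\<close>, so the uniform rate for the functional turns into a uniform
  Cauchy estimate for the normalised iterates.\<close>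

lemma v_diff: "x \<in> X \<Longrightarrow> \<bar>v (N + n) x - v N x\<bar> \<le> rate N * B\<^sup>2"
proof -
  assume x: "x \<in> X"
  have "\<bar>g (N + n) x - \<rho> ^ n * g N x\<bar> \<le> rate N * (B * \<rho> ^ n) * g N x"
    using \<nu>_rate[OF cone_g2[of n] _ order_refl x, of "B * \<rho> ^ n" N] g_bounds(1)
    unfolding \<nu>_g funpow_add o_def by blast
  then have "\<bar>g (N + n) x - \<rho> ^ n * g N x\<bar> / \<rho> ^ (N + n) \<le> rate N * (B * \<rho> ^ n) * g N x / \<rho> ^ (N + n)"
    using \<rho>_pos by (intro divide_right_mono) auto
  also have "\<bar>g (N + n) x - \<rho> ^ n * g N x\<bar> / \<rho> ^ (N + n) = \<bar>v (N + n) x - v N x\<bar>"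
    using \<rho>_pos by (simp add: v_def abs_divide[symmetric] diff_divide_distrib power_add abs_mult[symmetric] del: abs_divide)
      (simp add: field_simps)
  also have "rate N * (B * \<rho> ^ n) * g N x / \<rho> ^ (N + n) = rate N * (B * v N x)"
    using \<rho>_pos by (simp add: v_def power_add)
  also have "\<dots> \<le> rate N * (B * B)"
    using rate(2) B v_bounds[OF x] by (intro mult_left_mono) auto
  finally show ?thesis by (simp add: power2_eq_square)
qed

definition w :: "(nat \<Rightarrow> nat) \<Rightarrow> real" where "w x = lim (\<lambda>n. v n x)"

lemma v_lim: assumes x: "x \<in> X" shows "(\<lambda>n. v n x) \<longlonglongrightarrow> w x"
proof -
  have lim0: "(\<lambda>N. 2 * (rate N * B\<^sup>2)) \<longlonglongrightarrow> 0"
    using tendsto_mult_right_zero[OF tendsto_mult_left_zero[OF rate(1)]] by simp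
  have "Cauchy (\<lambda>n. v n x)"
  proof (rule CauchyI)
    fix e :: real assume "0 < e"
    then obtain n where n: "\<bar>2 * (rate n * B\<^sup>2)\<bar> < e"
      using lim0 by (metis LIMSEQ_D diff_zero order_refl real_norm_def)
    show "\<exists>M. \<forall>m\<ge>M. \<forall>n\<ge>M. norm (v m x - v n x) < e"
    proof (intro exI[of _ n] allI impI)
      fix i j assume "n \<le> i" "n \<le> j"
      then show "norm (v i x - v j x) < e"
        using v_diff[OF x, of n "i - n"] v_diff[OF x, of n "j - n"] n by auto
    qed
  qed
  then show ?thesis unfolding w_def by (simp add: Cauchy_convergent_iff convergent_LIMSEQ_iff)
qed

lemma w_bounds: "x \<in> X \<Longrightarrow> w x \<le> B" "x \<in> X \<Longrightarrow> 1 / B \<le> w x"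
  using v_lim[of x] v_bounds[of x] by (blast intro: LIMSEQ_le_const LIMSEQ_le_const2)+

lemma w_pos: "x \<in> X \<Longrightarrow> 0 < w x"
  using w_bounds(2)[of x] B by (auto intro: less_le_trans[of 0 "1 / B"])

lemma v_uniform: assumes x: "x \<in> X" shows "\<bar>v N x - w x\<bar> \<le> rate N * B\<^sup>2"
proof -
  have "(\<lambda>n. \<bar>v (n + N) x - v N x\<bar>) \<longlonglongrightarrow> \<bar>w x - v N x\<bar>"
    by (intro tendsto_intros LIMSEQ_ignore_initial_segment v_lim[OF x])
  then have "\<bar>w x - v N x\<bar> \<le> rate N * B\<^sup>2"
    using v_diff[OF x, of N] by (intro LIMSEQ_le_const2) (auto simp: add.commute)
  then show ?thesis by (simp add: abs_minus_commute)
qed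

lemma cone_w: "cone 0 K0 w"
  unfolding cone_def
proof safe
  fix x assume "x \<in> X" then show "0 \<le> w x" using w_pos by (auto intro: less_imp_le)
next
  fix x y j assume xy: "x \<in> X" "y \<in> X" and j: "max 1 0 \<le> (j::nat)" and ag: "agree j x y"
  have "v n x \<le> exp (K0 * \<theta> ^ j) * v n y" for n
    using coneD[OF cone_g xy _ _ ag, of n] j \<rho>_pos by (simp add: v_def divide_right_mono)
  then show "w x \<le> exp (K0 * \<theta> ^ j) * w y"
    by (intro LIMSEQ_le[OF v_lim[OF xy(1)] tendsto_mult_left[OF v_lim[OF xy(2)]]]) auto
qed

lemma L_w: assumes x: "x \<in> X" shows "L w x = \<rho> * w x"
proof -
  have "(\<lambda>n. L (v n) x) \<longlonglongrightarrow> L w x"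
    unfolding L_eq[OF x] by (intro tendsto_intros v_lim case_nat_pre x) auto
  moreover have "L (v n) x = \<rho> * v (Suc n) x" for n
    using fun_cong[OF Ln_linear[of 1 "1 / \<rho> ^ n" "g n" 0 "\<lambda>_. 0"], of x] \<rho>_pos by (simp add: v_def[abs_def])
  moreover have "(\<lambda>n. \<rho> * v (Suc n) x) \<longlonglongrightarrow> \<rho> * w x"
    by (intro tendsto_intros LIMSEQ_Suc v_lim x)
  ultimately show ?thesis using LIMSEQ_unique by simp
qed

section \<open>Cylinder weights of the invariant Gibbs measure\<close>

text \<open>The functional \<open>\<nu>\<close> extended to cones of positive level and normalised so that \<open>\<Lambda> w = 1\<close>.\<close>

definition \<Lambda> :: "((nat \<Rightarrow> nat) \<Rightarrow> real) \<Rightarrow> real" where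
  "\<Lambda> f = lim (\<lambda>N. (L ^^ N) f x0 / \<rho> ^ N) / w x0"

lemma \<Lambda>_lim:
  assumes f: "cone m K2 f" and x: "x \<in> X"
  shows "(\<lambda>N. (L ^^ N) f x / \<rho> ^ N) \<longlonglongrightarrow> \<Lambda> f * w x"
proof -
  have cf: "cone 0 K2 ((L ^^ m) f)" by (rule cone_Ln_0[OF f K2(2)]) simp
  have *: "(\<lambda>N. (L ^^ N) f x / \<rho> ^ N) \<longlonglongrightarrow> \<nu> ((L ^^ m) f) / \<rho> ^ m * w x" if x: "x \<in> X" for x
  proof -
    have "(\<lambda>N. (L ^^ N) ((L ^^ m) f) x / g N x * v N x / \<rho> ^ m) \<longlonglongrightarrow> \<nu> ((L ^^ m) f) * w x / \<rho> ^ m"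
      by (intro tendsto_intros \<nu>_lim[OF cf x] v_lim[OF x]) (use \<rho>_pos in auto)
    moreover have "(L ^^ N) ((L ^^ m) f) x / g N x * v N x / \<rho> ^ m = (L ^^ (N + m)) f x / \<rho> ^ (N + m)" for N
      using g_pos[OF x, of N] by (simp add: v_def funpow_add power_add)
    ultimately have "(\<lambda>N. (L ^^ (N + m)) f x / \<rho> ^ (N + m)) \<longlonglongrightarrow> \<nu> ((L ^^ m) f) * w x / \<rho> ^ m" by simp
    then show ?thesis using LIMSEQ_offset[where k=m] by simp
  qed
  have "\<Lambda> f = \<nu> ((L ^^ m) f) / \<rho> ^ m"
    using limI[OF *[OF x0]] w_pos[OF x0] by (simp add: \<Lambda>_def)
  then show ?thesis using *[OF x] by simp
qed

lemma \<Lambda>_eqI: assumes "(\<lambda>N. (L ^^ N) f x0 / \<rho> ^ N) \<longlonglongrightarrow> l * w x0" shows "\<Lambda> f = l"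
  using limI[OF assms] w_pos[OF x0] by (simp add: \<Lambda>_def)

text \<open>The mass of a cylinder under the invariant measure \<open>w d\<nu>\<close>. The two additivity properties below say
  that these weights are consistent and invariant under the shift.\<close>

definition weight :: "nat list \<Rightarrow> real" where "weight us = \<Lambda> (\<lambda>x. w x * indicator (cyl us) x)"

lemma cone_w_cyl: "cone (length us) K0 (\<lambda>x. w x * indicator (cyl us) x)"
proof -
  have "cone (length us) 0 (indicator (cyl us))"
    unfolding cone_def using cyl_agree[of _ us] 
    by (auto simp: indicator_def dest: agree_mono)
  from cone_mult[OF _ this] show ?thesis using cone_mono[OF cone_w] by simp
qed

lemma weight_lim: "x \<in> X \<Longrightarrow> (\<lambda>N. (L ^^ N) (\<lambda>x. w x * indicator (cyl us) x) x / \<rho> ^ N) \<longlonglongrightarrow> weight us * w x"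
  unfolding weight_def using \<Lambda>_lim[OF cone_mono[OF cone_w_cyl K2(2) order_refl]] .

lemma weight_nonneg: "0 \<le> weight us"
proof -
  have "0 \<le> (L ^^ N) (\<lambda>x. w x * indicator (cyl us) x) x0 / \<rho> ^ N" for N
    using cone_nonneg[OF cone_w_cyl[of us]] x0 \<rho>_pos by (auto intro!: Ln_nonneg divide_nonneg_nonneg)
  then have "0 \<le> weight us * w x0" by (intro LIMSEQ_le_const[OF weight_lim[OF x0]]) auto
  then show ?thesis using w_pos[OF x0] by (simp add: zero_le_mult_iff)
qed

lemma Ln_w: "x \<in> X \<Longrightarrow> (L ^^ n) w x = \<rho> ^ n * w x"
proof (induction n arbitrary: x)
  case (Suc n)
  have "L ((L ^^ n) w) x = L (\<lambda>x. \<rho> ^ n * w x + 0 * 0) x" using Suc by (intro L_cong) auto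
  then show ?case using L_w Suc.prems unfolding L_linear by simp
qed simp

lemma weight_Nil: "weight [] = 1"
  unfolding weight_def by (rule \<Lambda>_eqI) (use Ln_w[OF x0] \<rho>_pos in simp)

lemma sum_indicator_single:
  "finite S \<Longrightarrow> k \<in> S \<Longrightarrow> (\<Sum>a\<in>S. of_bool (k = a)) = (1::real)"
  by (simp add: of_bool_def)

lemma weight_snoc: "(\<Sum>a\<in>S. weight (us @ [a])) = weight us"
  unfolding weight_def[of us]
proof (rule \<Lambda>_eqI[symmetric])
  have "(L ^^ N) (\<lambda>x. w x * indicator (cyl us) x) x0
      = (\<Sum>a\<in>S. (L ^^ N) (\<lambda>x. w x * indicator (cyl (us @ [a])) x) x0)" for N
    unfolding Ln_sum[OF finite_S, symmetric]
  proof (rule Ln_cong)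
    fix y assume "y \<in> X"
    then have "y (length us) \<in> S" by (auto simp: X_iff)
    then show "w y * indicator (cyl us) y = (\<Sum>a\<in>S. w y * indicator (cyl (us @ [a])) y)"
      using sum_indicator_single[OF finite_S]
      by (simp add: indicator_def cyl_snoc sum_distrib_left[symmetric] of_bool_def)
  qed (rule x0)
  then have eq: "(L ^^ N) (\<lambda>x. w x * indicator (cyl us) x) x0 / \<rho> ^ N
      = (\<Sum>a\<in>S. (L ^^ N) (\<lambda>x. w x * indicator (cyl (us @ [a])) x) x0 / \<rho> ^ N)" for N
    by (simp add: sum_divide_distrib)
  show "(\<lambda>N. (L ^^ N) (\<lambda>x. w x * indicator (cyl us) x) x0 / \<rho> ^ N) \<longlonglongrightarrow> (\<Sum>a\<in>S. weight (us @ [a])) * w x0"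
    unfolding eq sum_distrib_right by (intro tendsto_sum weight_lim x0)
qed

text \<open>Shift invariance: \<open>L (w * (f \<circ> shift)) = f * L w = \<rho> * f * w\<close>.\<close>

lemma weight_Cons: "(\<Sum>a\<in>S. weight (a # us)) = weight us"
  unfolding weight_def[of us]
proof (rule \<Lambda>_eqI[symmetric])
  have "(\<Sum>a\<in>S. (L ^^ Suc N) (\<lambda>x. w x * indicator (cyl (a # us)) x) x0)
      = \<rho> * (L ^^ N) (\<lambda>x. w x * indicator (cyl us) x) x0" for N
  proof -
    have "(\<Sum>a\<in>S. (L ^^ Suc N) (\<lambda>x. w x * indicator (cyl (a # us)) x) x0)
        = (L ^^ Suc N) (\<lambda>x. w x * indicator (cyl us) (shift x)) x0"
      unfolding Ln_sum[OF finite_S, symmetric]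
    proof (rule Ln_cong)
      fix y assume "y \<in> X"
      then have "y 0 \<in> S" by (auto simp: X_iff)
      then show "(\<Sum>a\<in>S. w y * indicator (cyl (a # us)) y) = w y * indicator (cyl us) (shift y)"
        using sum_indicator_single[OF finite_S]
        by (simp add: indicator_def cyl_Cons sum_distrib_left[symmetric] of_bool_def)
    qed (rule x0)
    also have "\<dots> = (L ^^ N) (L (\<lambda>x. w x * indicator (cyl us) (shift x))) x0"
      by (simp add: funpow_swap1)
    also have "\<dots> = (L ^^ N) (\<lambda>x. \<rho> * (w x * indicator (cyl us) x)) x0"
      using x0 by (intro Ln_cong) (auto simp: L_shift L_w)
    finally show ?thesis unfolding Ln_scale .
  qed
  then have eq: "(L ^^ N) (\<lambda>x. w x * indicator (cyl us) x) x0 / \<rho> ^ N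
      = (\<Sum>a\<in>S. (L ^^ Suc N) (\<lambda>x. w x * indicator (cyl (a # us)) x) x0 / \<rho> ^ Suc N)" for N
    unfolding sum_divide_distrib[symmetric] using \<rho>_pos by (simp del: funpow.simps)
  show "(\<lambda>N. (L ^^ N) (\<lambda>x. w x * indicator (cyl us) x) x0 / \<rho> ^ N) \<longlonglongrightarrow> (\<Sum>a\<in>S. weight (a # us)) * w x0"
    unfolding eq sum_distrib_right by (intro tendsto_sum LIMSEQ_Suc[OF weight_lim[OF x0]])
qed

lemma weight_empty_cyl: assumes "cyl us \<inter> X = {}" shows "weight us = 0"
  unfolding weight_def
proof (rule \<Lambda>_eqI)
  have "(L ^^ N) (\<lambda>x. w x * indicator (cyl us) x) x0 = (L ^^ N) (\<lambda>x. 0 * 0) x0" for N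
    using assms x0 by (intro Ln_cong) (auto simp: indicator_def)
  then show "(\<lambda>N. (L ^^ N) (\<lambda>x. w x * indicator (cyl us) x) x0 / \<rho> ^ N) \<longlonglongrightarrow> 0 * w x0"
    unfolding Ln_scale by simp
qed

definition birkhoff :: "nat \<Rightarrow> (nat \<Rightarrow> nat) \<Rightarrow> real" where
  "birkhoff n x = (\<Sum>i<n. \<phi> ((shift ^^ i) x))"

lemma birkhoff_Suc_shift: "birkhoff (Suc n) x = \<phi> x + birkhoff n (shift x)"
  by (simp add: birkhoff_def sum.lessThan_Suc_shift funpow_swap1 del: sum.lessThan_Suc)

lemma Ln_lower_birkhoff:
  assumes "\<And>y. y \<in> X \<Longrightarrow> 0 \<le> f y" "y \<in> X"
  shows "exp (birkhoff n y) * f y \<le> (L ^^ n) f ((shift ^^ n) y)"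
  using assms
proof (induction n arbitrary: y f)
  case (Suc n)
  have y0: "y 0 \<in> pre (shift y)" using Suc.prems by (auto simp: pre_def X_iff shift_def)
  let ?h = "\<lambda>a. exp (\<phi> (case_nat a (shift y))) * f (case_nat a (shift y))"
  have "?h (y 0) \<le> sum ?h (pre (shift y))"
    using y0 Suc.prems case_nat_pre[OF shift_X[OF Suc.prems(2)]] by (intro member_le_sum) auto
  then have "exp (\<phi> y) * f y \<le> L f (shift y)"
    using Suc.prems unfolding L_eq[OF shift_X[OF Suc.prems(2)]] case_nat_shift by simp
  then have "exp (birkhoff (Suc n) y) * f y \<le> exp (birkhoff n (shift y)) * L f (shift y)"
    by (simp add: birkhoff_Suc_shift exp_add mult_ac)
  also have "\<dots> \<le> (L ^^ n) (L f) ((shift ^^ n) (shift y))"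
    using Suc.prems by (intro Suc.IH) (auto intro: L_nonneg)
  finally show ?case by (simp add: funpow_swap1)
qed (simp add: birkhoff_def)

text \<open>Only one branch of the \<open>n\<close>-fold preimages meets a cylinder of length \<open>n\<close>, and along it the Birkhoff sum
  differs from that of \<open>x\<close> by at most the sum of the moduli.\<close>

lemma Ln_upper_cyl:
  assumes "\<And>y. y \<in> X \<Longrightarrow> 0 \<le> f y" "\<And>y. y \<in> X \<Longrightarrow> f y \<le> s" "\<And>y. y \<in> X \<Longrightarrow> \<not> agree n x y \<Longrightarrow> f y = 0"
    "x \<in> X" "y \<in> X"
  shows "(L ^^ n) f y \<le> exp (birkhoff n x + (\<Sum>i<n. c * \<theta> ^ Suc i)) * s"
  using assms
proof (induction n arbitrary: f s x y)
  case (Suc n)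
  have s: "0 \<le> s" using Suc.prems by force
  let ?s = "exp (\<phi> x + c * \<theta> ^ Suc n) * s"
  have ub: "L f z \<le> ?s" and zero: "\<not> agree n (shift x) z \<Longrightarrow> L f z = 0" if z: "z \<in> X" for z
  proof -
    have t0: "exp (\<phi> (case_nat a z)) * f (case_nat a z) = 0"
      if "a \<in> pre z" "\<not> (a = x 0 \<and> agree n (shift x) z)" for a
      using Suc.prems(3)[OF case_nat_pre[OF z that(1)]] that(2) by (auto simp: agree_shift_iff)
    show "L f z = 0" if "\<not> agree n (shift x) z"
      unfolding L_eq[OF z] using t0 that by (intro sum.neutral) auto
    show "L f z \<le> ?s"
    proof (cases "x 0 \<in> pre z \<and> agree n (shift x) z")
      case True
      then have zz: "case_nat (x 0) z \<in> X" using case_nat_pre z by blast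
      have "agree (Suc n) (case_nat (x 0) z) x" using True by (auto simp: agree_shift_iff agree_sym)
      then have "\<phi> (case_nat (x 0) z) \<le> \<phi> x + c * \<theta> ^ Suc n"
        using \<phi>_lip[OF zz Suc.prems(4), of "Suc n"] by linarith
      then have "exp (\<phi> (case_nat (x 0) z)) * f (case_nat (x 0) z) \<le> ?s"
        using Suc.prems(1,2)[OF zz] by (intro mult_mono) auto
      moreover have "L f z = (\<Sum>a\<in>{x 0}. exp (\<phi> (case_nat a z)) * f (case_nat a z))"
        unfolding L_eq[OF z] using True t0 by (intro sum.mono_neutral_right) auto
      ultimately show ?thesis by simp
    next
      case False
      then have "L f z = 0" unfolding L_eq[OF z] using t0 by (intro sum.neutral) auto
      then show ?thesis using s by simp
    qed
  qed
  have "(L ^^ n) (L f) y \<le> exp (birkhoff n (shift x) + (\<Sum>i<n. c * \<theta> ^ Suc i)) * ?s"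
    using ub zero Suc.prems by (intro Suc.IH) (auto intro: L_nonneg)
  also have "\<dots> = exp (birkhoff (Suc n) x + (\<Sum>i<Suc n. c * \<theta> ^ Suc i)) * s"
    by (simp add: birkhoff_Suc_shift exp_add mult_ac)
  finally show ?case by (simp add: funpow_swap1)
qed (auto simp: birkhoff_def)

lemma sum_geometric_le: "(\<Sum>i<n. c * \<theta> ^ Suc i) \<le> K0"
proof -
  have "(\<Sum>i<n. c * \<theta> ^ Suc i) = c * \<theta> * (\<Sum>i<n. \<theta> ^ i)" by (simp add: sum_distrib_left mult_ac)
  also have "\<dots> = c * \<theta> * ((1 - \<theta> ^ n) / (1 - \<theta>))" using \<theta> by (simp add: sum_gp_strict)
  also have "\<dots> \<le> c * 1 * (1 / (1 - \<theta>))"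
    using \<theta> c by (intro mult_mono divide_right_mono) (auto simp: power_le_one divide_nonneg_nonneg)
  finally show ?thesis by (simp add: K0_def)
qed

text \<open>The Gibbs property. The iterate \<open>(L ^^ n) f\<close> of the function \<open>f = w\<close> restricted to the cylinder lives on a
  single branch, so it is bounded above by the weight \<open>exp (birkhoff n x)\<close> of this branch up to distortion.
  Below, it has this size at one point and, after \<open>M\<close> further steps, everywhere.\<close>

lemma weight_gibbs:
  "\<exists>G\<ge>1. \<forall>x\<in>X. \<forall>n. weight (map x [0..<n]) \<le> G * exp (birkhoff n x) / \<rho> ^ n \<and>
     exp (birkhoff n x) / \<rho> ^ n \<le> G * weight (map x [0..<n])"
proof -
  define G1 where "G1 = exp K0 * B"
  define G2 where "G2 = exp (K2 + b * M) * B * B * \<rho> ^ M"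
  have up: "weight (map x [0..<n]) \<le> G1 * exp (birkhoff n x) / \<rho> ^ n"
    and lo: "exp (birkhoff n x) / \<rho> ^ n \<le> G2 * weight (map x [0..<n])" if x: "x \<in> X" for x n
  proof -
    let ?C = "cyl (map x [0..<n])"
    define f where "f = (\<lambda>y. w y * indicator ?C y)"
    have fnn: "0 \<le> f y" if "y \<in> X" for y using w_pos[OF that] by (simp add: f_def)
    have fB: "f y \<le> B" if "y \<in> X" for y using w_bounds[OF that] B by (simp add: f_def indicator_def)
    have f0: "f y = 0" if "\<not> agree n x y" for y
      using that by (auto simp: f_def cyl_def agree_def indicator_def)
    have lim: "(\<lambda>N. (L ^^ (N + k)) f x0 / \<rho> ^ (N + k)) \<longlonglongrightarrow> weight (map x [0..<n]) * w x0" for k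
      using LIMSEQ_ignore_initial_segment[OF weight_lim[OF x0]] unfolding f_def .
    have up1: "(L ^^ n) f y \<le> exp (birkhoff n x) * G1 * 1" if "y \<in> X" for y
    proof -
      have "(L ^^ n) f y \<le> exp (birkhoff n x + (\<Sum>i<n. c * \<theta> ^ Suc i)) * B"
        using fnn fB f0 x that by (intro Ln_upper_cyl) auto
      also have "\<dots> \<le> exp (birkhoff n x + K0) * B"
        using sum_geometric_le[of n] B by (intro mult_right_mono) auto
      finally show ?thesis by (simp add: exp_add G1_def)
    qed
    have "(L ^^ (N + n)) f x0 / \<rho> ^ (N + n) \<le> exp (birkhoff n x) * G1 / \<rho> ^ n * v N x0" for N
    proof -
      have "(L ^^ N) ((L ^^ n) f) x0 \<le> (L ^^ N) (\<lambda>_. exp (birkhoff n x) * G1 * 1) x0"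
        using up1 x0 by (intro Ln_mono) auto
      then have "(L ^^ (N + n)) f x0 \<le> exp (birkhoff n x) * G1 * g N x0"
        unfolding Ln_scale by (simp add: funpow_add)
      then have "(L ^^ (N + n)) f x0 / \<rho> ^ (N + n) \<le> exp (birkhoff n x) * G1 * g N x0 / \<rho> ^ (N + n)"
        using \<rho>_pos by (intro divide_right_mono) auto
      also have "\<dots> = exp (birkhoff n x) * G1 / \<rho> ^ n * v N x0" by (simp add: v_def power_add)
      finally show ?thesis .
    qed
    then have "weight (map x [0..<n]) * w x0 \<le> exp (birkhoff n x) * G1 / \<rho> ^ n * w x0"
      using lim[of n] by (intro LIMSEQ_le[OF _ tendsto_mult_left[OF v_lim[OF x0]]]) auto
    then have "weight (map x [0..<n]) \<le> exp (birkhoff n x) * G1 / \<rho> ^ n"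
      using w_pos[OF x0] by (rule mult_right_le_imp_le)
    then show "weight (map x [0..<n]) \<le> G1 * exp (birkhoff n x) / \<rho> ^ n"
      by (simp only: mult.commute)
    have cf: "cone 0 K2 ((L ^^ n) f)"
      using cone_Ln_0[OF cone_mono[OF cone_w_cyl[of "map x [0..<n]"] K2(2) order_refl] K2(2), of n]
      by (simp add: f_def)
    have lo1: "exp (birkhoff n x) * (exp (- (K2 + b * M)) / B) * 1 \<le> (L ^^ M) ((L ^^ n) f) y" if y: "y \<in> X" for y
    proof -
      have xC: "x \<in> ?C" by (simp add: cyl_def)
      have "exp (birkhoff n x) * (1 / B) \<le> exp (birkhoff n x) * f x"
        using w_bounds[OF x] xC by (intro mult_left_mono) (auto simp: f_def)
      also have "\<dots> \<le> (L ^^ n) f ((shift ^^ n) x)" using fnn x by (rule Ln_lower_birkhoff)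
      also have "\<dots> \<le> exp (K2 + b * M) * (L ^^ M) ((L ^^ n) f) y"
        using x y by (intro cone_spread[OF cf K2(1)]) auto
      finally have "exp (- (K2 + b * M)) * (exp (birkhoff n x) * (1 / B))
          \<le> exp (- (K2 + b * M)) * (exp (K2 + b * M) * (L ^^ M) ((L ^^ n) f) y)"
        by (intro mult_left_mono) auto
      then show ?thesis by (simp add: mult.assoc[symmetric] exp_add[symmetric] mult_ac)
    qed
    let ?q = "exp (birkhoff n x) * (exp (- (K2 + b * M)) / B)"
    have "?q / \<rho> ^ (M + n) * v N x0 \<le> (L ^^ (N + (M + n))) f x0 / \<rho> ^ (N + (M + n))" for N
    proof -
      have "(L ^^ N) (\<lambda>_. ?q * 1) x0 \<le> (L ^^ N) ((L ^^ M) ((L ^^ n) f)) x0"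
        using lo1 x0 by (intro Ln_mono) auto
      then have "?q * g N x0 \<le> (L ^^ (N + (M + n))) f x0"
        unfolding Ln_scale by (simp add: funpow_add)
      then have "?q * g N x0 / \<rho> ^ (N + (M + n)) \<le> (L ^^ (N + (M + n))) f x0 / \<rho> ^ (N + (M + n))"
        using \<rho>_pos by (intro divide_right_mono) auto
      moreover have "?q * g N x0 / \<rho> ^ (N + (M + n)) = ?q / \<rho> ^ (M + n) * v N x0"
        by (simp add: v_def power_add)
      ultimately show ?thesis by simp
    qed
    then have "?q / \<rho> ^ (M + n) * w x0 \<le> weight (map x [0..<n]) * w x0"
      using lim[of "M + n"] by (intro LIMSEQ_le[OF tendsto_mult_left[OF v_lim[OF x0]]]) auto
    then have "?q / \<rho> ^ (M + n) \<le> weight (map x [0..<n])"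
      using w_pos[OF x0] by (rule mult_right_le_imp_le)
    then have "exp (K2 + b * M) * B * \<rho> ^ M * (?q / \<rho> ^ (M + n))
        \<le> exp (K2 + b * M) * B * \<rho> ^ M * weight (map x [0..<n])"
      using \<rho>_pos B by (intro mult_left_mono) auto
    moreover have "exp (K2 + b * M) * B * \<rho> ^ M * (?q / \<rho> ^ (M + n)) = exp (birkhoff n x) / \<rho> ^ n"
    proof -
      define E where "E = exp (K2 + b * M)"
      have "E > 0" "exp (- (K2 + b * M)) = 1 / E" unfolding E_def exp_minus by (auto simp: field_simps)
      then show ?thesis unfolding E_def[symmetric] using \<rho>_pos B by (simp add: power_add)
    qed
    ultimately have "exp (birkhoff n x) / \<rho> ^ n \<le> exp (K2 + b * M) * B * \<rho> ^ M * weight (map x [0..<n])"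
      by (simp only:)
    also have "\<dots> \<le> B * (exp (K2 + b * M) * B * \<rho> ^ M * weight (map x [0..<n]))"
      using B weight_nonneg \<rho>_pos
        mult_right_mono[of 1 B "exp (K2 + b * M) * B * \<rho> ^ M * weight (map x [0..<n])"] by auto
    finally show "exp (birkhoff n x) / \<rho> ^ n \<le> G2 * weight (map x [0..<n])" by (simp add: G2_def mult_ac)
  qed
  define G where "G = max 1 (max G1 G2)"
  show ?thesis
  proof (intro exI[of _ G] conjI ballI allI)
    fix x n assume x: "x \<in> X"
    have "G1 * exp (birkhoff n x) / \<rho> ^ n \<le> G * exp (birkhoff n x) / \<rho> ^ n"
      using \<rho>_pos by (intro divide_right_mono mult_right_mono) (auto simp: G_def)
    then show "weight (map x [0..<n]) \<le> G * exp (birkhoff n x) / \<rho> ^ n" using up[OF x, of n] by simp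
    have "G2 * weight (map x [0..<n]) \<le> G * weight (map x [0..<n])"
      using weight_nonneg by (intro mult_right_mono) (auto simp: G_def)
    then show "exp (birkhoff n x) / \<rho> ^ n \<le> G * weight (map x [0..<n])" using lo[OF x, of n] by simp
  qed (simp add: G_def)
qed

end

section \<open>Measures on sequence spaces given by cylinder weights\<close>

text \<open>Identifies the Borel sets with the product \<open>\<sigma>\<close>-algebra, on which projective limits of measures live.\<close>

lemma sets_borel_seq: "sets (borel :: (nat \<Rightarrow> nat) measure) = sets (PiM UNIV (\<lambda>_. count_space UNIV))"
proof -
  have "sets (borel :: (nat \<Rightarrow> nat) measure) = sets (PiM UNIV (\<lambda>_. borel))"
    by (rule sets_PiM_equal_borel[symmetric])
  also have "\<dots> = sets (PiM UNIV (\<lambda>_. count_space UNIV))"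
    by (intro sets_PiM_cong refl sets_borel_eq_count_space)
  finally show ?thesis .
qed

lemma measurable_coordinate [measurable]: "(\<lambda>x. x i) \<in> (borel :: (nat \<Rightarrow> nat) measure) \<rightarrow>\<^sub>M count_space UNIV"
proof -
  have "(\<lambda>x. x i) \<in> PiM UNIV (\<lambda>_. count_space (UNIV :: nat set)) \<rightarrow>\<^sub>M count_space UNIV"
    by (rule measurable_component_singleton) simp
  moreover have "(borel :: (nat \<Rightarrow> nat) measure) \<rightarrow>\<^sub>M count_space UNIV = PiM UNIV (\<lambda>_. count_space (UNIV :: nat set)) \<rightarrow>\<^sub>M count_space (UNIV :: nat set)"
    by (rule measurable_cong_sets[OF sets_borel_seq refl])
  ultimately show ?thesis by blast
qed

lemma measurable_seqI:
  fixes f :: "'a \<Rightarrow> nat \<Rightarrow> nat"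
  assumes "\<And>i. (\<lambda>x. f x i) \<in> M \<rightarrow>\<^sub>M count_space (UNIV :: nat set)"
  shows "f \<in> M \<rightarrow>\<^sub>M borel"
proof -
  have "f \<in> M \<rightarrow>\<^sub>M PiM UNIV (\<lambda>_. count_space (UNIV :: nat set))"
    using assms by (intro measurable_PiM_single') auto
  moreover have "M \<rightarrow>\<^sub>M (borel :: (nat \<Rightarrow> nat) measure) = M \<rightarrow>\<^sub>M PiM UNIV (\<lambda>_. count_space (UNIV :: nat set))"
    by (rule measurable_cong_sets[OF refl sets_borel_seq])
  ultimately show ?thesis by blast
qed

lemma measurable_shift [measurable]: "shift \<in> borel \<rightarrow>\<^sub>M borel"
  unfolding shift_def by (rule measurable_seqI) measurable

lemma cyl_sets [measurable]: "cyl us \<in> sets borel"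
proof -
  have "cyl us = {x \<in> space borel. \<forall>i\<in>{..<length us}. x i \<in> {us ! i}}" by (auto simp: cyl_def)
  also have "\<dots> \<in> sets borel" by measurable
  finally show ?thesis .
qed

lemma borel_eq_sigma_cyl: "sets (borel :: (nat \<Rightarrow> nat) measure) = sigma_sets UNIV (range cyl)"
proof
  show "sigma_sets UNIV (range cyl) \<subseteq> sets borel"
    using sets.sigma_sets_subset[of "range cyl" borel] cyl_sets by (auto simp: image_subset_iff)
  have "(\<lambda>x. x) \<in> sigma UNIV (range cyl) \<rightarrow>\<^sub>M borel"
  proof (rule measurable_seqI)
    fix i :: nat
    show "(\<lambda>x. x i) \<in> sigma UNIV (range cyl) \<rightarrow>\<^sub>M count_space (UNIV :: nat set)"
      unfolding measurable_count_space_eq2_countable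
    proof safe
      fix a :: nat
      have "(\<lambda>x. x i) -` {a} \<inter> space (sigma UNIV (range cyl)) = (\<Union>us\<in>{us. length us = i}. cyl (us @ [a]))"
      proof safe
        fix x :: "nat \<Rightarrow> nat"
        show "x \<in> (\<Union>us\<in>{us. length us = i}. cyl (us @ [x i]))"
          by (intro UN_I[of "map x [0..<i]"]) (auto simp: cyl_def nth_append less_Suc_eq)
      qed (auto simp: cyl_snoc)
      also have "\<dots> \<in> sets (sigma UNIV (range cyl))"
        by (intro sets.countable_UN') (auto intro: countable_subset)
      finally show "(\<lambda>x. x i) -` {a} \<inter> space (sigma UNIV (range cyl)) \<in> sets (sigma UNIV (range cyl))" .
    qed auto
  qed
  from measurable_sets[OF this] show "sets borel \<subseteq> sigma_sets UNIV (range cyl)" by auto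
qed

lemma cyl_Int: "cyl us \<inter> cyl vs = {} \<or> cyl us \<inter> cyl vs \<in> range cyl"
proof (cases "cyl us \<inter> cyl vs = {}")
  case False
  then obtain x where x: "x \<in> cyl us" "x \<in> cyl vs" by auto
  then have "cyl us \<inter> cyl vs = cyl (map x [0..<max (length us) (length vs)])"
    by (auto simp: cyl_def less_max_iff_disj)
  then show ?thesis by auto
qed auto

lemma seq_measure_eqI:
  fixes M N :: "(nat \<Rightarrow> nat) measure"
  assumes fin: "finite_measure M"
    and Y: "Y \<in> sets borel"
    and sM: "sets M = sets (restrict_space borel Y)" and sN: "sets N = sets (restrict_space borel Y)"
    and eq: "\<And>us. emeasure M (cyl us \<inter> Y) = emeasure N (cyl us \<inter> Y)"
  shows "M = N"
proof (rule measure_eqI)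
  have sp: "space M = Y" "space N = Y"
    using sets_eq_imp_space_eq[OF sM] sets_eq_imp_space_eq[OF sN] by (auto simp: space_restrict_space)
  have id: "(\<lambda>x. x) \<in> M \<rightarrow>\<^sub>M borel" "(\<lambda>x. x) \<in> N \<rightarrow>\<^sub>M borel"
    unfolding measurable_cong_sets[OF sM refl] measurable_cong_sets[OF sN refl]
    by (auto intro: measurable_restrict_space1)
  have em: "emeasure (distr M borel (\<lambda>x. x)) B = emeasure M (B \<inter> Y)"
      "emeasure (distr N borel (\<lambda>x. x)) B = emeasure N (B \<inter> Y)" if "B \<in> sets borel" for B
    using that by (simp_all add: emeasure_distr id sp)
  have "distr M borel (\<lambda>x. x) = distr N borel (\<lambda>x. x)"
  proof (rule measure_eqI_generator_eq[where E="insert {} (range cyl)" and \<Omega>=UNIV and A="\<lambda>_. UNIV"])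
    show "Int_stable (insert {} (range cyl))"
      using cyl_Int by (auto simp: Int_stable_def)
    have "sigma_sets UNIV (insert {} (range cyl)) = sigma_sets UNIV (range cyl)"
      by (rule sigma_sets_eqI) (auto intro: sigma_sets.Empty sigma_sets.Basic)
    then show "sets (distr M borel (\<lambda>x. x)) = sigma_sets UNIV (insert {} (range cyl))"
      "sets (distr N borel (\<lambda>x. x)) = sigma_sets UNIV (insert {} (range cyl))"
      by (simp_all add: borel_eq_sigma_cyl)
    show "range (\<lambda>_::nat. UNIV) \<subseteq> insert {} (range cyl)"
      using cyl_Nil by (metis image_subset_iff insertCI rangeI)
    show "emeasure (distr M borel (\<lambda>x. x)) UNIV \<noteq> \<infinity>"
      using finite_measure.emeasure_finite[OF fin] by (simp add: em)
  qed (auto simp: em eq)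
  then have eqB: "emeasure M (B \<inter> Y) = emeasure N (B \<inter> Y)" if "B \<in> sets borel" for B
    using em[OF that] by simp
  fix A assume "A \<in> sets M"
  then have "A \<in> sets borel" "A \<subseteq> Y" using Y by (auto simp: sM sets_restrict_space_iff)
  then show "emeasure M A = emeasure N A" using eqB[of A] by (simp add: Int_absorb2)
qed (simp add: sM sN)

lemma map_upt_eq_iff: "map x [0..<n] = us \<longleftrightarrow> length us = n \<and> (\<forall>i<n. x i = us ! i)"
  unfolding list_eq_iff_nth_eq by auto

text \<open>The conditional weights \<open>p (us @ [a]) / p us\<close> form a Markov kernel, and the theorem of Ionescu-Tulcea
  provides the measure.\<close>

lemma ex_measure_of_weights:
  fixes p :: "nat list \<Rightarrow> real"
  assumes S: "finite S" and nn: "\<And>us. 0 \<le> p us" and one: "p [] = 1"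
    and snoc: "\<And>us. (\<Sum>a\<in>S. p (us @ [a])) = p us" and out: "\<And>us a. a \<notin> S \<Longrightarrow> p (us @ [a]) = 0"
  shows "\<exists>M. prob_space M \<and> sets M = sets borel \<and> (\<forall>us. emeasure M (cyl us) = p us)"
proof -
  have le: "p (us @ [a]) \<le> p us" for us a
  proof (cases "a \<in> S")
    case True
    then show ?thesis using snoc[of us] member_le_sum[of a S "\<lambda>a. p (us @ [a])"] S nn by simp
  qed (simp add: out nn)
  \<comment> \<open>the kernel after a word of weight zero is irrelevant; a Dirac measure keeps it a probability\<close>
  define k where "k us = (if p us = 0 then return_pmf 0 else embed_pmf (\<lambda>a. p (us @ [a]) / p us))" for us
  have k: "ennreal (p us) * emeasure (measure_pmf (k us)) {a} = p (us @ [a])" for us a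
  proof (cases "p us = 0")
    case True
    then show ?thesis using le[of us a] nn[of "us @ [a]"] by simp
  next
    case False
    then have pos: "p us > 0" using nn[of us] by simp
    have "(\<integral>\<^sup>+a. ennreal (p (us @ [a]) / p us) \<partial>count_space UNIV)
        = (\<integral>\<^sup>+a. ennreal (p (us @ [a]) / p us) \<partial>count_space S)"
      by (rule nn_integral_count_space_eq) (auto simp: out)
    also have "\<dots> = (\<Sum>a\<in>S. ennreal (p (us @ [a]) / p us))" by (rule nn_integral_count_space_finite[OF S])
    also have "\<dots> = ennreal ((\<Sum>a\<in>S. p (us @ [a])) / p us)"
      using nn pos by (subst sum_ennreal) (auto simp: sum_divide_distrib)
    also have "\<dots> = 1" using snoc[of us] pos by simp
    finally have "pmf (embed_pmf (\<lambda>a. p (us @ [a]) / p us)) a = p (us @ [a]) / p us"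
      using nn by (intro pmf_embed_pmf) auto
    then have "pmf (k us) a = p (us @ [a]) / p us"
      using False by (simp add: k_def)
    then have "ennreal (p us) * emeasure (measure_pmf (k us)) {a} = ennreal (p us) * ennreal (p (us @ [a]) / p us)"
      by (simp add: emeasure_pmf_single)
    also have "\<dots> = ennreal (p us * (p (us @ [a]) / p us))"
      using pos nn by (intro ennreal_mult[symmetric]) auto
    also have "p us * (p (us @ [a]) / p us) = p (us @ [a])" using pos by simp
    finally show ?thesis .
  qed
  define N :: "nat \<Rightarrow> nat measure" where "N = (\<lambda>_. count_space UNIV)"
  define P where "P i x = measure_pmf (k (map x [0..<i]))" for i x
  have mlist: "(\<lambda>x. map x [0..<i]) \<in> PiM {0..<i} N \<rightarrow>\<^sub>M count_space UNIV" for i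
    unfolding measurable_count_space_eq2_countable
  proof (safe)
    fix us :: "nat list"
    have "(\<lambda>x. map x [0..<i]) -` {us} \<inter> space (PiM {0..<i} N)
        = (if length us = i then {x \<in> space (PiM {0..<i} N). \<forall>j\<in>{..<i}. x j \<in> {us ! j}} else {})"
      by (auto simp: map_upt_eq_iff)
    also have "\<dots> \<in> sets (PiM {0..<i} N)"
    proof (cases "length us = i")
      case True
      have "{x \<in> space (PiM {0..<i} N). \<forall>j\<in>{..<i}. x j \<in> {us ! j}} \<in> sets (PiM {0..<i} N)"
      proof (rule sets.sets_Collect_finite_All)
        fix j assume "j \<in> {..<i}"
        then have "(\<lambda>x. x j) \<in> PiM {0..<i} N \<rightarrow>\<^sub>M N j"
          by (intro measurable_component_singleton) auto
        from measurable_sets[OF this, of "{us ! j}"]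
        show "{x \<in> space (PiM {0..<i} N). x j \<in> {us ! j}} \<in> sets (PiM {0..<i} N)"
          by (simp add: N_def vimage_def Int_def conj_commute)
      qed simp
      then show ?thesis using True by simp
    qed auto
    finally show "(\<lambda>x. map x [0..<i]) -` {us} \<inter> space (PiM {0..<i} N) \<in> sets (PiM {0..<i} N)" .
  qed auto
  have Pm: "P i \<in> PiM {0..<i} N \<rightarrow>\<^sub>M subprob_algebra (N i)" for i
    unfolding P_def N_def
  proof (rule measurable_compose[OF mlist[unfolded N_def]])
    show "(\<lambda>us. measure_pmf (k us)) \<in> count_space UNIV \<rightarrow>\<^sub>M subprob_algebra (count_space UNIV)"
      by (simp add: measure_pmf_in_subprob_space)
  qed
  interpret IT: Ionescu_Tulcea P N
    by (rule Ionescu_Tulcea.intro[OF Pm]) (simp add: P_def measure_pmf.prob_space_axioms)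
  let ?u = "\<lambda>_::nat. undefined :: nat"
  \<comment> \<open>the cylinder of \<open>us\<close> as a set of finite sequences\<close>
  define Z where "Z us = {x \<in> space (PiM {0..<length us} N). \<forall>i<length us. x i = us ! i}" for us
  have Zsets: "Z us \<in> sets (PiM {0..<length us} N)" for us :: "nat list"
  proof -
    have "Z us = (\<lambda>x. map x [0..<length us]) -` {us} \<inter> space (PiM {0..<length us} N)"
      unfolding Z_def by (auto simp: map_upt_eq_iff)
    then show ?thesis using measurable_sets[OF mlist, of "{us}" "length us"] by simp
  qed
  have u0: "?u \<in> space (PiM {0..<0} N)" by (simp add: space_PiM)
  have C: "emeasure (IT.C 0 (length us) ?u) (Z us) = p us" for us
  proof (induction us rule: rev_induct)
    case Nil
    show ?case using u0 by (simp add: one Z_def)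
  next
    case (snoc a us)
    let ?n = "length us"
    have "emeasure (IT.C 0 (length (us @ [a])) ?u) (Z (us @ [a]))
       = (\<integral>\<^sup>+x. emeasure (IT.eP ?n x) (Z (us @ [a])) \<partial>IT.C 0 ?n ?u)"
    proof -
      have eq: "IT.C 0 (length (us @ [a])) ?u = IT.C 0 ?n ?u \<bind> IT.eP ?n" by simp
      moreover have "emeasure (IT.C 0 ?n ?u \<bind> IT.eP ?n) (Z (us @ [a]))
         = (\<integral>\<^sup>+x. emeasure (IT.eP ?n x) (Z (us @ [a])) \<partial>IT.C 0 ?n ?u)"
      proof (rule emeasure_bind)
        show "space (IT.C 0 ?n ?u) \<noteq> {}" using IT.prob_space_C[OF u0, of ?n] by (rule prob_space.not_empty)
        show "IT.eP ?n \<in> IT.C 0 ?n ?u \<rightarrow>\<^sub>M subprob_algebra (PiM {0..<Suc ?n} N)"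
        proof -
          have "sets (IT.C 0 ?n ?u) = sets (PiM {0..<?n} N)" using IT.sets_C[OF u0, of ?n] by simp
          from measurable_cong_sets[OF this refl] IT.measurable_eP[of ?n] show ?thesis by blast
        qed
        show "Z (us @ [a]) \<in> sets (PiM {0..<Suc ?n} N)" using Zsets[of "us @ [a]"] by simp
      qed
      ultimately show ?thesis unfolding eq by blast
    qed
    also have "\<dots> = (\<integral>\<^sup>+x. emeasure (measure_pmf (k us)) {a} * indicator (Z us) x \<partial>IT.C 0 ?n ?u)"
    proof (rule nn_integral_cong)
      fix x assume "x \<in> space (IT.C 0 ?n ?u)"
      then have x: "x \<in> space (PiM {0..<?n} N)" using IT.space_C[OF u0, of ?n] by simp
      have "emeasure (IT.eP ?n x) (Z (us @ [a]))
          = emeasure (P ?n x) ((\<lambda>y. x(?n := y)) -` Z (us @ [a]) \<inter> space (N ?n))"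
        using Zsets[of "us @ [a]"] by (intro IT.emeasure_eP[OF x]) simp
      also have "(\<lambda>y. x(?n := y)) -` Z (us @ [a]) \<inter> space (N ?n) = (if x \<in> Z us then {a} else {})"
        using x by (auto simp: Z_def space_PiM PiE_def extensional_def N_def nth_append less_Suc_eq)
      also have "emeasure (P ?n x) \<dots> = emeasure (measure_pmf (k us)) {a} * indicator (Z us) x"
      proof (cases "x \<in> Z us")
        case True
        then have "map x [0..<?n] = us" by (auto simp: map_upt_eq_iff Z_def)
        then show ?thesis using True by (simp add: P_def)
      qed auto
      finally show "emeasure (IT.eP ?n x) (Z (us @ [a])) = emeasure (measure_pmf (k us)) {a} * indicator (Z us) x" .
    qed
    also have "\<dots> = emeasure (measure_pmf (k us)) {a} * emeasure (IT.C 0 ?n ?u) (Z us)"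
      using Zsets[of us] IT.sets_C[OF u0, of ?n] by (intro nn_integral_cmult_indicator) simp
    also have "\<dots> = p (us @ [a])" using snoc k[of us a] by (simp add: mult.commute)
    finally show ?case .
  qed
  show ?thesis
  proof (intro exI conjI allI)
    have sl: "sets IT.PF.lim = sets (PiM UNIV N)" by simp
    also have "sets (PiM UNIV N) = sets borel" unfolding sets_borel_seq N_def ..
    finally show "sets IT.PF.lim = sets borel" .
    have em: "emeasure IT.PF.lim (cyl us) = p us" for us
    proof -
      have "cyl us = IT.PF.emb UNIV {0..<length us} (Z us)"
        by (auto simp: prod_emb_def N_def space_PiM cyl_def Z_def)
      also have "emeasure IT.PF.lim \<dots> = emeasure (IT.CI {0..<length us}) (Z us)"
        by (intro IT.lim Zsets) simp
      also have "\<dots> = emeasure (IT.C 0 (length us) ?u) (IT.PF.emb {0..<length us} {0..<length us} (Z us))"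
        by (intro IT.emeasure_CI Zsets) simp
      also have "IT.PF.emb {0..<length us} {0..<length us} (Z us) = Z us"
        using sets.sets_into_space[OF Zsets[of us]] by (intro prod_emb_id) (auto simp: space_PiM)
      finally show ?thesis by (simp add: C)
    qed
    show "emeasure IT.PF.lim (cyl us) = p us" for us by (rule em)
    show "prob_space IT.PF.lim"
    proof
      show "emeasure IT.PF.lim (space IT.PF.lim) = 1"
        using em[of "[]"] one unfolding sets_eq_imp_space_eq[OF sl]
        by (simp add: N_def space_PiM cyl_def)
    qed
  qed
qed

section \<open>Entropy of itineraries\<close>

lemma fekete:
  fixes a :: "nat \<Rightarrow> real"
  assumes nn: "\<And>n. 0 \<le> a n" and sub: "\<And>m n. a (m + n) \<le> a m + a n"
  shows "convergent (\<lambda>n. a n / n)"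
proof -
  define l where "l = (INF n\<in>{1..}. a n / n)"
  have bdd: "bdd_below ((\<lambda>n. a n / n) ` {1..})" using nn by (intro bdd_belowI[of _ 0]) auto
  have lower: "l \<le> a n / n" if "n \<ge> 1" for n
    unfolding l_def using that by (intro cINF_lower[OF bdd]) auto
  have lin: "a (q * k + r) \<le> q * a k + a r" for q k r
  proof (induction q)
    case (Suc q)
    have "a (Suc q * k + r) = a (k + (q * k + r))" by (simp add: ac_simps)
    also have "\<dots> \<le> a k + (q * a k + a r)" using sub[of k "q * k + r"] Suc by linarith
    finally show ?case by (simp add: algebra_simps)
  qed simp
  have "(\<lambda>n. a n / n) \<longlonglongrightarrow> l"
  proof (rule LIMSEQ_I)
    fix e :: real assume e: "0 < e"
    have "\<exists>k\<in>{1..}. a k / k < l + e / 2"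
      using e unfolding l_def by (subst cINF_less_iff[symmetric, OF _ bdd]) auto
    then obtain k :: nat where k: "k \<ge> 1" "a k / k < l + e / 2" by auto
    obtain N :: nat where N: "N > 2 * (k * a 1 + a 0) / e" using reals_Archimedean2 by blast
    show "\<exists>N. \<forall>n\<ge>N. norm (a n / n - l) < e"
    proof (intro exI[of _ "Suc N"] allI impI)
      fix n assume n: "n \<ge> Suc N"
      have ar: "a r \<le> k * a 1 + a 0" if "r < k" for r
      proof -
        have "a r \<le> r * a 1 + a 0" using lin[of r 1 0] by simp
        also have "\<dots> \<le> k * a 1 + a 0" using that nn[of 1] by (intro add_mono mult_right_mono) auto
        finally show ?thesis .
      qed
      have "a n \<le> (n div k) * a k + a (n mod k)" using lin[of "n div k" k "n mod k"] by simp
      also have "\<dots> \<le> (n / k) * a k + (k * a 1 + a 0)"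
        using k nn ar[of "n mod k"] of_nat_div_le_of_nat[of n k] by (intro add_mono mult_right_mono) auto
      finally have "a n / n \<le> ((n / k) * a k + (k * a 1 + a 0)) / n" by (intro divide_right_mono) auto
      also have "\<dots> = a k / k + (k * a 1 + a 0) / n" using n by (simp add: field_simps)
      also have "(k * a 1 + a 0) / n < e / 2"
      proof -
        have "2 * (k * a 1 + a 0) / e < n" using N n by linarith
        then show ?thesis using e n by (simp add: field_simps)
      qed
      finally have "a n / n < l + e" using k by simp
      then show "norm (a n / n - l) < e" using lower[of n] n e by simp
    qed
  qed
  then show ?thesis by (rule convergentI)
qed

lemma itinerary_0: "itinerary T \<xi> 0 x = []" by (simp add: itinerary_def)

lemma itinerary_Suc: "itinerary T \<xi> (Suc n) x = itinerary T \<xi> n x @ [\<xi> ((T ^^ n) x)]"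
  by (simp add: itinerary_def)

lemma itinerary_add: "itinerary T \<xi> (n + k) x = itinerary T \<xi> n x @ itinerary T \<xi> k ((T ^^ n) x)"
proof (induction k)
  case (Suc k)
  have "(T ^^ k) ((T ^^ n) x) = (T ^^ (n + k)) x" by (simp add: funpow_add add.commute[of n])
  then show ?case using Suc by (simp add: itinerary_Suc del: funpow.simps)
qed (simp add: itinerary_0)

lemma length_itinerary [simp]: "length (itinerary T \<xi> n x) = n" by (simp add: itinerary_def)

text \<open>Shannon entropy with natural logarithm, as a function of the labelling alone, without a target measure
  space that changes with the labelling.\<close>

definition ent :: "'a measure \<Rightarrow> ('a \<Rightarrow> 'b) \<Rightarrow> real" where
  "ent M f = - (\<Sum>v\<in>f ` space M. measure M (f -` {v} \<inter> space M) * ln (measure M (f -` {v} \<inter> space M)))"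

lemma ent_cong: "(\<And>x. x \<in> space M \<Longrightarrow> f x = g x) \<Longrightarrow> ent M f = ent M g"
proof -
  assume eq: "\<And>x. x \<in> space M \<Longrightarrow> f x = g x"
  then have "f ` space M = g ` space M" "\<And>v. f -` {v} \<inter> space M = g -` {v} \<inter> space M" by auto
  then show ?thesis by (simp add: ent_def)
qed

context prob_space
begin

lemma info_exp1: "information_space M (exp 1)"
  by unfold_locales simp

lemma entropy_eq_ent:
  assumes "simple_function M f"
  shows "entropy (exp 1) (count_space (f ` space M)) f = ent M f"
proof -
  interpret information_space M "exp 1" by (rule info_exp1)
  show ?thesis
    by (subst entropy_simple_distributed[OF simple_distributedI[OF assms measure_nonneg refl]])
      (simp add: ent_def log_def)
qed

lemma ent_nonneg: "0 \<le> ent M f"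
  unfolding ent_def neg_0_le_iff_le
proof (intro sum_nonpos mult_nonneg_nonpos measure_nonneg)
  show "ln (measure M (f -` {v} \<inter> space M)) \<le> 0" for v
    by (cases "measure M (f -` {v} \<inter> space M) = 0") (simp_all add: zero_less_measure_iff)
qed

lemma ent_compose: "simple_function M f \<Longrightarrow> ent M (\<lambda>x. F (f x)) \<le> ent M f"
proof -
  assume f: "simple_function M f"
  interpret information_space M "exp 1" by (rule info_exp1)
  show ?thesis using entropy_data_processing[OF f, of F] entropy_eq_ent[OF f]
      entropy_eq_ent[OF simple_function_compose[OF f, of F]] by (simp add: o_def)
qed

lemma ent_le_ent_add:
  assumes f: "simple_function M f" and g: "simple_function M g" and h: "\<And>x. x \<in> space M \<Longrightarrow> h x = F (f x) (g x)"
  shows "ent M h \<le> ent M f + ent M g"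
proof -
  interpret information_space M "exp 1" by (rule info_exp1)
  have "ent M h = ent M (\<lambda>x. case_prod F (f x, g x))" by (rule ent_cong) (simp add: h)
  also have "\<dots> \<le> ent M (\<lambda>x. (f x, g x))" by (intro ent_compose simple_function_Pair f g)
  also have "\<dots> \<le> ent M f + ent M g"
    using entropy_chain_rule[OF f g] conditional_entropy_less_eq_entropy[OF g f]
      entropy_eq_ent[OF f] entropy_eq_ent[OF g] entropy_eq_ent[OF simple_function_Pair[OF f g]] by simp
  finally show ?thesis .
qed

lemma simple_function_superset_sum:
  assumes "f ` space M \<subseteq> V" "finite V"
  shows "ent M f = - (\<Sum>v\<in>V. measure M (f -` {v} \<inter> space M) * ln (measure M (f -` {v} \<inter> space M)))"
proof -
  have "f -` {v} \<inter> space M = {}" if "v \<notin> f ` space M" for v using that by auto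
  then show ?thesis unfolding ent_def using assms by (intro arg_cong[of _ _ uminus] sum.mono_neutral_left) auto
qed

lemma ent_distr:
  assumes T: "T \<in> M \<rightarrow>\<^sub>M M" "distr M M T = M" and f: "simple_function M f"
  shows "ent M (\<lambda>x. f (T x)) = ent M f"
proof -
  have eq: "measure M ((\<lambda>x. f (T x)) -` {v} \<inter> space M) = measure M (f -` {v} \<inter> space M)" for v
  proof -
    have "measure M (f -` {v} \<inter> space M) = measure (distr M M T) (f -` {v} \<inter> space M)" using T by simp
    also have "\<dots> = measure M (T -` (f -` {v} \<inter> space M) \<inter> space M)"
      using T f by (intro measure_distr) (auto intro: simple_functionD)
    also have "T -` (f -` {v} \<inter> space M) \<inter> space M = (\<lambda>x. f (T x)) -` {v} \<inter> space M"
      using measurable_space[OF T(1)] by auto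
    finally show ?thesis ..
  qed
  have "(\<lambda>x. f (T x)) ` space M \<subseteq> f ` space M" using measurable_space[OF T(1)] by auto
  from simple_function_superset_sum[OF this] simple_functionD(1)[OF f]
  show ?thesis by (simp add: eq ent_def)
qed

lemma measure_preserving_funpow:
  assumes T: "T \<in> M \<rightarrow>\<^sub>M M" "distr M M T = M"
  shows "T ^^ n \<in> M \<rightarrow>\<^sub>M M \<and> distr M M (T ^^ n) = M"
proof (induction n)
  case (Suc n)
  then have m: "T ^^ n \<in> M \<rightarrow>\<^sub>M M" by simp
  then have "T ^^ Suc n \<in> M \<rightarrow>\<^sub>M M" using measurable_comp[OF m T(1)] by (simp add: o_def comp_def)
  moreover have "distr M M (T \<circ> T ^^ n) = distr (distr M M (T ^^ n)) M T"
    using distr_distr[OF T(1) m] by simp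
  ultimately show ?case using Suc T by (simp add: o_def)
qed (auto simp: distr_id2 id_def)

lemma simple_function_itinerary:
  assumes T: "T \<in> M \<rightarrow>\<^sub>M M" "distr M M T = M" and f: "simple_function M \<xi>"
  shows "simple_function M (itinerary T \<xi> n)"
proof (induction n)
  case 0
  show ?case by (simp add: itinerary_0[abs_def])
next
  case (Suc n)
  have "simple_function M (\<lambda>x. \<xi> ((T ^^ n) x))"
    using measure_preserving_funpow[OF T, of n] f by (blast intro: simple_function_comp)
  from simple_function_compose2[OF Suc this, of "\<lambda>us a. us @ [a]"]
  show ?case by (simp only: itinerary_Suc[abs_def])
qed

lemma join_entropy_eq_ent:
  assumes T: "T \<in> M \<rightarrow>\<^sub>M M" "distr M M T = M" and f: "simple_function M \<xi>"
  shows "join_entropy M T \<xi> n = ent M (itinerary T \<xi> n)"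
  unfolding join_entropy_def by (rule entropy_eq_ent[OF simple_function_itinerary[OF assms]])

lemma ent_itinerary_add:
  assumes T: "T \<in> M \<rightarrow>\<^sub>M M" "distr M M T = M" and f: "simple_function M \<xi>"
  shows "ent M (itinerary T \<xi> (n + k)) \<le> ent M (itinerary T \<xi> n) + ent M (itinerary T \<xi> k)"
proof -
  have Tn: "T ^^ n \<in> M \<rightarrow>\<^sub>M M" "distr M M (T ^^ n) = M" using measure_preserving_funpow[OF T] by auto
  note sf = simple_function_itinerary[OF T f]
  have "ent M (itinerary T \<xi> (n + k)) \<le> ent M (itinerary T \<xi> n) + ent M (\<lambda>x. itinerary T \<xi> k ((T ^^ n) x))"
    by (intro ent_le_ent_add[where F="(@)"] sf simple_function_comp[OF Tn(1)] itinerary_add)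
  then show ?thesis using ent_distr[OF Tn sf] by simp
qed

text \<open>Without convergence the operator \<open>lim\<close> in the definition of \<^const>\<open>ks_entropy\<close> would be meaningless.\<close>

lemma convergent_join_entropy:
  assumes T: "T \<in> M \<rightarrow>\<^sub>M M" "distr M M T = M" and f: "simple_function M \<xi>"
  shows "convergent (\<lambda>n. join_entropy M T \<xi> n / n)"
  using ent_itinerary_add[OF assms] by (intro fekete) (auto simp: join_entropy_eq_ent[OF assms] ent_nonneg)

lemma ent_itinerary_le:
  assumes T: "T \<in> M \<rightarrow>\<^sub>M M" "distr M M T = M" and f: "simple_function M \<xi>"
  shows "ent M (itinerary T \<xi> n) \<le> n * ent M \<xi>"
proof (induction n)
  case 0
  have "ent M (itinerary T \<xi> 0) = 0"
    by (subst simple_function_superset_sum[of _ "{[]}"]) (auto simp: itinerary_0 itinerary_0[abs_def] prob_space)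
  then show ?case by simp
next
  case (Suc n)
  have "ent M (itinerary T \<xi> 1) = ent M (\<lambda>x. [\<xi> x])" by (rule ent_cong) (simp add: itinerary_def)
  also have "\<dots> \<le> ent M \<xi>" by (rule ent_compose[OF f])
  finally show ?case using ent_itinerary_add[OF assms, of n 1] Suc by (simp add: algebra_simps)
qed

lemma integral_simple_compose:
  fixes F :: "'b \<Rightarrow> real"
  assumes f: "simple_function M f"
  shows "(\<integral>x. F (f x) \<partial>M) = (\<Sum>v\<in>f ` space M. measure M (f -` {v} \<inter> space M) * F v)"
proof -
  have fin: "finite (f ` space M)" and s: "f -` {v} \<inter> space M \<in> sets M" for v using simple_functionD[OF f] by auto
  have "(\<integral>x. F (f x) \<partial>M) = (\<integral>x. (\<Sum>v\<in>f ` space M. indicator (f -` {v} \<inter> space M) x * F v) \<partial>M)"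
  proof (rule Bochner_Integration.integral_cong)
    fix x assume x: "x \<in> space M"
    have "(\<Sum>v\<in>f ` space M. indicator (f -` {v} \<inter> space M) x * F v) = (\<Sum>v\<in>{f x}. indicator (f -` {v} \<inter> space M) x * F v)"
      using x fin by (intro sum.mono_neutral_right) (auto simp: indicator_def)
    then show "F (f x) = (\<Sum>v\<in>f ` space M. indicator (f -` {v} \<inter> space M) x * F v)" using x by simp
  qed simp
  also have "\<dots> = (\<Sum>v\<in>f ` space M. (\<integral>x. indicator (f -` {v} \<inter> space M) x * F v \<partial>M))"
    using s by (intro Bochner_Integration.integral_sum) (auto simp: top.not_eq_extremum[symmetric])
  also have "\<dots> = (\<Sum>v\<in>f ` space M. measure M (f -` {v} \<inter> space M) * F v)" by simp
  finally show ?thesis .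
qed

text \<open>From \<open>ln x \<le> x - 1\<close>; the right-hand side is the cross entropy of the law of \<open>f\<close> against \<open>q\<close>.\<close>

lemma gibbs_inequality:
  fixes q :: "'b \<Rightarrow> real"
  assumes f: "simple_function M f" and q: "\<And>v. v \<in> f ` space M \<Longrightarrow> 0 < q v" "(\<Sum>v\<in>f ` space M. q v) \<le> 1"
  shows "ent M f \<le> (\<integral>x. - ln (q (f x)) \<partial>M)"
proof -
  let ?p = "\<lambda>v. measure M (f -` {v} \<inter> space M)"
  have fin: "finite (f ` space M)" using simple_functionD[OF f] by auto
  have "?p v * ln (q v) - ?p v * ln (?p v) \<le> q v - ?p v" if v: "v \<in> f ` space M" for v
  proof (cases "?p v = 0")
    case False
    then have p: "?p v > 0" by (simp add: zero_less_measure_iff)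
    have "?p v * ln (q v / ?p v) \<le> ?p v * (q v / ?p v - 1)"
      using p q(1)[OF v] by (intro mult_left_mono ln_le_minus_one) auto
    then show ?thesis using p q(1)[OF v] by (simp add: ln_div right_diff_distrib)
  qed (use q(1)[OF v] in simp)
  then have "(\<Sum>v\<in>f ` space M. ?p v * ln (q v) - ?p v * ln (?p v)) \<le> (\<Sum>v\<in>f ` space M. q v - ?p v)"
    by (rule sum_mono)
  also have "\<dots> \<le> 0"
  proof -
    have "(\<Sum>v\<in>f ` space M. ?p v) = (\<integral>x. 1 \<partial>M)" using integral_simple_compose[OF f, of "\<lambda>_. 1"] by simp
    then show ?thesis using q(2) by (simp add: sum_subtractf prob_space)
  qed
  finally show ?thesis
    by (subst integral_simple_compose[OF f]) (simp add: ent_def sum_subtractf sum_negf)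
qed

text \<open>A partition with one dominant atom has small entropy: \<open>- p ln p\<close> is at most \<open>1 - p\<close> for the dominant atom
  and at most \<open>2 sqrt p\<close> for the others.\<close>

lemma ent_small:
  assumes d: "simple_function M d" and V: "d ` space M \<subseteq> insert v0 V" "finite V"
    and e: "0 \<le> e" "measure M {x \<in> space M. d x \<noteq> v0} \<le> e"
  shows "ent M d \<le> e + card V * (2 * sqrt e)"
proof -
  let ?p = "\<lambda>v. measure M (d -` {v} \<inter> space M)"
  have s: "d -` {v} \<inter> space M \<in> sets M" for v using simple_functionD[OF d] by auto
  have *: "{x \<in> space M. d x \<noteq> v0} = space M - (d -` {v0} \<inter> space M)" by auto
  have p0: "1 - ?p v0 \<le> e" using e(2) s[of v0] unfolding * by (simp add: prob_compl)
  have l1: "- (?p v * ln (?p v)) \<le> 1 - ?p v" for v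
  proof (cases "?p v = 0")
    case False
    then have p: "?p v > 0" by (simp add: zero_less_measure_iff)
    have "?p v * ln (1 / ?p v) \<le> ?p v * (1 / ?p v - 1)"
      using p by (intro mult_left_mono ln_le_minus_one) auto
    then show ?thesis using p by (simp add: ln_div right_diff_distrib)
  qed simp
  have l2: "- (?p v * ln (?p v)) \<le> 2 * sqrt e" if "v \<noteq> v0" for v
  proof (cases "?p v = 0")
    case False
    then have p: "?p v > 0" by (simp add: zero_less_measure_iff)
    have "?p v \<le> measure M {x \<in> space M. d x \<noteq> v0}"
      using that s[of v0] unfolding * by (intro finite_measure_mono) auto
    then have pe: "?p v \<le> e" using e by simp
    let ?r = "sqrt (?p v)"
    have r: "?r > 0" "?p v = ?r * ?r" using p by auto
    have "ln (?p v) = 2 * ln ?r" using p by (simp add: ln_sqrt)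
    moreover have "?r * ln (1 / ?r) \<le> ?r * (1 / ?r - 1)" using r by (intro mult_left_mono ln_le_minus_one) auto
    then have "- (?r * ln ?r) \<le> 1 - ?r" using r by (simp add: ln_div right_diff_distrib)
    then have "- (?r * ln ?r) \<le> 1" using r by linarith
    then have "2 * ?r * - (?r * ln ?r) \<le> 2 * ?r * 1" using r by (intro mult_left_mono) auto
    moreover have "2 * ?r * - (?r * ln ?r) = - ((?r * ?r) * (2 * ln ?r))" by simp
    ultimately have "- (?p v * ln (?p v)) \<le> 2 * ?r" using r by (simp only: mult_1_right)
    also have "\<dots> \<le> 2 * sqrt e" using pe by simp
    finally show ?thesis .
  qed (use e in simp)
  have "ent M d = (\<Sum>v\<in>insert v0 V. - (?p v * ln (?p v)))"
    using simple_function_superset_sum[OF V(1)] V(2) by (simp add: sum_negf)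
  also have "\<dots> = - (?p v0 * ln (?p v0)) + (\<Sum>v\<in>V - {v0}. - (?p v * ln (?p v)))"
    using V(2) by (subst sum.insert_remove) auto
  also have "\<dots> \<le> e + (\<Sum>v\<in>V - {v0}. 2 * sqrt e)"
    using l1[of v0] p0 l2 by (intro add_mono sum_mono) auto
  also have "\<dots> \<le> e + card V * (2 * sqrt e)"
    using V(2) e by (auto intro!: mult_right_mono card_mono)
  finally show ?thesis .
qed

end

section \<open>Approximation by cylinder sets\<close>

lemma measurable_map_upt: "(\<lambda>x. map x [0..<n]) \<in> (borel :: (nat \<Rightarrow> nat) measure) \<rightarrow>\<^sub>M count_space UNIV"
  unfolding measurable_count_space_eq2_countable
proof safe
  fix us :: "nat list"
  have "(\<lambda>x. map x [0..<n]) -` {us} \<inter> space borel = (if length us = n then cyl us else {})"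
    by (auto simp: map_upt_eq_iff cyl_def)
  then show "(\<lambda>x. map x [0..<n]) -` {us} \<inter> space borel \<in> sets borel" by simp
qed auto

text \<open>Sets that are approximated by unions of cylinders form a \<open>\<sigma>\<close>-algebra.\<close>

lemma cylinder_approximation:
  fixes M :: "(nat \<Rightarrow> nat) measure"
  assumes fin: "finite_measure M" and sM: "sets M = sets borel" and B: "B \<in> sets borel" and e: "0 < e"
  shows "\<exists>N W. measure M (sym_diff B {x. map x [0..<N] \<in> W}) < e"
proof -
  interpret finite_measure M by fact
  have C [measurable]: "{x. map x [0..<N] \<in> W} \<in> sets M" for N W
    using measurable_sets[OF measurable_map_upt, of W N] by (simp add: sM vimage_def)
  have "B \<in> sigma_sets UNIV (range cyl)" using B by (simp add: borel_eq_sigma_cyl)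
  then have "\<forall>e>0. \<exists>N W. measure M (sym_diff B {x. map x [0..<N] \<in> W}) < e"
  proof (induction rule: sigma_sets.induct)
    case (Basic a)
    then obtain us where us: "a = cyl us" by auto
    have "a = {x. map x [0..<length us] \<in> {us}}" unfolding us by (auto simp: map_upt_eq_iff cyl_def)
    then have "sym_diff a {x. map x [0..<length us] \<in> {us}} = {}" by simp
    then show ?case by (metis measure_empty)
  next
    case Empty
    have "sym_diff {} {x. map x [0..<0] \<in> {}} = {}" by simp
    then show ?case by (metis measure_empty)
  next
    case (Compl a)
    have "sym_diff (UNIV - a) {x. map x [0..<N] \<in> - W} = sym_diff a {x. map x [0..<N] \<in> W}" for N W by auto
    then show ?case using Compl.IH by metis
  next
    case (Union a)
    have aM [measurable]: "a i \<in> sets M" for i using Union.hyps by (simp add: sM borel_eq_sigma_cyl)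
    show ?case
    proof (intro allI impI)
      fix e :: real assume e: "0 < e"
      have "(\<lambda>k. measure M (\<Union>i<k. a i)) \<longlonglongrightarrow> measure M (\<Union>k. \<Union>i<k. a i)"
        by (intro finite_Lim_measure_incseq) (auto simp: incseq_def intro: less_le_trans)
      moreover have "(\<Union>k. \<Union>i<k. a i) = (\<Union>i. a i)" by (auto intro: lessI)
      ultimately obtain k where k: "\<bar>measure M (\<Union>i<k. a i) - measure M (\<Union>i. a i)\<bar> < e / 2"
        using e by (metis LIMSEQ_D half_gt_zero order_refl real_norm_def)
      have ek: "0 < e / (2 * (k + 1))" using e by simp
      have "\<exists>N W. measure M (sym_diff (a i) {x. map x [0..<N] \<in> W}) < e / (2 * (k + 1))" for i
        using Union.IH ek by blast
      then obtain N W where NW: "\<And>i. measure M (sym_diff (a i) {x. map x [0..<N i] \<in> W i}) < e / (2 * (k + 1))"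
        by metis
      define n where "n = (\<Sum>i<k. N i)"
      have n: "N i \<le> n" if "i < k" for i using that unfolding n_def by (intro member_le_sum) auto
      define V where "V = {us. \<exists>i<k. take (N i) us \<in> W i}"
      have V: "{x. map x [0..<n] \<in> V} = (\<Union>i<k. {x. map x [0..<N i] \<in> W i})"
        using n by (auto simp: V_def take_map)
      have "sym_diff (\<Union>i. a i) {x. map x [0..<n] \<in> V}
          \<subseteq> ((\<Union>i. a i) - (\<Union>i<k. a i)) \<union> (\<Union>i<k. sym_diff (a i) {x. map x [0..<N i] \<in> W i})"
        unfolding V by blast
      then have "measure M (sym_diff (\<Union>i. a i) {x. map x [0..<n] \<in> V})
          \<le> measure M (((\<Union>i. a i) - (\<Union>i<k. a i)) \<union> (\<Union>i<k. sym_diff (a i) {x. map x [0..<N i] \<in> W i}))"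
        by (intro finite_measure_mono) auto
      also have "\<dots> \<le> measure M ((\<Union>i. a i) - (\<Union>i<k. a i)) + measure M (\<Union>i<k. sym_diff (a i) {x. map x [0..<N i] \<in> W i})"
        by (intro measure_Un_le) auto
      also have "measure M ((\<Union>i. a i) - (\<Union>i<k. a i)) = measure M (\<Union>i. a i) - measure M (\<Union>i<k. a i)"
        by (intro finite_measure_Diff) auto
      also have "measure M (\<Union>i<k. sym_diff (a i) {x. map x [0..<N i] \<in> W i})
          \<le> (\<Sum>i<k. measure M (sym_diff (a i) {x. map x [0..<N i] \<in> W i}))"
        by (intro finite_measure_subadditive_finite) auto
      also have "\<dots> \<le> (\<Sum>i<k. e / (2 * (k + 1)))" using NW by (intro sum_mono) (auto intro: less_imp_le)
      also have "\<dots> \<le> e / 2" using e by (simp add: field_simps)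
      finally have "measure M (sym_diff (\<Union>i. a i) {x. map x [0..<n] \<in> V}) < e" using k by linarith
      then show "\<exists>N W. measure M (sym_diff (\<Union>i. a i) {x. map x [0..<N] \<in> W}) < e" by blast
    qed
  qed
  then show ?thesis using e by blast
qed

section \<open>The variational principle\<close>

context sft_potential
begin

lemma in_cyl_self: "x \<in> cyl (map x [0..<n])" by (simp add: cyl_def)

lemma X_complement: "- X = (\<Union>us\<in>{us. cyl us \<inter> X = {}}. cyl us)"
proof safe
  fix x assume x: "x \<notin> X"
  then obtain n where n: "x n \<notin> S \<or> A (x n) (x (Suc n)) \<noteq> 1" by (auto simp: X_iff)
  have "cyl (map x [0..<n + 2]) \<inter> X = {}"
  proof safe
    fix y assume y: "y \<in> cyl (map x [0..<n + 2])" "y \<in> X"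
    then have "y n = x n" "y (Suc n) = x (Suc n)" by (auto simp: cyl_def nth_append)
    moreover have "y n \<in> S" "A (y n) (y (Suc n)) = 1" using y(2) by (auto simp: X_iff)
    ultimately show "y \<in> {}" using n by simp
  qed
  moreover have "x \<in> cyl (map x [0..<n + 2])" by (rule in_cyl_self)
  ultimately show "x \<in> (\<Union>us\<in>{us. cyl us \<inter> X = {}}. cyl us)" by blast
qed auto

lemma X_borel [measurable]: "X \<in> sets borel"
proof -
  have "- X \<in> sets borel"
    unfolding X_complement by (intro sets.countable_UN') (auto intro: countable_subset)
  then show ?thesis by (metis borel_comp double_complement)
qed

lemma inv_sets: "m \<in> invariant_probs X \<Longrightarrow> sets m = sets (restrict_space borel X)"
  by (simp add: invariant_probs_def)

lemma inv_space: "m \<in> invariant_probs X \<Longrightarrow> space m = X"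
  using sets_eq_imp_space_eq[OF inv_sets] by (simp add: space_restrict_space)

lemma inv_prob: "m \<in> invariant_probs X \<Longrightarrow> prob_space m"
  by (simp add: invariant_probs_def)

lemma inv_measurable: "m \<in> invariant_probs X \<Longrightarrow> f \<in> borel \<rightarrow>\<^sub>M N \<Longrightarrow> f \<in> m \<rightarrow>\<^sub>M N"
  using measurable_cong_sets[OF inv_sets refl] measurable_restrict_space1 by blast

lemma inv_shift: "m \<in> invariant_probs X \<Longrightarrow> shift \<in> m \<rightarrow>\<^sub>M m" "m \<in> invariant_probs X \<Longrightarrow> distr m m shift = m"
proof -
  assume m: "m \<in> invariant_probs X"
  have "shift \<in> restrict_space borel X \<rightarrow>\<^sub>M restrict_space borel X"
    by (intro measurable_restrict_space3 measurable_shift) auto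
  then show "shift \<in> m \<rightarrow>\<^sub>M m" using measurable_cong_sets[OF inv_sets inv_sets, OF m m] by blast
  show "distr m m shift = m" using m by (simp add: invariant_probs_def)
qed

lemma inv_sets_Int: "m \<in> invariant_probs X \<Longrightarrow> U \<in> sets borel \<Longrightarrow> U \<inter> X \<in> sets m"
  by (auto simp: inv_sets sets_restrict_space)

lemma continuous_measurable:
  assumes m: "m \<in> invariant_probs X" and f: "continuous_on X f"
  shows "f \<in> borel_measurable m"
  using borel_measurable_continuous_on_restrict[OF f] measurable_cong_sets[OF inv_sets[OF m] refl] by blast

lemma words_simple: "m \<in> invariant_probs X \<Longrightarrow> simple_function m (\<lambda>x. map x [0..<n])"
  unfolding simple_function_eq_measurable
proof
  assume m: "m \<in> invariant_probs X"
  have "(\<lambda>x. map x [0..<n]) ` space m \<subseteq> {us. set us \<subseteq> S \<and> length us = n}"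
    using inv_space[OF m] by (auto simp: X_iff)
  then show "finite ((\<lambda>x. map x [0..<n]) ` space m)"
    using finite_lists_length_eq[OF finite_S] finite_subset by blast
  show "(\<lambda>x. map x [0..<n]) \<in> m \<rightarrow>\<^sub>M count_space UNIV"
    using inv_measurable[OF m measurable_map_upt] .
qed

lemma words_preimage: "(\<lambda>x. map x [0..<n]) -` {map x [0..<n]} \<inter> X = cyl (map x [0..<n]) \<inter> X"
  by (auto simp: map_upt_eq_iff cyl_def)

text \<open>The weights of words that do not occur in \<open>X\<close> vanish, so the measure lives on \<open>X\<close>.\<close>

theorem ex_gibbs_measure:
  "\<exists>m\<in>invariant_probs X. \<exists>G\<ge>1. \<forall>x\<in>X. \<forall>n.
     measure m (cyl (map x [0..<n]) \<inter> X) \<le> G * exp (birkhoff n x) / \<rho> ^ n \<and>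
     exp (birkhoff n x) / \<rho> ^ n \<le> G * measure m (cyl (map x [0..<n]) \<inter> X)"
proof -
  have out: "weight (us @ [a]) = 0" if "a \<notin> S" for us a
    using that by (intro weight_empty_cyl) (auto simp: cyl_snoc X_iff)
  obtain M' where M': "prob_space M'" and sM': "sets M' = sets borel" and eM': "\<And>us. emeasure M' (cyl us) = weight us"
    using ex_measure_of_weights[OF finite_S weight_nonneg weight_Nil weight_snoc out] by auto
  interpret M': prob_space M' by fact
  have cM' [measurable]: "cyl us \<in> sets M'" and XM' [measurable]: "X \<in> sets M'" for us by (auto simp: sM')
  have spM': "space M' = UNIV" using sets_eq_imp_space_eq[OF sM'] by simp
  have null: "emeasure M' (- X) = 0"
  proof -
    have "(\<Union>us\<in>{us. cyl us \<inter> X = {}}. cyl us) \<in> null_sets M'"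
      by (intro null_sets_UN') (auto simp: null_sets_def eM' weight_empty_cyl intro: countable_subset)
    then show ?thesis unfolding X_complement by auto
  qed
  have eX: "emeasure M' (cyl us \<inter> X) = weight us" for us
  proof -
    have "- X \<in> null_sets M'" using null XM' by (auto simp: null_sets_def sM' intro: borel_comp)
    then have "emeasure M' (cyl us - (- X)) = emeasure M' (cyl us)" by (intro emeasure_Diff_null_set) auto
    then show ?thesis by (simp add: eM' Diff_eq)
  qed
  define m where "m = restrict_space M' X"
  have sm: "sets m = sets (restrict_space borel X)"
    unfolding m_def by (rule sets_restrict_space_cong[OF sM'])
  have spm: "space m = X" by (simp add: m_def space_restrict_space spM')
  have em: "emeasure m (cyl us \<inter> X) = weight us" for us
    unfolding m_def by (subst emeasure_restrict_space) (auto simp: eX spM')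
  have pm: "prob_space m" using em[of "[]"] by (intro prob_spaceI) (simp add: spm weight_Nil)
  have shm: "shift \<in> m \<rightarrow>\<^sub>M m"
    unfolding measurable_cong_sets[OF sm sm] by (intro measurable_restrict_space3 measurable_shift) auto
  have "distr m m shift = m"
  proof (rule seq_measure_eqI[where Y=X])
    show "finite_measure (distr m m shift)"
      using prob_space.prob_space_distr[OF pm shm] by (rule prob_space.finite_measure)
    fix us
    have "emeasure (distr m m shift) (cyl us \<inter> X) = emeasure m (shift -` (cyl us \<inter> X) \<inter> X)"
      using shm by (subst emeasure_distr) (auto simp: sm sets_restrict_space spm)
    also have "shift -` (cyl us \<inter> X) \<inter> X = (\<Union>a\<in>S. cyl (a # us) \<inter> X)"
      by (auto simp: cyl_Cons X_iff shift_def)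
    also have "emeasure m \<dots> = (\<Sum>a\<in>S. emeasure m (cyl (a # us) \<inter> X))"
      using finite_S by (intro sum_emeasure[symmetric])
        (auto simp: sm sets_restrict_space disjoint_family_on_def cyl_Cons)
    also have "\<dots> = emeasure m (cyl us \<inter> X)"
      unfolding em by (subst sum_ennreal) (auto simp: weight_nonneg weight_Cons)
    finally show "emeasure (distr m m shift) (cyl us \<inter> X) = emeasure m (cyl us \<inter> X)" .
  qed (auto simp: sm)
  then have "m \<in> invariant_probs X" using sm pm by (simp add: invariant_probs_def)
  moreover have "measure m (cyl us \<inter> X) = weight us" for us
    using em[of us] weight_nonneg[of us] by (simp add: measure_def)
  ultimately show ?thesis using weight_gibbs by (intro bexI[of _ m]) (simp_all only:)
qed

lemma integral_birkhoff:
  assumes m: "m \<in> invariant_probs X" and \<phi>: "\<phi> \<in> borel_measurable m"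
  shows "integrable m (birkhoff n)" "integral\<^sup>L m (birkhoff n) = n * integral\<^sup>L m \<phi>"
proof -
  interpret prob_space m using m by (rule inv_prob)
  note T = measure_preserving_funpow[OF inv_shift[OF m]]
  have int: "integrable m \<phi>"
    using b(2) inv_space[OF m] \<phi> by (intro integrable_const_bound[where B=b]) auto
  have i: "integrable m (\<lambda>x. \<phi> ((shift ^^ i) x))" "(\<integral>x. \<phi> ((shift ^^ i) x) \<partial>m) = integral\<^sup>L m \<phi>" for i
    using T[of i] int integrable_distr[of "shift ^^ i" m m \<phi>] integral_distr[of "shift ^^ i" m m \<phi>] \<phi> by auto
  show "integrable m (birkhoff n)" "integral\<^sup>L m (birkhoff n) = n * integral\<^sup>L m \<phi>"
    unfolding birkhoff_def using i by auto
qed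

lemma itinerary_words: "itinerary shift (\<lambda>x. x 0) n x = map x [0..<n]"
  by (simp add: itinerary_def shift_funpow)

text \<open>Gibbs' inequality against the Gibbs measure \<open>m0\<close>: its negative logarithm on words of length \<open>n\<close> is
  \<open>n * ln \<rho>\<close> minus the Birkhoff sum, up to a constant, and the Birkhoff sum integrates to \<open>n\<close> times the
  integral of \<open>\<phi>\<close>.\<close>

lemma word_entropy_le:
  "\<exists>C. \<forall>m\<in>invariant_probs X. \<phi> \<in> borel_measurable m \<longrightarrow>
     (\<forall>n. ent m (\<lambda>x. map x [0..<n]) \<le> C + n * (ln \<rho> - integral\<^sup>L m \<phi>))"
proof -
  obtain m0 G where m0: "m0 \<in> invariant_probs X" and G: "G \<ge> 1"
    and low: "\<And>x n. x \<in> X \<Longrightarrow> exp (birkhoff n x) / \<rho> ^ n \<le> G * measure m0 (cyl (map x [0..<n]) \<inter> X)"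
    using ex_gibbs_measure by blast
  interpret m0: prob_space m0 using m0 by (rule inv_prob)
  show ?thesis
  proof (intro exI[of _ "ln G"] ballI impI allI)
    fix m n assume m: "m \<in> invariant_probs X" and \<phi>: "\<phi> \<in> borel_measurable m"
    interpret prob_space m using m by (rule inv_prob)
    let ?q = "\<lambda>us. measure m0 ((\<lambda>x. map x [0..<n]) -` {us} \<inter> space m0)"
    have q: "?q (map x [0..<n]) = measure m0 (cyl (map x [0..<n]) \<inter> X)" for x
      by (simp only: inv_space[OF m0] words_preimage)
    have bnd: "exp (birkhoff n x) / \<rho> ^ n \<le> G * ?q (map x [0..<n])" if "x \<in> X" for x
      using low[OF that, of n] by (simp only: q)
    have qpos: "0 < ?q (map x [0..<n])" if "x \<in> X" for x
    proof -
      have "0 < G * ?q (map x [0..<n])" using bnd[OF that] \<rho>_pos by (auto intro: less_le_trans[rotated])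
      then show ?thesis using G by (simp add: zero_less_mult_iff)
    qed
    have "ent m (\<lambda>x. map x [0..<n]) \<le> (\<integral>x. - ln (?q (map x [0..<n])) \<partial>m)"
    proof (rule gibbs_inequality[OF words_simple[OF m]])
      show "0 < ?q v" if "v \<in> (\<lambda>x. map x [0..<n]) ` space m" for v
        using that qpos inv_space[OF m] by auto
      have "(\<Sum>v\<in>(\<lambda>x. map x [0..<n]) ` space m. ?q v) = (\<integral>x. 1 \<partial>m0)"
        using m0.integral_simple_compose[OF words_simple[OF m0], of "\<lambda>_. 1" n] inv_space[OF m] inv_space[OF m0] by simp
      then show "(\<Sum>v\<in>(\<lambda>x. map x [0..<n]) ` space m. ?q v) \<le> 1" by (simp add: m0.prob_space)
    qed
    also have "\<dots> \<le> (\<integral>x. (ln G + n * ln \<rho>) - birkhoff n x \<partial>m)"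
    proof (rule integral_mono)
      show "integrable m (\<lambda>x. - ln (?q (map x [0..<n])))"
      proof (rule integrable_simple_function)
        show "simple_function m (\<lambda>x. - ln (?q (map x [0..<n])))"
          by (rule simple_function_compose1[OF words_simple[OF m]])
      qed (simp add: less_top[symmetric])
      show "integrable m (\<lambda>x. (ln G + n * ln \<rho>) - birkhoff n x)"
        using integral_birkhoff[OF m \<phi>] by auto
      fix x assume "x \<in> space m"
      then have x: "x \<in> X" using inv_space[OF m] by simp
      have "ln (exp (birkhoff n x) / \<rho> ^ n) \<le> ln (G * ?q (map x [0..<n]))"
        using bnd[OF x] \<rho>_pos by (intro ln_mono) auto
      then show "- ln (?q (map x [0..<n])) \<le> (ln G + n * ln \<rho>) - birkhoff n x"
        using qpos[OF x] G \<rho>_pos by (simp add: ln_mult ln_div ln_realpow)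
    qed
    also have "\<dots> = (ln G + n * ln \<rho>) - n * integral\<^sup>L m \<phi>"
      using integral_birkhoff[OF m \<phi>] by (simp add: prob_space)
    finally show "ent m (\<lambda>x. map x [0..<n]) \<le> ln G + n * (ln \<rho> - integral\<^sup>L m \<phi>)"
      by (simp add: algebra_simps)
  qed
qed

text \<open>Each of the finitely many level sets of \<open>\<xi>\<close> is approximated by a set of words, and \<open>F\<close> picks a label
  whose set contains the word. The value \<open>0\<close> is a default for words that belong to none of these sets.\<close>

lemma ex_cylinder_function:
  assumes m: "m \<in> invariant_probs X" and \<xi>: "simple_function m \<xi>" and e: "0 < e"
  shows "\<exists>N (F :: nat list \<Rightarrow> nat). (\<forall>us. F us \<in> insert 0 (\<xi> ` X)) \<and> measure m {x \<in> X. \<xi> x \<noteq> F (map x [0..<N])} < e"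
proof -
  interpret prob_space m using m by (rule inv_prob)
  let ?V = "\<xi> ` X"
  have V: "finite ?V" using simple_functionD(1)[OF \<xi>] inv_space[OF m] by simp
  define m' where "m' = distr m borel (\<lambda>x. x)"
  have id: "(\<lambda>x. x) \<in> m \<rightarrow>\<^sub>M borel" by (rule inv_measurable[OF m]) simp
  have m': "measure m' B = measure m (B \<inter> X)" if "B \<in> sets borel" for B
    using that id by (simp add: m'_def measure_distr inv_space[OF m])
  have fm': "finite_measure m'" using prob_space_distr[OF id] unfolding m'_def by (rule prob_space.finite_measure)
  define e' where "e' = e / (card ?V + 1)"
  have e': "0 < e'" using e by (simp add: e'_def)
  have "\<exists>N W. measure m (sym_diff (\<xi> -` {v} \<inter> X) {x \<in> X. map x [0..<N] \<in> W}) < e'" for v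
  proof -
    have "\<xi> -` {v} \<inter> space m \<in> sets m" using simple_functionD(2)[OF \<xi>] .
    then have "\<xi> -` {v} \<inter> X \<in> sets (restrict_space borel X)" by (simp only: inv_space[OF m] inv_sets[OF m])
    then have B: "\<xi> -` {v} \<inter> X \<in> sets borel" by (simp add: sets_restrict_space_iff)
    from cylinder_approximation[OF fm' _ B e'] obtain N W
      where NW: "measure m' (sym_diff (\<xi> -` {v} \<inter> X) {x. map x [0..<N] \<in> W}) < e'"
      by (auto simp: m'_def)
    have C: "{x. map x [0..<N] \<in> W} \<in> sets borel"
      using measurable_sets[OF measurable_map_upt, of W N] by (simp add: vimage_def)
    have "measure m (sym_diff (\<xi> -` {v} \<inter> X) {x. map x [0..<N] \<in> W} \<inter> X) < e'"
      using NW m'[of "sym_diff (\<xi> -` {v} \<inter> X) {x. map x [0..<N] \<in> W}"] B C by auto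
    moreover have "sym_diff (\<xi> -` {v} \<inter> X) {x. map x [0..<N] \<in> W} \<inter> X
        = sym_diff (\<xi> -` {v} \<inter> X) {x \<in> X. map x [0..<N] \<in> W}" by auto
    ultimately show ?thesis by auto
  qed
  then have "\<forall>v. \<exists>N W. measure m (sym_diff (\<xi> -` {v} \<inter> X) {x \<in> X. map x [0..<N] \<in> W}) < e'" by blast
  then have "\<exists>N W. \<forall>v. measure m (sym_diff (\<xi> -` {v} \<inter> X) {x \<in> X. map x [0..<N v] \<in> W v}) < e'"
    unfolding choice_iff .
  then obtain N W where NW: "\<And>v. measure m (sym_diff (\<xi> -` {v} \<inter> X) {x \<in> X. map x [0..<N v] \<in> W v}) < e'" by blast
  define n where "n = (\<Sum>v\<in>?V. N v)"
  have n: "N v \<le> n" if "v \<in> ?V" for v using that V unfolding n_def by (intro member_le_sum) auto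
  define F where "F us = (if \<exists>v\<in>?V. take (N v) us \<in> W v then SOME v. v \<in> ?V \<and> take (N v) us \<in> W v else 0)" for us
  have F: "F us \<in> insert 0 ?V" for us
    using someI_ex[of "\<lambda>v. v \<in> ?V \<and> take (N v) us \<in> W v"] by (auto simp: F_def)
  have sub: "{x \<in> X. \<xi> x \<noteq> F (map x [0..<n])} \<subseteq> (\<Union>v\<in>?V. sym_diff (\<xi> -` {v} \<inter> X) {x \<in> X. map x [0..<N v] \<in> W v})"
  proof (rule subsetI, rule ccontr)
    fix x assume "x \<in> {x \<in> X. \<xi> x \<noteq> F (map x [0..<n])}"
    then have x: "x \<in> X" "\<xi> x \<noteq> F (map x [0..<n])" by auto
    assume "x \<notin> (\<Union>v\<in>?V. sym_diff (\<xi> -` {v} \<inter> X) {x \<in> X. map x [0..<N v] \<in> W v})"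
    then have "x \<notin> sym_diff (\<xi> -` {v} \<inter> X) {x \<in> X. map x [0..<N v] \<in> W v}" if "v \<in> ?V" for v
      using that by blast
    then have iff: "\<xi> x = v \<longleftrightarrow> map x [0..<N v] \<in> W v" if "v \<in> ?V" for v using x(1) that by blast
    have *: "v \<in> ?V \<and> take (N v) (map x [0..<n]) \<in> W v \<longleftrightarrow> v = \<xi> x" for v
      using iff[of v] x n[of v] by (auto simp: take_map)
    have "\<exists>v\<in>?V. take (N v) (map x [0..<n]) \<in> W v" using * by blast
    then have "F (map x [0..<n]) = (SOME v. v \<in> ?V \<and> take (N v) (map x [0..<n]) \<in> W v)"
      by (simp only: F_def if_True)
    also have "\<dots> = \<xi> x" unfolding * by simp
    finally show False using x by simp
  qed
  have sets: "sym_diff (\<xi> -` {v} \<inter> X) {x \<in> X. map x [0..<N v] \<in> W v} \<in> sets m" for v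
  proof -
    have "\<xi> -` {v} \<inter> X \<in> sets m" using simple_functionD(2)[OF \<xi>, of "{v}"] by (simp only: inv_space[OF m])
    moreover have "{x \<in> X. map x [0..<N v] \<in> W v} = (\<lambda>x. map x [0..<N v]) -` W v \<inter> X" by auto
    then have "{x \<in> X. map x [0..<N v] \<in> W v} \<in> sets m"
      using simple_functionD(2)[OF words_simple[OF m], of "N v" "W v"] by (simp only: inv_space[OF m])
    ultimately show ?thesis by (intro sets.Un sets.Diff)
  qed
  have "measure m {x \<in> X. \<xi> x \<noteq> F (map x [0..<n])}
      \<le> measure m (\<Union>v\<in>?V. sym_diff (\<xi> -` {v} \<inter> X) {x \<in> X. map x [0..<N v] \<in> W v})"
    using sub V sets by (intro finite_measure_mono sets.finite_UN) auto
  also have "\<dots> \<le> (\<Sum>v\<in>?V. measure m (sym_diff (\<xi> -` {v} \<inter> X) {x \<in> X. map x [0..<N v] \<in> W v}))"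
    using V sets by (intro finite_measure_subadditive_finite) auto
  also have "\<dots> \<le> (\<Sum>v\<in>?V. e')" using NW by (intro sum_mono) (auto intro: less_imp_le)
  also have "\<dots> < e" using e by (simp add: e'_def field_simps)
  finally show ?thesis using F by blast
qed

text \<open>An arbitrary partition \<open>\<xi>\<close> is recovered from a partition \<open>\<eta>\<close> by words and a correction \<open>\<delta>\<close> that is
  rarely needed. The itineraries of \<open>\<eta>\<close> are functions of words, and those of \<open>\<delta>\<close> contribute an entropy
  of at most \<open>e\<close> per step.\<close>

lemma join_entropy_le:
  assumes m: "m \<in> invariant_probs X" and \<phi>: "\<phi> \<in> borel_measurable m" and \<xi>: "simple_function m \<xi>"
  shows "lim (\<lambda>n. join_entropy m shift \<xi> n / n) \<le> ln \<rho> - integral\<^sup>L m \<phi>"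
proof (rule field_le_epsilon)
  fix e :: real assume e: "0 < e"
  interpret prob_space m using m by (rule inv_prob)
  note T = inv_shift[OF m]
  obtain C where C: "\<And>n. ent m (\<lambda>x. map x [0..<n]) \<le> C + n * (ln \<rho> - integral\<^sup>L m \<phi>)"
    using word_entropy_le m \<phi> by blast
  let ?V = "insert 0 (\<xi> ` X)"
  have V: "finite ?V" using simple_functionD(1)[OF \<xi>] inv_space[OF m] by simp
  obtain d where d: "0 < d" "d + card (Suc ` ?V) * (2 * sqrt d) \<le> e"
  proof -
    have "((\<lambda>d. d + card (Suc ` ?V) * (2 * sqrt d)) \<longlongrightarrow> 0 + card (Suc ` ?V) * (2 * sqrt 0)) (at_right 0)"
      by (intro tendsto_intros)
    then have "\<forall>\<^sub>F d in at_right 0. d + card (Suc ` ?V) * (2 * sqrt d) < e"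
      using e by (intro order_tendstoD) auto
    then have "\<forall>\<^sub>F d in at_right 0. 0 < d \<and> d + card (Suc ` ?V) * (2 * sqrt d) < e"
      using eventually_at_right_less by (rule eventually_conj[rotated])
    then obtain d where "0 < d \<and> d + card (Suc ` ?V) * (2 * sqrt d) < e"
      using eventually_happens trivial_limit_at_right_real by blast
    then show ?thesis using that[of d] by auto
  qed
  obtain N F where F: "\<And>us. F us \<in> ?V" and N: "measure m {x \<in> X. \<xi> x \<noteq> F (map x [0..<N])} < d"
    using ex_cylinder_function[OF m \<xi> d(1)] by blast
  define \<eta> where "\<eta> x = F (map x [0..<N])" for x
  define \<delta> where "\<delta> x = (if \<xi> x = \<eta> x then 0 else Suc (\<xi> x))" for x
  have sf\<eta>: "simple_function m \<eta>" unfolding \<eta>_def by (rule simple_function_compose1[OF words_simple[OF m]])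
  have sf\<delta>: "simple_function m \<delta>"
    unfolding \<delta>_def by (rule simple_function_compose2[OF \<xi> sf\<eta>])
  have "ent m \<delta> \<le> d + card (Suc ` ?V) * (2 * sqrt d)"
  proof (rule ent_small[OF sf\<delta>])
    show "\<delta> ` space m \<subseteq> insert 0 (Suc ` ?V)" by (auto simp: \<delta>_def inv_space[OF m])
    have "{x \<in> space m. \<delta> x \<noteq> 0} = {x \<in> X. \<xi> x \<noteq> F (map x [0..<N])}"
      by (auto simp: \<delta>_def \<eta>_def inv_space[OF m])
    then show "measure m {x \<in> space m. \<delta> x \<noteq> 0} \<le> d" using N by simp
  qed (use V d in auto)
  then have ent\<delta>: "ent m \<delta> \<le> e" using d by simp
  have bound: "join_entropy m shift \<xi> n / n \<le> (C + N * (ln \<rho> - integral\<^sup>L m \<phi>)) / n + (ln \<rho> - integral\<^sup>L m \<phi>) + e"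
    if n: "n > 0" for n :: nat
  proof -
    \<comment> \<open>decodes \<open>\<xi>\<close> from \<open>\<delta>\<close> and \<open>\<eta>\<close>: \<open>0\<close> means that \<open>\<eta>\<close> is right, and \<open>Suc v\<close> that the label is \<open>v\<close>\<close>
    let ?dec = "map2 (\<lambda>d v. if d = 0 then v else d - 1)"
    have "itinerary shift \<xi> n x = ?dec (itinerary shift \<delta> n x) (itinerary shift \<eta> n x)" for x
      by (rule nth_equalityI) (auto simp: itinerary_def \<delta>_def)
    then have "ent m (itinerary shift \<xi> n) \<le> ent m (itinerary shift \<delta> n) + ent m (itinerary shift \<eta> n)"
      by (intro ent_le_ent_add simple_function_itinerary[OF T] sf\<delta> sf\<eta>)
    also have "ent m (itinerary shift \<delta> n) \<le> n * e"
      using ent_itinerary_le[OF T sf\<delta>, of n] mult_left_mono[OF ent\<delta>, of n] by simp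
    also have "ent m (itinerary shift \<eta> n) \<le> ent m (\<lambda>x. map x [0..<n + N])"
    proof -
      have "itinerary shift \<eta> n x = map (\<lambda>i. F (take N (drop i (map x [0..<n + N])))) [0..<n]" for x
      proof (rule nth_equalityI)
        fix i assume "i < length (itinerary shift \<eta> n x)"
        then have i: "i < n" by simp
        have "take N (drop i (map x [0..<n + N])) = map ((shift ^^ i) x) [0..<N]"
          using i by (intro nth_equalityI) (auto simp: shift_funpow add.commute)
        then show "itinerary shift \<eta> n x ! i = map (\<lambda>i. F (take N (drop i (map x [0..<n + N])))) [0..<n] ! i"
          using i by (simp add: itinerary_def \<eta>_def)
      qed simp
      then have "ent m (itinerary shift \<eta> n) = ent m (\<lambda>x. map (\<lambda>i. F (take N (drop i (map x [0..<n + N])))) [0..<n])"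
        by (intro ent_cong)
      also have "\<dots> \<le> ent m (\<lambda>x. map x [0..<n + N])"
        by (rule ent_compose[OF words_simple[OF m], of "\<lambda>us. map (\<lambda>i. F (take N (drop i us))) [0..<n]"])
      finally show ?thesis .
    qed
    also have "\<dots> \<le> C + real (n + N) * (ln \<rho> - integral\<^sup>L m \<phi>)" by (rule C)
    finally have "join_entropy m shift \<xi> n \<le> (C + N * (ln \<rho> - integral\<^sup>L m \<phi>)) + n * (ln \<rho> - integral\<^sup>L m \<phi>) + n * e"
      by (simp add: join_entropy_eq_ent[OF T \<xi>] algebra_simps)
    then have "join_entropy m shift \<xi> n / n \<le> ((C + N * (ln \<rho> - integral\<^sup>L m \<phi>)) + n * (ln \<rho> - integral\<^sup>L m \<phi>) + n * e) / n"
      by (intro divide_right_mono) auto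
    then show ?thesis using n by (simp add: add_divide_distrib)
  qed
  have conv: "(\<lambda>n. join_entropy m shift \<xi> n / n) \<longlonglongrightarrow> lim (\<lambda>n. join_entropy m shift \<xi> n / n)"
    using convergent_join_entropy[OF T \<xi>] by (simp add: convergent_LIMSEQ_iff)
  have "(\<lambda>n. (C + N * (ln \<rho> - integral\<^sup>L m \<phi>)) / n + (ln \<rho> - integral\<^sup>L m \<phi>) + e) \<longlonglongrightarrow> 0 + (ln \<rho> - integral\<^sup>L m \<phi>) + e"
    by (intro tendsto_intros lim_const_over_n)
  then show "lim (\<lambda>n. join_entropy m shift \<xi> n / n) \<le> ln \<rho> - integral\<^sup>L m \<phi> + e"
    using conv bound by (intro LIMSEQ_le[OF conv]) (auto intro!: exI[of _ 1])
qed

text \<open>The upper bound for every invariant measure is the entropy estimate for partitions. It is attained by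
  the Gibbs measure with the partition into first symbols, where the upper Gibbs bound makes the
  information of words as large as it can be.\<close>

theorem pressure_eq:
  assumes cont: "continuous_on X \<phi>"
  shows "pressure X \<phi> = ereal (ln \<rho>)"
    and "m \<in> invariant_probs X \<Longrightarrow> ks_entropy m shift \<le> ereal (ln \<rho> - integral\<^sup>L m \<phi>)"
proof -
  have up: "ks_entropy m shift \<le> ereal (ln \<rho> - integral\<^sup>L m \<phi>)" if m: "m \<in> invariant_probs X" for m
    unfolding ks_entropy_def
    using join_entropy_le[OF m continuous_measurable[OF m cont]] by (intro SUP_least) auto
  then show "m \<in> invariant_probs X \<Longrightarrow> ks_entropy m shift \<le> ereal (ln \<rho> - integral\<^sup>L m \<phi>)" .
  obtain m G where m: "m \<in> invariant_probs X" and G: "G \<ge> 1"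
    and up': "\<And>x n. x \<in> X \<Longrightarrow> measure m (cyl (map x [0..<n]) \<inter> X) \<le> G * exp (birkhoff n x) / \<rho> ^ n"
    using ex_gibbs_measure by blast
  interpret prob_space m using m by (rule inv_prob)
  note \<phi> = continuous_measurable[OF m cont] and T = inv_shift[OF m]
  let ?\<alpha> = "\<lambda>x :: nat \<Rightarrow> nat. x 0"
  have sf: "simple_function m ?\<alpha>"
    using simple_function_compose1[OF words_simple[OF m, of 1], of hd] by simp
  have low: "n * (ln \<rho> - integral\<^sup>L m \<phi>) - ln G \<le> join_entropy m shift ?\<alpha> n" for n
  proof -
    let ?p = "\<lambda>us. measure m ((\<lambda>x. map x [0..<n]) -` {us} \<inter> space m)"
    have p: "?p (map x [0..<n]) = measure m (cyl (map x [0..<n]) \<inter> X)" for x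
      by (simp only: inv_space[OF m] words_preimage)
    have "join_entropy m shift ?\<alpha> n = ent m (\<lambda>x. map x [0..<n])"
      by (simp add: join_entropy_eq_ent[OF T sf] itinerary_words[abs_def])
    also have "\<dots> = (\<integral>x. - ln (?p (map x [0..<n])) \<partial>m)"
      by (subst integral_simple_compose[OF words_simple[OF m], of "\<lambda>us. - ln (?p us)"]) (simp add: ent_def sum_negf)
    also have "\<dots> \<ge> (\<integral>x. (n * ln \<rho> - ln G) - birkhoff n x \<partial>m)"
    proof (rule integral_mono_AE)
      show "integrable m (\<lambda>x. - ln (?p (map x [0..<n])))"
      proof (rule integrable_simple_function)
        show "simple_function m (\<lambda>x. - ln (?p (map x [0..<n])))"
          by (rule simple_function_compose1[OF words_simple[OF m]])
      qed (simp add: less_top[symmetric])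
      show "integrable m (\<lambda>x. (n * ln \<rho> - ln G) - birkhoff n x)"
        using integral_birkhoff[OF m \<phi>] by auto
      have "AE x in m. 0 < ?p (map x [0..<n])"
      proof -
        let ?Z = "{us \<in> (\<lambda>x. map x [0..<n]) ` space m. ?p us = 0}"
        have "(\<Union>us\<in>?Z. (\<lambda>x. map x [0..<n]) -` {us} \<inter> space m) \<in> null_sets m"
          using simple_functionD[OF words_simple[OF m, of n]]
          by (intro null_sets_UN') (auto simp: null_sets_def emeasure_eq_measure intro: countable_finite)
        then show ?thesis
          by (rule AE_I') (auto simp: zero_less_measure_iff)
      qed
      then show "AE x in m. (n * ln \<rho> - ln G) - birkhoff n x \<le> - ln (?p (map x [0..<n]))"
      proof (rule AE_mp, intro AE_I2 impI)
        fix x assume "x \<in> space m" and pos: "0 < ?p (map x [0..<n])"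
        then have x: "x \<in> X" using inv_space[OF m] by simp
        have "ln (?p (map x [0..<n])) \<le> ln (G * exp (birkhoff n x) / \<rho> ^ n)"
          using up'[OF x, of n] pos unfolding p by (intro ln_mono) auto
        then show "(n * ln \<rho> - ln G) - birkhoff n x \<le> - ln (?p (map x [0..<n]))"
          using G \<rho>_pos by (simp add: ln_mult ln_div ln_realpow)
      qed
    qed
    also have "(\<integral>x. (n * ln \<rho> - ln G) - birkhoff n x \<partial>m) = n * (ln \<rho> - integral\<^sup>L m \<phi>) - ln G"
      using integral_birkhoff[OF m \<phi>] by (simp add: prob_space algebra_simps)
    finally show ?thesis .
  qed
  have conv: "(\<lambda>n. join_entropy m shift ?\<alpha> n / n) \<longlonglongrightarrow> lim (\<lambda>n. join_entropy m shift ?\<alpha> n / n)"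
    using convergent_join_entropy[OF T sf] by (simp add: convergent_LIMSEQ_iff)
  have "ln \<rho> - integral\<^sup>L m \<phi> - 0 \<le> lim (\<lambda>n. join_entropy m shift ?\<alpha> n / n)"
  proof (rule LIMSEQ_le[OF _ conv])
    show "(\<lambda>n. ln \<rho> - integral\<^sup>L m \<phi> - ln G / n) \<longlonglongrightarrow> ln \<rho> - integral\<^sup>L m \<phi> - 0"
      by (intro tendsto_intros lim_const_over_n)
    have "ln \<rho> - integral\<^sup>L m \<phi> - ln G / n \<le> join_entropy m shift ?\<alpha> n / n" if "n \<ge> 1" for n :: nat
      using divide_right_mono[OF low[of n], of n] that by (simp add: diff_divide_distrib)
    then show "\<exists>N. \<forall>n\<ge>N. ln \<rho> - integral\<^sup>L m \<phi> - ln G / n \<le> join_entropy m shift ?\<alpha> n / n" by blast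
  qed
  then have "ereal (ln \<rho> - integral\<^sup>L m \<phi>) \<le> ks_entropy m shift"
    unfolding ks_entropy_def using sf by (intro SUP_upper2[of ?\<alpha>]) auto
  then have "ks_entropy m shift = ereal (ln \<rho> - integral\<^sup>L m \<phi>)" using up[OF m] by (rule antisym[rotated])
  then have eq: "ks_entropy m shift + ereal (integral\<^sup>L m \<phi>) = ereal (ln \<rho>)" by simp
  show "pressure X \<phi> = ereal (ln \<rho>)"
    unfolding pressure_def
  proof (rule antisym)
    show "(SUP m\<in>invariant_probs X. ks_entropy m shift + ereal (integral\<^sup>L m \<phi>)) \<le> ereal (ln \<rho>)"
    proof (rule SUP_least)
      fix m assume "m \<in> invariant_probs X"
      from add_right_mono[OF up[OF this], of "ereal (integral\<^sup>L m \<phi>)"]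
      show "ks_entropy m shift + ereal (integral\<^sup>L m \<phi>) \<le> ereal (ln \<rho>)" by simp
    qed
    show "ereal (ln \<rho>) \<le> (SUP m\<in>invariant_probs X. ks_entropy m shift + ereal (integral\<^sup>L m \<phi>))"
      using m eq by (intro SUP_upper2[OF m]) simp
  qed
qed

end

section \<open>Equilibrium states are fixed by the dual transfer operator\<close>

lemma open_agree: "open {y :: nat \<Rightarrow> nat. agree n x y}"
proof -
  have "open ((\<lambda>y :: nat \<Rightarrow> nat. y i) -` {x i})" for i
    by (rule open_vimage) (auto simp: continuous_on_product_coordinates intro: Topological_Spaces.open_discrete)
  then have "open (\<Inter>i\<in>{..<n}. (\<lambda>y :: nat \<Rightarrow> nat. y i) -` {x i})" by (intro open_INT) auto
  also have "(\<Inter>i\<in>{..<n}. (\<lambda>y. y i) -` {x i}) = {y. agree n x y}" by (auto simp: agree_def)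
  finally show ?thesis .
qed

definition determined :: "nat \<Rightarrow> (nat \<Rightarrow> nat) set \<Rightarrow> bool" where
  "determined n E \<longleftrightarrow> (\<forall>x y. agree n x y \<longrightarrow> x \<in> E \<longrightarrow> y \<in> E)"

lemma determined_iff: "determined n E \<Longrightarrow> agree n x y \<Longrightarrow> x \<in> E \<longleftrightarrow> y \<in> E"
  by (auto simp: determined_def dest: agree_sym)

lemma determined_mono: "determined n E \<Longrightarrow> n \<le> m \<Longrightarrow> determined m E"
  by (auto simp: determined_def dest: agree_mono)

lemma determined_sets: assumes "determined n E" shows "E \<in> sets borel"
proof -
  have "E = (\<lambda>x. map x [0..<n]) -` ((\<lambda>x. map x [0..<n]) ` E) \<inter> space borel"
  proof safe
    fix x y :: "nat \<Rightarrow> nat" assume "map x [0..<n] = map y [0..<n]" "y \<in> E"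
    then have "agree n y x" by (auto simp: agree_def)
    then show "x \<in> E" using assms \<open>y \<in> E\<close> by (auto simp: determined_def)
  qed auto
  then show ?thesis using measurable_sets[OF measurable_map_upt] by (metis UNIV_I sets_UNIV)
qed

lemma determined_cyl: "determined (length us) (cyl us)"
  by (auto simp: determined_def cyl_def agree_def)

lemma determined_Int: "determined n E \<Longrightarrow> determined n F \<Longrightarrow> determined n (E \<inter> F)"
  unfolding determined_def by blast

lemma determined_vimage: "determined n E \<Longrightarrow> determined (m + n) ((shift ^^ m) -` E)"
  unfolding determined_def by (auto intro: agree_funpow)

context sft_potential
begin

text \<open>Hoelder functions for the fixed exponent \<open>\<theta>\<close>; they form an algebra that is invariant under the transfer
  operator, and contain the indicators of determined events.\<close>

definition lip :: "((nat \<Rightarrow> nat) \<Rightarrow> real) \<Rightarrow> bool" where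
  "lip f \<longleftrightarrow> (\<exists>C. \<forall>x\<in>X. \<forall>y\<in>X. \<forall>j. agree j x y \<longrightarrow> \<bar>f x - f y\<bar> \<le> C * \<theta> ^ j)"

lemma lipE:
  assumes "lip f"
  obtains C where "0 \<le> C" "\<And>x y j. x \<in> X \<Longrightarrow> y \<in> X \<Longrightarrow> agree j x y \<Longrightarrow> \<bar>f x - f y\<bar> \<le> C * \<theta> ^ j"
    "\<And>x. x \<in> X \<Longrightarrow> \<bar>f x\<bar> \<le> C"
proof -
  obtain C where C: "\<And>x y j. x \<in> X \<Longrightarrow> y \<in> X \<Longrightarrow> agree j x y \<Longrightarrow> \<bar>f x - f y\<bar> \<le> C * \<theta> ^ j"
    using assms by (auto simp: lip_def)
  let ?C = "\<bar>C\<bar> + \<bar>f x0\<bar>"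
  have "\<bar>f x - f y\<bar> \<le> ?C * \<theta> ^ j" if "x \<in> X" "y \<in> X" "agree j x y" for x y j
  proof -
    have "C * \<theta> ^ j \<le> ?C * \<theta> ^ j" using \<theta> by (intro mult_right_mono) auto
    then show ?thesis using C[OF that] by linarith
  qed
  moreover have "\<bar>f x\<bar> \<le> ?C" if "x \<in> X" for x using C[OF that x0, of 0] by simp
  ultimately show ?thesis using that[of ?C] by auto
qed

text \<open>Points with fewer than \<open>n\<close> common symbols are covered by the bound on \<open>f\<close>, since then \<open>\<theta> ^ n \<le> \<theta> ^ j\<close>.\<close>

lemma lip_of_level:
  assumes bd: "\<And>x. x \<in> X \<Longrightarrow> \<bar>f x\<bar> \<le> C"
    and C: "\<And>x y j. x \<in> X \<Longrightarrow> y \<in> X \<Longrightarrow> n \<le> j \<Longrightarrow> agree j x y \<Longrightarrow> \<bar>f x - f y\<bar> \<le> C * \<theta> ^ j"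
  shows "lip f"
  unfolding lip_def
proof (intro exI[of _ "2 * C / \<theta> ^ n"] ballI allI impI)
  fix x y j assume xy: "x \<in> X" "y \<in> X" and ag: "agree j x y"
  have C0: "0 \<le> C" using bd[OF xy(1)] by simp
  show "\<bar>f x - f y\<bar> \<le> 2 * C / \<theta> ^ n * \<theta> ^ j"
  proof (cases "n \<le> j")
    case True
    have "C * \<theta> ^ j \<le> 2 * C / \<theta> ^ n * \<theta> ^ j"
    proof (rule mult_right_mono)
      have "C * \<theta> ^ n \<le> 2 * C" using C0 \<theta> mult_left_mono[of "\<theta> ^ n" 2 C] by (simp add: power_le_one mult.commute
          order.trans[OF power_le_one[of \<theta> n]])
      then show "C \<le> 2 * C / \<theta> ^ n" using \<theta> by (simp add: pos_le_divide_eq)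
    qed (use \<theta> in auto)
    then show ?thesis using C[OF xy True ag] by linarith
  next
    case False
    have "\<theta> ^ n \<le> \<theta> ^ j" using False \<theta> by (intro power_decreasing) auto
    then have "2 * C * \<theta> ^ n \<le> 2 * C * \<theta> ^ j" using C0 by (intro mult_left_mono) auto
    then have "2 * C \<le> 2 * C / \<theta> ^ n * \<theta> ^ j" using \<theta> by (simp add: field_simps)
    then show ?thesis using bd[OF xy(1)] bd[OF xy(2)] by linarith
  qed
qed

lemma lip_const: "lip (\<lambda>_. a)" by (auto simp: lip_def intro!: exI[of _ 0])

lemma lip_\<phi>: "lip \<phi>" using \<phi>_lip by (auto simp: lip_def)

lemma lip_add: assumes "lip f" "lip h" shows "lip (\<lambda>x. f x + h x)"
proof -
  obtain C where C: "\<And>x y j. x \<in> X \<Longrightarrow> y \<in> X \<Longrightarrow> agree j x y \<Longrightarrow> \<bar>f x - f y\<bar> \<le> C * \<theta> ^ j" by (rule lipE[OF assms(1)]) blast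
  obtain C' where C': "\<And>x y j. x \<in> X \<Longrightarrow> y \<in> X \<Longrightarrow> agree j x y \<Longrightarrow> \<bar>h x - h y\<bar> \<le> C' * \<theta> ^ j" by (rule lipE[OF assms(2)]) blast
  have "\<bar>f x + h x - (f y + h y)\<bar> \<le> (C + C') * \<theta> ^ j" if "x \<in> X" "y \<in> X" "agree j x y" for x y j
    using C[OF that] C'[OF that] by (simp add: distrib_right)
  then show ?thesis by (auto simp: lip_def)
qed

lemma lip_mult: assumes "lip f" "lip h" shows "lip (\<lambda>x. f x * h x)"
proof -
  obtain C where C0: "0 \<le> C" and C: "\<And>x y j. x \<in> X \<Longrightarrow> y \<in> X \<Longrightarrow> agree j x y \<Longrightarrow> \<bar>f x - f y\<bar> \<le> C * \<theta> ^ j"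
    and Cb: "\<And>x. x \<in> X \<Longrightarrow> \<bar>f x\<bar> \<le> C" by (rule lipE[OF assms(1)]) blast
  obtain C' where C0': "0 \<le> C'" and C': "\<And>x y j. x \<in> X \<Longrightarrow> y \<in> X \<Longrightarrow> agree j x y \<Longrightarrow> \<bar>h x - h y\<bar> \<le> C' * \<theta> ^ j"
    and Cb': "\<And>x. x \<in> X \<Longrightarrow> \<bar>h x\<bar> \<le> C'" by (rule lipE[OF assms(2)]) blast
  have "\<bar>f x * h x - f y * h y\<bar> \<le> (2 * (C * C')) * \<theta> ^ j" if xy: "x \<in> X" "y \<in> X" "agree j x y" for x y j
  proof -
    have "f x * h x - f y * h y = f x * (h x - h y) + (f x - f y) * h y" by (simp add: algebra_simps)
    also have "\<bar>\<dots>\<bar> \<le> \<bar>f x\<bar> * \<bar>h x - h y\<bar> + \<bar>f x - f y\<bar> * \<bar>h y\<bar>"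
      using abs_triangle_ineq[of "f x * (h x - h y)" "(f x - f y) * h y"] by (simp only: abs_mult)
    also have "\<dots> \<le> C * (C' * \<theta> ^ j) + (C * \<theta> ^ j) * C'"
      using C[OF xy] C'[OF xy] Cb[OF xy(1)] Cb'[OF xy(2)] C0 C0' \<theta> by (intro add_mono mult_mono) auto
    finally show ?thesis by (simp add: algebra_simps)
  qed
  then show ?thesis by (auto simp: lip_def)
qed

lemma lip_scale: "lip f \<Longrightarrow> lip (\<lambda>x. a * f x)" by (intro lip_mult lip_const)

lemma lip_diff: "lip f \<Longrightarrow> lip h \<Longrightarrow> lip (\<lambda>x. f x - h x)"
  using lip_add[OF _ lip_scale[of h "-1"], of f] by simp

lemma lip_compose:
  assumes f: "lip f" and F: "\<And>a d. a \<in> f ` X \<Longrightarrow> d \<in> f ` X \<Longrightarrow> \<bar>F a - F d\<bar> \<le> Q * \<bar>a - d\<bar>" and Q: "0 \<le> Q"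
  shows "lip (\<lambda>x. F (f x))"
proof -
  obtain C where C: "\<And>x y j. x \<in> X \<Longrightarrow> y \<in> X \<Longrightarrow> agree j x y \<Longrightarrow> \<bar>f x - f y\<bar> \<le> C * \<theta> ^ j" by (rule lipE[OF f]) blast
  have "\<bar>F (f x) - F (f y)\<bar> \<le> (Q * C) * \<theta> ^ j" if xy: "x \<in> X" "y \<in> X" "agree j x y" for x y j
    using F[of "f x" "f y"] mult_left_mono[OF C[OF xy] Q] xy by (auto simp: mult.assoc)
  then show ?thesis by (auto simp: lip_def)
qed

lemma lip_exp_\<phi>: "lip (\<lambda>x. exp (\<phi> x))"
proof (rule lip_compose[OF lip_\<phi>, where Q="exp b"])
  fix a d assume "a \<in> \<phi> ` X" "d \<in> \<phi> ` X"
  then have ad: "a \<le> b" "d \<le> b" using b(2) by (auto dest: abs_le_D1)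
  have *: "exp d - exp a \<le> exp b * (d - a)" if "a \<le> d" "d \<le> b" for a d :: real
  proof -
    have "exp d * (1 - exp (a - d)) \<le> exp d * (d - a)"
      using exp_ge_add_one_self[of "a - d"] by (intro mult_left_mono) (linarith, simp)
    also have "\<dots> \<le> exp b * (d - a)" using that by (intro mult_right_mono) auto
    finally show ?thesis by (simp add: right_diff_distrib exp_add[symmetric])
  qed
  show "\<bar>exp a - exp d\<bar> \<le> exp b * \<bar>a - d\<bar>"
    using *[of a d] *[of d a] ad by (cases "a \<le> d") auto
qed simp

lemma lip_shift: assumes "lip f" shows "lip (\<lambda>x. f (shift x))"
proof -
  obtain C where C0: "0 \<le> C" and C: "\<And>x y j. x \<in> X \<Longrightarrow> y \<in> X \<Longrightarrow> agree j x y \<Longrightarrow> \<bar>f x - f y\<bar> \<le> C * \<theta> ^ j"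
    and Cb: "\<And>x. x \<in> X \<Longrightarrow> \<bar>f x\<bar> \<le> C" by (rule lipE[OF assms]) blast
  show ?thesis
  proof (rule lip_of_level[where C="C / \<theta>" and n=1])
    fix x assume "x \<in> X"
    then have "\<bar>f (shift x)\<bar> \<le> C" using Cb by auto
    also have "C \<le> C / \<theta>" using C0 \<theta> by (simp add: pos_le_divide_eq mult_left_le)
    finally show "\<bar>f (shift x)\<bar> \<le> C / \<theta>" .
  next
    fix x y and j :: nat assume xy: "x \<in> X" "y \<in> X" and j: "1 \<le> j" and ag: "agree j x y"
    then obtain i where i: "j = Suc i" by (cases j) auto
    have "\<bar>f (shift x) - f (shift y)\<bar> \<le> C * \<theta> ^ i"
      using xy ag unfolding i by (intro C shift_X agree_shift)
    then show "\<bar>f (shift x) - f (shift y)\<bar> \<le> C / \<theta> * \<theta> ^ j" using \<theta> by (simp add: i)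
  qed
qed

lemma lip_L: assumes "lip f" shows "lip (L f)"
proof -
  obtain C where C0: "0 \<le> C" and C: "\<And>x y j. x \<in> X \<Longrightarrow> y \<in> X \<Longrightarrow> agree j x y \<Longrightarrow>
      \<bar>exp (\<phi> x) * f x - exp (\<phi> y) * f y\<bar> \<le> C * \<theta> ^ j"
    and Cb: "\<And>x. x \<in> X \<Longrightarrow> \<bar>exp (\<phi> x) * f x\<bar> \<le> C"
    by (rule lipE[OF lip_mult[OF lip_exp_\<phi> assms]]) blast
  have card: "card (pre x) \<le> card S" for x using finite_S by (auto simp: pre_def intro: card_mono)
  show ?thesis
  proof (rule lip_of_level[where C="card S * C" and n=1])
    fix x assume x: "x \<in> X"
    have "\<bar>L f x\<bar> \<le> (\<Sum>a\<in>pre x. \<bar>exp (\<phi> (case_nat a x)) * f (case_nat a x)\<bar>)"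
      unfolding L_eq[OF x] by (rule sum_abs)
    also have "\<dots> \<le> (\<Sum>a\<in>pre x. C)" using Cb case_nat_pre[OF x] by (intro sum_mono) blast
    also have "\<dots> \<le> card S * C" using card C0 by (simp add: mult_right_mono)
    finally show "\<bar>L f x\<bar> \<le> card S * C" .
  next
    fix x y j assume xy: "x \<in> X" "y \<in> X" and j: "1 \<le> j" and ag: "agree j x y"
    have eq: "pre y = pre x" using ag j by (intro pre_cong) (auto simp: agree_def)
    have "\<bar>L f x - L f y\<bar> \<le> (\<Sum>a\<in>pre x. \<bar>exp (\<phi> (case_nat a x)) * f (case_nat a x) - exp (\<phi> (case_nat a y)) * f (case_nat a y)\<bar>)"
      unfolding L_eq[OF xy(1)] L_eq[OF xy(2)] eq sum_subtractf[symmetric] by (rule sum_abs)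
    also have "\<dots> \<le> (\<Sum>a\<in>pre x. C * \<theta> ^ j)"
    proof (rule sum_mono)
      fix a assume a: "a \<in> pre x"
      have "\<bar>exp (\<phi> (case_nat a x)) * f (case_nat a x) - exp (\<phi> (case_nat a y)) * f (case_nat a y)\<bar> \<le> C * \<theta> ^ Suc j"
        using case_nat_pre xy a eq agree_case_nat[OF ag] by (intro C) auto
      also have "\<dots> \<le> C * \<theta> ^ j" using C0 \<theta> by (intro mult_left_mono power_decreasing) auto
      finally show "\<bar>exp (\<phi> (case_nat a x)) * f (case_nat a x) - exp (\<phi> (case_nat a y)) * f (case_nat a y)\<bar> \<le> C * \<theta> ^ j" .
    qed
    also have "\<dots> \<le> card S * (C * \<theta> ^ j)" using card C0 \<theta> by (simp add: mult_right_mono)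
    finally show "\<bar>L f x - L f y\<bar> \<le> card S * C * \<theta> ^ j" by (simp add: mult.assoc)
  qed
qed

lemma lip_Ln: "lip f \<Longrightarrow> lip ((L ^^ n) f)" by (induction n) (auto intro: lip_L)

lemma lip_indicator: assumes "determined n E" shows "lip (indicator E)"
proof (rule lip_of_level[where C=1 and n=n])
  fix x y :: "nat \<Rightarrow> nat" and j assume "n \<le> j" "agree j x y"
  then have "agree n x y" using agree_mono by blast
  then have "x \<in> E \<longleftrightarrow> y \<in> E" by (rule determined_iff[OF assms])
  then show "\<bar>indicator E x - indicator E y\<bar> \<le> 1 * \<theta> ^ j" using \<theta> by (simp add: indicator_def)
qed (simp add: indicator_def)

lemma lip_continuous: assumes "lip f" shows "continuous_on X f"
  unfolding continuous_on_topological
proof (intro ballI allI impI)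
  fix x U assume x: "x \<in> X" and U: "open U" "f x \<in> U"
  obtain C where C: "0 \<le> C" "\<And>x y j. x \<in> X \<Longrightarrow> y \<in> X \<Longrightarrow> agree j x y \<Longrightarrow> \<bar>f x - f y\<bar> \<le> C * \<theta> ^ j"
    by (rule lipE[OF assms]) blast
  obtain e where e: "e > 0" "\<And>z. \<bar>z - f x\<bar> < e \<Longrightarrow> z \<in> U"
    using U by (auto simp: open_dist dist_real_def)
  have "(\<lambda>j. C * \<theta> ^ j) \<longlonglongrightarrow> C * 0" using \<theta> by (intro tendsto_intros LIMSEQ_power_zero) auto
  then have "\<forall>\<^sub>F j in sequentially. C * \<theta> ^ j < e" using e by (intro order_tendstoD) auto
  then obtain j where j: "C * \<theta> ^ j < e" by (auto simp: eventually_sequentially)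
  show "\<exists>V. open V \<and> x \<in> V \<and> (\<forall>y\<in>X. y \<in> V \<longrightarrow> f y \<in> U)"
  proof (intro exI[of _ "{y. agree j x y}"] conjI ballI impI)
    fix y assume "y \<in> X" "y \<in> {y. agree j x y}"
    then have "\<bar>f x - f y\<bar> < e" using C(2)[OF x, of y j] j by auto
    then show "f y \<in> U" by (intro e(2)) (simp add: abs_minus_commute)
  qed (auto intro: open_agree)
qed

lemma lip_ln:
  assumes F: "lip F" and bd: "\<And>x. x \<in> X \<Longrightarrow> \<bar>F x\<bar> \<le> 1 / 2"
  shows "lip (\<lambda>x. ln (1 + F x))"
proof (rule lip_compose[OF F, where F="\<lambda>a. ln (1 + a)" and Q=2])
  fix a d assume "a \<in> F ` X" "d \<in> F ` X"
    then obtain x y where "x \<in> X" "a = F x" "y \<in> X" "d = F y" by auto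
  then have "- (1 / 2) \<le> a" "- (1 / 2) \<le> d" using bd[of x] bd[of y] by linarith+
  have *: "ln (1 + d) - ln (1 + a) \<le> 2 * (d - a)" if "a \<le> d" "- (1 / 2) \<le> a" for a d :: real
  proof -
    have "ln ((1 + d) / (1 + a)) \<le> (1 + d) / (1 + a) - 1" using that by (intro ln_le_minus_one) auto
    also have "\<dots> = (d - a) / (1 + a)" using that by (simp add: field_simps)
    also have "\<dots> \<le> (d - a) / (1 / 2)" using that by (intro divide_left_mono) auto
    finally show ?thesis using that by (simp add: ln_div)
  qed
  have mono: "ln (1 + a) \<le> ln (1 + d)" if "a \<le> d" "- (1 / 2) \<le> a" for a d :: real
    using that by (intro ln_mono) auto
  show "\<bar>ln (1 + a) - ln (1 + d)\<bar> \<le> 2 * \<bar>a - d\<bar>"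
    using *[of a d] *[of d a] mono[of a d] mono[of d a] \<open>- (1 / 2) \<le> a\<close> \<open>- (1 / 2) \<le> d\<close>
    by (cases "a \<le> d") auto
qed simp

lemma \<rho>_eq_1: assumes "\<And>x. x \<in> X \<Longrightarrow> L (\<lambda>_. 1) x = 1" shows "x \<in> X \<Longrightarrow> g n x = 1" "\<rho> = 1"
proof -
  show g1: "g n x = 1" if "x \<in> X" for n x
    using that
  proof (induction n arbitrary: x)
    case (Suc n)
    have "L (g n) x = L (\<lambda>_. 1) x" using Suc by (intro L_cong) auto
    then show ?case using assms Suc.prems by simp
  qed simp
  have "(\<lambda>N. g (N + 1) x0 / g N x0) \<longlonglongrightarrow> \<rho> ^ 1" using g_quot[OF x0] .
  then show "\<rho> = 1" unfolding g1[OF x0] using LIMSEQ_unique[OF tendsto_const] by fastforce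
qed

end

locale equilibrium = sft_potential +
  fixes \<mu> :: "(nat \<Rightarrow> nat) measure"
  assumes L_one: "\<And>x. x \<in> X \<Longrightarrow> L (\<lambda>_. 1) x = 1"
    and equilibrium: "equilibrium_state X \<phi> \<mu>"
begin

lemma g_1 [simp]: "x \<in> X \<Longrightarrow> g n x = 1" by (rule \<rho>_eq_1[OF L_one])

lemma inv: "\<mu> \<in> invariant_probs X" using equilibrium by (simp add: equilibrium_state_def)

sublocale prob_space \<mu> using inv by (rule inv_prob)

lemma space_\<mu> [simp]: "space \<mu> = X" using inv by (rule inv_space)

lemma prob_X [simp]: "prob X = 1" using prob_space by simp

lemma entropy_\<mu>: "ks_entropy \<mu> shift = ereal (- integral\<^sup>L \<mu> \<phi>)"
proof -
  have "pressure X \<phi> = 0"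
    using pressure_eq(1)[OF lip_continuous[OF lip_\<phi>]] \<rho>_eq_1(2)[OF L_one] by (simp add: zero_ereal_def)
  then have eq: "ks_entropy \<mu> shift + ereal (integral\<^sup>L \<mu> \<phi>) = 0" using equilibrium by (simp add: equilibrium_state_def)
  then show ?thesis
  proof (cases "ks_entropy \<mu> shift")
    case (real r)
    then show ?thesis using eq by (simp add: zero_ereal_def)
  qed auto
qed

lemma lip_measurable: "lip f \<Longrightarrow> f \<in> borel_measurable \<mu>"
  by (rule continuous_measurable[OF inv lip_continuous])

lemma lip_integrable: assumes "lip f" shows "integrable \<mu> f"
proof -
  obtain C where "\<And>x. x \<in> X \<Longrightarrow> \<bar>f x\<bar> \<le> C" by (rule lipE[OF assms]) blast
  then show ?thesis using lip_measurable[OF assms] by (intro integrable_const_bound[where B=C]) auto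
qed

text \<open>If \<open>L F = 0\<close>, then \<open>\<phi> + ln (1 + F)\<close> is again normalised, hence of pressure \<open>0\<close>; but \<open>\<mu>\<close> contributes
  \<open>\<integral> ln (1 + F) d\<mu>\<close> to the supremum that defines this pressure.\<close>

lemma perturbed_integral_le_0:
  assumes F: "lip F" and LF: "\<And>x. x \<in> X \<Longrightarrow> L F x = 0" and bd: "\<And>x. x \<in> X \<Longrightarrow> \<bar>F x\<bar> \<le> 1 / 2"
  shows "(\<integral>x. ln (1 + F x) \<partial>\<mu>) \<le> 0"
proof -
  have lipln: "lip (\<lambda>x. ln (1 + F x))" using F bd by (rule lip_ln)
  define \<psi> where "\<psi> x = \<phi> x + ln (1 + F x)" for x
  have lip\<psi>: "lip \<psi>" unfolding \<psi>_def by (intro lip_add lip_\<phi> lipln)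
  obtain C where C: "0 \<le> C" "\<And>x y j. x \<in> X \<Longrightarrow> y \<in> X \<Longrightarrow> agree j x y \<Longrightarrow> \<bar>\<psi> x - \<psi> y\<bar> \<le> C * \<theta> ^ j"
    by (rule lipE[OF lip\<psi>]) blast
  interpret \<psi>: sft_potential S A \<psi> \<theta> C
    by unfold_locales (use finite_S entries irreducible aperiodic \<theta> C in auto)
  have "transfer_op X \<psi> (\<lambda>_. 1) x = 1" if x: "x \<in> X" for x
  proof -
    have "transfer_op X \<psi> (\<lambda>_. 1) x = L (\<lambda>x. 1 * 1 + 1 * F x) x"
      unfolding transfer_op_def
    proof (rule sum.cong)
      fix y assume "y \<in> {y \<in> X. shift y = x}"
      then have "1 + F y > 0" using bd[of y] by (auto simp: abs_le_iff)
      then show "exp (\<psi> y) * 1 = exp (\<phi> y) * (1 * 1 + 1 * F y)" by (simp add: \<psi>_def exp_add)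
    qed simp
    also have "\<dots> = 1" unfolding L_linear using L_one LF x by simp
    finally show ?thesis .
  qed
  then have "\<psi>.\<rho> = 1" by (rule \<psi>.\<rho>_eq_1(2))
  then have "ks_entropy \<mu> shift \<le> ereal (- integral\<^sup>L \<mu> \<psi>)"
    using \<psi>.pressure_eq(2)[OF lip_continuous[OF lip\<psi>] inv] by simp
  then have "integral\<^sup>L \<mu> \<psi> \<le> integral\<^sup>L \<mu> \<phi>" by (simp add: entropy_\<mu>)
  moreover have "integral\<^sup>L \<mu> \<psi> = integral\<^sup>L \<mu> \<phi> + (\<integral>x. ln (1 + F x) \<partial>\<mu>)"
    unfolding \<psi>_def by (intro Bochner_Integration.integral_add lip_integrable lip_\<phi> lipln)
  ultimately show ?thesis by simp
qed

text \<open>Apply the perturbed inequality to \<open>s * F\<close>, divide by \<open>s\<close> and let \<open>s\<close> tend to \<open>0\<close>.\<close>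

lemma integral_kernel_le_0:
  assumes F: "lip F" and LF: "\<And>x. x \<in> X \<Longrightarrow> L F x = 0"
  shows "integral\<^sup>L \<mu> F \<le> 0"
proof -
  obtain C where C: "0 \<le> C" "\<And>x. x \<in> X \<Longrightarrow> \<bar>F x\<bar> \<le> C" by (rule lipE[OF F]) blast
  define s where "s n = 1 / (2 * (C + 1) * real (Suc n))" for n
  have s: "0 < s n" "s n * C \<le> 1 / 2" for n
  proof -
    show "0 < s n" using C by (simp add: s_def add_pos_nonneg)
    have "C \<le> (C + 1) * real (Suc n)" using C mult_mono[of 1 "real (Suc n)" C "C + 1"] by (simp add: algebra_simps)
    then have "C * 2 \<le> (2 * C + 2) * (1 + real n)" by (simp add: algebra_simps)
    then show "s n * C \<le> 1 / 2" using C by (simp add: s_def divide_le_eq add_pos_nonneg)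
  qed
  have "integral\<^sup>L \<mu> F \<le> s n * (2 * C\<^sup>2)" for n
  proof -
    have bd: "\<bar>s n * F x\<bar> \<le> 1 / 2" if "x \<in> X" for x
    proof -
      have "\<bar>s n * F x\<bar> \<le> s n * C" using C(2)[OF that] s(1)[of n] by (simp add: abs_mult mult_left_mono)
      then show ?thesis using s(2)[of n] by linarith
    qed
    have lips: "lip (\<lambda>x. s n * F x)" by (rule lip_scale[OF F])
    have L0: "L (\<lambda>x. s n * F x) x = 0" if "x \<in> X" for x
      using Ln_scale[of 1 "s n" F x] LF[OF that] by simp
    have "(\<integral>x. s n * F x - 2 * (s n)\<^sup>2 * C\<^sup>2 \<partial>\<mu>) \<le> (\<integral>x. ln (1 + s n * F x) \<partial>\<mu>)"
    proof (rule integral_mono)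
      fix x assume "x \<in> space \<mu>"
      then have x: "x \<in> X" by simp
      have "(s n * F x)\<^sup>2 \<le> (s n)\<^sup>2 * C\<^sup>2"
        using C(2)[OF x] abs_le_square_iff[of "F x" C] C(1) by (simp add: power_mult_distrib mult_left_mono)
      then show "s n * F x - 2 * (s n)\<^sup>2 * C\<^sup>2 \<le> ln (1 + s n * F x)"
        using abs_ln_one_plus_x_minus_x_bound[of "s n * F x"] bd[OF x] by (simp add: abs_le_iff)
    qed (use lip_integrable[OF lips] lip_integrable[OF lip_ln[OF lips bd]] in auto)
    then have "s n * integral\<^sup>L \<mu> F - 2 * (s n)\<^sup>2 * C\<^sup>2 \<le> 0"
      using perturbed_integral_le_0[OF lips L0 bd] lip_integrable[OF F] by (simp add: prob_space)
    then have "s n * integral\<^sup>L \<mu> F \<le> s n * (s n * (2 * C\<^sup>2))" by (simp add: power2_eq_square algebra_simps)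
    then show ?thesis using s(1)[of n] by simp
  qed
  moreover have "(\<lambda>n. s n * (2 * C\<^sup>2)) \<longlonglongrightarrow> 0 * (2 * C\<^sup>2)"
  proof (intro tendsto_intros)
    have "(\<lambda>n. 1 / (2 * (C + 1)) * (1 / real (Suc n))) \<longlonglongrightarrow> 1 / (2 * (C + 1)) * 0"
      by (intro tendsto_intros LIMSEQ_Suc lim_const_over_n)
    then show "s \<longlonglongrightarrow> 0" by (simp add: s_def[abs_def])
  qed
  ultimately show ?thesis by (intro LIMSEQ_le_const[where X="\<lambda>n. s n * (2 * C\<^sup>2)"]) auto
qed

text \<open>The function \<open>f - (L f) \<circ> shift\<close> is in the kernel of \<open>L\<close>, and so is its negative; invariance removes the shift.\<close>

lemma integral_L: assumes f: "lip f" shows "integral\<^sup>L \<mu> (L f) = integral\<^sup>L \<mu> f"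
proof -
  have LfT: "lip (\<lambda>x. L f (shift x))" by (intro lip_shift lip_L f)
  have eq: "L (\<lambda>x. L f (shift x)) x = L f x" if x: "x \<in> X" for x
    using L_shift[OF x, of "\<lambda>_. 1" "L f"] L_one[OF x] by simp
  have inv': "(\<integral>x. L f (shift x) \<partial>\<mu>) = integral\<^sup>L \<mu> (L f)"
    using integral_distr[OF inv_shift(1)[OF inv] lip_measurable[OF lip_L[OF f]]] inv_shift(2)[OF inv] by simp
  have L1: "L (\<lambda>x. u x - z x) x = L u x - L z x" for u z x
    using fun_cong[OF L_linear[of 1 u "-1" z], of x] by simp
  have "(\<integral>x. f x - L f (shift x) \<partial>\<mu>) \<le> 0"
    by (rule integral_kernel_le_0) (auto intro: lip_diff f LfT simp: L1 eq)
  moreover have "(\<integral>x. L f (shift x) - f x \<partial>\<mu>) \<le> 0"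
    by (rule integral_kernel_le_0) (auto intro: lip_diff f LfT simp: L1 eq)
  ultimately show ?thesis
    using lip_integrable[OF f] lip_integrable[OF LfT] inv' by simp
qed

lemma integral_Ln: "lip f \<Longrightarrow> integral\<^sup>L \<mu> ((L ^^ n) f) = integral\<^sup>L \<mu> f"
  by (induction n) (auto simp: integral_L lip_Ln)

section \<open>Decay of correlations\<close>

text \<open>By spreading, a function of the cone is bounded by a multiple of its mean. Applied to iterates of
  indicators, this gives bounds proportional to the measure of the event, as is needed for rare events.\<close>

lemma cone_integral:
  assumes f: "cone 0 K2 f" "lip f" and x: "x \<in> X"
  shows "f x \<le> exp (K2 + b * M) * integral\<^sup>L \<mu> f"
proof -
  have "(\<integral>y. f x \<partial>\<mu>) \<le> (\<integral>y. exp (K2 + b * M) * (L ^^ M) f y \<partial>\<mu>)"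
    using cone_spread[OF f(1) K2(1) x] lip_integrable[OF lip_Ln[OF f(2)]] by (intro integral_mono) auto
  then show ?thesis using integral_Ln[OF f(2)] by (simp add: prob_space)
qed

lemma cone_mixing:
  assumes f: "cone 0 K2 f" "lip f" and x: "x \<in> X"
  shows "\<bar>(L ^^ q) f x - integral\<^sup>L \<mu> f\<bar> \<le> rate q * (exp (K2 + b * M) * integral\<^sup>L \<mu> f)"
proof -
  let ?a = "exp (K2 + b * M) * integral\<^sup>L \<mu> f"
  have r: "\<bar>(L ^^ q) f x - \<nu> f\<bar> \<le> rate q * ?a" if "x \<in> X" for q x
    using \<nu>_rate[OF f(1) cone_integral[OF f] order_refl that, of q] that by simp
  have "\<bar>integral\<^sup>L \<mu> f - \<nu> f\<bar> \<le> rate q * ?a" for q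
  proof -
    have eq: "integral\<^sup>L \<mu> f - \<nu> f = (\<integral>x. (L ^^ q) f x - \<nu> f \<partial>\<mu>)"
      using integral_Ln[OF f(2)] lip_integrable[OF lip_Ln[OF f(2)]] by (simp add: prob_space)
    have "\<bar>\<integral>x. (L ^^ q) f x - \<nu> f \<partial>\<mu>\<bar> \<le> (\<integral>x. \<bar>(L ^^ q) f x - \<nu> f\<bar> \<partial>\<mu>)" by (rule integral_abs_bound)
    also have "\<dots> \<le> (\<integral>x. rate q * ?a \<partial>\<mu>)"
      using r lip_integrable[OF lip_Ln[OF f(2)]] by (intro integral_mono) auto
    finally show ?thesis unfolding eq by (simp add: prob_space)
  qed
  then have "\<bar>integral\<^sup>L \<mu> f - \<nu> f\<bar> \<le> 0 * ?a"
    by (intro LIMSEQ_le_const[OF tendsto_mult_right[OF rate(1)]]) auto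
  then show ?thesis using r[OF x, of q] by simp
qed

lemma cone_indicator: "determined m E \<Longrightarrow> cone 0 K2 ((L ^^ m) (indicator E))"
proof (rule cone_Ln_0)
  assume E: "determined m E"
  show "cone m K2 (indicator E)"
    unfolding cone_def
  proof safe
    fix x y :: "nat \<Rightarrow> nat" and j assume "max 1 m \<le> j" "agree j x y"
    then have "x \<in> E \<longleftrightarrow> y \<in> E" using determined_iff[OF E] agree_mono by fastforce
    moreover have "1 \<le> exp (K2 * \<theta> ^ j)" using K2 \<theta> by simp
    ultimately show "indicator E x \<le> exp (K2 * \<theta> ^ j) * indicator E y" by (simp add: indicator_def)
  qed simp
qed (use K2 in auto)

lemma measurable_shift_n: "shift ^^ n \<in> \<mu> \<rightarrow>\<^sub>M \<mu>" and distr_shift_n: "distr \<mu> \<mu> (shift ^^ n) = \<mu>"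
  using measure_preserving_funpow[OF inv_shift[OF inv]] by auto

lemma determined_sets_\<mu>: "determined n E \<Longrightarrow> E \<inter> X \<in> sets \<mu>"
  using inv_sets_Int[OF inv] determined_sets by blast

lemma indicator_measurable [measurable]: "determined n E \<Longrightarrow> (indicator E :: _ \<Rightarrow> real) \<in> borel_measurable \<mu>"
  by (intro lip_measurable lip_indicator)

text \<open>The density of the future after conditioning on an event of the past. Cylinders of the future factor out
  of \<open>L ^^ m\<close>, and \<open>\<mu>\<close> is fixed by the dual operator.\<close>

lemma transfer_density:
  assumes E: "determined m E"
  shows "distr (density \<mu> (\<lambda>x. ennreal (indicator E x))) \<mu> (shift ^^ m) = density \<mu> (\<lambda>x. ennreal ((L ^^ m) (indicator E) x))"
proof (rule seq_measure_eqI[where Y=X])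
  have mT: "shift ^^ m \<in> density \<mu> (\<lambda>x. ennreal (indicator E x)) \<rightarrow>\<^sub>M \<mu>"
    using measurable_shift_n by simp
  have lE: "lip ((L ^^ m) (indicator E))" by (intro lip_Ln lip_indicator[OF E])
  have nn: "0 \<le> (L ^^ m) (indicator E) x" if "x \<in> X" for x using that by (intro Ln_nonneg) auto
  show "X \<in> sets borel" by (rule X_borel)
  show "sets (distr (density \<mu> (\<lambda>x. ennreal (indicator E x))) \<mu> (shift ^^ m)) = sets (restrict_space borel X)"
    "sets (density \<mu> (\<lambda>x. ennreal ((L ^^ m) (indicator E) x))) = sets (restrict_space borel X)"
    using inv_sets[OF inv] by simp_all
  have iE: "(indicator E :: _ \<Rightarrow> real) \<in> borel_measurable \<mu>" using E by (rule indicator_measurable)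
  show fin: "finite_measure (distr (density \<mu> (\<lambda>x. ennreal (indicator E x))) \<mu> (shift ^^ m))"
  proof (rule finite_measureI)
    have "emeasure (distr (density \<mu> (\<lambda>x. ennreal (indicator E x))) \<mu> (shift ^^ m)) X
        = (\<integral>\<^sup>+x. ennreal (indicator E x) * indicator X x \<partial>\<mu>)"
    proof -
      have "(shift ^^ m) -` X \<inter> X = X" by auto
      then show ?thesis using mT iE sets.top[of \<mu>] by (subst emeasure_distr) (auto simp: emeasure_density)
    qed
    also have "\<dots> \<le> (\<integral>\<^sup>+x. 1 \<partial>\<mu>)" by (intro nn_integral_mono) (auto simp: indicator_def)
    also have "\<dots> < \<infinity>" by (simp add: emeasure_space_1[unfolded space_\<mu>])
    finally show "emeasure (distr (density \<mu> (\<lambda>x. ennreal (indicator E x))) \<mu> (shift ^^ m))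
       (space (distr (density \<mu> (\<lambda>x. ennreal (indicator E x))) \<mu> (shift ^^ m))) \<noteq> \<infinity>" by simp
  qed
  fix us
  let ?U = "cyl us \<inter> X"
  have U: "?U \<in> sets \<mu>" using determined_sets_\<mu>[OF determined_cyl] .
  have D: "determined (m + length us) (E \<inter> (shift ^^ m) -` cyl us)"
    by (intro determined_Int determined_mono[OF E] determined_vimage determined_cyl) auto
  have "emeasure (distr (density \<mu> (\<lambda>x. ennreal (indicator E x))) \<mu> (shift ^^ m)) ?U
      = (\<integral>\<^sup>+x. ennreal (indicator E x) * indicator ((shift ^^ m) -` ?U \<inter> X) x \<partial>\<mu>)"
    using mT iE U measurable_sets[OF measurable_shift_n U] by (subst emeasure_distr) (auto simp: emeasure_density)
  also have "\<dots> = (\<integral>\<^sup>+x. ennreal (indicator (E \<inter> (shift ^^ m) -` cyl us) x) \<partial>\<mu>)"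
    by (intro nn_integral_cong) (auto simp: indicator_def)
  also have "\<dots> = ennreal (integral\<^sup>L \<mu> (indicator (E \<inter> (shift ^^ m) -` cyl us)))"
    by (intro nn_integral_eq_integral lip_integrable lip_indicator[OF D]) auto
  also have "integral\<^sup>L \<mu> (indicator (E \<inter> (shift ^^ m) -` cyl us)) = integral\<^sup>L \<mu> ((L ^^ m) (indicator (E \<inter> (shift ^^ m) -` cyl us)))"
    by (rule integral_Ln[symmetric, OF lip_indicator[OF D]])
  also have "\<dots> = (\<integral>x. (L ^^ m) (indicator E) x * indicator (cyl us) x \<partial>\<mu>)"
  proof (rule Bochner_Integration.integral_cong)
    fix x assume x: "x \<in> space \<mu>"
    have "(L ^^ m) (indicator (E \<inter> (shift ^^ m) -` cyl us)) x
        = (L ^^ m) (\<lambda>y. indicator E y * indicator (cyl us) ((shift ^^ m) y)) x"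
      using x by (intro Ln_cong) (auto simp: indicator_def)
    then show "(L ^^ m) (indicator (E \<inter> (shift ^^ m) -` cyl us)) x = (L ^^ m) (indicator E) x * indicator (cyl us) x"
      using x Ln_shift[of x m "indicator E" "indicator (cyl us)"] by simp
  qed simp
  also have "ennreal \<dots> = (\<integral>\<^sup>+x. ennreal ((L ^^ m) (indicator E) x * indicator (cyl us) x) \<partial>\<mu>)"
    using nn by (intro nn_integral_eq_integral[symmetric] lip_integrable lip_mult lE lip_indicator[OF determined_cyl]) auto
  also have "\<dots> = (\<integral>\<^sup>+x. ennreal ((L ^^ m) (indicator E) x) * indicator ?U x \<partial>\<mu>)"
    by (intro nn_integral_cong) (auto simp: indicator_def)
  also have "\<dots> = emeasure (density \<mu> (\<lambda>x. ennreal ((L ^^ m) (indicator E) x))) ?U"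
    using lip_measurable[OF lE] U by (subst emeasure_density) auto
  finally show "emeasure (distr (density \<mu> (\<lambda>x. ennreal (indicator E x))) \<mu> (shift ^^ m)) ?U
      = emeasure (density \<mu> (\<lambda>x. ennreal ((L ^^ m) (indicator E) x))) ?U" .
qed

lemma integral_past_future:
  fixes F :: "(nat \<Rightarrow> nat) \<Rightarrow> 'b::{banach, second_countable_topology}"
  assumes E: "determined m E" and F: "F \<in> borel_measurable \<mu>"
  shows "(\<integral>x. indicator E x *\<^sub>R F ((shift ^^ m) x) \<partial>\<mu>) = (\<integral>x. (L ^^ m) (indicator E) x *\<^sub>R F x \<partial>\<mu>)"
proof -
  have lE: "lip ((L ^^ m) (indicator E))" by (intro lip_Ln lip_indicator[OF E])
  have nn: "0 \<le> (L ^^ m) (indicator E) x" if "x \<in> X" for x using that by (intro Ln_nonneg) auto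
  have FT: "(\<lambda>x. F ((shift ^^ m) x)) \<in> borel_measurable \<mu>"
    using measurable_compose[OF measurable_shift_n F] .
  have "(\<integral>x. indicator E x *\<^sub>R F ((shift ^^ m) x) \<partial>\<mu>) = integral\<^sup>L (density \<mu> (\<lambda>x. ennreal (indicator E x))) (\<lambda>x. F ((shift ^^ m) x))"
    using FT indicator_measurable[OF E] by (intro integral_density[symmetric]) auto
  also have "\<dots> = integral\<^sup>L (distr (density \<mu> (\<lambda>x. ennreal (indicator E x))) \<mu> (shift ^^ m)) F"
    using measurable_shift_n F by (intro integral_distr[symmetric]) auto
  also have "\<dots> = (\<integral>x. (L ^^ m) (indicator E) x *\<^sub>R F x \<partial>\<mu>)"
    unfolding transfer_density[OF E] using F lip_measurable[OF lE] nn by (intro integral_density) auto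
  finally show ?thesis .
qed

definition "C\<mu> = exp (K2 + b * M)"

text \<open>A past event and a non-negative future observable are independent up to the constant \<open>C\<mu>\<close>, without any
  gap between them.\<close>

lemma integral_past_future_le:
  assumes E: "determined m E" and F: "integrable \<mu> F" "\<And>x. x \<in> X \<Longrightarrow> 0 \<le> F x"
  shows "(\<integral>x. indicator E x * F ((shift ^^ m) x) \<partial>\<mu>) \<le> C\<mu> * measure \<mu> (E \<inter> X) * integral\<^sup>L \<mu> F"
proof -
  have lE: "lip ((L ^^ m) (indicator E))" by (intro lip_Ln lip_indicator[OF E])
  have "(\<integral>x. indicator E x * F ((shift ^^ m) x) \<partial>\<mu>) = (\<integral>x. (L ^^ m) (indicator E) x * F x \<partial>\<mu>)"
    using integral_past_future[OF E, of F] F by simp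
  also have "\<dots> \<le> (\<integral>x. C\<mu> * measure \<mu> (E \<inter> X) * F x \<partial>\<mu>)"
  proof (rule integral_mono_AE')
    show "AE x in \<mu>. (L ^^ m) (indicator E) x * F x \<le> C\<mu> * measure \<mu> (E \<inter> X) * F x"
    proof (rule AE_I2)
      fix x assume x: "x \<in> space \<mu>"
      have "(L ^^ m) (indicator E) x \<le> C\<mu> * integral\<^sup>L \<mu> ((L ^^ m) (indicator E))"
        unfolding C\<mu>_def using x by (intro cone_integral cone_indicator[OF E] lE) simp
      then show "(L ^^ m) (indicator E) x * F x \<le> C\<mu> * measure \<mu> (E \<inter> X) * F x"
        using F(2) x by (intro mult_right_mono) (auto simp: integral_Ln[OF lip_indicator[OF E]])
    qed
    show "AE x in \<mu>. 0 \<le> C\<mu> * measure \<mu> (E \<inter> X) * F x"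
      using F(2) by (intro AE_I2) (auto simp: C\<mu>_def)
  qed (use F in simp)
  finally show ?thesis by simp
qed

text \<open>After a gap of length \<open>q\<close> the density of the future given \<open>E\<close> is close to the constant \<open>\<mu>(E)\<close>, with
  an error relative to \<open>\<mu>(E)\<close> that does not depend on the event or the observable.\<close>

lemma decorrelation:
  fixes F :: "(nat \<Rightarrow> nat) \<Rightarrow> complex"
  assumes E: "determined m E" and F: "F \<in> borel_measurable \<mu>" "\<And>x. x \<in> X \<Longrightarrow> norm (F x) \<le> 1"
  shows "norm ((\<integral>x. indicator E x *\<^sub>R F ((shift ^^ (m + q)) x) \<partial>\<mu>) - measure \<mu> (E \<inter> X) *\<^sub>R integral\<^sup>L \<mu> F)
    \<le> C\<mu> * rate q * measure \<mu> (E \<inter> X)"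
proof -
  have E': "determined (m + q) E" using determined_mono[OF E] by simp
  let ?f = "(L ^^ m) (indicator E)"
  have f: "cone 0 K2 ?f" "lip ?f" using cone_indicator[OF E] lip_Ln[OF lip_indicator[OF E]] by auto
  have intf: "integral\<^sup>L \<mu> ?f = measure \<mu> (E \<inter> X)" by (simp add: integral_Ln[OF lip_indicator[OF E]])
  have LE: "(L ^^ (m + q)) (indicator E) = (L ^^ q) ?f" by (simp add: funpow_add add.commute[of m])
  have lq: "lip ((L ^^ q) ?f)" by (rule lip_Ln[OF f(2)])
  have iF: "integrable \<mu> F" using F by (intro integrable_const_bound[where B=1]) auto
  obtain Q where Q: "\<And>x. x \<in> X \<Longrightarrow> \<bar>(L ^^ q) ?f x\<bar> \<le> Q" by (rule lipE[OF lq]) blast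
  have i2: "integrable \<mu> (\<lambda>x. (L ^^ q) ?f x *\<^sub>R F x)"
  proof (rule integrable_const_bound[where B=Q])
    show "AE x in \<mu>. norm ((L ^^ q) ?f x *\<^sub>R F x) \<le> Q"
    proof (rule AE_I2)
      fix x assume "x \<in> space \<mu>"
      then have "\<bar>(L ^^ q) ?f x\<bar> * norm (F x) \<le> Q * 1"
        using Q[of x] F(2)[of x] by (intro mult_mono) auto
      then show "norm ((L ^^ q) ?f x *\<^sub>R F x) \<le> Q" by simp
    qed
  qed (use F lip_measurable[OF lq] in simp)
  have eq: "(\<integral>x. indicator E x *\<^sub>R F ((shift ^^ (m + q)) x) \<partial>\<mu>) - measure \<mu> (E \<inter> X) *\<^sub>R integral\<^sup>L \<mu> F
      = (\<integral>x. ((L ^^ q) ?f x - measure \<mu> (E \<inter> X)) *\<^sub>R F x \<partial>\<mu>)"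
    unfolding integral_past_future[OF E' F(1)] LE using iF i2
    by (simp add: scaleR_diff_left)
  have "norm (\<integral>x. ((L ^^ q) ?f x - measure \<mu> (E \<inter> X)) *\<^sub>R F x \<partial>\<mu>)
      \<le> (\<integral>x. norm (((L ^^ q) ?f x - measure \<mu> (E \<inter> X)) *\<^sub>R F x) \<partial>\<mu>)"
    by (rule integral_norm_bound)
  also have "\<dots> \<le> (\<integral>x. C\<mu> * rate q * measure \<mu> (E \<inter> X) \<partial>\<mu>)"
  proof (rule integral_mono_AE')
    show "AE x in \<mu>. norm (((L ^^ q) ?f x - measure \<mu> (E \<inter> X)) *\<^sub>R F x) \<le> C\<mu> * rate q * measure \<mu> (E \<inter> X)"
    proof (rule AE_I2)
      fix x assume "x \<in> space \<mu>"
      then have "\<bar>(L ^^ q) ?f x - measure \<mu> (E \<inter> X)\<bar> * norm (F x) \<le> (rate q * (C\<mu> * measure \<mu> (E \<inter> X))) * 1"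
        using cone_mixing[OF f, of x q] F(2)[of x] unfolding intf C\<mu>_def[symmetric] by (intro mult_mono) auto
      then show "norm (((L ^^ q) ?f x - measure \<mu> (E \<inter> X)) *\<^sub>R F x) \<le> C\<mu> * rate q * measure \<mu> (E \<inter> X)"
        by (simp add: mult_ac)
    qed
    show "AE x in \<mu>. 0 \<le> C\<mu> * rate q * measure \<mu> (E \<inter> X)" using rate(2) by (simp add: C\<mu>_def)
  qed simp
  finally show ?thesis unfolding eq by (simp add: prob_space)
qed

end

section \<open>Escape rate from a neighbourhood of the subsystem\<close>

text \<open>The continuity of \<open>h\<close> is expressed by a modulus of its own, since its Hoelder exponent may differ from
  that of \<open>\<phi>\<close>.\<close>

locale escape = equilibrium S A \<phi> \<theta> c \<mu> + sub: sft_potential \<Delta> A \<phi> \<theta> c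
  for S A \<phi> \<theta> c \<mu> \<Delta> +
  fixes h :: "(nat \<Rightarrow> nat) \<Rightarrow> real"
  assumes \<Delta>: "\<Delta> \<subset> S"
    and h_modulus: "\<And>e. 0 < e \<Longrightarrow> \<exists>j. \<forall>x\<in>sft S A. \<forall>y\<in>sft S A. agree j x y \<longrightarrow> \<bar>h x - h y\<bar> < e"
    and h_measurable: "h \<in> borel_measurable \<mu>"
    and h_eigen: "\<And>x. x \<in> sft S A \<Longrightarrow> restricted_transfer_op (sft S A) \<Delta> \<phi> h x = sub.\<rho> * h x"
    and h_sub: "\<And>x. x \<in> sft \<Delta> A \<Longrightarrow> h x = sub.w x"
begin

definition N\<Delta> :: "nat \<Rightarrow> (nat \<Rightarrow> nat) set" where "N\<Delta> n = {x. \<forall>i<n. x i \<in> \<Delta>}"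

lemma N\<Delta>_Suc: "x \<in> N\<Delta> (Suc n) \<longleftrightarrow> x \<in> N\<Delta> n \<and> x n \<in> \<Delta>"
  by (auto simp: N\<Delta>_def less_Suc_eq)

lemma N\<Delta>_antimono: "m \<le> n \<Longrightarrow> N\<Delta> n \<subseteq> N\<Delta> m" by (auto simp: N\<Delta>_def)

lemma determined_N\<Delta>: "determined n (N\<Delta> n)"
  by (auto simp: determined_def N\<Delta>_def agree_def)

abbreviation "L\<Delta> \<equiv> restricted_transfer_op X \<Delta> \<phi>"

lemma L\<Delta>_eq: "L\<Delta> f = L (\<lambda>y. f y * indicator (N\<Delta> 1) y)"
  by (auto simp: restricted_transfer_op_def N\<Delta>_def indicator_def)

text \<open>An indicator that depends on the point reached after \<open>n\<close> shifts can be pulled out of \<open>L ^^ n\<close>.\<close>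

lemma L\<Delta>n_eq: "x \<in> X \<Longrightarrow> (L\<Delta> ^^ n) f x = (L ^^ n) (\<lambda>y. f y * indicator (N\<Delta> n) y) x"
proof (induction n arbitrary: x)
  case 0
  show ?case by (simp add: N\<Delta>_def)
next
  case (Suc n)
  have "(L ^^ Suc n) (\<lambda>y. f y * indicator (N\<Delta> (Suc n)) y) x
      = L ((L ^^ n) (\<lambda>y. (f y * indicator (N\<Delta> n) y) * indicator (N\<Delta> 1) ((shift ^^ n) y))) x"
    using Suc.prems by (simp, intro L_cong Ln_cong) (auto simp: N\<Delta>_def indicator_def shift_funpow less_Suc_eq)
  also have "\<dots> = L (\<lambda>z. (L\<Delta> ^^ n) f z * indicator (N\<Delta> 1) z) x"
  proof (rule L_cong[OF _ Suc.prems])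
    fix y assume y: "y \<in> X"
    show "(L ^^ n) (\<lambda>y. f y * indicator (N\<Delta> n) y * indicator (N\<Delta> 1) ((shift ^^ n) y)) y
        = (L\<Delta> ^^ n) f y * indicator (N\<Delta> 1) y"
      unfolding Ln_shift[OF y, of n "\<lambda>y. f y * indicator (N\<Delta> n) y" "indicator (N\<Delta> 1)"] Suc.IH[OF y]
      by (rule mult.commute)
  qed
  finally show ?case unfolding funpow.simps o_apply L\<Delta>_eq[of "(L\<Delta> ^^ n) f"] by simp
qed

abbreviation "g\<Delta> n \<equiv> (L\<Delta> ^^ n) (\<lambda>_. 1)"

lemma g\<Delta>_eq: "x \<in> X \<Longrightarrow> g\<Delta> n x = (L ^^ n) (indicator (N\<Delta> n)) x"
  using L\<Delta>n_eq[of x n "\<lambda>_. 1"] by (simp add: indicator_def[abs_def])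

lemma measure_N\<Delta>: "measure \<mu> (N\<Delta> n \<inter> X) = integral\<^sup>L \<mu> (g\<Delta> n)"
proof -
  have "integral\<^sup>L \<mu> (g\<Delta> n) = integral\<^sup>L \<mu> ((L ^^ n) (indicator (N\<Delta> n)))"
    by (intro Bochner_Integration.integral_cong) (auto simp: g\<Delta>_eq)
  also have "\<dots> = measure \<mu> (N\<Delta> n \<inter> X)" by (simp add: integral_Ln[OF lip_indicator[OF determined_N\<Delta>]])
  finally show ?thesis ..
qed

lemma g\<Delta>_integrable: "integrable \<mu> (g\<Delta> n)"
proof -
  have "integrable \<mu> ((L ^^ n) (indicator (N\<Delta> n)))"
    by (intro lip_integrable lip_Ln lip_indicator[OF determined_N\<Delta>])
  then show ?thesis by (subst Bochner_Integration.integrable_cong[OF refl g\<Delta>_eq]) auto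
qed

text \<open>Multiplication by the indicator of the first symbol being in \<open>\<Delta>\<close> preserves every cone, because the cone
  only compares points with the same first symbol.\<close>

lemma cone_g\<Delta>: "cone 0 K0 (g\<Delta> n)"
proof (induction n)
  case 0
  show ?case using cone_const[of 1 K0 0] K0 by simp
next
  case (Suc n)
  have "cone 0 0 (indicator (N\<Delta> 1))"
    by (auto simp: cone_def indicator_def N\<Delta>_def agree_def)
  from cone_mult[OF Suc this] have "cone 0 K0 (\<lambda>y. g\<Delta> n y * indicator (N\<Delta> 1) y)" by simp
  from cone_L_invariant[OF this order_refl] show ?case
    unfolding funpow.simps o_apply L\<Delta>_eq[of "g\<Delta> n"] by simp
qed

lemma sub_X: "x \<in> sub.X \<Longrightarrow> x \<in> X"
  using \<Delta> by (auto simp: X_iff sub.X_iff)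

lemma sub_L: "(\<And>y. y \<in> sub.X \<Longrightarrow> f y = f' y) \<Longrightarrow> x \<in> sub.X \<Longrightarrow> L\<Delta> f x = sub.L f' x"
proof -
  assume f: "\<And>y. y \<in> sub.X \<Longrightarrow> f y = f' y" and x: "x \<in> sub.X"
  have sp: "sub.pre x = {a \<in> pre x. a \<in> \<Delta>}" using \<Delta> by (auto simp: pre_def sub.pre_def)
  have "L\<Delta> f x = (\<Sum>a\<in>pre x. exp (\<phi> (case_nat a x)) * (f (case_nat a x) * indicator (N\<Delta> 1) (case_nat a x)))"
    unfolding L\<Delta>_eq by (rule L_eq[OF sub_X[OF x]])
  also have "\<dots> = (\<Sum>a\<in>sub.pre x. exp (\<phi> (case_nat a x)) * f' (case_nat a x))"
    using f sub.case_nat_pre[OF x] unfolding sp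
    by (intro sum.mono_neutral_cong_right) (auto simp: N\<Delta>_def)
  finally show ?thesis by (simp add: sub.L_eq[OF x])
qed

lemma sub_g: "x \<in> sub.X \<Longrightarrow> g\<Delta> n x = sub.g n x"
  by (induction n arbitrary: x) (auto intro: sub_L)

text \<open>The normalised iterates whose limit is the density \<open>h\<close>.\<close>

definition u :: "nat \<Rightarrow> (nat \<Rightarrow> nat) \<Rightarrow> real" where "u n x = g\<Delta> n x / sub.\<rho> ^ n"

definition C1 :: real where "C1 = 1 + D * (exp K0 * sub.B) / sub.\<rho>"

lemma C1: "C1 \<ge> 1"
proof -
  have "0 \<le> D * (exp K0 * sub.B) / sub.\<rho>"
    using D sub.B sub.\<rho>_pos by (intro divide_nonneg_pos mult_nonneg_nonneg) auto
  then show ?thesis by (simp add: C1_def)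
qed

text \<open>A point with first symbol in \<open>\<Delta>\<close> is compared with a point of the subsystem that has the same first
  symbol.\<close>

lemma g\<Delta>_on_\<Delta>: assumes x: "x \<in> X" "x 0 \<in> \<Delta>" shows "g\<Delta> n x \<le> exp K0 * (sub.B * sub.\<rho> ^ n)"
  "exp (- K0) / sub.B * sub.\<rho> ^ n \<le> g\<Delta> n x"
proof -
  obtain z where z: "z \<in> sub.X" "z 0 = x 0" using sub.ex_point[OF x(2)] by auto
  have e: "exp (K0 * \<theta> ^ 1) \<le> exp K0" using K0 \<theta> by (simp add: mult_left_le)
  have ag: "agree 1 x z" using z by (auto simp: agree_def)
  have nn: "0 \<le> g\<Delta> n y" if "y \<in> X" for y using cone_nonneg[OF cone_g\<Delta> that] .
  have "g\<Delta> n x \<le> exp (K0 * \<theta> ^ 1) * g\<Delta> n z"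
    by (rule coneD[OF cone_g\<Delta> x(1) sub_X[OF z(1)] _ _ ag]) auto
  also have "\<dots> \<le> exp K0 * (sub.B * sub.\<rho> ^ n)"
    using e sub.g_bounds(1)[OF z(1), of n] nn[OF sub_X[OF z(1)]] by (intro mult_mono) (auto simp: sub_g[OF z(1)])
  finally show "g\<Delta> n x \<le> exp K0 * (sub.B * sub.\<rho> ^ n)" .
  have "g\<Delta> n z \<le> exp (K0 * \<theta> ^ 1) * g\<Delta> n x"
    by (rule coneD[OF cone_g\<Delta> sub_X[OF z(1)] x(1) _ _ agree_sym[OF ag]]) auto
  also have "\<dots> \<le> exp K0 * g\<Delta> n x" using e nn[OF x(1)] by (intro mult_right_mono) auto
  finally have "sub.\<rho> ^ n \<le> sub.B * (exp K0 * g\<Delta> n x)"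
    using sub.g_bounds(2)[OF z(1), of n] sub.B mult_left_mono[of "g\<Delta> n z" "exp K0 * g\<Delta> n x" sub.B]
    unfolding sub_g[OF z(1)] by linarith
  then show "exp (- K0) / sub.B * sub.\<rho> ^ n \<le> g\<Delta> n x" using sub.B by (simp add: exp_minus field_simps)
qed

lemma u_bound: assumes x: "x \<in> X" shows "0 \<le> u n x" "u n x \<le> C1"
proof -
  show "0 \<le> u n x" using cone_nonneg[OF cone_g\<Delta> x] sub.\<rho>_pos by (simp add: u_def)
  show "u n x \<le> C1"
  proof (cases n)
    case 0
    then show ?thesis using C1 by (simp add: u_def)
  next
    case (Suc k)
    have "g\<Delta> n x = (L ^^ 1) (\<lambda>y. g\<Delta> k y * indicator (N\<Delta> 1) y) x" by (simp add: Suc L\<Delta>_eq)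
    also have "\<dots> \<le> D ^ 1 * (exp K0 * (sub.B * sub.\<rho> ^ k))"
    proof (rule Ln_upper[OF _ _ x])
      fix y assume y: "y \<in> X"
      show "0 \<le> g\<Delta> k y * indicator (N\<Delta> 1) y" using cone_nonneg[OF cone_g\<Delta> y] by simp
      show "g\<Delta> k y * indicator (N\<Delta> 1) y \<le> exp K0 * (sub.B * sub.\<rho> ^ k)"
        using g\<Delta>_on_\<Delta>(1)[OF y, of k] sub.B sub.\<rho>_pos by (auto simp: indicator_def N\<Delta>_def)
    qed
    finally have "u n x \<le> D * (exp K0 * (sub.B * sub.\<rho> ^ k)) / sub.\<rho> ^ n"
      unfolding u_def using sub.\<rho>_pos by (intro divide_right_mono) auto
    also have "\<dots> = D * (exp K0 * sub.B) / sub.\<rho>" using sub.\<rho>_pos by (simp add: Suc)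
    finally show ?thesis by (simp add: C1_def)
  qed
qed

text \<open>The initial block of \<open>y\<close> is continued by a point of the subsystem that starts with its last symbol.\<close>

lemma shadow: assumes y: "y \<in> X" "y \<in> N\<Delta> m" shows "\<exists>z\<in>sub.X. agree m y z"
proof (cases m)
  case 0
  then show ?thesis using sub.X_nonempty by auto
next
  case (Suc k)
  then have "y k \<in> \<Delta>" using y by (auto simp: N\<Delta>_def)
  then obtain z' where z': "z' \<in> sub.X" "z' 0 = y k" using sub.ex_point by blast
  define z where "z i = (if i < m then y i else z' (i - k))" for i
  have "z \<in> sub.X"
    unfolding sub.X_iff
  proof (intro conjI allI)
    fix n show "z n \<in> \<Delta>" using y z' by (auto simp: z_def N\<Delta>_def sub.X_iff)
    show "A (z n) (z (Suc n)) = 1"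
    proof -
      consider "Suc n < m" | "n = k" | "n > k" using Suc by linarith
      then show ?thesis
      proof cases
        case 1
        then show ?thesis using y by (auto simp: z_def X_iff)
      next
        case 2
        have "A (z' 0) (z' (Suc 0)) = 1" using z'(1) by (auto simp: sub.X_iff)
        then show ?thesis using z'(2) 2 Suc by (simp add: z_def)
      next
        case 3
        then have "Suc n - k = Suc (n - k)" by simp
        then show ?thesis using z' 3 Suc by (auto simp: z_def sub.X_iff)
      qed
    qed
  qed
  then show ?thesis by (intro bexI[of _ z]) (auto simp: agree_def z_def)
qed

lemma L\<Delta>_h: "x \<in> X \<Longrightarrow> (L\<Delta> ^^ m) h x = sub.\<rho> ^ m * h x"
proof (induction m arbitrary: x)
  case (Suc m)
  have "L\<Delta> ((L\<Delta> ^^ m) h) x = (L ^^ 1) (\<lambda>y. sub.\<rho> ^ m * (h y * indicator (N\<Delta> 1) y)) x"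
    unfolding L\<Delta>_eq[of "(L\<Delta> ^^ m) h"] using Suc by (simp, intro L_cong) auto
  also have "\<dots> = sub.\<rho> ^ m * L\<Delta> h x" unfolding Ln_scale by (simp add: L\<Delta>_eq)
  finally show ?case using h_eigen[OF Suc.prems] by simp
qed simp

text \<open>On \<open>N\<Delta> m\<close> both \<open>u n\<close> and \<open>h\<close> are close to their values at a shadowing point of the subsystem, where
  \<open>u n\<close> converges to \<open>w = h\<close>. Up to the common factor \<open>sub.\<rho> ^ m\<close>, the restricted operator
  applied \<open>m\<close> times turns \<open>u n\<close> into \<open>u (m + n)\<close> and fixes \<open>h\<close>; it only looks at points of \<open>N\<Delta> m\<close> and
  so carries the estimate to all of \<open>X\<close>.\<close>

lemma u_uniform: assumes e: "0 < e" shows "\<exists>N. \<forall>n\<ge>N. \<forall>x\<in>X. \<bar>u n x - h x\<bar> \<le> e"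
proof -
  define e' where "e' = e / (3 * C1)"
  have e': "0 < e'" using e C1 by (simp add: e'_def)
  obtain j where j: "\<And>x y. x \<in> X \<Longrightarrow> y \<in> X \<Longrightarrow> agree j x y \<Longrightarrow> \<bar>h x - h y\<bar> < e'"
    using h_modulus[OF e'] by blast
  have "(\<lambda>m. C1 * (exp (K0 * \<theta> ^ m) - 1)) \<longlonglongrightarrow> C1 * (exp (K0 * 0) - 1)"
    using \<theta> by (intro tendsto_intros LIMSEQ_power_zero) auto
  then have "\<forall>\<^sub>F m in sequentially. C1 * (exp (K0 * \<theta> ^ m) - 1) < e'"
    using e' by (intro order_tendstoD) auto
  then obtain m0 where m0: "\<And>m. m \<ge> m0 \<Longrightarrow> C1 * (exp (K0 * \<theta> ^ m) - 1) < e'"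
    by (auto simp: eventually_sequentially)
  define m where "m = Suc (max j m0)"
  have "(\<lambda>n. sub.rate n * sub.B\<^sup>2) \<longlonglongrightarrow> 0" using tendsto_mult_left_zero[OF sub.rate(1)] by simp
  then have "\<forall>\<^sub>F n in sequentially. sub.rate n * sub.B\<^sup>2 < e'" using e' by (rule order_tendstoD)
  then obtain n0 where n0: "\<And>n. n \<ge> n0 \<Longrightarrow> sub.rate n * sub.B\<^sup>2 < e'"
    by (auto simp: eventually_sequentially)
  have close: "\<bar>u n y - h y\<bar> \<le> 3 * e'" if n: "n \<ge> n0" and y: "y \<in> X" "y \<in> N\<Delta> m" for n y
  proof -
    obtain z where z: "z \<in> sub.X" "agree m y z" using shadow[OF y] by blast
    have zX: "z \<in> X" by (rule sub_X[OF z(1)])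
    have ud: "u n s - u n t \<le> C1 * (exp (K0 * \<theta> ^ m) - 1)" if "s \<in> X" "t \<in> X" "agree m s t" for s t
    proof -
      have "g\<Delta> n s \<le> exp (K0 * \<theta> ^ m) * g\<Delta> n t"
        using that by (intro coneD[OF cone_g\<Delta>]) (auto simp: m_def)
      then have "u n s \<le> exp (K0 * \<theta> ^ m) * u n t"
        using sub.\<rho>_pos by (simp add: u_def divide_right_mono)
      then have "u n s - u n t \<le> u n t * (exp (K0 * \<theta> ^ m) - 1)" by (simp add: algebra_simps)
      also have "\<dots> \<le> C1 * (exp (K0 * \<theta> ^ m) - 1)"
        using u_bound[OF that(2)] K0 \<theta> by (intro mult_right_mono) auto
      finally show ?thesis .
    qed
    have "C1 * (exp (K0 * \<theta> ^ m) - 1) < e'" by (rule m0) (simp add: m_def)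
    then have "\<bar>u n y - u n z\<bar> < e'" using ud[OF y(1) zX z(2)] ud[OF zX y(1) agree_sym[OF z(2)]] by linarith
    moreover have "u n z = sub.v n z" using sub_g[OF z(1)] by (simp add: u_def sub.v_def)
    then have "\<bar>u n z - h z\<bar> < e'" using sub.v_uniform[OF z(1), of n] n0[OF n] h_sub[OF z(1)] by simp
    moreover have "\<bar>h y - h z\<bar> < e'"
      using j[OF y(1) zX agree_mono[OF z(2)]] by (simp add: m_def)
    ultimately show ?thesis by linarith
  qed
  show ?thesis
  proof (intro exI[of _ "m + n0"] allI impI ballI)
    fix N x assume "m + n0 \<le> N" and x: "x \<in> X"
    then obtain n where n: "N = m + n" "n \<ge> n0" by (metis add_le_cancel_left le_Suc_ex le_add1 order.trans)
    have a: "(L\<Delta> ^^ m) (u n) x = u N x * sub.\<rho> ^ m"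
    proof -
      have "(L\<Delta> ^^ m) (u n) x = (L ^^ m) (\<lambda>y. 1 / sub.\<rho> ^ n * (g\<Delta> n y * indicator (N\<Delta> m) y)) x"
        unfolding L\<Delta>n_eq[OF x] by (simp add: u_def)
      also have "\<dots> = 1 / sub.\<rho> ^ n * g\<Delta> N x"
        unfolding Ln_scale L\<Delta>n_eq[OF x, symmetric] by (simp add: n funpow_add)
      finally show ?thesis using sub.\<rho>_pos by (simp add: u_def n power_add)
    qed
    have "(u N x - h x) * sub.\<rho> ^ m = (L\<Delta> ^^ m) (u n) x - (L\<Delta> ^^ m) h x"
      using a L\<Delta>_h[OF x] by (simp add: algebra_simps)
    also have "\<dots> = (L ^^ m) (\<lambda>y. u n y * indicator (N\<Delta> m) y - 1 * (h y * indicator (N\<Delta> m) y)) x"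
      unfolding L\<Delta>n_eq[OF x] Ln_diff by simp
    finally have eq: "(u N x - h x) * sub.\<rho> ^ m = (L ^^ m) (\<lambda>y. u n y * indicator (N\<Delta> m) y - 1 * (h y * indicator (N\<Delta> m) y)) x" .
    have up: "(u N x - h x) * sub.\<rho> ^ m \<le> (3 * e') * g\<Delta> m x"
      unfolding eq g\<Delta>_eq[OF x] Ln_scale[symmetric]
      using close[OF n(2)] e' by (intro Ln_mono[OF _ x]) (auto simp: indicator_def abs_le_iff)
    have lo: "(- (3 * e')) * g\<Delta> m x \<le> (u N x - h x) * sub.\<rho> ^ m"
      unfolding eq g\<Delta>_eq[OF x] Ln_scale[symmetric]
      using close[OF n(2)] e' by (intro Ln_mono[OF _ x]) (force simp: indicator_def abs_le_iff)
    have "\<bar>(u N x - h x) * sub.\<rho> ^ m\<bar> \<le> (3 * e') * g\<Delta> m x" using up lo by (simp add: abs_le_iff)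
    then have "\<bar>u N x - h x\<bar> * sub.\<rho> ^ m \<le> (3 * e' * u m x) * sub.\<rho> ^ m"
      using sub.\<rho>_pos by (simp add: abs_mult u_def)
    then have "\<bar>u N x - h x\<bar> \<le> 3 * e' * u m x" using sub.\<rho>_pos by (simp add: mult_le_cancel_right)
    also have "\<dots> \<le> 3 * e' * C1" using e' u_bound[OF x] by (intro mult_left_mono) auto
    also have "\<dots> = e" using C1 by (simp add: e'_def)
    finally show "\<bar>u N x - h x\<bar> \<le> e" .
  qed
qed

lemma h_bounds: assumes x: "x \<in> X" shows "0 \<le> h x" "h x \<le> C1 + 1" "x 0 \<in> \<Delta> \<Longrightarrow> exp (- K0) / sub.B \<le> h x"
proof -
  have lim: "(\<lambda>n. u n x) \<longlonglongrightarrow> h x"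
  proof (rule LIMSEQ_I)
    fix e :: real assume "0 < e"
    then obtain N where "\<forall>n\<ge>N. \<forall>x\<in>X. \<bar>u n x - h x\<bar> \<le> e / 2" using u_uniform[of "e / 2"] by auto
    then show "\<exists>no. \<forall>n\<ge>no. norm (u n x - h x) < e" using x \<open>0 < e\<close>
      by (metis field_sum_of_halves less_add_same_cancel1 half_gt_zero order.strict_trans1 real_norm_def)
  qed
  show "0 \<le> h x" by (rule LIMSEQ_le_const[OF lim]) (use u_bound[OF x] in auto)
  have "h x \<le> C1" by (rule LIMSEQ_le_const2[OF lim]) (use u_bound[OF x] in auto)
  then show "h x \<le> C1 + 1" by simp
  assume x0: "x 0 \<in> \<Delta>"
  have "exp (- K0) / sub.B \<le> u n x" for n
    using g\<Delta>_on_\<Delta>(2)[OF x x0, of n] sub.\<rho>_pos by (simp add: u_def pos_le_divide_eq)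
  then show "exp (- K0) / sub.B \<le> h x" by (intro LIMSEQ_le_const[OF lim]) auto
qed

lemma h_integrable: "integrable \<mu> h"
  using h_bounds h_measurable by (intro integrable_const_bound[where B="C1 + 1"]) auto

definition \<kappa> :: real where "\<kappa> = integral\<^sup>L \<mu> h"

theorem measure_N\<Delta>_asymp: "(\<lambda>n. measure \<mu> (N\<Delta> n \<inter> X) / sub.\<rho> ^ n) \<longlonglongrightarrow> \<kappa>"
proof (rule LIMSEQ_I)
  fix e :: real assume e: "0 < e"
  then obtain N where N: "\<And>n x. n \<ge> N \<Longrightarrow> x \<in> X \<Longrightarrow> \<bar>u n x - h x\<bar> \<le> e / 2" using u_uniform[of "e / 2"] by auto
  show "\<exists>no. \<forall>n\<ge>no. norm (measure \<mu> (N\<Delta> n \<inter> X) / sub.\<rho> ^ n - \<kappa>) < e"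
  proof (intro exI[of _ N] allI impI)
    fix n assume n: "N \<le> n"
    have iu: "integrable \<mu> (u n)" unfolding u_def using g\<Delta>_integrable by simp
    have eq: "measure \<mu> (N\<Delta> n \<inter> X) / sub.\<rho> ^ n - \<kappa> = (\<integral>x. u n x - h x \<partial>\<mu>)"
      using Bochner_Integration.integral_diff[OF iu h_integrable] by (simp add: measure_N\<Delta> u_def[abs_def] \<kappa>_def)
    have "\<bar>\<integral>x. u n x - h x \<partial>\<mu>\<bar> \<le> (\<integral>x. \<bar>u n x - h x\<bar> \<partial>\<mu>)" by (rule integral_abs_bound)
    also have "\<dots> \<le> (\<integral>x. e / 2 \<partial>\<mu>)" using N[OF n] iu h_integrable by (intro integral_mono) auto
    finally show "norm (measure \<mu> (N\<Delta> n \<inter> X) / sub.\<rho> ^ n - \<kappa>) < e" unfolding eq using e by (simp add: prob_space)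
  qed
qed

lemma measure_pos: assumes E: "determined m E" and x: "x \<in> E" "x \<in> X" shows "0 < measure \<mu> (E \<inter> X)"
proof -
  have "0 < exp (- b * m) * indicator E x" using x by simp
  also have "\<dots> \<le> (L ^^ m) (indicator E) ((shift ^^ m) x)" using x by (intro Ln_lower) auto
  also have "\<dots> \<le> exp (K2 + b * M) * integral\<^sup>L \<mu> ((L ^^ m) (indicator E))"
    using x by (intro cone_integral cone_indicator[OF E] lip_Ln lip_indicator[OF E]) auto
  also have "integral\<^sup>L \<mu> ((L ^^ m) (indicator E)) = measure \<mu> (E \<inter> X)" by (simp add: integral_Ln[OF lip_indicator[OF E]])
  finally show ?thesis by (simp add: zero_less_mult_iff)
qed

lemma \<kappa>_pos: "0 < \<kappa>"
proof -
  obtain z where z: "z \<in> sub.X" using sub.X_nonempty by auto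
  have q: "0 < exp (- K0) / sub.B" using sub.B by simp
  have "0 < measure \<mu> (N\<Delta> 1 \<inter> X)"
    using z by (intro measure_pos[OF determined_N\<Delta>, of z]) (auto simp: sub_X N\<Delta>_def sub.X_iff)
  then have "0 < exp (- K0) / sub.B * measure \<mu> (N\<Delta> 1 \<inter> X)" using q by (rule mult_pos_pos[rotated])
  also have "\<dots> = (\<integral>x. exp (- K0) / sub.B * indicator (N\<Delta> 1) x \<partial>\<mu>)" by simp
  also have "\<dots> \<le> \<kappa>"
    unfolding \<kappa>_def
  proof (rule integral_mono)
    show "integrable \<mu> (\<lambda>x. exp (- K0) / sub.B * indicator (N\<Delta> 1) x)"
      by (intro integrable_mult_right lip_integrable[OF lip_indicator[OF determined_N\<Delta>]])
  qed (use h_integrable h_bounds in \<open>auto simp: indicator_def N\<Delta>_def\<close>)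
  finally show ?thesis .
qed

text \<open>By mixing, from every point some \<open>M\<close>-fold preimage starts with a symbol outside \<open>\<Delta>\<close>, so \<open>M\<close> steps of the
  restricted operator lose at least the fraction \<open>\<delta>\<close> of the mass.\<close>

lemma sub_\<rho>_less_1: "sub.\<rho> < 1"
proof (rule ccontr)
  assume "\<not> sub.\<rho> < 1"
  then have \<rho>1: "1 \<le> sub.\<rho>" by simp
  obtain s where s: "s \<in> S" "s \<notin> \<Delta>" using \<Delta> by auto
  define \<delta> where "\<delta> = exp (- b * M)"
  have \<delta>: "0 < \<delta>" "\<delta> \<le> 1" using b by (auto simp: \<delta>_def)
  have step: "g\<Delta> M x \<le> 1 - \<delta>" if x: "x \<in> X" for x
  proof -
    obtain y where y: "y \<in> X" "(shift ^^ M) y = x" "y 0 = s" using ex_preimage[OF x s(1), of M] by auto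
    have "y \<notin> N\<Delta> M" using y s M(1) unfolding N\<Delta>_def by (auto intro!: exI[of _ 0])
    then have "\<delta> \<le> exp (- b * M) * (1 - 1 * indicator (N\<Delta> M) y)" by (simp add: \<delta>_def)
    also have "\<dots> \<le> (L ^^ M) (\<lambda>y. 1 - 1 * indicator (N\<Delta> M) y) ((shift ^^ M) y)"
      using y by (intro Ln_lower) (auto simp: indicator_def)
    also have "\<dots> = 1 - g\<Delta> M x" unfolding Ln_diff using x y by (simp add: g\<Delta>_eq)
    finally show ?thesis by simp
  qed
  have pow: "g\<Delta> (k * M) x \<le> (1 - \<delta>) ^ k" if "x \<in> X" for k x
    using that
  proof (induction k arbitrary: x)
    case (Suc k)
    have "g\<Delta> (Suc k * M) x = (L\<Delta> ^^ M) (g\<Delta> (k * M)) x" by (simp add: funpow_add)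
    also have "\<dots> = (L ^^ M) (\<lambda>y. g\<Delta> (k * M) y * indicator (N\<Delta> M) y) x" by (rule L\<Delta>n_eq[OF Suc.prems])
    also have "\<dots> \<le> (L ^^ M) (\<lambda>y. (1 - \<delta>) ^ k * indicator (N\<Delta> M) y) x"
      using Suc by (intro Ln_mono) (auto simp: indicator_def)
    also have "\<dots> = (1 - \<delta>) ^ k * g\<Delta> M x" unfolding Ln_scale using Suc.prems by (simp add: g\<Delta>_eq)
    also have "\<dots> \<le> (1 - \<delta>) ^ k * (1 - \<delta>)" using step[OF Suc.prems] \<delta> by (intro mult_left_mono) auto
    finally show ?case by (simp add: mult.commute)
  qed simp
  obtain z where z: "z \<in> sub.X" using sub.X_nonempty by auto
  have "1 \<le> sub.B * (1 - \<delta>) ^ k" for k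
  proof -
    have "1 \<le> sub.\<rho> ^ (k * M)" using \<rho>1 by (rule one_le_power)
    also have "\<dots> \<le> sub.B * sub.g (k * M) z" by (rule sub.g_bounds(2)[OF z])
    also have "\<dots> \<le> sub.B * (1 - \<delta>) ^ k"
      using pow[OF sub_X[OF z], of k] sub.B by (intro mult_left_mono) (auto simp: sub_g[OF z])
    finally show ?thesis .
  qed
  moreover have "(\<lambda>k. sub.B * (1 - \<delta>) ^ k) \<longlonglongrightarrow> sub.B * 0"
    using \<delta> by (intro tendsto_intros LIMSEQ_power_zero) auto
  ultimately have "1 \<le> sub.B * 0" by (intro LIMSEQ_le_const[where X="\<lambda>k. sub.B * (1 - \<delta>) ^ k"]) auto
  then show False by simp
qed

end

section \<open>The characteristic function of the hitting process\<close>

lemma norm_iexp_diff_le: "norm (iexp a - iexp d) \<le> 2" "norm (iexp a - iexp d) \<le> \<bar>a - d\<bar>"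
proof -
  show "norm (iexp a - iexp d) \<le> 2" using norm_triangle_ineq4[of "iexp a" "iexp d"] by simp
  have "iexp a - iexp d = iexp d * (iexp (a - d) - 1)"
    by (simp add: right_diff_distrib exp_add[symmetric])
  then have "norm (iexp a - iexp d) = norm (iexp (a - d) - 1)" by (simp add: norm_mult)
  also have "\<dots> \<le> \<bar>a - d\<bar>" using iexp_approx1[of "a - d" 0] by simp
  finally show "norm (iexp a - iexp d) \<le> \<bar>a - d\<bar>" .
qed

lemma norm_one_minus_iexp: "0 \<le> r \<Longrightarrow> r < 1 \<Longrightarrow> 1 - r \<le> norm (1 - of_real r * iexp a)"
  using norm_triangle_ineq2[of 1 "of_real r * iexp a"] by (simp add: norm_mult)

lemma uniformly_continuous_half_line:
  fixes f :: "real \<Rightarrow> 'b::real_normed_vector"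
  assumes f: "continuous_on {0..} f" and R: "\<And>t. R < t \<Longrightarrow> f t = 0" and e: "0 < e"
  shows "\<exists>d>0. \<forall>s\<ge>0. \<forall>t\<ge>0. \<bar>s - t\<bar> < d \<longrightarrow> norm (f s - f t) < e"
proof -
  have "uniformly_continuous_on {0..\<bar>R\<bar> + 2} f"
    by (intro compact_uniformly_continuous continuous_on_subset[OF f]) auto
  then obtain d where d: "d > 0" "\<And>s t. s \<in> {0..\<bar>R\<bar> + 2} \<Longrightarrow> t \<in> {0..\<bar>R\<bar> + 2} \<Longrightarrow> dist t s < d \<Longrightarrow> dist (f t) (f s) < e"
    using e unfolding uniformly_continuous_on_def by metis
  show ?thesis
  proof (intro exI[of _ "min d 1"] conjI allI impI)
    fix s t :: real assume st: "0 \<le> s" "0 \<le> t" "\<bar>s - t\<bar> < min d 1"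
    show "norm (f s - f t) < e"
    proof (cases "s \<le> \<bar>R\<bar> + 1 \<or> t \<le> \<bar>R\<bar> + 1")
      case True
      then show ?thesis using d(2)[of t s] st by (auto simp: dist_norm)
    next
      case False
      then have "R < s" "R < t" by linarith+
      then show ?thesis using R[of s] R[of t] e by simp
    qed
  qed (use d in auto)
qed

context escape
begin

abbreviation "r \<equiv> sub.\<rho>"

lemma r: "0 < r" "r < 1" using sub.\<rho>_pos sub_\<rho>_less_1 .

abbreviation "p n \<equiv> measure \<mu> (N\<Delta> n \<inter> X)"

lemma N\<Delta>_shift_measurable: "(\<lambda>x. indicator (N\<Delta> n) ((shift ^^ j) x) :: real) \<in> borel_measurable \<mu>"
  by (rule measurable_compose[OF measurable_shift_n indicator_measurable[OF determined_N\<Delta>]])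

lemma N\<Delta>_shift_integral: "(\<integral>x. indicator (N\<Delta> n) ((shift ^^ j) x) \<partial>\<mu>) = p n"
proof -
  have "(\<integral>x. indicator (N\<Delta> n) ((shift ^^ j) x) \<partial>\<mu>) = (\<integral>x. (indicator (N\<Delta> n) x :: real) \<partial>distr \<mu> \<mu> (shift ^^ j))"
    using measurable_shift_n indicator_measurable[OF determined_N\<Delta>[of n]] by (intro integral_distr[symmetric])
  then show ?thesis by (simp add: distr_shift_n)
qed

lemma N\<Delta>_shift_integrable: "integrable \<mu> (\<lambda>x. indicator (N\<Delta> n) ((shift ^^ j) x) :: real)"
  using N\<Delta>_shift_measurable by (intro integrable_const_bound[where B=1]) auto

text \<open>\<open>W a K n k x\<close> sums the weights \<open>a j\<close> of those times \<open>j\<close> between \<open>k\<close> and \<open>K\<close> at which \<open>\<Delta>\<^sub>n\<close> is visited, if the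
  orbit is at \<open>x\<close> at time \<open>k\<close>. Measuring time from \<open>k\<close> makes stationarity usable: the mean \<open>\<Phi>\<close> does not change
  when the orbit is started elsewhere.\<close>

definition W :: "(nat \<Rightarrow> real) \<Rightarrow> nat \<Rightarrow> nat \<Rightarrow> nat \<Rightarrow> (nat \<Rightarrow> nat) \<Rightarrow> real" where
  "W a K n k x = (\<Sum>j<Suc K - k. a (k + j) * indicator (N\<Delta> n) ((shift ^^ j) x))"

definition \<Phi> :: "(nat \<Rightarrow> real) \<Rightarrow> nat \<Rightarrow> nat \<Rightarrow> nat \<Rightarrow> complex" where
  "\<Phi> a K n k = (\<integral>x. iexp (W a K n k x) \<partial>\<mu>)"

lemma W_step:
  assumes a: "\<And>j. K < j \<Longrightarrow> a j = 0"
  shows "W a K n k x = a k * indicator (N\<Delta> n) x + W a K n (Suc k) (shift x)"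
proof (cases "k \<le> K")
  case True
  then have "Suc K - k = Suc (Suc K - Suc k)" by simp
  then show ?thesis by (simp add: W_def sum.lessThan_Suc_shift funpow_swap1 del: sum.lessThan_Suc)
next
  case False
  then show ?thesis using a[of k] by (simp add: W_def)
qed

lemma W_steps:
  assumes a: "\<And>j. K < j \<Longrightarrow> a j = 0"
  shows "W a K n k x = (\<Sum>j<s. a (k + j) * indicator (N\<Delta> n) ((shift ^^ j) x)) + W a K n (k + s) ((shift ^^ s) x)"
proof (induction s)
  case (Suc s)
  have "W a K n (k + s) ((shift ^^ s) x) = a (k + s) * indicator (N\<Delta> n) ((shift ^^ s) x) + W a K n (k + Suc s) ((shift ^^ Suc s) x)"
    using W_step[of K a n "k + s" "(shift ^^ s) x", OF a] by simp
  then show ?case using Suc by simp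
qed simp

lemma W_measurable: "W a K n k \<in> borel_measurable \<mu>"
  unfolding W_def using N\<Delta>_shift_measurable by measurable

lemma W_shift_measurable: "(\<lambda>x. W a K n k ((shift ^^ s) x)) \<in> borel_measurable \<mu>"
  by (rule measurable_compose[OF measurable_shift_n W_measurable])

lemma iexp_integrable: "f \<in> borel_measurable \<mu> \<Longrightarrow> integrable \<mu> (\<lambda>x. iexp (f x))"
  by (intro integrable_const_bound[where B=1]) auto

lemma \<Phi>_shift: "\<Phi> a K n k = (\<integral>x. iexp (W a K n k ((shift ^^ s) x)) \<partial>\<mu>)"
proof -
  have "(\<lambda>x. iexp (W a K n k x)) \<in> borel_measurable \<mu>" using W_measurable by measurable
  then have "(\<integral>x. iexp (W a K n k ((shift ^^ s) x)) \<partial>\<mu>) = (\<integral>x. iexp (W a K n k x) \<partial>distr \<mu> \<mu> (shift ^^ s))"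
    using measurable_shift_n by (intro integral_distr[symmetric])
  then show ?thesis by (simp add: distr_shift_n \<Phi>_def)
qed

lemma norm_\<Phi>_le_1: "norm (\<Phi> a K n k) \<le> 1"
proof -
  have "norm (\<Phi> a K n k) \<le> (\<integral>x. norm (iexp (W a K n k x)) \<partial>\<mu>)" unfolding \<Phi>_def by (rule integral_norm_bound)
  then show ?thesis by (simp add: prob_space)
qed

text \<open>Omitting \<open>s\<close> steps changes nothing unless a visit occurs during them.\<close>

lemma iexp_W_skip:
  assumes a: "\<And>j. K < j \<Longrightarrow> a j = 0"
  shows "norm (iexp (W a K n k x) - iexp (W a K n (k + s) ((shift ^^ s) x)))
    \<le> (\<Sum>j<s. 2 * indicator (N\<Delta> n) ((shift ^^ j) x))"
proof (cases "\<exists>j<s. (shift ^^ j) x \<in> N\<Delta> n")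
  case True
  then obtain j where j: "j < s" "(shift ^^ j) x \<in> N\<Delta> n" by auto
  have "(2::real) = 2 * indicator (N\<Delta> n) ((shift ^^ j) x)" using j by simp
  also have "\<dots> \<le> (\<Sum>j<s. 2 * indicator (N\<Delta> n) ((shift ^^ j) x))"
    using j by (intro member_le_sum[where f="\<lambda>j. 2 * indicator (N\<Delta> n) ((shift ^^ j) x)"]) auto
  finally show ?thesis using norm_iexp_diff_le(1) order.trans by blast
next
  case False
  then have "(\<Sum>j<s. a (k + j) * indicator (N\<Delta> n) ((shift ^^ j) x)) = 0" by (intro sum.neutral) auto
  then have "W a K n k x = W a K n (k + s) ((shift ^^ s) x)" using W_steps[of K a n k x s, OF a] by simp
  then show ?thesis by (auto intro: sum_nonneg)
qed

lemma \<Phi>_skip: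
  assumes a: "\<And>j. K < j \<Longrightarrow> a j = 0"
  shows "norm (\<Phi> a K n k - \<Phi> a K n (k + s)) \<le> 2 * s * p n"
proof -
  have "\<Phi> a K n k - \<Phi> a K n (k + s) = (\<integral>x. iexp (W a K n k x) - iexp (W a K n (k + s) ((shift ^^ s) x)) \<partial>\<mu>)"
    unfolding \<Phi>_shift[of a K n "k + s" s]
    unfolding \<Phi>_def by (intro Bochner_Integration.integral_diff[symmetric] iexp_integrable W_measurable W_shift_measurable)
  then have "norm (\<Phi> a K n k - \<Phi> a K n (k + s)) \<le> (\<integral>x. norm (iexp (W a K n k x) - iexp (W a K n (k + s) ((shift ^^ s) x))) \<partial>\<mu>)"
    by (simp only: integral_norm_bound)
  also have "\<dots> \<le> (\<integral>x. (\<Sum>j<s. 2 * indicator (N\<Delta> n) ((shift ^^ j) x)) \<partial>\<mu>)"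
    by (intro integral_mono iexp_W_skip a integrable_norm Bochner_Integration.integrable_diff iexp_integrable
        W_measurable W_shift_measurable Bochner_Integration.integrable_sum integrable_mult_right N\<Delta>_shift_integrable)
  also have "\<dots> = (\<Sum>j<s. 2 * p n)"
    using N\<Delta>_shift_integrable by (subst Bochner_Integration.integral_sum) (auto simp: N\<Delta>_shift_integral)
  finally show ?thesis by simp
qed

text \<open>The current run of visits to \<open>\<Delta>\<^sub>n\<close> has exactly \<open>s\<close> visits after the present one.\<close>

definition run :: "nat \<Rightarrow> nat \<Rightarrow> (nat \<Rightarrow> nat) set" where "run n s = N\<Delta> (n + s) - N\<Delta> (Suc (n + s))"

lemma determined_run: "determined (Suc (n + s)) (run n s)"
  using determined_N\<Delta>[of "Suc (n + s)"] determined_mono[OF determined_N\<Delta>[of "n + s"], of "Suc (n + s)"]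
  unfolding run_def determined_def by (metis DiffD1 DiffD2 DiffI agree_sym le_SucI order_refl)

lemma measure_run: "measure \<mu> (run n s \<inter> X) = p (n + s) - p (Suc (n + s))"
proof -
  have "run n s \<inter> X = (N\<Delta> (n + s) \<inter> X) - (N\<Delta> (Suc (n + s)) \<inter> X)" by (auto simp: run_def)
  then show ?thesis
    using finite_measure_Diff[OF determined_sets_\<mu>[OF determined_N\<Delta>] determined_sets_\<mu>[OF determined_N\<Delta>],
      of "Suc (n + s)" "n + s"] N\<Delta>_antimono[of "n + s" "Suc (n + s)"] by auto
qed

lemma N\<Delta>_runs: "indicator (N\<Delta> n) x = (\<Sum>s<J. indicator (run n s) x) + (indicator (N\<Delta> (n + J)) x :: real)"
proof (induction J)
  case (Suc J)
  have "indicator (N\<Delta> (n + J)) x = indicator (run n J) x + (indicator (N\<Delta> (n + Suc J)) x :: real)"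
    using N\<Delta>_antimono[of "n + J" "Suc (n + J)"] by (auto simp: run_def indicator_def)
  then show ?case using Suc by simp
qed simp

text \<open>On \<open>run n s\<close> the orbit visits \<open>\<Delta>\<^sub>n\<close> at the next \<open>s\<close> times; then the symbol outside \<open>\<Delta>\<close> at position
  \<open>n + s\<close> excludes visits for \<open>n\<close> steps, until it has left the window.\<close>

lemma W_run:
  assumes a: "\<And>j. K < j \<Longrightarrow> a j = 0" and x: "x \<in> run n s"
  shows "W a K n (Suc k) (shift x) = (\<Sum>j<s. a (Suc k + j)) + W a K n (Suc k + (n + s)) ((shift ^^ Suc (n + s)) x)"
proof -
  have hit: "(shift ^^ j) (shift x) \<in> N\<Delta> n \<longleftrightarrow> j < s" if jn: "j < n + s" for j
  proof
    assume "j < s"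
    then show "(shift ^^ j) (shift x) \<in> N\<Delta> n" using x
      by (auto simp: run_def N\<Delta>_def shift_funpow shift_def)
  next
    assume *: "(shift ^^ j) (shift x) \<in> N\<Delta> n"
    have "x (n + s) \<notin> \<Delta>" using x by (auto simp: run_def N\<Delta>_Suc)
    show "j < s"
    proof (rule ccontr)
      assume "\<not> j < s"
      then obtain i where "i < n" "Suc (i + j) = n + s"
        using jn by (intro that[of "n + s - Suc j"]) auto
      then show False using * \<open>x (n + s) \<notin> \<Delta>\<close> by (auto simp: N\<Delta>_def shift_funpow shift_def)
    qed
  qed
  have "(\<Sum>j<n + s. a (Suc k + j) * indicator (N\<Delta> n) ((shift ^^ j) (shift x))) = (\<Sum>j<s. a (Suc k + j))"
    using hit by (intro sum.mono_neutral_cong_right) (auto simp: indicator_def)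
  moreover have "(shift ^^ (n + s)) (shift x) = (shift ^^ Suc (n + s)) x" by (simp add: funpow_swap1)
  ultimately show ?thesis using W_steps[of K a n "Suc k" "shift x" "n + s", OF a] by simp
qed

lemma indicator_scaleR_integrable:
  fixes f :: "(nat \<Rightarrow> nat) \<Rightarrow> complex"
  assumes E: "determined l E" and f: "f \<in> borel_measurable \<mu>" "\<And>x. norm (f x) = 1"
  shows "integrable \<mu> (\<lambda>x. indicator E x *\<^sub>R f x)"
proof (rule integrable_const_bound[where B=1])
  show "(\<lambda>x. indicator E x *\<^sub>R f x) \<in> borel_measurable \<mu>"
    by (intro borel_measurable_scaleR indicator_measurable[OF E] f)
qed (use f in \<open>auto simp: indicator_def\<close>)

text \<open>The values with and without the contribution of time \<open>k\<close> differ only if a visit occurs then; by stationarity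
  the orbit can be taken to be at \<open>x\<close> at time \<open>k\<close> in one case and at \<open>shift x\<close> at time \<open>k + 1\<close> in the other.\<close>

lemma \<Phi>_diff:
  assumes a: "\<And>j. K < j \<Longrightarrow> a j = 0"
  shows "\<Phi> a K n k - \<Phi> a K n (Suc k) = (iexp (a k) - 1) * (\<integral>x. indicator (N\<Delta> n) x *\<^sub>R iexp (W a K n (Suc k) (shift x)) \<partial>\<mu>)"
proof -
  note m = W_shift_measurable[where s=1, simplified]
  have i: "integrable \<mu> (\<lambda>x. indicator (N\<Delta> n) x *\<^sub>R iexp (W a K n (Suc k) (shift x)))"
    using m by (intro indicator_scaleR_integrable[OF determined_N\<Delta>]) auto
  have "\<Phi> a K n k = (\<integral>x. iexp (W a K n (Suc k) (shift x)) + (iexp (a k) - 1) * (indicator (N\<Delta> n) x *\<^sub>R iexp (W a K n (Suc k) (shift x))) \<partial>\<mu>)"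
    unfolding \<Phi>_def
  proof (rule Bochner_Integration.integral_cong)
    fix x
    have "W a K n k x = a k * indicator (N\<Delta> n) x + W a K n (Suc k) (shift x)" by (rule W_step[OF a])
    then have "iexp (W a K n k x) = iexp (a k * indicator (N\<Delta> n) x + W a K n (Suc k) (shift x))" by (simp only:)
    also have "\<dots> = iexp (a k * indicator (N\<Delta> n) x) * iexp (W a K n (Suc k) (shift x))"
      by (simp add: exp_add distrib_left)
    also have "\<dots> = iexp (W a K n (Suc k) (shift x)) + (iexp (a k) - 1) * (indicator (N\<Delta> n) x *\<^sub>R iexp (W a K n (Suc k) (shift x)))"
      by (cases "x \<in> N\<Delta> n") (simp_all add: left_diff_distrib)
    finally show "iexp (W a K n k x) = iexp (W a K n (Suc k) (shift x)) + (iexp (a k) - 1) * (indicator (N\<Delta> n) x *\<^sub>R iexp (W a K n (Suc k) (shift x)))" .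
  qed simp
  also have "\<dots> = (\<integral>x. iexp (W a K n (Suc k) (shift x)) \<partial>\<mu>) + (iexp (a k) - 1) * (\<integral>x. indicator (N\<Delta> n) x *\<^sub>R iexp (W a K n (Suc k) (shift x)) \<partial>\<mu>)"
    unfolding Bochner_Integration.integral_add[OF iexp_integrable[OF m] integrable_mult_right[OF i]]
      integral_mult_right_zero ..
  also have "(\<integral>x. iexp (W a K n (Suc k) (shift x)) \<partial>\<mu>) = \<Phi> a K n (Suc k)"
    using \<Phi>_shift[of a K n "Suc k" 1] by simp
  finally show ?thesis by simp
qed

text \<open>After the run, a gap of \<open>q\<close> steps is inserted, which by the bound without gap rarely contains a visit;
  then the future decouples from the run, and its mean is close to \<open>\<Phi> a K n (Suc k)\<close> because visits during
  \<open>n + s + q\<close> steps are rare. All errors are relative to the measure of the run.\<close>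

lemma run_integral:
  assumes a: "\<And>j. K < j \<Longrightarrow> a j = 0"
  shows "norm ((\<integral>x. indicator (run n s) x *\<^sub>R iexp (W a K n (Suc k) (shift x)) \<partial>\<mu>)
      - measure \<mu> (run n s \<inter> X) *\<^sub>R (iexp (\<Sum>j<s. a (Suc k + j)) * \<Phi> a K n (Suc k)))
    \<le> measure \<mu> (run n s \<inter> X) * (C\<mu> * (2 * q * p n) + C\<mu> * rate q + 2 * (n + s + q) * p n)"
proof -
  let ?E = "run n s" and ?m = "Suc (n + s)" and ?c = "iexp (\<Sum>j<s. a (Suc k + j))"
  let ?P = "measure \<mu> (run n s \<inter> X)"
  define F where "F x = iexp (W a K n (k + ?m) x)" for x
  define F' where "F' x = iexp (W a K n (k + ?m + q) x)" for x
  have Fm: "F \<in> borel_measurable \<mu>" "F' \<in> borel_measurable \<mu>" unfolding F_def F'_def using W_measurable by measurable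
  note E = determined_run[of n s]
  have ie: "integrable \<mu> (\<lambda>x. indicator ?E x *\<^sub>R f x)" if "f \<in> borel_measurable \<mu>" "\<And>x. norm (f x) = 1" for f :: "_ \<Rightarrow> complex"
    using indicator_scaleR_integrable[OF E that] .
  have Fs: "(\<lambda>x. F ((shift ^^ s) x)) \<in> borel_measurable \<mu>" "(\<lambda>x. F' ((shift ^^ s) x)) \<in> borel_measurable \<mu>" for s
    using measurable_compose[OF measurable_shift_n Fm(1)] measurable_compose[OF measurable_shift_n Fm(2)] by auto
  have "(\<integral>x. indicator ?E x *\<^sub>R iexp (W a K n (Suc k) (shift x)) \<partial>\<mu>) = (\<integral>x. ?c * (indicator ?E x *\<^sub>R F ((shift ^^ ?m) x)) \<partial>\<mu>)"
  proof (rule Bochner_Integration.integral_cong)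
    fix x
    show "indicator ?E x *\<^sub>R iexp (W a K n (Suc k) (shift x)) = ?c * (indicator ?E x *\<^sub>R F ((shift ^^ ?m) x))"
    proof (cases "x \<in> ?E")
      case True
      have "W a K n (Suc k) (shift x) = (\<Sum>j<s. a (Suc k + j)) + W a K n (k + ?m) ((shift ^^ ?m) x)"
        using W_run[of K a x n s k, OF a True] by simp
      then show ?thesis using True by (simp add: F_def exp_add distrib_left del: funpow.simps)
    qed simp
  qed simp
  also have "\<dots> = ?c * (\<integral>x. indicator ?E x *\<^sub>R F ((shift ^^ ?m) x) \<partial>\<mu>)"
    by (rule integral_mult_right_zero)
  finally have 0: "(\<integral>x. indicator ?E x *\<^sub>R iexp (W a K n (Suc k) (shift x)) \<partial>\<mu>) = ?c * (\<integral>x. indicator ?E x *\<^sub>R F ((shift ^^ ?m) x) \<partial>\<mu>)" .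
  have 1: "norm ((\<integral>x. indicator ?E x *\<^sub>R F ((shift ^^ ?m) x) \<partial>\<mu>) - (\<integral>x. indicator ?E x *\<^sub>R F' ((shift ^^ (?m + q)) x) \<partial>\<mu>))
      \<le> C\<mu> * ?P * (2 * q * p n)"
  proof -
    have eq: "(\<integral>x. indicator ?E x *\<^sub>R F ((shift ^^ ?m) x) \<partial>\<mu>) - (\<integral>x. indicator ?E x *\<^sub>R F' ((shift ^^ (?m + q)) x) \<partial>\<mu>)
        = (\<integral>x. indicator ?E x *\<^sub>R F ((shift ^^ ?m) x) - indicator ?E x *\<^sub>R F' ((shift ^^ (?m + q)) x) \<partial>\<mu>)"
      by (intro Bochner_Integration.integral_diff[symmetric] ie Fs) (auto simp: F_def F'_def)
    define H where "H x = (\<Sum>j<q. 2 * indicator (N\<Delta> n) ((shift ^^ j) x) :: real)" for x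
    have H0: "0 \<le> H x" for x unfolding H_def by (intro sum_nonneg) simp
    have iH: "integrable \<mu> H" unfolding H_def by (intro Bochner_Integration.integrable_sum integrable_mult_right N\<Delta>_shift_integrable)
    have Hq: "H x \<le> 2 * q" for x
    proof -
      have "H x \<le> (\<Sum>j<q. 2)" unfolding H_def by (intro sum_mono) (auto simp: indicator_def)
      then show ?thesis by simp
    qed
    have iEH: "integrable \<mu> (\<lambda>x. indicator ?E x * H ((shift ^^ ?m) x))"
    proof (rule integrable_const_bound[where B="2 * q"])
      show "AE x in \<mu>. norm (indicator ?E x * H ((shift ^^ ?m) x)) \<le> 2 * q"
      proof (rule AE_I2)
        fix x
        show "norm (indicator ?E x * H ((shift ^^ ?m) x)) \<le> 2 * q"
          using Hq[of "(shift ^^ ?m) x"] H0[of "(shift ^^ ?m) x"]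
          by (cases "x \<in> ?E") (simp_all del: funpow.simps)
      qed
      show "(\<lambda>x. indicator ?E x * H ((shift ^^ ?m) x)) \<in> borel_measurable \<mu>"
        by (intro borel_measurable_times indicator_measurable[OF E]
            measurable_compose[OF measurable_shift_n borel_measurable_integrable[OF iH]])
    qed
    have "norm (\<integral>x. indicator ?E x *\<^sub>R F ((shift ^^ ?m) x) - indicator ?E x *\<^sub>R F' ((shift ^^ (?m + q)) x) \<partial>\<mu>)
        \<le> (\<integral>x. norm (indicator ?E x *\<^sub>R F ((shift ^^ ?m) x) - indicator ?E x *\<^sub>R F' ((shift ^^ (?m + q)) x)) \<partial>\<mu>)"
      by (rule integral_norm_bound)
    also have "\<dots> \<le> (\<integral>x. indicator ?E x * H ((shift ^^ ?m) x) \<partial>\<mu>)"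
    proof (rule integral_mono[OF _ iEH])
      show "integrable \<mu> (\<lambda>x. norm (indicator ?E x *\<^sub>R F ((shift ^^ ?m) x) - indicator ?E x *\<^sub>R F' ((shift ^^ (?m + q)) x)))"
        by (intro integrable_norm Bochner_Integration.integrable_diff ie Fs) (auto simp: F_def F'_def)
      fix x
      have "(shift ^^ (?m + q)) x = (shift ^^ q) ((shift ^^ ?m) x)" by (subst add.commute) (simp only: funpow_add o_apply)
      then show "norm (indicator ?E x *\<^sub>R F ((shift ^^ ?m) x) - indicator ?E x *\<^sub>R F' ((shift ^^ (?m + q)) x))
          \<le> indicator ?E x * H ((shift ^^ ?m) x)"
        using iexp_W_skip[of K a n "k + ?m" "(shift ^^ ?m) x" q, OF a]
        by (cases "x \<in> ?E") (simp_all add: F_def F'_def H_def del: funpow.simps)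
    qed
    also have "\<dots> \<le> C\<mu> * ?P * integral\<^sup>L \<mu> H"
      by (rule integral_past_future_le[OF E iH H0])
    also have "integral\<^sup>L \<mu> H = 2 * q * p n"
      unfolding H_def using N\<Delta>_shift_integrable by (subst Bochner_Integration.integral_sum) (auto simp: N\<Delta>_shift_integral)
    finally show ?thesis unfolding eq .
  qed
  have 2: "norm ((\<integral>x. indicator ?E x *\<^sub>R F' ((shift ^^ (?m + q)) x) \<partial>\<mu>) - ?P *\<^sub>R \<Phi> a K n (k + ?m + q)) \<le> C\<mu> * rate q * ?P"
  proof -
    have "\<Phi> a K n (k + ?m + q) = integral\<^sup>L \<mu> F'" unfolding \<Phi>_def F'_def ..
    then show ?thesis using decorrelation[OF E Fm(2), of q] by (simp add: F'_def del: funpow.simps)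
  qed
  have 3: "norm (?P *\<^sub>R \<Phi> a K n (k + ?m + q) - ?P *\<^sub>R \<Phi> a K n (Suc k)) \<le> ?P * (2 * (n + s + q) * p n)"
  proof -
    have "norm (\<Phi> a K n (k + ?m + q) - \<Phi> a K n (Suc k)) \<le> 2 * (n + s + q) * p n"
      using \<Phi>_skip[of K a n "Suc k" "n + s + q", OF a] by (simp add: norm_minus_commute add_ac)
    then show ?thesis by (simp add: scaleR_diff_right[symmetric] mult_left_mono)
  qed
  let ?I = "\<integral>x. indicator ?E x *\<^sub>R F ((shift ^^ ?m) x) \<partial>\<mu>"
  let ?I' = "\<integral>x. indicator ?E x *\<^sub>R F' ((shift ^^ (?m + q)) x) \<partial>\<mu>"
  have "norm (?I - ?P *\<^sub>R \<Phi> a K n (Suc k)) \<le> norm (?I - ?I') + norm (?I' - ?P *\<^sub>R \<Phi> a K n (k + ?m + q))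
      + norm (?P *\<^sub>R \<Phi> a K n (k + ?m + q) - ?P *\<^sub>R \<Phi> a K n (Suc k))"
    by (rule norm_diff_triangle_le[OF norm_diff_triangle_le[OF order_refl order_refl] order_refl])
  also have "\<dots> \<le> C\<mu> * ?P * (2 * q * p n) + C\<mu> * rate q * ?P + ?P * (2 * (n + s + q) * p n)"
    using 1 2 3 by linarith
  finally have 4: "norm (?I - ?P *\<^sub>R \<Phi> a K n (Suc k)) \<le> ?P * (C\<mu> * (2 * q * p n) + C\<mu> * rate q + 2 * (n + s + q) * p n)"
    by (simp add: algebra_simps)
  have "norm (?c * ?I - ?P *\<^sub>R (?c * \<Phi> a K n (Suc k))) = norm (?c * (?I - ?P *\<^sub>R \<Phi> a K n (Suc k)))"
    by (simp add: right_diff_distrib)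
  also have "\<dots> = norm (?I - ?P *\<^sub>R \<Phi> a K n (Suc k))" by (simp only: norm_mult norm_exp_i_times mult_1_left)
  finally show ?thesis using 4 unfolding 0 by simp
qed

text \<open>Runs with \<open>s \<ge> n\<close> lie in \<open>N\<Delta> (2 * n)\<close>, whose measure is negligible compared with \<open>r ^ n\<close>; the gap is
  taken to be \<open>q = n\<close>.\<close>

lemma \<Phi>_step:
  assumes a: "\<And>j. K < j \<Longrightarrow> a j = 0"
  shows "norm (\<Phi> a K n k - \<Phi> a K n (Suc k)
      - (iexp (a k) - 1) * (\<Sum>s<n. measure \<mu> (run n s \<inter> X) *\<^sub>R iexp (\<Sum>j<s. a (Suc k + j))) * \<Phi> a K n (Suc k))
    \<le> 2 * (p n * (C\<mu> * (2 * real n * p n) + C\<mu> * rate n + 2 * (3 * real n) * p n) + p (2 * n))"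
proof -
  note m = W_shift_measurable[where s=1, simplified]
  let ?f = "\<lambda>x. iexp (W a K n (Suc k) (shift x))"
  let ?P = "\<lambda>s. measure \<mu> (run n s \<inter> X)"
  let ?A = "C\<mu> * (2 * real n * p n) + C\<mu> * rate n + 2 * (3 * real n) * p n"
  have A0: "0 \<le> ?A" using rate(2)[of n] by (simp add: C\<mu>_def)
  have ie: "integrable \<mu> (\<lambda>x. indicator E x *\<^sub>R ?f x)" if "determined l E" for E l
    using m by (intro indicator_scaleR_integrable[OF that]) auto
  have "(\<integral>x. indicator (N\<Delta> n) x *\<^sub>R ?f x \<partial>\<mu>)
      = (\<integral>x. (\<Sum>s<n. indicator (run n s) x *\<^sub>R ?f x) + indicator (N\<Delta> (n + n)) x *\<^sub>R ?f x \<partial>\<mu>)"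
    by (intro Bochner_Integration.integral_cong refl)
      (subst N\<Delta>_runs[where J=n], simp add: scaleR_left.sum scaleR_left.add)
  also have "\<dots> = (\<integral>x. (\<Sum>s<n. indicator (run n s) x *\<^sub>R ?f x) \<partial>\<mu>) + (\<integral>x. indicator (N\<Delta> (n + n)) x *\<^sub>R ?f x \<partial>\<mu>)"
    by (intro Bochner_Integration.integral_add Bochner_Integration.integrable_sum ie[OF determined_run] ie[OF determined_N\<Delta>])
  also have "(\<integral>x. (\<Sum>s<n. indicator (run n s) x *\<^sub>R ?f x) \<partial>\<mu>) = (\<Sum>s<n. \<integral>x. indicator (run n s) x *\<^sub>R ?f x \<partial>\<mu>)"
    by (intro Bochner_Integration.integral_sum ie[OF determined_run])
  finally have I: "(\<integral>x. indicator (N\<Delta> n) x *\<^sub>R ?f x \<partial>\<mu>)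
      = (\<Sum>s<n. \<integral>x. indicator (run n s) x *\<^sub>R ?f x \<partial>\<mu>) + (\<integral>x. indicator (N\<Delta> (n + n)) x *\<^sub>R ?f x \<partial>\<mu>)" .
  let ?S = "\<Sum>s<n. ?P s *\<^sub>R iexp (\<Sum>j<s. a (Suc k + j))"
  have tail: "norm (\<integral>x. indicator (N\<Delta> (n + n)) x *\<^sub>R ?f x \<partial>\<mu>) \<le> p (2 * n)"
  proof -
    have "norm (\<integral>x. indicator (N\<Delta> (n + n)) x *\<^sub>R ?f x \<partial>\<mu>) \<le> (\<integral>x. norm (indicator (N\<Delta> (n + n)) x *\<^sub>R ?f x) \<partial>\<mu>)"
      by (rule integral_norm_bound)
    also have "\<dots> = p (2 * n)" by (simp add: mult_2)
    finally show ?thesis .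
  qed
  have runs: "norm ((\<Sum>s<n. \<integral>x. indicator (run n s) x *\<^sub>R ?f x \<partial>\<mu>) - ?S * \<Phi> a K n (Suc k)) \<le> p n * ?A"
  proof -
    let ?T = "\<Sum>s<n. (\<integral>x. indicator (run n s) x *\<^sub>R ?f x \<partial>\<mu>)
        - ?P s *\<^sub>R (iexp (\<Sum>j<s. a (Suc k + j)) * \<Phi> a K n (Suc k))"
    have eq: "(\<Sum>s<n. \<integral>x. indicator (run n s) x *\<^sub>R ?f x \<partial>\<mu>) - ?S * \<Phi> a K n (Suc k)
        = (\<Sum>s<n. (\<integral>x. indicator (run n s) x *\<^sub>R ?f x \<partial>\<mu>) - ?P s *\<^sub>R (iexp (\<Sum>j<s. a (Suc k + j)) * \<Phi> a K n (Suc k)))"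
      by (simp add: sum_subtractf sum_distrib_right)
    have "norm ?T \<le> (\<Sum>s<n. ?P s * ?A)"
    proof (rule sum_norm_le)
      fix s assume s: "s \<in> {..<n}"
      have "2 * (real n + real s + real n) * p n \<le> 2 * (3 * real n) * p n" using s by (intro mult_right_mono) auto
      then have "C\<mu> * (2 * real n * p n) + C\<mu> * rate n + 2 * (real n + real s + real n) * p n \<le> ?A" by simp
      then have "?P s * (C\<mu> * (2 * real n * p n) + C\<mu> * rate n + 2 * (real n + real s + real n) * p n) \<le> ?P s * ?A" by (intro mult_left_mono) auto
      from order.trans[OF run_integral[of K a n s k n] this] a
      show "norm ((\<integral>x. indicator (run n s) x *\<^sub>R ?f x \<partial>\<mu>) - ?P s *\<^sub>R (iexp (\<Sum>j<s. a (Suc k + j)) * \<Phi> a K n (Suc k))) \<le> ?P s * ?A"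
        by blast
    qed
    also have "\<dots> = (\<Sum>s<n. p (n + s) - p (n + Suc s)) * ?A" by (simp add: measure_run sum_distrib_right)
    also have "(\<Sum>s<n. p (n + s) - p (n + Suc s)) = p (n + 0) - p (n + n)"
      by (rule sum_lessThan_telescope')
    also have "(p (n + 0) - p (n + n)) * ?A \<le> p n * ?A" using A0 by (intro mult_right_mono) auto
    finally show ?thesis unfolding eq .
  qed
  have eq: "\<Phi> a K n k - \<Phi> a K n (Suc k) - (iexp (a k) - 1) * ?S * \<Phi> a K n (Suc k)
      = (iexp (a k) - 1) * (((\<Sum>s<n. \<integral>x. indicator (run n s) x *\<^sub>R ?f x \<partial>\<mu>) - ?S * \<Phi> a K n (Suc k))
        + (\<integral>x. indicator (N\<Delta> (n + n)) x *\<^sub>R ?f x \<partial>\<mu>))"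
  proof -
    have d: "\<Phi> a K n k - \<Phi> a K n (Suc k) = (iexp (a k) - 1) * (\<integral>x. indicator (N\<Delta> n) x *\<^sub>R ?f x \<partial>\<mu>)"
      using a by (rule \<Phi>_diff)
    show ?thesis unfolding d I by (simp add: algebra_simps)
  qed
  show ?thesis
    unfolding eq norm_mult
    using norm_iexp_diff_le(1)[of "a k" 0] runs tail
    by (intro mult_mono norm_triangle_le add_mono) auto
qed

end

section \<open>Comparison with the limiting differential equation\<close>

context escape
begin

text \<open>With \<open>\<pi>\<close> the characteristic function of the geometric marks, this is \<open>\<kappa> * (1 - r) * (\<pi> t - 1)\<close>, the exponent of the
  compound Poisson law.\<close>

definition c\<^sub>P :: "real \<Rightarrow> complex" where
  "c\<^sub>P t = of_real (\<kappa> * (1 - r)) * (iexp t - 1) / (1 - of_real r * iexp t)"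

lemma denominator: "1 - r \<le> norm (1 - of_real r * iexp t)" "1 - of_real r * iexp t \<noteq> 0"
proof -
  show *: "1 - r \<le> norm (1 - of_real r * iexp t)" using r by (intro norm_one_minus_iexp) auto
  show "1 - of_real r * iexp t \<noteq> 0"
  proof
    assume "1 - of_real r * iexp t = 0"
    then have "1 - r \<le> 0" using * by simp
    then show False using r by simp
  qed
qed

lemma norm_of_real_\<kappa>: "norm (of_real (\<kappa> * (1 - r)) :: complex) = \<kappa> * (1 - r)"
  using r \<kappa>_pos by (subst norm_of_real) simp

lemma norm_c\<^sub>P: "norm (c\<^sub>P t) \<le> 2 * \<kappa>"
proof -
  have "norm (iexp t - 1) \<le> 2" using norm_iexp_diff_le(1)[of t 0] by simp
  then have "norm (c\<^sub>P t) \<le> \<kappa> * (1 - r) * 2 / (1 - r)"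
    unfolding c\<^sub>P_def norm_divide norm_mult[of "of_real (\<kappa> * (1 - r))"] norm_of_real_\<kappa> using denominator(1)[of t] r \<kappa>_pos
    by (intro frac_le mult_mono) auto
  then show ?thesis using r by simp
qed

lemma continuous_c\<^sub>P: "continuous_on U c\<^sub>P"
  unfolding c\<^sub>P_def using denominator(2) by (intro continuous_intros) auto

lemma c\<^sub>P_0: "c\<^sub>P 0 = 0" by (simp add: c\<^sub>P_def)

lemma geometric_iexp:
  fixes t :: real
  shows "norm ((\<Sum>s<n. of_real (r ^ s) * iexp (s * t)) - 1 / (1 - of_real r * iexp t)) \<le> r ^ n / (1 - r)"
proof -
  let ?q = "of_real r * iexp t"
  have q: "?q \<noteq> 1" using denominator(2)[of t] by auto
  have pow: "?q ^ s = of_real (r ^ s) * iexp (s * t)" for s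
    by (simp add: power_mult_distrib exp_of_nat_mult[symmetric] algebra_simps)
  have eq: "(\<Sum>s<n. of_real (r ^ s) * iexp (s * t)) - 1 / (1 - ?q) = - (?q ^ n / (1 - ?q))"
    unfolding pow[symmetric] using q by (simp add: sum_gp_strict diff_divide_distrib)
  have "norm (- (?q ^ n / (1 - ?q))) = r ^ n / norm (1 - ?q)"
    using r by (simp add: norm_divide norm_mult norm_power)
  also have "\<dots> \<le> r ^ n / (1 - r)"
  proof -
    have "0 < norm (1 - ?q)" using denominator(2)[of t] by simp
    then show ?thesis using denominator(1)[of t] r by (intro divide_left_mono) auto
  qed
  finally show ?thesis unfolding eq .
qed

lemma sum_arith_geometric_le: "(\<Sum>s<n. real s * r ^ s) \<le> 1 / (1 - r)\<^sup>2"
proof -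
  have s: "(\<lambda>n. of_nat (Suc n) * r ^ n) sums (1 / (1 - r)\<^sup>2)" using r by (intro geometric_deriv_sums) simp
  have "(\<Sum>s<n. real s * r ^ s) \<le> (\<Sum>s<n. of_nat (Suc s) * r ^ s)"
    using r by (intro sum_mono mult_right_mono) auto
  also have "\<dots> \<le> (\<Sum>s. of_nat (Suc s) * r ^ s)"
    using s r by (intro sum_le_suminf sums_summable[OF s]) auto
  also have "\<dots> = 1 / (1 - r)\<^sup>2" using s by (rule sums_unique[symmetric])
  finally show ?thesis .
qed

text \<open>The errors of one step are of smaller order than the step \<open>r ^ n\<close>, since \<open>n * p n\<close> and \<open>rate n\<close> tend to
  \<open>0\<close> and \<open>p (2 * n)\<close> is of the order of \<open>r ^ (2 * n)\<close>.\<close>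

lemma step_error_lim:
  "(\<lambda>n. 2 * (p n * (C\<mu> * (2 * real n * p n) + C\<mu> * rate n + 2 * (3 * real n) * p n) + p (2 * n)) / r ^ n) \<longlonglongrightarrow> 0"
proof -
  note pk = measure_N\<Delta>_asymp
  have np: "(\<lambda>n. real n * p n) \<longlonglongrightarrow> 0"
  proof -
    have "(\<lambda>n. (real n * r ^ n) * (p n / r ^ n)) \<longlonglongrightarrow> 0 * \<kappa>"
      using r by (intro tendsto_mult pk powser_times_n_limit_0) auto
    then show ?thesis using r by simp
  qed
  have p2: "(\<lambda>n. p (2 * n) / r ^ (2 * n) * r ^ n) \<longlonglongrightarrow> \<kappa> * 0"
    using r by (intro tendsto_mult LIMSEQ_power_zero filterlim_compose[OF pk] mult_nat_left_at_top) auto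
  have "(\<lambda>n. 2 * (p n / r ^ n * (2 * C\<mu> * (real n * p n) + C\<mu> * rate n + 6 * (real n * p n)) + p (2 * n) / r ^ (2 * n) * r ^ n))
      \<longlonglongrightarrow> 2 * (\<kappa> * (2 * C\<mu> * 0 + C\<mu> * 0 + 6 * 0) + \<kappa> * 0)"
    by (intro tendsto_intros pk np rate(1) p2)
  moreover have "2 * (p n / r ^ n * (2 * C\<mu> * (real n * p n) + C\<mu> * rate n + 6 * (real n * p n)) + p (2 * n) / r ^ (2 * n) * r ^ n)
      = 2 * (p n * (C\<mu> * (2 * real n * p n) + C\<mu> * rate n + 2 * (3 * real n) * p n) + p (2 * n)) / r ^ n" for n
  proof -
    have "p (2 * n) / r ^ (2 * n) * r ^ n = p (2 * n) / r ^ n" using r by (simp add: mult_2 power_add)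
    then show ?thesis by (simp add: add_divide_distrib algebra_simps)
  qed
  ultimately show ?thesis by simp
qed

text \<open>The runs have measure close to \<open>\<kappa> * (1 - r) * r ^ (n + s)\<close>, and during a run of at most \<open>n\<close> steps the test
  function is nearly constant; so the sum is nearly a geometric series with ratio \<open>r * iexp (a k)\<close>.\<close>

lemma run_sum_error:
  assumes e1: "\<And>m. n \<le> m \<Longrightarrow> \<bar>p m / r ^ m - \<kappa>\<bar> \<le> e1"
    and e2: "\<And>j. j < n \<Longrightarrow> \<bar>a (Suc k + j) - a k\<bar> \<le> e2" and n: "0 < n"
  shows "norm ((iexp (a k) - 1) * (\<Sum>s<n. measure \<mu> (run n s \<inter> X) *\<^sub>R iexp (\<Sum>j<s. a (Suc k + j))) - r ^ n *\<^sub>R c\<^sub>P (a k))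
    \<le> r ^ n * (2 * (2 * e1 / (1 - r) + \<kappa> * e2 / (1 - r) + \<kappa> * r ^ n))"
proof -
  let ?P = "\<lambda>s. measure \<mu> (run n s \<inter> X)" and ?t = "a k"
  have e: "0 \<le> e1" "0 \<le> e2" using e1[of n] e2[of 0] n by auto
  have P: "\<bar>?P s - r ^ n * (\<kappa> * (1 - r) * r ^ s)\<bar> \<le> r ^ n * (r ^ s * (2 * e1))" for s
  proof -
    have eq: "?P s - r ^ n * (\<kappa> * (1 - r) * r ^ s)
        = r ^ (n + s) * ((p (n + s) / r ^ (n + s) - \<kappa>) - r * (p (Suc (n + s)) / r ^ Suc (n + s) - \<kappa>))"
      using r by (simp add: measure_run power_add field_simps)
    have "\<bar>r ^ (n + s) * ((p (n + s) / r ^ (n + s) - \<kappa>) - r * (p (Suc (n + s)) / r ^ Suc (n + s) - \<kappa>))\<bar> \<le> r ^ (n + s) * (e1 + 1 * e1)"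
    proof -
      have "r * \<bar>p (Suc (n + s)) / r ^ Suc (n + s) - \<kappa>\<bar> \<le> 1 * e1"
        using r e1[of "Suc (n + s)"] by (intro mult_mono) auto
      then have "\<bar>(p (n + s) / r ^ (n + s) - \<kappa>) - r * (p (Suc (n + s)) / r ^ Suc (n + s) - \<kappa>)\<bar> \<le> e1 + 1 * e1"
        using e1[of "n + s"] r abs_triangle_ineq4[of "p (n + s) / r ^ (n + s) - \<kappa>" "r * (p (Suc (n + s)) / r ^ Suc (n + s) - \<kappa>)"]
        by (simp add: abs_mult)
      then show ?thesis using r by (simp add: abs_mult mult_left_mono)
    qed
    then show ?thesis unfolding eq by (simp add: power_add mult_ac)
  qed
  have ph: "norm (iexp (\<Sum>j<s. a (Suc k + j)) - iexp (s * ?t)) \<le> s * e2" if s: "s < n" for s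
  proof -
    have "norm (iexp (\<Sum>j<s. a (Suc k + j)) - iexp (s * ?t)) \<le> \<bar>(\<Sum>j<s. a (Suc k + j)) - s * ?t\<bar>"
      by (rule norm_iexp_diff_le)
    also have "(\<Sum>j<s. a (Suc k + j)) - s * ?t = (\<Sum>j<s. a (Suc k + j) - ?t)" by (simp add: sum_subtractf)
    also have "\<bar>\<dots>\<bar> \<le> (\<Sum>j<s. \<bar>a (Suc k + j) - ?t\<bar>)" by (rule sum_abs)
    also have "\<dots> \<le> (\<Sum>j<s. e2)" using e2 s by (intro sum_mono) auto
    finally show ?thesis by simp
  qed
  let ?Z = "of_real (\<kappa> * (1 - r)) :: complex"
  let ?S = "\<Sum>s<n. ?P s *\<^sub>R iexp (\<Sum>j<s. a (Suc k + j))"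
  let ?S' = "\<Sum>s<n. of_real (r ^ s) * iexp (s * ?t)"
  have S1: "norm (?S - r ^ n *\<^sub>R (?Z * ?S')) \<le> r ^ n * (2 * e1 / (1 - r) + \<kappa> * e2 / (1 - r))"
  proof -
    have eq: "?S - r ^ n *\<^sub>R (?Z * ?S') = (\<Sum>s<n. (?P s - r ^ n * (\<kappa> * (1 - r) * r ^ s)) *\<^sub>R iexp (\<Sum>j<s. a (Suc k + j))
        + (r ^ n * (\<kappa> * (1 - r) * r ^ s)) *\<^sub>R (iexp (\<Sum>j<s. a (Suc k + j)) - iexp (s * ?t)))"
      unfolding sum_distrib_left scaleR_right.sum sum_subtractf[symmetric]
      by (intro sum.cong refl) (simp add: scaleR_conv_of_real algebra_simps)
    have "norm (\<Sum>s<n. (?P s - r ^ n * (\<kappa> * (1 - r) * r ^ s)) *\<^sub>R iexp (\<Sum>j<s. a (Suc k + j))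
        + (r ^ n * (\<kappa> * (1 - r) * r ^ s)) *\<^sub>R (iexp (\<Sum>j<s. a (Suc k + j)) - iexp (s * ?t)))
        \<le> (\<Sum>s<n. r ^ n * (r ^ s * (2 * e1)) + (r ^ n * (\<kappa> * (1 - r) * r ^ s)) * (s * e2))"
    proof (rule sum_norm_le)
      fix s assume "s \<in> {..<n}"
      then have s: "s < n" by simp
      have "norm ((?P s - r ^ n * (\<kappa> * (1 - r) * r ^ s)) *\<^sub>R iexp (\<Sum>j<s. a (Suc k + j))) \<le> r ^ n * (r ^ s * (2 * e1))"
        using P[of s] by (simp only: norm_scaleR norm_exp_i_times mult_1_right)
      moreover have "norm ((r ^ n * (\<kappa> * (1 - r) * r ^ s)) *\<^sub>R (iexp (\<Sum>j<s. a (Suc k + j)) - iexp (s * ?t)))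
          \<le> (r ^ n * (\<kappa> * (1 - r) * r ^ s)) * (s * e2)"
        unfolding norm_scaleR using ph[OF s] r \<kappa>_pos by (intro mult_mono) auto
      ultimately show "norm ((?P s - r ^ n * (\<kappa> * (1 - r) * r ^ s)) *\<^sub>R iexp (\<Sum>j<s. a (Suc k + j))
        + (r ^ n * (\<kappa> * (1 - r) * r ^ s)) *\<^sub>R (iexp (\<Sum>j<s. a (Suc k + j)) - iexp (s * ?t)))
        \<le> r ^ n * (r ^ s * (2 * e1)) + (r ^ n * (\<kappa> * (1 - r) * r ^ s)) * (s * e2)"
        by (rule norm_triangle_le[OF add_mono])
    qed
    also have "\<dots> = r ^ n * (2 * e1 * (\<Sum>s<n. r ^ s) + \<kappa> * (1 - r) * e2 * (\<Sum>s<n. real s * r ^ s))"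
      by (simp add: sum.distrib sum_distrib_left distrib_left mult_ac)
    also have "\<dots> \<le> r ^ n * (2 * e1 * (1 / (1 - r)) + \<kappa> * (1 - r) * e2 * (1 / (1 - r)\<^sup>2))"
    proof (intro mult_left_mono add_mono)
      show "(\<Sum>s<n. r ^ s) \<le> 1 / (1 - r)" using r by (simp add: sum_gp_strict divide_right_mono)
    qed (use e r \<kappa>_pos sum_arith_geometric_le in auto)
    also have "\<dots> = r ^ n * (2 * e1 / (1 - r) + \<kappa> * e2 / (1 - r))" using r by (simp add: power2_eq_square)
    finally show ?thesis unfolding eq .
  qed
  have S2: "norm (r ^ n *\<^sub>R (?Z * ?S') - r ^ n *\<^sub>R (?Z / (1 - of_real r * iexp ?t))) \<le> r ^ n * (\<kappa> * r ^ n)"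
  proof -
    have eq: "r ^ n *\<^sub>R (?Z * ?S') - r ^ n *\<^sub>R (?Z / (1 - of_real r * iexp ?t)) = r ^ n *\<^sub>R (?Z * (?S' - 1 / (1 - of_real r * iexp ?t)))"
      by (simp add: scaleR_diff_right[symmetric] right_diff_distrib)
    have "norm (r ^ n *\<^sub>R (?Z * (?S' - 1 / (1 - of_real r * iexp ?t))))
        = r ^ n * (\<kappa> * (1 - r) * norm (?S' - 1 / (1 - of_real r * iexp ?t)))"
      unfolding norm_scaleR norm_mult[of ?Z] norm_of_real_\<kappa> using r by simp
    also have "\<dots> \<le> r ^ n * (\<kappa> * (1 - r) * (r ^ n / (1 - r)))"
      using r \<kappa>_pos geometric_iexp by (intro mult_left_mono) auto
    finally show ?thesis unfolding eq using r by simp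
  qed
  have "norm (?S - r ^ n *\<^sub>R (?Z / (1 - of_real r * iexp ?t))) \<le> r ^ n * (2 * e1 / (1 - r) + \<kappa> * e2 / (1 - r)) + r ^ n * (\<kappa> * r ^ n)"
    by (rule norm_diff_triangle_le[OF S1 S2])
  then have S3: "norm (?S - r ^ n *\<^sub>R (?Z / (1 - of_real r * iexp ?t))) \<le> r ^ n * (2 * e1 / (1 - r) + \<kappa> * e2 / (1 - r) + \<kappa> * r ^ n)"
    by (simp add: distrib_left)
  have eq: "(iexp ?t - 1) * ?S - r ^ n *\<^sub>R c\<^sub>P ?t = (iexp ?t - 1) * (?S - r ^ n *\<^sub>R (?Z / (1 - of_real r * iexp ?t)))"
  proof -
    have "c\<^sub>P ?t = (iexp ?t - 1) * (?Z / (1 - of_real r * iexp ?t))" by (simp add: c\<^sub>P_def)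
    then show ?thesis by (simp only: right_diff_distrib mult_scaleR_right)
  qed
  have "norm ((iexp ?t - 1) * (?S - r ^ n *\<^sub>R (?Z / (1 - of_real r * iexp ?t))))
      \<le> 2 * (r ^ n * (2 * e1 / (1 - r) + \<kappa> * e2 / (1 - r) + \<kappa> * r ^ n))"
    unfolding norm_mult using norm_iexp_diff_le(1)[of ?t 0] S3 by (intro mult_mono) auto
  then show ?thesis unfolding eq mult.left_commute[of "r ^ n" 2] .
qed

lemma \<Phi>_recursion:
  assumes f: "continuous_on {0..} f" and R: "\<And>t. R < t \<Longrightarrow> f t = (0::real)" and e: "0 < e"
  shows "\<exists>N. \<forall>n\<ge>N. \<forall>K k. (\<forall>j>K. f (real j * r ^ n) = 0) \<longrightarrow>
    norm (\<Phi> (\<lambda>j. f (j * r ^ n)) K n k - \<Phi> (\<lambda>j. f (j * r ^ n)) K n (Suc k)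
      - r ^ n *\<^sub>R c\<^sub>P (f (k * r ^ n)) * \<Phi> (\<lambda>j. f (j * r ^ n)) K n (Suc k)) \<le> r ^ n * e"
proof -
  \<comment> \<open>chosen so that the two error terms of \<open>run_sum_error\<close> become \<open>e / 8\<close> each\<close>
  define e1 where "e1 = e * (1 - r) / 16"
  define e2 where "e2 = e * (1 - r) / (8 * \<kappa>)"
  have e12: "0 < e1" "0 < e2" using e r \<kappa>_pos by (auto simp: e1_def e2_def)
  obtain N1 where "\<And>m. N1 \<le> m \<Longrightarrow> norm (p m / r ^ m - \<kappa>) < e1"
    using LIMSEQ_D[OF measure_N\<Delta>_asymp e12(1)] by blast
  then have N1: "\<bar>p m / r ^ m - \<kappa>\<bar> \<le> e1" if "N1 \<le> m" for m
    using that unfolding real_norm_def by (blast intro: less_imp_le)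
  have "\<exists>d>0. \<forall>s\<ge>0. \<forall>t\<ge>0. \<bar>s - t\<bar> < d \<longrightarrow> norm (f s - f t) < e2"
    using R by (rule uniformly_continuous_half_line[OF f _ e12(2)])
  then obtain d where d: "d > 0" "\<And>s t. 0 \<le> s \<Longrightarrow> 0 \<le> t \<Longrightarrow> \<bar>s - t\<bar> < d \<Longrightarrow> norm (f s - f t) < e2"
    by blast
  have "(\<lambda>n. real n * r ^ n) \<longlonglongrightarrow> 0" using r by (intro powser_times_n_limit_0) auto
  from LIMSEQ_D[OF this d(1)] obtain N2 where "\<And>n. N2 \<le> n \<Longrightarrow> norm (real n * r ^ n - 0) < d" by blast
  then have N2: "\<And>n. N2 \<le> n \<Longrightarrow> real n * r ^ n < d" using r by (simp add: abs_mult)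
  have "(\<lambda>n. \<kappa> * r ^ n) \<longlonglongrightarrow> \<kappa> * 0" using r by (intro tendsto_intros LIMSEQ_power_zero) auto
  then have "\<forall>\<^sub>F n in sequentially. \<kappa> * r ^ n < e / 8" using e by (intro order_tendstoD) auto
  then obtain N3 where N3: "\<And>n. N3 \<le> n \<Longrightarrow> \<kappa> * r ^ n < e / 8" by (auto simp: eventually_sequentially)
  define err where "err n = 2 * (p n * (C\<mu> * (2 * real n * p n) + C\<mu> * rate n + 2 * (3 * real n) * p n) + p (2 * n)) / r ^ n" for n
  have "\<forall>\<^sub>F n in sequentially. err n < e / 4"
    using e step_error_lim unfolding err_def[symmetric] by (intro order_tendstoD) auto
  then obtain N4 where N4: "\<And>n. N4 \<le> n \<Longrightarrow> err n < e / 4" by (auto simp: eventually_sequentially)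
  show ?thesis
  proof (intro exI[of _ "Max {1, N1, N2, N3, N4}"] allI impI)
    fix n K k assume n: "Max {1, N1, N2, N3, N4} \<le> n" and fK: "\<forall>j>K. f (real j * r ^ n) = 0"
    then have n': "1 \<le> n" "N1 \<le> n" "N2 \<le> n" "N3 \<le> n" "N4 \<le> n" by auto
    define a where "a j = f (j * r ^ n)" for j :: nat
    have a: "a j = 0" if "K < j" for j using fK that by (simp add: a_def)
    let ?S = "\<Sum>s<n. measure \<mu> (run n s \<inter> X) *\<^sub>R iexp (\<Sum>j<s. a (Suc k + j))"
    let ?F = "\<Phi> a K n (Suc k)"
    have 1: "norm (\<Phi> a K n k - ?F - (iexp (a k) - 1) * ?S * ?F) \<le> r ^ n * err n"
      using \<Phi>_step[of K a n k] a r unfolding err_def by simp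
    have 2: "norm ((iexp (a k) - 1) * ?S - r ^ n *\<^sub>R c\<^sub>P (a k)) \<le> r ^ n * (2 * (2 * e1 / (1 - r) + \<kappa> * e2 / (1 - r) + \<kappa> * r ^ n))"
    proof (rule run_sum_error)
      fix j assume j: "j < n"
      have "\<bar>(Suc k + j) * r ^ n - k * r ^ n\<bar> = Suc j * r ^ n" using r by (simp add: algebra_simps)
      also have "\<dots> \<le> n * r ^ n" using j r by (intro mult_right_mono) auto
      also have "\<dots> < d" by (rule N2[OF n'(3)])
      finally show "\<bar>a (Suc k + j) - a k\<bar> \<le> e2"
        using d(2)[of "(Suc k + j) * r ^ n" "k * r ^ n"] r by (simp add: a_def less_imp_le)
    qed (use N1 n' in auto)
    have 3: "2 * (2 * e1 / (1 - r) + \<kappa> * e2 / (1 - r) + \<kappa> * r ^ n) \<le> 3 * e / 4"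
    proof -
      have a: "2 * e1 / (1 - r) = e / 8" "\<kappa> * e2 / (1 - r) = e / 8" using r \<kappa>_pos by (auto simp: e1_def e2_def field_simps)
      have "\<kappa> * r ^ n \<le> e / 8" using N3[OF n'(4)] by simp
      then have "2 * (2 * e1 / (1 - r) + \<kappa> * e2 / (1 - r) + \<kappa> * r ^ n) \<le> 2 * (e / 8 + e / 8 + e / 8)"
        unfolding a by (intro mult_left_mono add_mono) auto
      then show ?thesis by simp
    qed
    have 4: "norm ((iexp (a k) - 1) * ?S * ?F - r ^ n *\<^sub>R c\<^sub>P (a k) * ?F) \<le> r ^ n * (3 * e / 4)"
    proof -
      have "norm (((iexp (a k) - 1) * ?S - r ^ n *\<^sub>R c\<^sub>P (a k)) * ?F) \<le> (r ^ n * (3 * e / 4)) * 1"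
        unfolding norm_mult
      proof (rule mult_mono)
        have "r ^ n * (2 * (2 * e1 / (1 - r) + \<kappa> * e2 / (1 - r) + \<kappa> * r ^ n)) \<le> r ^ n * (3 * e / 4)"
          using 3 r by (intro mult_left_mono) auto
        then show "norm ((iexp (a k) - 1) * ?S - r ^ n *\<^sub>R c\<^sub>P (a k)) \<le> r ^ n * (3 * e / 4)" using 2 by linarith
      qed (use norm_\<Phi>_le_1 r e in auto)
      then show ?thesis by (simp add: left_diff_distrib)
    qed
    have "norm (\<Phi> a K n k - ?F - r ^ n *\<^sub>R c\<^sub>P (a k) * ?F) \<le> r ^ n * err n + r ^ n * (3 * e / 4)"
      by (rule norm_diff_triangle_le[OF 1 4])
    also have "\<dots> \<le> r ^ n * (e / 4) + r ^ n * (3 * e / 4)"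
      using N4[OF n'(5)] r by (intro add_right_mono mult_left_mono) auto
    finally show "norm (\<Phi> (\<lambda>j. f (j * r ^ n)) K n k - \<Phi> (\<lambda>j. f (j * r ^ n)) K n (Suc k)
      - r ^ n *\<^sub>R c\<^sub>P (f (k * r ^ n)) * \<Phi> (\<lambda>j. f (j * r ^ n)) K n (Suc k)) \<le> r ^ n * e"
      unfolding a_def by (simp add: distrib_left[symmetric] mult.commute)
  qed
qed

text \<open>The exact solution satisfies the same recursion up to an error that is small relative to the step.\<close>

lemma ode_step:
  assumes f: "continuous_on {0..} f" and R: "\<And>t. R < t \<Longrightarrow> f t = (0::real)"
    and F: "\<And>t. 0 \<le> t \<Longrightarrow> (F has_vector_derivative - (c\<^sub>P (f t) * F t)) (at t within {0..})"
    and FR: "\<And>t. R < t \<Longrightarrow> F t = 1" and e: "0 < e"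
  shows "\<exists>d>0. \<forall>s t. 0 \<le> s \<longrightarrow> s \<le> t \<longrightarrow> t - s < d \<longrightarrow> norm (F s - F t - (t - s) *\<^sub>R c\<^sub>P (f s) * F t) \<le> (t - s) * e"
proof -
  have Fc: "continuous_on {0..} F"
    by (rule continuous_on_vector_derivative) (use F in auto)
  have "continuous_on {0..} (\<lambda>t. c\<^sub>P (f t) * F t)"
    by (intro continuous_on_mult Fc continuous_on_compose2[OF continuous_c\<^sub>P[of UNIV] f]) auto
  from uniformly_continuous_half_line[OF this, of R "e / 2"] obtain d1 where d1: "d1 > 0"
    "\<And>s t. 0 \<le> s \<Longrightarrow> 0 \<le> t \<Longrightarrow> \<bar>s - t\<bar> < d1 \<Longrightarrow> norm (c\<^sub>P (f s) * F s - c\<^sub>P (f t) * F t) < e / 2"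
    using R c\<^sub>P_0 e by auto
  define e' where "e' = e / (4 * \<kappa>)"
  have e': "0 < e'" using e \<kappa>_pos by (simp add: e'_def)
  have "continuous_on {0..} (\<lambda>t. F t - 1)" by (intro continuous_intros Fc)
  from uniformly_continuous_half_line[OF this, of R e'] obtain d2 where d2: "d2 > 0"
    "\<And>s t. 0 \<le> s \<Longrightarrow> 0 \<le> t \<Longrightarrow> \<bar>s - t\<bar> < d2 \<Longrightarrow> norm (F s - F t) < e'"
    using FR e' by auto
  show ?thesis
  proof (intro exI[of _ "min d1 d2"] conjI allI impI)
    fix s t :: real assume st: "0 \<le> s" "s \<le> t" "t - s < min d1 d2"
    have "norm (F s - F t - (s - t) *\<^sub>R (- (c\<^sub>P (f s) * F s))) \<le> norm (s - t) * (e / 2)"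
    proof (rule vector_differentiable_bound_linearization[where S="{s..t}" and f'="\<lambda>t. - (c\<^sub>P (f t) * F t)"])
      fix v assume "v \<in> {s..t}"
      then show "(F has_vector_derivative - (c\<^sub>P (f v) * F v)) (at v within {s..t})"
        using st by (intro has_vector_derivative_within_subset[OF F]) auto
    next
      fix v assume v: "v \<in> {s..t}"
      then show "norm (- (c\<^sub>P (f v) * F v) - - (c\<^sub>P (f s) * F s)) \<le> e / 2"
        using d1(2)[of s v] st by (auto simp: norm_minus_commute)
    qed (use st in \<open>auto simp: closed_segment_eq_real_ivl\<close>)
    then have 1: "norm (F s - F t - (t - s) *\<^sub>R (c\<^sub>P (f s) * F s)) \<le> (t - s) * (e / 2)"
      using st by (simp add: scaleR_diff_left)
    have 2: "norm ((t - s) *\<^sub>R (c\<^sub>P (f s) * F s) - (t - s) *\<^sub>R (c\<^sub>P (f s) * F t)) \<le> (t - s) * (e / 2)"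
    proof -
      have "norm (c\<^sub>P (f s) * (F s - F t)) \<le> (2 * \<kappa>) * e'"
        unfolding norm_mult using norm_c\<^sub>P[of "f s"] d2(2)[of s t] st \<kappa>_pos by (intro mult_mono) auto
      also have "\<dots> = e / 2" using \<kappa>_pos by (simp add: e'_def)
      finally have "(t - s) * norm (c\<^sub>P (f s) * (F s - F t)) \<le> (t - s) * (e / 2)"
        using st by (intro mult_left_mono) auto
      then have "norm ((t - s) *\<^sub>R (c\<^sub>P (f s) * (F s - F t))) \<le> (t - s) * (e / 2)"
        using st by simp
      then show ?thesis by (simp add: right_diff_distrib scaleR_diff_right)
    qed
    have "(t - s) * (e / 2) + (t - s) * (e / 2) = (t - s) * e" by (simp add: field_simps)
    with norm_diff_triangle_le[OF 1 2] show "norm (F s - F t - (t - s) *\<^sub>R c\<^sub>P (f s) * F t) \<le> (t - s) * e"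
      by (simp only: mult_scaleR_left)
  qed (use d1 d2 in auto)
qed

text \<open>A discrete Gronwall argument, run backwards from time \<open>R\<close>, beyond which both sides are \<open>1\<close>: each of the
  \<open>R / r ^ n\<close> steps multiplies the error by at most \<open>1 + 2 * \<kappa> * r ^ n\<close> and adds \<open>2 * e' * r ^ n\<close>.\<close>

theorem \<Phi>_lim:
  assumes f: "continuous_on {0..} f" and R: "\<And>t. R < t \<Longrightarrow> f t = (0::real)" "0 \<le> R"
    and F: "\<And>t. 0 \<le> t \<Longrightarrow> (F has_vector_derivative - (c\<^sub>P (f t) * F t)) (at t within {0..})"
    and FR: "\<And>t. R < t \<Longrightarrow> F t = 1"
  shows "(\<lambda>n. \<Phi> (\<lambda>j. f (j * r ^ n)) (nat \<lfloor>R / r ^ n\<rfloor>) n 1) \<longlonglongrightarrow> F 0"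
proof -
  define K where "K n = nat \<lfloor>R / r ^ n\<rfloor>" for n
  have K: "K n * r ^ n \<le> R" "R < Suc (K n) * r ^ n" for n
  proof -
    have q: "0 \<le> R / r ^ n" using R r by simp
    have "real (K n) \<le> R / r ^ n" using q by (simp add: K_def)
    then show "K n * r ^ n \<le> R" using r by (simp add: pos_le_divide_eq)
    have "R / r ^ n < real (Suc (K n))" using q by (simp add: K_def) linarith
    then show "R < Suc (K n) * r ^ n" using r by (simp add: pos_divide_less_eq)
  qed
  have fK: "f (j * r ^ n) = 0" if "K n < j" for j n
  proof -
    have "Suc (K n) * r ^ n \<le> j * r ^ n" using that r by (intro mult_right_mono) auto
    then show ?thesis using K(2)[of n] by (intro R) simp
  qed
  let ?\<Phi> = "\<lambda>n k. \<Phi> (\<lambda>j. f (j * r ^ n)) (K n) n k"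
  have \<Phi>end: "?\<Phi> n (Suc (K n)) = 1" for n by (simp add: \<Phi>_def W_def prob_space)
  have r0: "(\<lambda>n. r ^ n) \<longlonglongrightarrow> 0" using r by (intro LIMSEQ_power_zero) auto
  have main: "(\<lambda>n. ?\<Phi> n 1 - F (r ^ n)) \<longlonglongrightarrow> 0"
  proof (rule LIMSEQ_I)
    fix e :: real assume e: "0 < e"
    define Q where "Q = (R + 1) * exp (2 * \<kappa> * R)"
    have Q: "0 < Q" using R by (simp add: Q_def)
    define e' where "e' = e / (4 * Q)"
    have e': "0 < e'" using e Q by (simp add: e'_def)
    obtain N1 where N1: "\<And>n K k. N1 \<le> n \<Longrightarrow> (\<And>j. K < j \<Longrightarrow> f (real j * r ^ n) = 0) \<Longrightarrow>
      norm (\<Phi> (\<lambda>j. f (j * r ^ n)) K n k - \<Phi> (\<lambda>j. f (j * r ^ n)) K n (Suc k)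
      - r ^ n *\<^sub>R c\<^sub>P (f (k * r ^ n)) * \<Phi> (\<lambda>j. f (j * r ^ n)) K n (Suc k)) \<le> r ^ n * e'"
      using \<Phi>_recursion[OF f R(1) e'] by blast
    obtain d where d: "d > 0" "\<And>s t. 0 \<le> s \<Longrightarrow> s \<le> t \<Longrightarrow> t - s < d \<Longrightarrow>
        norm (F s - F t - (t - s) *\<^sub>R c\<^sub>P (f s) * F t) \<le> (t - s) * e'"
      using ode_step[OF f R(1) F FR e'] by blast
    obtain N2 where N2: "\<And>n. N2 \<le> n \<Longrightarrow> r ^ n < d" using LIMSEQ_D[OF r0 d(1)] r by auto
    show "\<exists>no. \<forall>n\<ge>no. norm (?\<Phi> n 1 - F (r ^ n) - 0) < e"
    proof (intro exI[of _ "max N1 N2"] allI impI)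
      fix n assume "max N1 N2 \<le> n"
      then have n: "N1 \<le> n" "N2 \<le> n" by auto
      define \<delta> where "\<delta> = r ^ n"
      have \<delta>: "0 < \<delta>" using r by (simp add: \<delta>_def)
      define E where "E k = norm (?\<Phi> n k - F (k * \<delta>))" for k
      have step: "E k \<le> (1 + \<delta> * (2 * \<kappa>)) * E (Suc k) + \<delta> * (2 * e')" for k
      proof -
        let ?c = "\<delta> *\<^sub>R c\<^sub>P (f (k * \<delta>))"
        have 1: "norm (?\<Phi> n k - ?\<Phi> n (Suc k) - ?c * ?\<Phi> n (Suc k)) \<le> \<delta> * e'"
          using N1[OF n(1), of "K n" k] fK unfolding \<delta>_def by blast
        have 2: "norm (F (k * \<delta>) - F (Suc k * \<delta>) - ?c * F (Suc k * \<delta>)) \<le> \<delta> * e'"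
          using d(2)[of "k * \<delta>" "Suc k * \<delta>"] N2[OF n(2)] \<delta> by (simp add: \<delta>_def[symmetric] algebra_simps)
        have 3: "norm (?c * (?\<Phi> n (Suc k) - F (Suc k * \<delta>))) \<le> \<delta> * (2 * \<kappa>) * E (Suc k)"
          unfolding norm_mult E_def using norm_c\<^sub>P[of "f (k * \<delta>)"] \<delta> by (intro mult_right_mono) (auto simp: norm_mult)
        have eq: "?\<Phi> n k - F (k * \<delta>) = (?\<Phi> n k - ?\<Phi> n (Suc k) - ?c * ?\<Phi> n (Suc k))
            - (F (k * \<delta>) - F (Suc k * \<delta>) - ?c * F (Suc k * \<delta>))
            + (?\<Phi> n (Suc k) - F (Suc k * \<delta>)) + ?c * (?\<Phi> n (Suc k) - F (Suc k * \<delta>))"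
          by (simp add: algebra_simps)
        have tri: "norm (x - y + z + u) \<le> norm x + norm y + norm z + norm u" for x y z u :: complex
          using norm_triangle_ineq[of "x - y + z" u] norm_triangle_ineq[of "x - y" z] norm_triangle_ineq4[of x y]
          by linarith
        have "E k \<le> norm (?\<Phi> n k - ?\<Phi> n (Suc k) - ?c * ?\<Phi> n (Suc k))
            + norm (F (k * \<delta>) - F (Suc k * \<delta>) - ?c * F (Suc k * \<delta>))
            + norm (?\<Phi> n (Suc k) - F (Suc k * \<delta>)) + norm (?c * (?\<Phi> n (Suc k) - F (Suc k * \<delta>)))"
          unfolding E_def eq by (rule tri)
        then have "E k \<le> \<delta> * e' + \<delta> * e' + E (Suc k) + \<delta> * (2 * \<kappa>) * E (Suc k)"
          using 1 2 3 unfolding E_def[of "Suc k"] by linarith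
        then show ?thesis by (simp add: algebra_simps)
      qed
      have "E (Suc (K n) - i) \<le> i * (\<delta> * (2 * e')) * (1 + \<delta> * (2 * \<kappa>)) ^ i" if "i \<le> Suc (K n)" for i
        using that
      proof (induction i)
        case 0
        have "F (Suc (K n) * \<delta>) = 1" using K(2)[of n] by (intro FR) (simp add: \<delta>_def)
        then show ?case using \<Phi>end by (simp add: E_def)
      next
        case (Suc i)
        let ?q = "1 + \<delta> * (2 * \<kappa>)"
        have q1: "1 \<le> ?q" using \<delta> \<kappa>_pos by simp
        have "Suc (Suc (K n) - Suc i) = Suc (K n) - i" using Suc.prems by simp
        then have "E (Suc (K n) - Suc i) \<le> ?q * E (Suc (K n) - i) + \<delta> * (2 * e')"
          using step[of "Suc (K n) - Suc i"] by simp
        also have "\<dots> \<le> ?q * (i * (\<delta> * (2 * e')) * ?q ^ i) + \<delta> * (2 * e') * ?q ^ Suc i"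
        proof (rule add_mono)
          show "?q * E (Suc (K n) - i) \<le> ?q * (i * (\<delta> * (2 * e')) * ?q ^ i)"
            using Suc q1 by (intro mult_left_mono) auto
          have "1 \<le> ?q ^ Suc i" using q1 by (rule one_le_power)
          then show "\<delta> * (2 * e') \<le> \<delta> * (2 * e') * ?q ^ Suc i"
            using \<delta> e' mult_left_mono[of 1 "?q ^ Suc i" "\<delta> * (2 * e')"] by simp
        qed
        also have "\<dots> = Suc i * (\<delta> * (2 * e')) * ?q ^ Suc i" by (simp add: algebra_simps)
        finally show ?case .
      qed
      from this[of "K n"] have "E 1 \<le> K n * (\<delta> * (2 * e')) * (1 + \<delta> * (2 * \<kappa>)) ^ K n" by simp
      also have "\<dots> \<le> (R * (2 * e')) * exp (2 * \<kappa> * R)"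
      proof (rule mult_mono)
        have "(K n * \<delta>) * (2 * e') \<le> R * (2 * e')" using K(1)[of n] e' by (intro mult_right_mono) (auto simp: \<delta>_def)
        then show "K n * (\<delta> * (2 * e')) \<le> R * (2 * e')" by simp
        have "(1 + \<delta> * (2 * \<kappa>)) ^ K n \<le> exp (\<delta> * (2 * \<kappa>)) ^ K n"
          using \<delta> \<kappa>_pos by (intro power_mono exp_ge_add_one_self) auto
        also have "\<dots> = exp (2 * \<kappa> * (K n * \<delta>))" by (simp add: exp_of_nat_mult[symmetric] mult_ac)
        also have "\<dots> \<le> exp (2 * \<kappa> * R)" using K(1)[of n] \<kappa>_pos by (simp add: \<delta>_def)
        finally show "(1 + \<delta> * (2 * \<kappa>)) ^ K n \<le> exp (2 * \<kappa> * R)" .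
      qed (use R e' \<delta> \<kappa>_pos in auto)
      also have "\<dots> \<le> 2 * e' * Q" using e' by (simp add: Q_def algebra_simps)
      also have "\<dots> < e" using Q e by (simp add: e'_def)
      finally show "norm (?\<Phi> n 1 - F (r ^ n) - 0) < e" by (simp add: E_def \<delta>_def)
    qed
  qed
  have Fc: "continuous_on {0..} F"
    by (rule continuous_on_vector_derivative) (use F in auto)
  have "(\<lambda>n. F (r ^ n)) \<longlonglongrightarrow> F 0"
    by (rule continuous_on_tendsto_compose[OF Fc r0]) (use r in auto)
  from tendsto_add[OF main this] show ?thesis by (simp add: K_def)
qed

end

section \<open>The characteristic function of a compound Poisson process\<close>

text \<open>A concrete probability space: an independent sequence of pairs of an exponential and a geometric
  variable.\<close>

locale compound_poisson =
  fixes lam q :: real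
  assumes lam: "0 < lam" and q: "0 < q" "q < 1"
begin

definition E :: "real measure" where "E = density lborel (exponential_density lam)"
definition G :: "nat measure" where "G = measure_pmf (geometric_pmf (1 - q))"
definition B :: "(real \<times> nat) measure" where "B = E \<Otimes>\<^sub>M G"
definition S :: "(nat \<Rightarrow> real \<times> nat) measure" where "S = PiM UNIV (\<lambda>_. B)"

lemma prob_E: "prob_space E" unfolding E_def by (rule prob_space_exponential_density[OF lam])
lemma prob_G: "prob_space G" unfolding G_def by (rule measure_pmf.prob_space_axioms)

sublocale E: prob_space E by (rule prob_E)
sublocale G: prob_space G by (rule prob_G)
sublocale EG: pair_prob_space E G ..
lemma prob_B: "prob_space B" unfolding B_def by (rule EG.prob_space_axioms)
sublocale B: prob_space B by (rule prob_B)
sublocale S: sequence_space B ..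

lemma prob_S: "prob_space S" unfolding S_def by (rule prob_space_PiM[OF prob_B])
sublocale prob_space S by (rule prob_S)

lemma sets_E [measurable_cong]: "sets E = sets borel" by (simp add: E_def)
lemma sets_G [measurable_cong]: "sets G = sets (count_space UNIV)" by (simp add: G_def)
lemma sets_B [measurable_cong]: "sets B = sets (borel \<Otimes>\<^sub>M count_space UNIV)"
  unfolding B_def by (intro sets_pair_measure_cong sets_E sets_G)
lemma space_E [simp]: "space E = UNIV" by (simp add: E_def)
lemma space_G [simp]: "space G = UNIV" by (simp add: G_def)
lemma space_B [simp]: "space B = UNIV" by (simp add: B_def space_pair_measure)
lemma space_S [simp]: "space S = UNIV" by (simp add: S_def space_PiM)

lemma coordinate [measurable]: "(\<lambda>\<omega>. \<omega> i) \<in> S \<rightarrow>\<^sub>M B"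
  unfolding S_def by (rule measurable_component_singleton) simp

text \<open>The exponential law gives no mass to negative numbers; the truncation makes the arrival times monotone
  everywhere, not just almost everywhere.\<close>

definition d :: "real \<times> nat \<Rightarrow> real" where "d s = max 0 (fst s)"
definition l :: "real \<times> nat \<Rightarrow> nat" where "l s = Suc (snd s)"

lemma d_measurable [measurable]: "d \<in> borel_measurable B" unfolding d_def by measurable
lemma l_measurable [measurable]: "l \<in> B \<rightarrow>\<^sub>M count_space UNIV" unfolding l_def by measurable
lemma d_nonneg [simp]: "0 \<le> d s" by (simp add: d_def)

text \<open>Waiting times are read off the even coordinates and marks off the odd ones, so that prepending two
  coordinates inserts a new first point.\<close>

definition arrival :: "nat \<Rightarrow> (nat \<Rightarrow> real \<times> nat) \<Rightarrow> real" where "arrival k \<omega> = (\<Sum>j<k. d (\<omega> (2 * j)))"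
definition LL :: "nat \<Rightarrow> (nat \<Rightarrow> real \<times> nat) \<Rightarrow> nat" where "LL k \<omega> = l (\<omega> (Suc (2 * k)))"

lemma arrival_measurable [measurable]: "arrival k \<in> borel_measurable S"
  unfolding arrival_def by (intro borel_measurable_sum measurable_compose[OF coordinate d_measurable])

lemma LL_measurable [measurable]: "LL k \<in> S \<rightarrow>\<^sub>M count_space UNIV"
  unfolding LL_def by (rule measurable_compose[OF coordinate l_measurable])

lemma arrival_nonneg [simp]: "0 \<le> arrival k \<omega>" unfolding arrival_def by (intro sum_nonneg) simp

lemma arrival_mono: "k \<le> m \<Longrightarrow> arrival k \<omega> \<le> arrival m \<omega>"
  unfolding arrival_def by (intro sum_mono2) auto

lemma arrival_cons: "arrival (Suc k) (case_nat s (case_nat s' \<omega>)) = d s + arrival k \<omega>"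
  unfolding arrival_def by (subst sum.lessThan_Suc_shift) simp

lemma LL_cons: "LL 0 (case_nat s (case_nat s' \<omega>)) = l s'" "LL (Suc k) (case_nat s (case_nat s' \<omega>)) = LL k \<omega>"
  by (simp_all add: LL_def)

lemma integral_S_cons:
  fixes f :: "_ \<Rightarrow> 'b::{banach, second_countable_topology}"
  assumes f: "f \<in> borel_measurable S" and bd: "\<And>\<omega>. norm (f \<omega>) \<le> C"
  shows "integral\<^sup>L S f = (\<integral>s. \<integral>\<omega>. f (case_nat s \<omega>) \<partial>S \<partial>B)"
    and "s \<in> space B \<Longrightarrow> (\<lambda>\<omega>. f (case_nat s \<omega>)) \<in> borel_measurable S"
proof -
  have iter: "distr (B \<Otimes>\<^sub>M S) S (\<lambda>(s, \<omega>). case_nat s \<omega>) = S" unfolding S_def by (rule S.PiM_iter)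
  have m: "(\<lambda>(s, \<omega>). case_nat s \<omega>) \<in> B \<Otimes>\<^sub>M S \<rightarrow>\<^sub>M S" unfolding S_def by measurable
  interpret BS: pair_prob_space B S ..
  have fm: "(\<lambda>z. f ((\<lambda>(s, \<omega>). case_nat s \<omega>) z)) \<in> borel_measurable (B \<Otimes>\<^sub>M S)"
    by (rule measurable_compose[OF m f])
  have "integral\<^sup>L S f = integral\<^sup>L (distr (B \<Otimes>\<^sub>M S) S (\<lambda>(s, \<omega>). case_nat s \<omega>)) f" by (simp only: iter)
  also have "\<dots> = (\<integral>z. f ((\<lambda>(s, \<omega>). case_nat s \<omega>) z) \<partial>(B \<Otimes>\<^sub>M S))" by (rule integral_distr[OF m f])
  also have "\<dots> = (\<integral>s. \<integral>\<omega>. f ((\<lambda>(s, \<omega>). case_nat s \<omega>) (s, \<omega>)) \<partial>S \<partial>B)"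
    using fm bd by (intro BS.integral_fst'[symmetric] BS.P.integrable_const_bound[where B=C]) auto
  finally show "integral\<^sup>L S f = (\<integral>s. \<integral>\<omega>. f (case_nat s \<omega>) \<partial>S \<partial>B)" by simp
  show "(\<lambda>\<omega>. f (case_nat s \<omega>)) \<in> borel_measurable S" if "s \<in> space B"
    using measurable_compose[OF measurable_Pair1'[OF that] fm] by simp
qed

lemma integral_S_cons2:
  fixes f :: "_ \<Rightarrow> 'b::{banach, second_countable_topology}"
  assumes f: "f \<in> borel_measurable S" and bd: "\<And>\<omega>. norm (f \<omega>) \<le> C"
  shows "integral\<^sup>L S f = (\<integral>s. \<integral>s'. \<integral>\<omega>. f (case_nat s (case_nat s' \<omega>)) \<partial>S \<partial>B \<partial>B)"
  unfolding integral_S_cons(1)[OF f bd]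
proof (rule Bochner_Integration.integral_cong)
  fix s assume "s \<in> space B"
  from integral_S_cons(1)[OF integral_S_cons(2)[OF f bd this] bd]
  show "(\<integral>\<omega>. f (case_nat s \<omega>) \<partial>S) = (\<integral>s'. \<integral>\<omega>. f (case_nat s (case_nat s' \<omega>)) \<partial>S \<partial>B)" .
qed simp

lemma integral_B_fst:
  fixes f :: "real \<Rightarrow> 'b::{banach, second_countable_topology}"
  assumes f: "f \<in> borel_measurable borel"
  shows "(\<integral>s. f (fst s) \<partial>B) = integral\<^sup>L E f"
proof -
  have "integral\<^sup>L E f = integral\<^sup>L (distr B E fst) f" unfolding B_def by (simp add: G.distr_pair_fst)
  also have "\<dots> = (\<integral>s. f (fst s) \<partial>B)"
    using f by (intro integral_distr) (auto simp: B_def measurable_cong_sets[OF sets_E refl])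
  finally show ?thesis ..
qed

lemma integral_B_snd:
  fixes f :: "nat \<Rightarrow> 'b::{banach, second_countable_topology}"
  assumes bd: "\<And>n. norm (f n) \<le> C"
  shows "(\<integral>s. f (snd s) \<partial>B) = integral\<^sup>L G f"
proof -
  have fm: "(\<lambda>s. f (snd s)) \<in> borel_measurable (E \<Otimes>\<^sub>M G)"
    by (rule measurable_compose[OF measurable_snd]) (simp add: measurable_cong_sets[OF sets_G refl])
  have "(\<integral>x. \<integral>y. f (snd (x, y)) \<partial>G \<partial>E) = integral\<^sup>L (E \<Otimes>\<^sub>M G) (\<lambda>s. f (snd s))"
    using fm bd by (intro EG.integral_fst' EG.integrable_const_bound[where B=C]) auto
  then show ?thesis by (simp add: B_def E.prob_space[unfolded space_E])
qed

lemma integral_exp_neg_d: "(\<integral>s. exp (- d s) \<partial>B) = lam / (lam + 1)"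
proof -
  have "(\<integral>s. exp (- d s) \<partial>B) = (\<integral>x. exp (- max 0 x) \<partial>E)"
    unfolding d_def by (rule integral_B_fst) measurable
  also have "\<dots> = (\<integral>x. exponential_density lam x *\<^sub>R exp (- max 0 x) \<partial>lborel)"
    unfolding E_def by (rule integral_density) (use lam in \<open>auto simp: exponential_density_nonneg\<close>)
  also have "\<dots> = (\<integral>x. lam / (lam + 1) * exponential_density (lam + 1) x \<partial>lborel)"
  proof (rule Bochner_Integration.integral_cong)
    fix x :: real
    show "exponential_density lam x *\<^sub>R exp (- max 0 x) = lam / (lam + 1) * exponential_density (lam + 1) x"
    proof (cases "x < 0")
      case False
      have "exp (- x * lam) * exp (- x) = exp (- x * (lam + 1))" by (simp add: exp_add[symmetric] algebra_simps)
      then show ?thesis using False lam by (simp add: exponential_density_def max_absorb2)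
    qed (simp add: exponential_density_def)
  qed simp
  also have "\<dots> = lam / (lam + 1) * (\<integral>x. exponential_density (lam + 1) x \<partial>lborel)" by (rule integral_mult_right_zero)
  also have "(\<integral>x. exponential_density (lam + 1) x \<partial>lborel) = 1"
  proof -
    interpret P: prob_space "density lborel (exponential_density (lam + 1))"
      using lam by (intro prob_space_exponential_density) simp
    have "(\<integral>x. (1::real) \<partial>density lborel (exponential_density (lam + 1))) = (\<integral>x. exponential_density (lam + 1) x *\<^sub>R 1 \<partial>lborel)"
      by (rule integral_density) (use lam in \<open>auto simp: exponential_density_nonneg\<close>)
    then show ?thesis using P.prob_space by simp
  qed
  finally show ?thesis by simp
qed

lemma integral_exp_neg_arrival: "(\<integral>\<omega>. exp (- arrival k \<omega>) \<partial>S) = (lam / (lam + 1)) ^ k"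
proof (induction k)
  case 0
  show ?case by (simp add: arrival_def prob_space[unfolded space_S])
next
  case (Suc k)
  have "(\<integral>\<omega>. exp (- arrival (Suc k) \<omega>) \<partial>S) = (\<integral>s. \<integral>s'. \<integral>\<omega>. exp (- arrival (Suc k) (case_nat s (case_nat s' \<omega>))) \<partial>S \<partial>B \<partial>B)"
    by (rule integral_S_cons2[where C=1]) auto
  also have "\<dots> = (\<integral>s. \<integral>s'. \<integral>\<omega>. exp (- d s) * exp (- arrival k \<omega>) \<partial>S \<partial>B \<partial>B)"
    by (simp add: arrival_cons exp_add[symmetric])
  also have "\<dots> = (\<integral>s. exp (- d s) * (lam / (lam + 1)) ^ k \<partial>B)"
    by (simp only: integral_mult_right_zero Suc) (simp add: B.prob_space[unfolded space_B])
  also have "\<dots> = (lam / (lam + 1)) ^ Suc k"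
    using integral_exp_neg_d by simp
  finally show ?case .
qed

text \<open>Markov's inequality for \<open>exp (- arrival k)\<close>, whose mean decays geometrically.\<close>

lemma AE_arrival_unbounded: "AE \<omega> in S. \<exists>k. R < arrival k \<omega>"
proof -
  have sets: "{\<omega> \<in> space S. \<forall>k. arrival k \<omega> \<le> R} \<in> sets S" by measurable
  have le: "measure S {\<omega> \<in> space S. \<forall>k. arrival k \<omega> \<le> R} \<le> exp R * (lam / (lam + 1)) ^ k" for k
  proof -
    have "measure S {\<omega> \<in> space S. \<forall>k. arrival k \<omega> \<le> R} = (\<integral>\<omega>. indicator {\<omega> \<in> space S. \<forall>k. arrival k \<omega> \<le> R} \<omega> \<partial>S)"
      using sets by simp
    also have "\<dots> \<le> (\<integral>\<omega>. exp R * exp (- arrival k \<omega>) \<partial>S)"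
    proof (rule integral_mono)
      show "integrable S (\<lambda>\<omega>. exp R * exp (- arrival k \<omega>))"
        by (intro integrable_mult_right integrable_const_bound[where B=1]) auto
      show "integrable S (indicator {\<omega> \<in> space S. \<forall>k. arrival k \<omega> \<le> R} :: _ \<Rightarrow> real)"
        using sets by (intro integrable_const_bound[where B=1]) (auto simp: indicator_def)
      fix \<omega>
      show "indicator {\<omega> \<in> space S. \<forall>k. arrival k \<omega> \<le> R} \<omega> \<le> exp R * exp (- arrival k \<omega>)"
        by (auto simp: indicator_def exp_add[symmetric])
    qed
    also have "\<dots> = exp R * (lam / (lam + 1)) ^ k" by (simp add: integral_exp_neg_arrival)
    finally show ?thesis .
  qed
  have "(\<lambda>k. exp R * (lam / (lam + 1)) ^ k) \<longlonglongrightarrow> exp R * 0"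
    using lam by (intro tendsto_intros LIMSEQ_power_zero) auto
  then have "measure S {\<omega> \<in> space S. \<forall>k. arrival k \<omega> \<le> R} \<le> exp R * 0"
    by (rule LIMSEQ_le_const) (use le in blast)
  then have "measure S {\<omega> \<in> space S. \<forall>k. arrival k \<omega> \<le> R} = 0" by (simp add: measure_le_0_iff)
  then have "{\<omega> \<in> space S. \<forall>k. arrival k \<omega> \<le> R} \<in> null_sets S"
    using sets by (simp add: null_sets_def emeasure_eq_measure)
  then show ?thesis by (rule AE_I') (auto simp: not_less)
qed

text \<open>The characteristic function of a mark, see \<open>integral_mark\<close>.\<close>

definition \<pi> :: "real \<Rightarrow> complex" where "\<pi> t = of_real (1 - q) * iexp t / (1 - of_real q * iexp t)"

lemma \<pi>_denominator: "1 - of_real q * iexp t \<noteq> 0"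
proof
  assume "1 - of_real q * iexp t = 0"
  then have "norm (of_real q * iexp t) = 1" by simp
  then show False using q by (simp add: norm_mult)
qed

lemma continuous_\<pi>: "continuous_on U \<pi>"
  unfolding \<pi>_def using \<pi>_denominator by (intro continuous_intros) auto

lemma integral_mark: "(\<integral>s. iexp (t * real (l s)) \<partial>B) = \<pi> t"
proof -
  have "(\<integral>s. iexp (t * real (l s)) \<partial>B) = integral\<^sup>L G (\<lambda>n. iexp (t * real (Suc n)))"
    unfolding l_def by (rule integral_B_snd[where C=1]) simp
  also have "\<dots> = (\<integral>n. pmf (geometric_pmf (1 - q)) n *\<^sub>R iexp (t * real (Suc n)) \<partial>count_space UNIV)"
    unfolding G_def measure_pmf_eq_density by (rule integral_density) auto
  also have "\<dots> = (\<Sum>n. pmf (geometric_pmf (1 - q)) n *\<^sub>R iexp (t * real (Suc n)))"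
  proof (rule integral_count_space_nat)
    show "integrable (count_space UNIV) (\<lambda>n. pmf (geometric_pmf (1 - q)) n *\<^sub>R iexp (t * real (Suc n)))"
      using q by (simp add: integrable_count_space_nat_iff summable_mult2 summable_geometric)
  qed
  also have "\<dots> = \<pi> t"
  proof (rule sums_unique[symmetric])
    have "(\<lambda>n. of_real (1 - q) * iexp t * (of_real q * iexp t) ^ n) sums (of_real (1 - q) * iexp t * (1 / (1 - of_real q * iexp t)))"
      using q by (intro sums_mult geometric_sums) (simp add: norm_mult)
    moreover have "of_real (1 - q) * iexp t * (of_real q * iexp t) ^ n = pmf (geometric_pmf (1 - q)) n *\<^sub>R iexp (t * real (Suc n))" for n
    proof -
      have "iexp (t * real (Suc n)) = iexp t * iexp t ^ n"
        by (simp add: exp_of_nat_mult[symmetric] exp_add[symmetric] algebra_simps)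
      then show ?thesis using q by (simp add: power_mult_distrib scaleR_conv_of_real)
    qed
    ultimately show "(\<lambda>n. pmf (geometric_pmf (1 - q)) n *\<^sub>R iexp (t * real (Suc n))) sums \<pi> t" by (simp add: \<pi>_def)
  qed
  finally show ?thesis .
qed

end

text \<open>The process after time \<open>t\<close> is the process itself translated by \<open>t\<close>, so the test function \<open>g\<close> is
  evaluated at the translated arrival times.\<close>

locale poisson_functional = compound_poisson +
  fixes g :: "real \<Rightarrow> real" and R :: real
  assumes g_cont: "continuous_on {0..} g" and g_0: "\<And>t. R < t \<Longrightarrow> g t = 0" and R: "0 \<le> R"
begin

definition V :: "real \<Rightarrow> (nat \<Rightarrow> real \<times> nat) \<Rightarrow> real" where
  "V t \<omega> = (\<Sum>k. real (LL k \<omega>) * g (t + arrival (Suc k) \<omega>))"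

definition F :: "real \<Rightarrow> complex" where "F t = (\<integral>\<omega>. iexp (V t \<omega>) \<partial>S)"

lemma g_measurable: "f \<in> borel_measurable M \<Longrightarrow> (\<And>x. 0 \<le> f x) \<Longrightarrow> (\<lambda>x. g (f x)) \<in> borel_measurable M"
proof -
  assume f: "f \<in> borel_measurable M" "\<And>x. 0 \<le> f x"
  have "(\<lambda>x. g (max 0 x)) \<in> borel_measurable borel"
    by (intro borel_measurable_continuous_onI continuous_on_compose2[OF g_cont]) (auto intro!: continuous_intros)
  from measurable_compose[OF f(1) this] show ?thesis using f(2) by (simp add: max_absorb2)
qed

lemma V_measurable: "0 \<le> t \<Longrightarrow> V t \<in> borel_measurable S"
  unfolding V_def by (intro borel_measurable_suminf borel_measurable_times g_measurable) (auto intro: measurable_compose[OF LL_measurable])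

lemma V_finite: "0 \<le> t \<Longrightarrow> R < arrival m \<omega> \<Longrightarrow> V t \<omega> = (\<Sum>k<m. real (LL k \<omega>) * g (t + arrival (Suc k) \<omega>))"
  unfolding V_def
proof (rule suminf_finite)
  fix k assume *: "0 \<le> t" "R < arrival m \<omega>" "k \<notin> {..<m}"
  then have "arrival m \<omega> \<le> arrival (Suc k) \<omega>" by (intro arrival_mono) auto
  then have "R < t + arrival (Suc k) \<omega>" using * by linarith
  then show "real (LL k \<omega>) * g (t + arrival (Suc k) \<omega>) = 0" by (simp add: g_0)
qed simp

lemma V_cons:
  assumes t: "0 \<le> t" and \<omega>: "R < arrival m \<omega>"
  shows "V t (case_nat s (case_nat s' \<omega>)) = real (l s') * g (t + d s) + V (t + d s) \<omega>"
proof -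
  have t': "0 \<le> t + d s" using t d_nonneg[of s] by linarith
  have "R < arrival (Suc m) (case_nat s (case_nat s' \<omega>))"
    unfolding arrival_cons using \<omega> d_nonneg[of s] by linarith
  from V_finite[OF t this] show ?thesis
    unfolding V_finite[OF t' \<omega>] by (subst (asm) sum.lessThan_Suc_shift) (simp add: arrival_cons LL_cons add.assoc, simp add: arrival_def)
qed

lemma F_end: "R < t \<Longrightarrow> F t = 1"
proof -
  assume t: "R < t"
  have "V t \<omega> = 0" for \<omega>
  proof -
    have "g (t + arrival (Suc k) \<omega>) = 0" for k using t arrival_nonneg[of "Suc k" \<omega>] by (intro g_0) linarith
    then show ?thesis by (simp add: V_def)
  qed
  then show ?thesis by (simp add: F_def prob_space[unfolded space_S])
qed

lemma F_continuous: "continuous_on {0..} F"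
  unfolding continuous_on_sequentially
proof (intro allI ballI impI)
  fix u :: "nat \<Rightarrow> real" and t :: real assume t: "t \<in> {0..}" and u: "(\<forall>n. u n \<in> {0..}) \<and> u \<longlonglongrightarrow> t"
  have "(\<lambda>n. \<integral>\<omega>. iexp (V (u n) \<omega>) \<partial>S) \<longlonglongrightarrow> (\<integral>\<omega>. iexp (V t \<omega>) \<partial>S)"
  proof (rule integral_dominated_convergence[where w="\<lambda>_. 1"])
    show "AE \<omega> in S. (\<lambda>n. iexp (V (u n) \<omega>)) \<longlonglongrightarrow> iexp (V t \<omega>)"
    proof (rule AE_mp[OF AE_arrival_unbounded], intro AE_I2 impI)
      fix \<omega> assume "\<exists>k. R < arrival k \<omega>"
      then obtain m where m: "R < arrival m \<omega>" by blast
      have "(\<lambda>n. g (u n + arrival (Suc k) \<omega>)) \<longlonglongrightarrow> g (t + arrival (Suc k) \<omega>)" for k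
        using t u arrival_nonneg[of "Suc k" \<omega>]
        by (intro continuous_on_tendsto_compose[OF g_cont]) (auto intro!: tendsto_intros add_nonneg_nonneg)
      then have "(\<lambda>n. V (u n) \<omega>) \<longlonglongrightarrow> V t \<omega>"
        using t u by (simp add: V_finite[OF _ m]) (intro tendsto_intros)
      then show "(\<lambda>n. iexp (V (u n) \<omega>)) \<longlonglongrightarrow> iexp (V t \<omega>)" by (intro tendsto_intros)
    qed
  qed (use t u V_measurable in auto)
  then show "(F \<circ> u) \<longlonglongrightarrow> F t" by (simp add: F_def[abs_def] o_def)
qed

definition H :: "real \<Rightarrow> complex" where "H v = \<pi> (g v) * F v"

lemma H_continuous: "continuous_on {0..} H"
  unfolding H_def by (intro continuous_on_mult F_continuous continuous_on_compose2[OF continuous_\<pi>[of UNIV] g_cont]) auto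

text \<open>Condition on the first point: it occurs after an exponential time, contributes its mark, and the process
  starts afresh.\<close>

lemma F_renewal: assumes t: "0 \<le> t" shows "F t = (\<integral>x. H (t + max 0 x) \<partial>E)"
proof -
  have "F t = (\<integral>s. \<integral>s'. \<integral>\<omega>. iexp (V t (case_nat s (case_nat s' \<omega>))) \<partial>S \<partial>B \<partial>B)"
    unfolding F_def
    by (rule integral_S_cons2[where C=1]) (use V_measurable[OF t] in auto)
  also have "\<dots> = (\<integral>s. \<integral>s'. iexp (g (t + d s) * real (l s')) * F (t + d s) \<partial>B \<partial>B)"
  proof (intro Bochner_Integration.integral_cong refl)
    fix s s'
    have t': "0 \<le> t + d s" using t d_nonneg[of s] by linarith
    have cons: "AE \<omega> in S. iexp (V t (case_nat s (case_nat s' \<omega>))) = iexp (g (t + d s) * real (l s')) * iexp (V (t + d s) \<omega>)"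
    proof (rule AE_mp[OF AE_arrival_unbounded[of R]], intro AE_I2 impI)
      fix \<omega> assume "\<exists>k. R < arrival k \<omega>"
      then obtain m where "R < arrival m \<omega>" by blast
      from V_cons[OF t this, of s s']
      show "iexp (V t (case_nat s (case_nat s' \<omega>))) = iexp (g (t + d s) * real (l s')) * iexp (V (t + d s) \<omega>)"
        by (simp add: exp_add[symmetric] algebra_simps)
    qed
    have m1: "(\<lambda>\<omega>. iexp (V t \<omega>)) \<in> borel_measurable S" using V_measurable[OF t] by measurable
    have m2: "(\<lambda>\<omega>. iexp (V t (case_nat s (case_nat s' \<omega>)))) \<in> borel_measurable S"
      using integral_S_cons(2)[OF integral_S_cons(2)[OF m1, of 1 s], of 1 s'] by simp
    have "(\<integral>\<omega>. iexp (V t (case_nat s (case_nat s' \<omega>))) \<partial>S) = (\<integral>\<omega>. iexp (g (t + d s) * real (l s')) * iexp (V (t + d s) \<omega>) \<partial>S)"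
      using m2 V_measurable[OF t'] cons by (intro integral_cong_AE) auto
    then show "(\<integral>\<omega>. iexp (V t (case_nat s (case_nat s' \<omega>))) \<partial>S) = iexp (g (t + d s) * real (l s')) * F (t + d s)"
      by (simp only: integral_mult_right_zero F_def)
  qed
  also have "\<dots> = (\<integral>s. H (t + d s) \<partial>B)"
    by (simp only: integral_mult_left_zero integral_mark H_def)
  also have "\<dots> = (\<integral>s. (\<lambda>x. H (t + max 0 x)) (fst s) \<partial>B)" by (simp add: d_def)
  also have "\<dots> = (\<integral>x. H (t + max 0 x) \<partial>E)"
    using t by (intro integral_B_fst borel_measurable_continuous_onI continuous_on_compose2[OF H_continuous])
      (auto intro!: continuous_intros)
  finally show ?thesis .
qed

definition weighted_H :: "real \<Rightarrow> complex" where "weighted_H v = of_real (lam * exp (- lam * v)) * H v"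

text \<open>Substituting \<open>v = t + x\<close> in the renewal equation moves the dependence on \<open>t\<close> out of the unknown function,
  so that \<open>F\<close> can be differentiated.\<close>

lemma F_integral:
  assumes t: "0 \<le> t"
  shows "F t = of_real (exp (lam * t)) * (\<integral>v. indicator {t..} v *\<^sub>R weighted_H v \<partial>lborel)"
proof -
  have m: "(\<lambda>x. H (t + max 0 x)) \<in> borel_measurable borel"
    using t by (intro borel_measurable_continuous_onI continuous_on_compose2[OF H_continuous]) (auto intro!: continuous_intros)
  have "F t = (\<integral>x. exponential_density lam x *\<^sub>R H (t + max 0 x) \<partial>lborel)"
    unfolding F_renewal[OF t] E_def by (rule integral_density) (use lam m in \<open>auto simp: exponential_density_nonneg\<close>)
  also have "\<dots> = (\<integral>x. of_real (exp (lam * t)) * (indicator {t..} (t + 1 * x) *\<^sub>R weighted_H (t + 1 * x)) \<partial>lborel)"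
  proof (rule Bochner_Integration.integral_cong)
    fix x :: real
    show "exponential_density lam x *\<^sub>R H (t + max 0 x) = of_real (exp (lam * t)) * (indicator {t..} (t + 1 * x) *\<^sub>R weighted_H (t + 1 * x))"
    proof (cases "x < 0")
      case False
      have "lam * exp (- x * lam) = exp (lam * t) * (lam * exp (- lam * (t + x)))"
        by (simp add: exp_add[symmetric] algebra_simps)
      from arg_cong[OF this, of complex_of_real]
      have "of_real (lam * exp (- x * lam)) = of_real (exp (lam * t)) * complex_of_real (lam * exp (- lam * (t + x)))"
        by (simp only: of_real_mult)
      then have "of_real (lam * exp (- x * lam)) * H (t + x) = of_real (exp (lam * t)) * (of_real (lam * exp (- lam * (t + x))) * H (t + x))"
        by (simp only: mult.assoc)
      then show ?thesis using False by (simp only: exponential_density_def weighted_H_def scaleR_conv_of_real) simp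
    qed (simp add: exponential_density_def)
  qed simp
  also have "\<dots> = of_real (exp (lam * t)) * (\<integral>x. indicator {t..} (t + 1 * x) *\<^sub>R weighted_H (t + 1 * x) \<partial>lborel)"
    by (rule integral_mult_right_zero)
  also have "(\<integral>x. indicator {t..} (t + 1 * x) *\<^sub>R weighted_H (t + 1 * x) \<partial>lborel) = (\<integral>v. indicator {t..} v *\<^sub>R weighted_H v \<partial>lborel)"
    using lborel_integral_real_affine[of 1 "\<lambda>v. indicator {t..} v *\<^sub>R weighted_H v" t] by simp
  finally show ?thesis .
qed

lemma weighted_H_continuous: "continuous_on {0..} weighted_H"
  unfolding weighted_H_def by (intro continuous_intros H_continuous)

text \<open>Up to the fixed time \<open>T\<close> the tail integral is an integral over a compact interval plus a constant; beyond
  \<open>R\<close> the function \<open>F\<close> is constant.\<close>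

theorem F_derivative:
  assumes t: "0 \<le> t"
  shows "(F has_vector_derivative - (of_real lam * (\<pi> (g t) - 1) * F t)) (at t within {0..})"
proof (cases "R < t")
  case True
  have "((\<lambda>_. 1) has_vector_derivative (0::complex)) (at t)" by (rule has_vector_derivative_const)
  then have "(F has_vector_derivative 0) (at t)"
    by (rule has_vector_derivative_transform_within_open[where S="{R<..}"]) (use True F_end in auto)
  then have "(F has_vector_derivative 0) (at t within {0..})" by (rule has_vector_derivative_at_within)
  moreover have "\<pi> (g t) = 1" using g_0[OF True] q by (simp add: \<pi>_def)
  ultimately show ?thesis by simp
next
  case False
  define T where "T = R + 1"
  have tT: "t < T" using False by (simp add: T_def)
  define J where "J u = integral {0..u} weighted_H" for u
  have Dc: "continuous_on {0..T} weighted_H" by (rule continuous_on_subset[OF weighted_H_continuous]) auto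
  have J: "(J has_vector_derivative weighted_H t) (at t within {0..T})"
    unfolding J_def using t tT by (intro integral_has_vector_derivative Dc) auto
  define c0 where "c0 = (\<integral>v. indicator {T<..} v *\<^sub>R weighted_H v \<partial>lborel)"
  have int1: "set_integrable lborel {s..T} weighted_H" if "0 \<le> s" for s
    using that by (intro borel_integrable_atLeastAtMost' continuous_on_subset[OF weighted_H_continuous]) auto
  have int2: "integrable lborel (\<lambda>v. indicator {T<..} v *\<^sub>R weighted_H v)"
  proof (rule Bochner_Integration.integrable_bound)
    have "integrable lborel (exponential_density lam)"
    proof -
      interpret P: prob_space "density lborel (exponential_density lam)" using lam by (rule prob_space_exponential_density)
      have "integrable (density lborel (exponential_density lam)) (\<lambda>_. 1::real)" by simp
      then show ?thesis using lam by (subst (asm) integrable_density) (auto simp: exponential_density_nonneg)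
    qed
    then show "integrable lborel (exponential_density lam)" .
    have "(\<lambda>v. indicator {T<..} v *\<^sub>R weighted_H v) = (\<lambda>v. indicator {T<..} v *\<^sub>R of_real (lam * exp (- lam * v)))"
    proof
      fix v
      show "indicator {T<..} v *\<^sub>R weighted_H v = indicator {T<..} v *\<^sub>R of_real (lam * exp (- lam * v))"
        using F_end[of v] g_0[of v] q R by (auto simp: indicator_def weighted_H_def H_def T_def \<pi>_def)
    qed
    then show "(\<lambda>v. indicator {T<..} v *\<^sub>R weighted_H v) \<in> borel_measurable lborel" by simp
    show "AE v in lborel. norm (indicator {T<..} v *\<^sub>R weighted_H v) \<le> norm (exponential_density lam v)"
    proof (rule AE_I2)
      fix v
      show "norm (indicator {T<..} v *\<^sub>R weighted_H v) \<le> norm (exponential_density lam v)"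
        using F_end[of v] g_0[of v] q R lam
        by (auto simp: indicator_def weighted_H_def H_def T_def \<pi>_def exponential_density_def norm_mult mult.commute)
    qed
  qed
  have FJ: "F s = of_real (exp (lam * s)) * ((J T - J s) + c0)" if s: "s \<in> {0..T}" for s
  proof -
    have "(\<integral>v. indicator {s..} v *\<^sub>R weighted_H v \<partial>lborel) = (\<integral>v. indicator {s..T} v *\<^sub>R weighted_H v + indicator {T<..} v *\<^sub>R weighted_H v \<partial>lborel)"
      using s by (intro Bochner_Integration.integral_cong refl) (auto simp: indicator_def)
    also have "\<dots> = (\<integral>v. indicator {s..T} v *\<^sub>R weighted_H v \<partial>lborel) + c0"
      unfolding c0_def using s by (intro Bochner_Integration.integral_add int2 int1[unfolded set_integrable_def]) auto
    also have "(\<integral>v. indicator {s..T} v *\<^sub>R weighted_H v \<partial>lborel) = integral {s..T} weighted_H"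
      using set_borel_integral_eq_integral(2)[OF int1] s by (simp add: set_lebesgue_integral_def)
    also have "integral {s..T} weighted_H = J T - J s"
      using s Henstock_Kurzweil_Integration.integral_combine[where a=0 and c=s and b=T and f=weighted_H] integrable_continuous_real[OF Dc] by (simp add: J_def algebra_simps)
    finally show ?thesis using F_integral[of s] s by simp
  qed
  have e: "((\<lambda>s. of_real (exp (lam * s)) :: complex) has_vector_derivative of_real (lam * exp (lam * t))) (at t within {0..T})"
    by (rule has_vector_derivative_of_real) (auto intro!: derivative_eq_intros simp: has_real_derivative_iff_has_vector_derivative[symmetric])
  have "((\<lambda>s. of_real (exp (lam * s)) * ((J T - J s) + c0)) has_vector_derivative
      of_real (exp (lam * t)) * ((0 - weighted_H t) + 0) + of_real (lam * exp (lam * t)) * ((J T - J t) + c0)) (at t within {0..T})"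
    by (intro has_vector_derivative_mult e has_vector_derivative_add has_vector_derivative_diff J has_vector_derivative_const)
  also have "of_real (exp (lam * t)) * ((0 - weighted_H t) + 0) + of_real (lam * exp (lam * t)) * ((J T - J t) + c0)
      = - (of_real lam * (\<pi> (g t) - 1) * F t)"
  proof -
    have a: "of_real (exp (lam * t)) * weighted_H t = of_real lam * H t"
    proof -
      have "of_real (exp (lam * t)) * weighted_H t = of_real (exp (lam * t) * exp (- lam * t)) * (of_real lam * H t)"
        by (simp add: weighted_H_def mult_ac)
      then show ?thesis by (simp add: exp_add[symmetric])
    qed
    have b: "of_real (lam * exp (lam * t)) * ((J T - J t) + c0) = of_real lam * F t"
      using FJ[of t] t tT by simp
    have "of_real (exp (lam * t)) * ((0 - weighted_H t) + 0) = - (of_real lam * H t)" using a by simp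
    then show ?thesis unfolding b by (simp add: H_def algebra_simps)
  qed
  finally have "(F has_vector_derivative - (of_real lam * (\<pi> (g t) - 1) * F t)) (at t within {0..T})"
    by (rule has_vector_derivative_transform[rotated 2]) (use FJ t tT in auto)
  moreover have "at t within {0..T} = at t within {0..}"
    using tT t by (intro at_within_nhd[of t "{..<T}"]) auto
  ultimately show ?thesis by simp
qed

end

section \<open>Integrals against the point processes\<close>

lemma integral_dirac_series:
  fixes g :: "real \<Rightarrow> real"
  assumes g: "continuous_on {0..} g" and t: "\<And>k. 0 < k \<Longrightarrow> 0 \<le> t k" and a: "\<And>k. 0 \<le> a k"
  shows "integral\<^sup>L (dirac_series (\<lambda>k. ennreal (a k)) t) g = (\<integral>k. a k * g (t k) \<partial>count_space {0<..})"
proof -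
  have tm: "t \<in> point_measure {0<..} (\<lambda>k. ennreal (a k)) \<rightarrow>\<^sub>M restrict_space borel {0..}"
    using t by (auto simp: space_restrict_space)
  have gm: "g \<in> borel_measurable (restrict_space borel {0..})"
    by (rule borel_measurable_continuous_on_restrict[OF g])
  have "integral\<^sup>L (dirac_series (\<lambda>k. ennreal (a k)) t) g = (\<integral>k. g (t k) \<partial>point_measure {0<..} (\<lambda>k. ennreal (a k)))"
    unfolding dirac_series_def by (rule integral_distr[OF tm gm])
  also have "\<dots> = (\<integral>k. a k * g (t k) \<partial>count_space {0<..})"
    unfolding point_measure_def by (subst integral_density) (use a in auto)
  finally show ?thesis .
qed

lemma integral_count_space_finite:
  fixes f :: "nat \<Rightarrow> real"
  assumes "\<And>k. K < k \<Longrightarrow> f k = 0"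
  shows "(\<integral>k. f k \<partial>count_space {0<..}) = (\<Sum>k<K. f (Suc k))"
proof -
  have sub: "{k \<in> {0<..}. f k \<noteq> 0} \<subseteq> {1..K}"
  proof
    fix k assume "k \<in> {k \<in> {0<..}. f k \<noteq> 0}"
    then show "k \<in> {1..K}" using assms[of k] by (cases "K < k") auto
  qed
  have fin: "finite {k \<in> {0<..}. f k \<noteq> 0}" by (rule finite_subset[OF sub]) simp
  have "(\<integral>k. f k \<partial>count_space {0<..}) = sum f {k \<in> {0<..}. f k \<noteq> 0}"
    by (rule lebesgue_integral_count_space_finite_support[OF fin])
  also have "\<dots> = sum f {1..K}" by (rule sum.mono_neutral_left[OF _ sub]) auto
  finally show ?thesis by (simp add: sum.atLeast1_atMost_eq)
qed

lemma char_distr: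
  assumes f: "f \<in> borel_measurable M"
  shows "char (distr M borel f) s = (\<integral>x. iexp (s * f x) \<partial>M)"
  unfolding char_def using f by (subst integral_distr) auto

context compound_poisson
begin

definition waiting :: "nat \<Rightarrow> (nat \<Rightarrow> real \<times> nat) \<Rightarrow> real" where "waiting k \<omega> = d (\<omega> (2 * (k - 1)))"
definition mark :: "nat \<Rightarrow> (nat \<Rightarrow> real \<times> nat) \<Rightarrow> nat" where "mark k \<omega> = LL (k - 1) \<omega>"

definition \<tau> :: "(nat \<Rightarrow> real \<times> nat) \<Rightarrow> real measure" where
  "\<tau> \<omega> = dirac_series (\<lambda>k. of_nat (mark k \<omega>)) (\<lambda>k. \<Sum>i=1..k. waiting i \<omega>)"

lemma sum_D: "(\<Sum>i=1..k. waiting i \<omega>) = arrival k \<omega>"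
  by (simp add: arrival_def waiting_def sum.atLeast1_atMost_eq)

lemma distr_coordinate: "distr S B (\<lambda>\<omega>. \<omega> i) = B"
  unfolding S_def by (rule distr_PiM_component[OF prob_B]) simp

lemma indep_coordinates:
  assumes f: "inj_on f I" and I: "I \<noteq> {}"
  shows "indep_vars (\<lambda>_. B) (\<lambda>i \<omega>. \<omega> (f i)) I"
proof (subst indep_vars_iff_distr_eq_PiM'[OF I coordinate])
  show "distr S (PiM I (\<lambda>_. B)) (\<lambda>x. \<lambda>i\<in>I. x (f i)) = PiM I (\<lambda>i. distr S B (\<lambda>\<omega>. \<omega> (f i)))"
    unfolding distr_coordinate unfolding S_def by (rule distr_PiM_reindex[OF prob_B f]) auto
qed

lemma indep_waiting_times_marks:
  "indep_vars (\<lambda>_. borel) (case_sum waiting (\<lambda>k \<omega>. real (mark k \<omega>))) ({1..} <+> {1..})"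
proof -
  define f :: "nat + nat \<Rightarrow> nat" where "f = case_sum (\<lambda>k. 2 * (k - 1)) (\<lambda>k. Suc (2 * (k - 1)))"
  define Y :: "nat + nat \<Rightarrow> real \<times> nat \<Rightarrow> real" where "Y = case_sum (\<lambda>_. d) (\<lambda>_ s. real (l s))"
  have f: "inj_on f ({1..} <+> {1..})"
  proof (rule inj_onI)
    fix i j :: "nat + nat" assume "i \<in> {1..} <+> {1..}" "j \<in> {1..} <+> {1..}" "f i = f j"
    then show "i = j" by (auto simp: f_def) presburger+
  qed
  have "Y i \<in> borel_measurable B" for i
    by (cases i) (auto simp: Y_def intro: measurable_compose[OF l_measurable])
  then have "indep_vars (\<lambda>_. borel) (\<lambda>i \<omega>. Y i (\<omega> (f i))) ({1..} <+> {1..})"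
    by (intro indep_vars_compose2[OF indep_coordinates[OF f]]) auto
  also have "(\<lambda>i \<omega>. Y i (\<omega> (f i))) = case_sum waiting (\<lambda>k \<omega>. real (mark k \<omega>))"
    by (rule ext) (auto simp: Y_def f_def waiting_def mark_def LL_def fun_eq_iff split: sum.split)
  finally show ?thesis .
qed

lemma waiting_exponential: "distributed S lborel (waiting k) (exponential_density lam)"
proof -
  have Dm: "waiting k \<in> S \<rightarrow>\<^sub>M lborel" unfolding waiting_def[abs_def]
    using measurable_compose[OF coordinate d_measurable] by simp
  have Elb: "sets E = sets lborel" by (simp add: E_def)
  have dm: "d \<in> B \<rightarrow>\<^sub>M lborel" using d_measurable by simp
  have fm: "fst \<in> B \<rightarrow>\<^sub>M E" unfolding B_def by (rule measurable_fst)
  have mm: "(\<lambda>x. max 0 x) \<in> E \<rightarrow>\<^sub>M lborel" by (simp add: measurable_cong_sets[OF sets_E refl])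
  have "distr S lborel (waiting k) = distr (distr S B (\<lambda>\<omega>. \<omega> (2 * (k - 1)))) lborel d"
    unfolding distr_distr[OF dm coordinate] by (simp add: waiting_def[abs_def] o_def)
  also have "\<dots> = distr (distr B E fst) lborel (\<lambda>x. max 0 x)"
    unfolding distr_coordinate distr_distr[OF mm fm] by (simp add: d_def[abs_def] o_def)
  also have "distr B E fst = E" unfolding B_def by (simp add: G.distr_pair_fst)
  also have "distr E lborel (\<lambda>x. max 0 x) = distr E lborel (\<lambda>x. x)"
  proof (rule distr_cong_AE)
    show "AE x in E. max 0 x = x"
      unfolding E_def by (subst AE_density) (auto simp: exponential_density_def max_def)
  qed (use mm in \<open>auto simp: measurable_cong_sets[OF sets_E refl]\<close>)
  also have "\<dots> = E" by (rule distr_id2[OF Elb[symmetric]])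
  finally show ?thesis using Dm lam by (simp add: distributed_def E_def)
qed

lemma measure_mark: assumes j: "1 \<le> j" shows "measure S {\<omega> \<in> space S. mark k \<omega> = j} = (1 - q) * q ^ (j - 1)"
proof -
  have l_j: "{s. l s = j} \<in> sets B" using measurable_sets[OF l_measurable, of "{j}"] by (simp add: vimage_def)
  have "measure S {\<omega> \<in> space S. mark k \<omega> = j} = measure (distr S B (\<lambda>\<omega>. \<omega> (Suc (2 * (k - 1))))) {s. l s = j}"
    using l_j by (subst measure_distr) (auto simp: mark_def LL_def intro!: arg_cong[of _ _ "measure S"])
  also have "\<dots> = (\<integral>s. indicator {s. l s = j} s \<partial>B)"
    unfolding distr_coordinate using l_j by simp
  also have "\<dots> = (\<integral>s. indicator {j - 1} (snd s) \<partial>B)"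
    using j by (intro Bochner_Integration.integral_cong) (auto simp: l_def indicator_def)
  also have "\<dots> = (\<integral>n. indicator {j - 1} n \<partial>G)" by (rule integral_B_snd[where C=1]) (simp add: indicator_def)
  also have "\<dots> = (1 - q) * q ^ (j - 1)" using q unfolding G_def by (simp add: measure_pmf_single)
  finally show ?thesis .
qed

lemma marked_poisson:
  assumes \<pi>': "\<And>j. 1 \<le> j \<Longrightarrow> \<pi>' j = (1 - q) * q ^ (j - 1)"
  shows "marked_poisson_process lam \<pi>' S \<tau>"
  unfolding marked_poisson_process_def
proof (intro conjI exI[of _ waiting] exI[of _ mark] allI impI ballI)
  show "0 \<le> \<pi>' j" if "1 \<le> j" for j using \<pi>'[OF that] q by simp
  have "(\<lambda>j. (1 - q) * q ^ j) sums ((1 - q) * (1 / (1 - q)))" using q by (intro sums_mult geometric_sums) auto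
  then show "(\<lambda>j. \<pi>' (Suc j)) sums 1" using q by (simp add: \<pi>')
  show "mark k \<in> S \<rightarrow>\<^sub>M count_space {1..}" for k
    using LL_measurable[of "k - 1"] unfolding mark_def[abs_def]
    by (rule measurable_count_space_extend[rotated 2]) (auto simp: LL_def l_def)
  show "measure S {\<omega> \<in> space S. mark k \<omega> = j} = \<pi>' j" if "1 \<le> j" for k j
    using measure_mark[OF that] \<pi>'[OF that] by simp
qed (use prob_S lam indep_waiting_times_marks waiting_exponential in \<open>auto simp: \<tau>_def\<close>)

lemma integral_\<tau>:
  assumes g: "continuous_on {0..} g"
  shows "integral\<^sup>L (\<tau> \<omega>) g = (\<integral>k. real (mark k \<omega>) * g (arrival k \<omega>) \<partial>count_space {0<..})"
  unfolding \<tau>_def sum_D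
  using integral_dirac_series[OF g, of "\<lambda>k. arrival k \<omega>" "\<lambda>k. real (mark k \<omega>)"] by (simp add: ennreal_of_nat_eq_real_of_nat)

end

context poisson_functional
begin

lemma integral_\<tau>_measurable: "(\<lambda>\<omega>. integral\<^sup>L (\<tau> \<omega>) g) \<in> borel_measurable S"
proof -
  interpret C: sigma_finite_measure "count_space {0<..} :: nat measure" by (rule sigma_finite_measure_count_space)
  have "(\<lambda>(k, \<omega>). real (mark k \<omega>) * g (arrival k \<omega>)) \<in> borel_measurable (count_space {0<..} \<Otimes>\<^sub>M S)"
    unfolding mark_def[abs_def]
    by (intro measurable_pair_measure_countable1)
      (auto intro!: borel_measurable_times g_measurable measurable_compose[OF LL_measurable])
  then have "(\<lambda>(\<omega>, k). real (mark k \<omega>) * g (arrival k \<omega>)) \<in> borel_measurable (S \<Otimes>\<^sub>M count_space {0<..})"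
    by (subst measurable_pair_swap_iff) (simp add: case_prod_beta)
  then show ?thesis unfolding integral_\<tau>[OF g_cont] by (rule C.borel_measurable_lebesgue_integral)
qed

text \<open>Outside a null set only finitely many points lie in the support of \<open>g\<close>; the integral over the point process,
  which is defined as \<open>0\<close> when it diverges, is then a finite sum.\<close>

lemma integral_\<tau>_AE: "AE \<omega> in S. integral\<^sup>L (\<tau> \<omega>) g = V 0 \<omega>"
proof (rule AE_mp[OF AE_arrival_unbounded[of R]], intro AE_I2 impI)
  fix \<omega> assume "\<exists>k. R < arrival k \<omega>"
  then obtain m where m: "R < arrival m \<omega>" by blast
  have "real (mark k \<omega>) * g (arrival k \<omega>) = 0" if "m < k" for k
    using arrival_mono[of m k \<omega>] m that by (intro mult_eq_0_iff[THEN iffD2] disjI2 g_0) linarith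
  from integral_count_space_finite[of m "\<lambda>k. real (mark k \<omega>) * g (arrival k \<omega>)", OF this]
  show "integral\<^sup>L (\<tau> \<omega>) g = V 0 \<omega>"
    unfolding integral_\<tau>[OF g_cont] V_finite[OF order_refl m] by (simp add: mark_def)
qed

lemma F_eq_char: "F 0 = (\<integral>\<omega>. iexp (integral\<^sup>L (\<tau> \<omega>) g) \<partial>S)"
  unfolding F_def using integral_\<tau>_AE integral_\<tau>_measurable V_measurable[of 0]
  by (intro integral_cong_AE) auto

end

lemma compound_poisson_functional:
  assumes "compound_poisson lam q" "continuous_on {0..} g" "\<And>t. R < t \<Longrightarrow> g t = 0" "0 \<le> R"
  shows "poisson_functional lam q g R"
  using assms by (simp add: poisson_functional_def poisson_functional_axioms_def)

section \<open>Convergence of the hitting processes\<close>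

context escape
begin

text \<open>Only times \<open>k\<close> with \<open>k * r ^ n \<le> R\<close> contribute, and time starts at \<open>1\<close>, when the orbit is at \<open>shift x\<close>.\<close>

lemma integral_hitting_process:
  fixes g :: "real \<Rightarrow> real"
  assumes g: "continuous_on {0..} g" and g0: "\<And>t. R < t \<Longrightarrow> g t = 0" and R: "0 \<le> R"
    and P: "exp P = r" and x: "x \<in> X"
  shows "integral\<^sup>L (hitting_process X \<Delta> P n x) g = W (\<lambda>j. g (j * r ^ n)) (nat \<lfloor>R / r ^ n\<rfloor>) n 1 ((shift ^^ 1) x)"
proof -
  define K where "K = nat \<lfloor>R / r ^ n\<rfloor>"
  have rn: "exp (real n * P) = r ^ n" using P by (simp add: exp_of_nat_mult)
  have ind: "indicator (neighbourhood X \<Delta> n) ((shift ^^ k) x) = ennreal (indicator (N\<Delta> n) ((shift ^^ k) x))" for k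
    using funpow_X[OF x, of k] by (auto simp: indicator_def neighbourhood_def N\<Delta>_def)
  have "integral\<^sup>L (hitting_process X \<Delta> P n x) g = (\<integral>k. indicator (N\<Delta> n) ((shift ^^ k) x) * g (k * r ^ n) \<partial>count_space {0<..})"
    unfolding hitting_process_def ind rn using g r by (intro integral_dirac_series) auto
  also have "\<dots> = (\<Sum>k<K. indicator (N\<Delta> n) ((shift ^^ Suc k) x) * g (Suc k * r ^ n))"
  proof (rule integral_count_space_finite)
    fix k assume k: "K < k"
    have "R / r ^ n < k" using k unfolding K_def by linarith
    then have "R < k * r ^ n" using r by (simp add: pos_divide_less_eq)
    then show "indicator (N\<Delta> n) ((shift ^^ k) x) * g (k * r ^ n) = 0" by (simp add: g0)
  qed
  also have "\<dots> = W (\<lambda>j. g (j * r ^ n)) K n 1 ((shift ^^ 1) x)"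
    unfolding W_def by (intro sum.cong) (simp_all add: funpow_swap1 mult.commute)
  finally show ?thesis by (simp add: K_def)
qed

lemma integral_hitting_measurable:
  fixes g :: "real \<Rightarrow> real"
  assumes "continuous_on {0..} g" "\<And>t. R < t \<Longrightarrow> g t = 0" "0 \<le> R" "exp P = r"
  shows "(\<lambda>x. integral\<^sup>L (hitting_process X \<Delta> P n x) g) \<in> borel_measurable \<mu>"
proof (subst measurable_cong)
  show "(\<lambda>x. W (\<lambda>j. g (j * r ^ n)) (nat \<lfloor>R / r ^ n\<rfloor>) n 1 ((shift ^^ 1) x)) \<in> borel_measurable \<mu>"
    by (rule W_shift_measurable)
qed (simp add: integral_hitting_process[OF assms] del: funpow.simps)

text \<open>For a test function \<open>g\<close>, the characteristic function at \<open>s\<close> of its integral is treated as the mean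
  belonging to the test function \<open>s * g\<close>.\<close>

theorem hitting_process_converges:
  assumes P: "exp P = r" and \<pi>': "\<And>j. 1 \<le> j \<Longrightarrow> \<pi>' j = (1 - r) * r ^ (j - 1)"
  shows "\<exists>(N :: (nat \<Rightarrow> real \<times> nat) measure) \<tau>.
    marked_poisson_process ((1 - r) * \<kappa>) \<pi>' N \<tau> \<and> converges_in_law \<mu> (hitting_process X \<Delta> P) N \<tau>"
proof -
  define lam where "lam = (1 - r) * \<kappa>"
  have cp: "compound_poisson lam r" using r \<kappa>_pos by unfold_locales (auto simp: lam_def)
  interpret cp: compound_poisson lam r by (rule cp)
  have "converges_in_law \<mu> (hitting_process X \<Delta> P) cp.S cp.\<tau>"
    unfolding converges_in_law_def
  proof (intro allI impI, elim conjE exE)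
    fix g :: "real \<Rightarrow> real" and R0 assume g: "continuous_on {0..} g" and R0: "\<forall>t>R0. g t = 0"
    define R where "R = max R0 0"
    have gR: "g t = 0" if "R < t" for t using that R0 by (simp add: R_def)
    have R: "0 \<le> R" by (simp add: R_def)
    interpret pf: poisson_functional lam r g R by (rule compound_poisson_functional[OF cp g gR R])
    have hit: "integral\<^sup>L (hitting_process X \<Delta> P n x) g
        = W (\<lambda>j. g (j * r ^ n)) (nat \<lfloor>R / r ^ n\<rfloor>) n 1 ((shift ^^ 1) x)" if "x \<in> X" for n x
      using g gR R P that by (rule integral_hitting_process)
    have hm: "(\<lambda>x. integral\<^sup>L (hitting_process X \<Delta> P n x) g) \<in> borel_measurable \<mu>" for n
      using g gR R P by (rule integral_hitting_measurable)
    show "weak_conv_m (\<lambda>n. distr \<mu> borel (\<lambda>x. integral\<^sup>L (hitting_process X \<Delta> P n x) g))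
        (distr cp.S borel (\<lambda>\<omega>. integral\<^sup>L (cp.\<tau> \<omega>) g))"
    proof (rule levy_continuity)
      show "real_distribution (distr \<mu> borel (\<lambda>x. integral\<^sup>L (hitting_process X \<Delta> P n x) g))" for n
        by (rule real_distribution_distr[OF hm])
      show "real_distribution (distr cp.S borel (\<lambda>\<omega>. integral\<^sup>L (cp.\<tau> \<omega>) g))"
        by (rule cp.real_distribution_distr[OF pf.integral_\<tau>_measurable])
    next
      fix s :: real
      have sg: "continuous_on {0..} (\<lambda>t. s * g t)" using g by (intro continuous_intros)
      have sgR: "s * g t = 0" if "R < t" for t using gR[OF that] by simp
      interpret sf: poisson_functional lam r "\<lambda>t. s * g t" R
        by (rule compound_poisson_functional[OF cp sg sgR R])
      have cP: "of_real lam * (cp.\<pi> t - 1) = c\<^sub>P t" for t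
      proof -
        have "cp.\<pi> t - 1 = (iexp t - 1) / (1 - of_real r * iexp t)"
        proof -
          have minus_1: "z' / z - 1 = (z' - z) / z" if "z \<noteq> 0" for z z' :: complex
            using that by (simp add: diff_divide_distrib)
          have "cp.\<pi> t - 1 = (of_real (1 - r) * iexp t - (1 - of_real r * iexp t)) / (1 - of_real r * iexp t)"
            unfolding cp.\<pi>_def by (rule minus_1[OF cp.\<pi>_denominator])
          also have "of_real (1 - r) * iexp t - (1 - of_real r * iexp t) = iexp t - 1" by (simp add: algebra_simps)
          finally show ?thesis .
        qed
        then show ?thesis by (simp add: c\<^sub>P_def lam_def mult.commute)
      qed
      have lim: "(\<lambda>n. \<Phi> (\<lambda>j. s * g (j * r ^ n)) (nat \<lfloor>R / r ^ n\<rfloor>) n 1) \<longlonglongrightarrow> sf.F 0"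
        using \<Phi>_lim[OF sg sgR R sf.F_derivative[unfolded cP] sf.F_end] by simp
      have "char (distr \<mu> borel (\<lambda>x. integral\<^sup>L (hitting_process X \<Delta> P n x) g)) s
          = \<Phi> (\<lambda>j. s * g (j * r ^ n)) (nat \<lfloor>R / r ^ n\<rfloor>) n 1" for n
      proof -
        have "char (distr \<mu> borel (\<lambda>x. integral\<^sup>L (hitting_process X \<Delta> P n x) g)) s
            = (\<integral>x. iexp (s * integral\<^sup>L (hitting_process X \<Delta> P n x) g) \<partial>\<mu>)"
          by (rule char_distr[OF hm])
        also have "\<dots> = (\<integral>x. iexp (W (\<lambda>j. s * g (j * r ^ n)) (nat \<lfloor>R / r ^ n\<rfloor>) n 1 ((shift ^^ 1) x)) \<partial>\<mu>)"
        proof (rule Bochner_Integration.integral_cong)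
          fix x assume "x \<in> space \<mu>"
          then have x: "x \<in> X" by simp
          show "iexp (s * integral\<^sup>L (hitting_process X \<Delta> P n x) g)
              = iexp (W (\<lambda>j. s * g (j * r ^ n)) (nat \<lfloor>R / r ^ n\<rfloor>) n 1 ((shift ^^ 1) x))"
            unfolding hit[OF x] W_def by (simp only: sum_distrib_left mult.assoc)
        qed simp
        finally show ?thesis by (simp only: \<Phi>_shift[where s=1])
      qed
      moreover have "char (distr cp.S borel (\<lambda>\<omega>. integral\<^sup>L (cp.\<tau> \<omega>) g)) s = sf.F 0"
      proof -
        have "s * integral\<^sup>L (cp.\<tau> \<omega>) g = integral\<^sup>L (cp.\<tau> \<omega>) (\<lambda>t. s * g t)" for \<omega>
          unfolding cp.integral_\<tau>[OF g] cp.integral_\<tau>[OF sg] by (simp add: mult.left_commute)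
        then show ?thesis
          using char_distr[OF pf.integral_\<tau>_measurable, of s] by (simp only: sf.F_eq_char)
      qed
      ultimately show "(\<lambda>n. char (distr \<mu> borel (\<lambda>x. integral\<^sup>L (hitting_process X \<Delta> P n x) g)) s)
          \<longlonglongrightarrow> char (distr cp.S borel (\<lambda>\<omega>. integral\<^sup>L (cp.\<tau> \<omega>) g)) s"
        using lim by simp
    qed
  qed
  then show ?thesis using cp.marked_poisson[OF \<pi>'] unfolding lam_def by blast
qed

end

section \<open>Hoelder functions on a compact shift space\<close>

lemma compact_sft: assumes "finite S" shows "compact (sft S A)"
proof -
  have "compact (PiE UNIV (\<lambda>_. S) :: (nat \<Rightarrow> nat) set)"
    unfolding compactin_euclidean_iff[symmetric] euclidean_product_topology[symmetric] compactin_PiE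
    unfolding compactin_euclidean_iff using assms by (simp add: finite_imp_compact)
  moreover have "closed (sft S A)"
  proof (unfold closed_def, subst open_subopen, intro ballI)
    fix x assume "x \<in> - sft S A"
    then obtain n where n: "x n \<notin> S \<or> (1 \<le> n \<and> A (x (n - 1)) (x n) \<noteq> 1)" by (auto simp: sft_def)
    have "{y. agree (Suc n) x y} \<subseteq> - sft S A"
    proof
      fix y assume "y \<in> {y. agree (Suc n) x y}"
      then have "x n = y n" "x (n - 1) = y (n - 1)" by (auto simp: agree_def)
      then show "y \<in> - sft S A" using n by (auto simp: sft_def)
    qed
    then show "\<exists>T. open T \<and> x \<in> T \<and> T \<subseteq> - sft S A"
      using open_agree[of "Suc n" x] by (intro exI[of _ "{y. agree (Suc n) x y}"]) auto
  qed
  ultimately have "compact (PiE UNIV (\<lambda>_. S) \<inter> sft S A)" by (rule compact_Int_closed)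
  moreover have "PiE UNIV (\<lambda>_. S) \<inter> sft S A = sft S A" by (auto simp: sft_def)
  ultimately show ?thesis by simp
qed

text \<open>Compactness makes \<open>\<psi>\<close> bounded, so that the suprema in \<^const>\<open>variation\<close> are genuine; boundedness also
  covers points without a common symbol.\<close>

lemma hoelder_onE:
  fixes \<psi> :: "(nat \<Rightarrow> nat) \<Rightarrow> real"
  assumes \<psi>: "hoelder_on X \<psi>" and X: "compact X"
  obtains \<theta> C where "0 < \<theta>" "\<theta> < 1" "0 \<le> C"
    "\<And>x y j. x \<in> X \<Longrightarrow> y \<in> X \<Longrightarrow> agree j x y \<Longrightarrow> \<bar>\<psi> x - \<psi> y\<bar> \<le> C * \<theta> ^ j"
proof -
  obtain \<theta> where \<theta>: "0 < \<theta>" "\<theta> < 1" and "bdd_above (range (\<lambda>n. variation X n \<psi> / \<theta> ^ n))"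
    using \<psi> by (auto simp: hoelder_on_def)
  then obtain C0 where C0: "\<And>n. variation X n \<psi> / \<theta> ^ n \<le> C0" by (auto simp: bdd_above_def)
  have "bounded (\<psi> ` X)" using \<psi> X by (intro compact_imp_bounded compact_continuous_image) (auto simp: hoelder_on_def)
  then obtain m where m: "\<And>x. x \<in> X \<Longrightarrow> \<bar>\<psi> x\<bar> \<le> m" by (auto simp: bounded_iff)
  have diff: "\<bar>\<psi> x - \<psi> y\<bar> \<le> 2 * m" if "x \<in> X" "y \<in> X" for x y using m[OF that(1)] m[OF that(2)] by linarith
  define C where "C = max 0 (max (2 * m) (C0 / \<theta>))"
  have "\<bar>\<psi> x - \<psi> y\<bar> \<le> C * \<theta> ^ j" if xy: "x \<in> X" "y \<in> X" "agree j x y" for x y j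
  proof (cases j)
    case 0
    then show ?thesis using diff[OF xy(1,2)] by (simp add: C_def)
  next
    case (Suc n)
    have "\<bar>\<psi> x - \<psi> y\<bar> \<le> variation X n \<psi>"
      unfolding variation_def
    proof (rule cSup_upper)
      show "\<bar>\<psi> x - \<psi> y\<bar> \<in> {norm (\<psi> x - \<psi> y) | x y. x \<in> X \<and> y \<in> X \<and> (\<forall>i\<le>n. x i = y i)}"
        using xy Suc by (intro CollectI exI[of _ x] exI[of _ y]) (auto simp: agree_def)
      show "bdd_above {norm (\<psi> x - \<psi> y) | x y. x \<in> X \<and> y \<in> X \<and> (\<forall>i\<le>n. x i = y i)}"
        by (rule bdd_aboveI[of _ "2 * m"]) (use diff in auto)
    qed
    also have "\<dots> \<le> C0 * \<theta> ^ n" using C0[of n] \<theta> by (simp add: pos_divide_le_eq)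
    also have "\<dots> = C0 / \<theta> * \<theta> ^ j" using \<theta> Suc by simp
    also have "\<dots> \<le> C * \<theta> ^ j" using \<theta> by (intro mult_right_mono) (auto simp: C_def)
    finally show ?thesis .
  qed
  then show thesis using that[of \<theta> C] \<theta> by (auto simp: C_def)
qed

text \<open>The locale \<open>escape\<close> is instantiated with a common Hoelder modulus of \<open>\<phi>\<close>. Its hypotheses on \<open>h\<close> are those
  on the density, rewritten with \<open>exp P = sub.\<rho>\<close>, which is the variational principle for the subsystem.\<close>

theorem theorem8:
  fixes l :: nat and A :: "nat \<Rightarrow> nat \<Rightarrow> nat" and \<Delta> :: "nat set"
    and X :: "(nat \<Rightarrow> nat) set" and \<phi> h :: "(nat \<Rightarrow> nat) \<Rightarrow> real"
    and \<mu> :: "(nat \<Rightarrow> nat) measure" and P :: real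
  assumes "\<forall>i\<in>{1..l}. \<forall>j\<in>{1..l}. A i j \<in> {0, 1}"
    and "irreducible_matrix {1..l} A" and "aperiodic_matrix {1..l} A"
    and "X = sft {1..l} A"
    and "hoelder_on X \<phi>" and "normalised X \<phi>"
    and "equilibrium_state X \<phi> \<mu>"
    and "\<Delta> \<subset> {1..l}"
    and "irreducible_matrix \<Delta> A" and "aperiodic_matrix \<Delta> A"
    and "ereal P = pressure (subsystem X \<Delta>) \<phi>"
    and "pianigiani_yorke_density X \<Delta> \<phi> P h"
  shows "\<exists>(N :: (nat \<Rightarrow> real \<times> nat) measure) \<tau>.
           marked_poisson_process ((1 - exp P) * (\<integral>x. h x \<partial>\<mu>))
             (\<lambda>j. (1 - exp P) * exp ((real j - 1) * P)) N \<tau> \<and>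
           converges_in_law \<mu> (hitting_process X \<Delta> P) N \<tau>"
proof -
  have X: "X = sft {1..l} A" by fact
  have cX: "compact X" unfolding X by (rule compact_sft) simp
  have sub: "subsystem X \<Delta> = sft \<Delta> A" using assms(8) by (auto simp: X subsystem_def sft_def)
  then have subX: "sft \<Delta> A \<subseteq> X" by (auto simp: subsystem_def)
  obtain \<theta> c where \<theta>: "0 < \<theta>" "\<theta> < 1" "0 \<le> c"
    and lip: "\<And>x y j. x \<in> X \<Longrightarrow> y \<in> X \<Longrightarrow> agree j x y \<Longrightarrow> \<bar>\<phi> x - \<phi> y\<bar> \<le> c * \<theta> ^ j"
    using hoelder_onE[OF assms(5) cX] by blast
  have pot: "sft_potential {1..l} A \<phi> \<theta> c"
    using assms \<theta> lip by unfold_locales auto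
  have sub_pot: "sft_potential \<Delta> A \<phi> \<theta> c"
  proof
    show "finite \<Delta>" using assms(8) finite_subset by blast
  qed (use assms(1,8-10) \<theta> lip subX in blast)+
  interpret full: sft_potential "{1..l}" A \<phi> \<theta> c by (rule pot)
  interpret sub: sft_potential \<Delta> A \<phi> \<theta> c by (rule sub_pot)
  have P: "exp P = sub.\<rho>"
    using assms(11) sub.pressure_eq(1)[OF sub.lip_continuous[OF sub.lip_\<phi>]] sub.\<rho>_pos by (simp add: sub)
  have Pn: "exp (- real n * P) = 1 / sub.\<rho> ^ n" for n
    by (simp add: exp_minus P[symmetric] exp_of_nat_mult[symmetric] divide_inverse)
  have inv: "\<mu> \<in> invariant_probs (sft {1..l} A)" using assms(7) by (simp add: X equilibrium_state_def)
  have h: "hoelder_on X h" "\<And>x. x \<in> X \<Longrightarrow> restricted_transfer_op X \<Delta> \<phi> h x = exp P * h x"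
    "\<And>x. x \<in> subsystem X \<Delta> \<Longrightarrow> h x = subsystem_eigenfunction X \<Delta> \<phi> P x"
    using assms(12) by (auto simp: pianigiani_yorke_density_def)
  interpret escape "{1..l}" A \<phi> \<theta> c \<mu> \<Delta> h
  proof
    show "transfer_op (sft {1..l} A) \<phi> (\<lambda>_. 1) x = 1" if "x \<in> sft {1..l} A" for x
      using assms(6) that by (simp add: normalised_def X)
    show "equilibrium_state (sft {1..l} A) \<phi> \<mu>" using assms(7) by (simp add: X)
    show "\<Delta> \<subset> {1..l}" by fact
    fix e :: real assume e: "0 < e"
    obtain \<eta> C where \<eta>: "0 < \<eta>" "\<eta> < 1" "0 \<le> C"
      and hl: "\<And>x y j. x \<in> X \<Longrightarrow> y \<in> X \<Longrightarrow> agree j x y \<Longrightarrow> \<bar>h x - h y\<bar> \<le> C * \<eta> ^ j"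
      using hoelder_onE[OF h(1) cX] by blast
    have "(\<lambda>j. C * \<eta> ^ j) \<longlonglongrightarrow> C * 0" using \<eta> by (intro tendsto_intros LIMSEQ_power_zero) auto
    then have "eventually (\<lambda>j. C * \<eta> ^ j < e) sequentially" using e by (intro order_tendstoD) auto
    then obtain j where "C * \<eta> ^ j < e" by (meson eventually_sequentially order_refl)
    then show "\<exists>j. \<forall>x\<in>sft {1..l} A. \<forall>y\<in>sft {1..l} A. agree j x y \<longrightarrow> \<bar>h x - h y\<bar> < e"
      using hl X by (intro exI[of _ j]) (meson le_less_trans)
  next
    show "h \<in> borel_measurable \<mu>"
      using h(1) by (intro full.continuous_measurable[OF inv]) (simp add: hoelder_on_def X)
    show "restricted_transfer_op (sft {1..l} A) \<Delta> \<phi> h x = sub.\<rho> * h x" if "x \<in> sft {1..l} A" for x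
      using h(2)[of x] that by (simp add: X P)
    show "h x = sub.w x" if x: "x \<in> sft \<Delta> A" for x
    proof -
      have "h x = lim (\<lambda>n. exp (- real n * P) * sub.g n x)"
        using h(3)[of x] x by (simp add: sub subsystem_eigenfunction_def)
      also have "(\<lambda>n. exp (- real n * P) * sub.g n x) = (\<lambda>n. sub.v n x)"
        by (simp only: Pn sub.v_def) simp
      also have "lim \<dots> = sub.w x" by (simp add: sub.w_def)
      finally show ?thesis .
    qed
  qed
  have "(1 - exp P) * exp ((real j - 1) * P) = (1 - sub.\<rho>) * sub.\<rho> ^ (j - 1)" if "1 \<le> j" for j
    using that by (simp add: P[symmetric] exp_of_nat_mult[symmetric] of_nat_diff)
  from hitting_process_converges[OF P this]
  show ?thesis by (simp add: P X \<kappa>_def)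
qed

end
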